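(* For every $m\in\mathbb N=\{0,1,2,\dots\}$ there exist positive constants $c_m$ and $C_m$ such that for every $k\in\mathbb Z$, every 2D axisymmetric domain $\breve\Omega\subset\mathbb R^2$ with meridian domain $\Omega\subset\mathbb R_+$, and every $w_r,w_\theta\in L^2_1(\Omega)$, $$ c_m\,\|(w_r,w_\theta)\|_{\mathbf H^m_{(k)}(\Omega)}\le\|(w_r,w_\theta)\|_{\mathbf C^m_{(k)}(\Omega)}\le C_m\,\|(w_r,w_\theta)\|_{\mathbf H^m_{(k)}(\Omega)}, $$ where $$ \|(w_r,w_\theta)\|^2_{\mathbf C^m_{(k)}(\Omega)}= \begin{cases} \|w_r\|^2_{C^m_{(k)}(\Omega)}+\|w_\theta\|^2_{C^m_{(k)}(\Omega)} & \text{if } |k|\ge m+1,\\[1ex] \|w_r\|^2_{C^m_{(|k|-1)}(\Omega)}+\|w_\theta\|^2_{C^m_{(|k|-1)}(\Omega)}+\Big\|\big(\tfrac1r\big)^{|k|}\big(w_r+i\tfrac{k}{|k|}w_\theta\big)\Big\|^2_{H^{m-|k|}_1(\Omega)} & \text{if } 1\le|k|\le m,\\[1ex] \|w_r\|^2_{C^m_{(1)}(\Omega)}+\|w_\theta\|^2_{C^m_{(1)}(\Omega)} & \text{if } k=0. \end{cases} $$ The constants $c_m,C_m$ are independent of $k$ and $\Omega$.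
   Context: Functions are complex valued; $\mathbb R_+=(0,\infty)$. A 2D axisymmetric domain $\breve\Omega\subset\mathbb R^2$ is a domain invariant under all rotations around the origin; its meridian domain is the interval $\Omega=\{r>0:(r,0)\in\breve\Omega\}$. Polar coordinates: $x=r\cos\theta$, $y=r\sin\theta$. Let $\mathbf e_x,\mathbf e_y$ be the canonical basis of $\mathbb R^2$ and $\mathbf e_r=\cos\theta\,\mathbf e_x+\sin\theta\,\mathbf e_y$, $\mathbf e_\theta=-\sin\theta\,\mathbf e_x+\cos\theta\,\mathbf e_y$. $\|v\|^2_{L^2_1(\Omega)}=2\pi\int_\Omega|v(r)|^2\,r\,dr$, and $\|v\|^2_{H^j_1(\Omega)}=\sum_{a=0}^{j}\|\partial_r^a v\|^2_{L^2_1(\Omega)}$. The vector norm is $\|(w_r,w_\theta)\|_{\mathbf H^m_{(k)}(\Omega)}:=\|(w_r\,\mathbf e_r+w_\theta\,\mathbf e_\theta)\,e^{ik\theta}\|_{\mathbf H^m(\breve\Omega)}$, where $\mathbf H^m(\breve\Omega)=H^m(\breve\Omega)^2$ (Sobolev norm of the two Cartesian components, $\|\breve u\|^2_{H^m(\breve\Omega)}=\sum_{|\alpha|\le m}\|\partial^\alpha_{(x,y)}\breve u\|^2_{L^2(\breve\Omega)}$ for each). For $m\in\mathbb N$, $k\in\mathbb Z$ the scalar weighted norm is $$\|w\|^2_{C^m_{(k)}(\Omega)}=\sum_{\ell=0}^{\min\{|k|,m\}}\Big\|\Big(\tfrac{|k|}{r}\Big)^{\ell}w\Big\|^2_{H^{m-\ell}_1(\Omega)}+\sum_{1\le\ell\le(m-|k|)/2}\Big\|\Big(\tfrac1r\partial_r\Big)^{\ell}\Big(\tfrac1r\Big)^{|k|}w\Big\|^2_{H^{m-|k|-2\ell}_1(\Omega)},$$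 with $(|k|/r)^0\equiv1$ also for $k=0$, empty sums equal to $0$, and the rightmost operator acting first. Norms take values in $[0,+\infty]$, being $+\infty$ when a required distributional derivative is not in the corresponding $L^2$ space. *)

theory Defs
  imports "HOL-Analysis.Analysis"
begin

section \<open>Distributions on open sets\<close>

definition dir_deriv :: "'a::euclidean_space \<Rightarrow> ('a \<Rightarrow> complex) \<Rightarrow> 'a \<Rightarrow> complex" where
  "dir_deriv v f = (\<lambda>x. frechet_derivative f (at x) v)"

definition smooth_fun :: "('a::euclidean_space \<Rightarrow> complex) \<Rightarrow> bool" where
  "smooth_fun f \<longleftrightarrow>
     (\<forall>vs. set vs \<subseteq> Basis \<longrightarrow> (\<forall>x. fold dir_deriv vs f differentiable (at x)))"

definition test_functions :: "'a::euclidean_space set \<Rightarrow> ('a \<Rightarrow> complex) set" where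
  "test_functions U =
     {\<phi>. smooth_fun \<phi> \<and> compact (closure {x. \<phi> x \<noteq> 0}) \<and> closure {x. \<phi> x \<noteq> 0} \<subseteq> U}"

text \<open>
  A distribution on \<open>U\<close> is given by its values on the test functions on \<open>U\<close>; its values on
  other functions are never used. All distributions that occur below arise from locally
  integrable functions by differentiation and by multiplication with functions smooth on \<open>U\<close>.
\<close>

type_synonym 'a distrib = "('a \<Rightarrow> complex) \<Rightarrow> complex"

definition dist_of :: "'a::euclidean_space set \<Rightarrow> ('a \<Rightarrow> complex) \<Rightarrow> 'a distrib" where
  "dist_of U f = (\<lambda>\<phi>. LINT x|lebesgue_on U. f x * \<phi> x)"

definition dist_deriv :: "'a::euclidean_space \<Rightarrow> 'a distrib \<Rightarrow> 'a distrib" where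
  "dist_deriv v T = (\<lambda>\<phi>. - T (dir_deriv v \<phi>))"

definition dist_mult :: "('a::euclidean_space \<Rightarrow> real) \<Rightarrow> 'a distrib \<Rightarrow> 'a distrib" where
  "dist_mult g T = (\<lambda>\<phi>. T (\<lambda>x. of_real (g x) * \<phi> x))"


section \<open>Weighted $L^2$ norms\<close>

definition L2_sqnorm :: "('a::euclidean_space \<Rightarrow> real) \<Rightarrow> 'a set \<Rightarrow> ('a \<Rightarrow> complex) \<Rightarrow> ennreal" where
  "L2_sqnorm \<rho> U f = (\<integral>\<^sup>+x. ennreal (\<rho> x * (cmod (f x))\<^sup>2) \<partial>lebesgue_on U)"

definition L2_space :: "('a::euclidean_space \<Rightarrow> real) \<Rightarrow> 'a set \<Rightarrow> ('a \<Rightarrow> complex) set" where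
  "L2_space \<rho> U = {f \<in> borel_measurable (lebesgue_on U). L2_sqnorm \<rho> U f < \<infinity>}"

text \<open>
  For the weights used below, the functions representing \<open>T\<close> agree almost everywhere, so
  the infimum is their common squared norm. If no function in the \<open>L\<^sup>2\<close> space represents \<open>T\<close>,
  it is the infimum of the empty set, that is \<open>\<infinity>\<close>.
\<close>

definition dist_L2_sqnorm :: "('a::euclidean_space \<Rightarrow> real) \<Rightarrow> 'a set \<Rightarrow> 'a distrib \<Rightarrow> ennreal" where
  "dist_L2_sqnorm \<rho> U T =
     Inf {L2_sqnorm \<rho> U f |f. f \<in> L2_space \<rho> U \<and> (\<forall>\<phi>\<in>test_functions U. T \<phi> = dist_of U f \<phi>)}"

definition ennreal_sqrt :: "ennreal \<Rightarrow> ennreal" where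
  "ennreal_sqrt a = (if a = \<infinity> then \<infinity> else ennreal (sqrt (enn2real a)))"


section \<open>Axisymmetric domains\<close>

definition rotation :: "real \<Rightarrow> real \<times> real \<Rightarrow> real \<times> real" where
  "rotation \<theta> = (\<lambda>(x, y). (x * cos \<theta> - y * sin \<theta>, x * sin \<theta> + y * cos \<theta>))"

definition axisymmetric_domain :: "(real \<times> real) set \<Rightarrow> bool" where
  "axisymmetric_domain D \<longleftrightarrow>
     open D \<and> connected D \<and> D \<noteq> {} \<and> (\<forall>\<theta>. rotation \<theta> ` D = D)"

definition meridian :: "(real \<times> real) set \<Rightarrow> real set" where
  "meridian D = {r. 0 < r \<and> (r, 0) \<in> D}"


section \<open>Sobolev norms on the domain\<close>

definition Sobolev_sqnorm :: "nat \<Rightarrow> (real \<times> real) set \<Rightarrow> (real \<times> real \<Rightarrow> complex) \<Rightarrow> ennreal" where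
  "Sobolev_sqnorm m D u =
     (\<Sum>(a, b) \<in> {(a, b). a + b \<le> m}.
        dist_L2_sqnorm (\<lambda>_. 1) D
          ((dist_deriv (1, 0) ^^ a) ((dist_deriv (0, 1) ^^ b) (dist_of D u))))"

text \<open>
  Cartesian components of $(w_r \mathbf e_r + w_\theta \mathbf e_\theta) e^{ik\theta}$. Their
  values at the origin, where the polar angle is arbitrary, do not matter, as the origin is a
  null set.
\<close>

definition polar_angle :: "real \<times> real \<Rightarrow> real" where
  "polar_angle p = Arg (Complex (fst p) (snd p))"

definition field_x ::
  "int \<Rightarrow> (real \<Rightarrow> complex) \<Rightarrow> (real \<Rightarrow> complex) \<Rightarrow> real \<times> real \<Rightarrow> complex" where
  "field_x k wr wt p =
     (let r = norm p; \<theta> = polar_angle p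
      in (wr r * of_real (cos \<theta>) - wt r * of_real (sin \<theta>)) * exp (\<i> * of_int k * of_real \<theta>))"

definition field_y ::
  "int \<Rightarrow> (real \<Rightarrow> complex) \<Rightarrow> (real \<Rightarrow> complex) \<Rightarrow> real \<times> real \<Rightarrow> complex" where
  "field_y k wr wt p =
     (let r = norm p; \<theta> = polar_angle p
      in (wr r * of_real (sin \<theta>) + wt r * of_real (cos \<theta>)) * exp (\<i> * of_int k * of_real \<theta>))"

definition vec_H_norm ::
  "nat \<Rightarrow> int \<Rightarrow> (real \<times> real) set \<Rightarrow> (real \<Rightarrow> complex) \<Rightarrow> (real \<Rightarrow> complex) \<Rightarrow> ennreal" where
  "vec_H_norm m k D wr wt =
     ennreal_sqrt (Sobolev_sqnorm m D (field_x k wr wt) + Sobolev_sqnorm m D (field_y k wr wt))"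


section \<open>Weighted norms on the meridian domain\<close>

definition axi_weight :: "real \<Rightarrow> real" where
  "axi_weight r = 2 * pi * r"

definition H1_sqnorm :: "nat \<Rightarrow> real set \<Rightarrow> real distrib \<Rightarrow> ennreal" where
  "H1_sqnorm j \<Omega> T = (\<Sum>a = 0..j. dist_L2_sqnorm axi_weight \<Omega> ((dist_deriv 1 ^^ a) T))"

text \<open>
  In the second sum the subtraction on natural numbers is truncated: for \<open>m < nat \<bar>k\<bar>\<close> the
  sum is empty. In the first sum the summand for \<open>k = 0\<close>, \<open>l = 0\<close> has the factor \<open>0 ^ 0 = 1\<close>.
\<close>

definition scal_C_sqnorm :: "nat \<Rightarrow> int \<Rightarrow> real set \<Rightarrow> (real \<Rightarrow> complex) \<Rightarrow> ennreal" where
  "scal_C_sqnorm m k \<Omega> w =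
     (\<Sum>l = 0..min (nat \<bar>k\<bar>) m.
        H1_sqnorm (m - l) \<Omega> (dist_of \<Omega> (\<lambda>r. of_real ((\<bar>of_int k\<bar> / r) ^ l) * w r)))
   + (\<Sum>l = 1..(m - nat \<bar>k\<bar>) div 2.
        H1_sqnorm (m - nat \<bar>k\<bar> - 2 * l) \<Omega>
          (((\<lambda>T. dist_mult (\<lambda>r. 1 / r) (dist_deriv 1 T)) ^^ l)
             (dist_of \<Omega> (\<lambda>r. of_real ((1 / r) ^ nat \<bar>k\<bar>) * w r))))"

definition vec_C_norm ::
  "nat \<Rightarrow> int \<Rightarrow> real set \<Rightarrow> (real \<Rightarrow> complex) \<Rightarrow> (real \<Rightarrow> complex) \<Rightarrow> ennreal" where
  "vec_C_norm m k \<Omega> wr wt = ennreal_sqrt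
     (if \<bar>k\<bar> \<ge> int m + 1 then
        scal_C_sqnorm m k \<Omega> wr + scal_C_sqnorm m k \<Omega> wt
      else if 1 \<le> \<bar>k\<bar> then
        scal_C_sqnorm m (\<bar>k\<bar> - 1) \<Omega> wr + scal_C_sqnorm m (\<bar>k\<bar> - 1) \<Omega> wt
        + H1_sqnorm (m - nat \<bar>k\<bar>) \<Omega>
            (dist_of \<Omega> (\<lambda>r. of_real ((1 / r) ^ nat \<bar>k\<bar>)
                              * (wr r + \<i> * (of_int k / of_int \<bar>k\<bar>) * wt r)))
      else
        scal_C_sqnorm m 1 \<Omega> wr + scal_C_sqnorm m 1 \<Omega> wt)"

end

(*
Put w = wr +- i wt. The combinations u_x +- i u_y of the Cartesian components are the scalar
fields w e^{i(k +- 1)theta}, so the vector norm is equivalent to the sum of two scalar norms, one for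
each of the modes k + 1 and k - 1. The operators d_x +- i d_y shift the mode: away from the origin
(d_x + i d_y)^a (d_x - i d_y)^b maps w e^{ik theta} to e^{i(k+a-b)theta} r^{-(a+b)} p(r d/dr) w for an
explicit polynomial p depending on a, b and k. The summands of the weighted norms have the form
r^{-j} p(r d/dr) w as well. Comparing the norms at each order j thus amounts to bounding, uniformly
in k, one family of polynomials by another one; for small k both families span the polynomials of
degree at most j that vanish at the points k, k + 2, k + 4, ... below j. The term that couples wr and
wt arises as this condition for k + 1 is the one for k - 1 without the point k - 1. Finally the origin
is removable for distributions with square integrable derivatives in the plane.
*)

theory Submission
  imports Defs "HOL-Computational_Algebra.Polynomial"
begin

section \<open>Comparing families of polynomials\<close>

text \<open>Norms may be infinite, so no estimate may rest on finiteness, and a square norm is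
  additive only up to the factor 2. Both facts are built into \<open>quasi\<close>, which is imposed
  on functionals of polynomials; a bound valid for every such functional is a purely algebraic
  statement about linear combinations with bounded coefficients, from which the domain and the field
  have disappeared. Uniformity in k is won by treating large and small k differently. For large k
  the coefficients come from recursions: the half sum of the two mode shifts is the radial
  derivative, their half difference is, up to sign, the current mode number k + a - b over r, and
  for k above the order this number can be divided out because it is comparable to k. For small k it
  may vanish; but these are finitely many, constants may depend on k, and equality of spans is
  enough. The Sobolev norm and the weighted norm meet in a third quantity, the weighted norms of the
  two modes with the indices |k + 1| and |k - 1|. The origin can be cut out because a point of the
  plane has zero capacity.\<close>

definition quasi :: "(complex poly \<Rightarrow> ennreal) \<Rightarrow> bool" where
  "quasi \<nu> \<longleftrightarrow> (\<forall>f g. \<nu> (f + g) \<le> 2 * (\<nu> f + \<nu> g)) \<and>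
     (\<forall>c f. \<nu> (smult c f) \<le> ennreal ((cmod c)\<^sup>2) * \<nu> f)"

text \<open>The constant precedes both quantifiers: it serves all \<open>k\<close> in
  \<open>K\<close> and all functionals at once. Letting \<nu> range over all of \<open>quasi\<close>
  permits replacing \<nu> by its composition with a linear map, the engine of
  \<open>bounded_by_compose\<close>.\<close>

definition bounded_by ::
  "'i set \<Rightarrow> ('i \<Rightarrow> complex poly) \<Rightarrow> ('i \<Rightarrow> (complex poly \<Rightarrow> ennreal) \<Rightarrow> ennreal) \<Rightarrow> bool" where
  "bounded_by K f G \<longleftrightarrow> (\<exists>C::real. \<forall>k\<in>K. \<forall>\<nu>. quasi \<nu> \<longrightarrow> \<nu> (f k) \<le> ennreal C * G k \<nu>)"

lemma quasi_add: "quasi \<nu> \<Longrightarrow> \<nu> (f + g) \<le> 2 * (\<nu> f + \<nu> g)"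
  and quasi_smult: "quasi \<nu> \<Longrightarrow> \<nu> (smult c f) \<le> ennreal ((cmod c)\<^sup>2) * \<nu> f"
  by (auto simp: quasi_def)

lemma quasi_0: "quasi \<nu> \<Longrightarrow> \<nu> 0 = 0"
  using quasi_smult[of \<nu> 0 0] by simp

text \<open>The maps \<open>L\<close> used later are multiplication by a polynomial, scaling, and
  the substitution of X - l for X.\<close>

lemma quasi_compose:
  assumes "quasi \<nu>" "\<And>f g. L (f + g) = L f + L g" "\<And>c f. L (smult c f) = smult c (L f)"
  shows "quasi (\<lambda>f. \<nu> (L f))"
  using assms by (simp add: quasi_def)

section \<open>Calculus of uniform bounds\<close>

lemma bounded_byI:
  "(\<And>k \<nu>. k \<in> K \<Longrightarrow> quasi \<nu> \<Longrightarrow> \<nu> (f k) \<le> ennreal C * G k \<nu>) \<Longrightarrow> bounded_by K f G"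
  by (auto simp: bounded_by_def)

lemma bounded_byE:
  assumes "bounded_by K f G"
  obtains C where "C > 0" "\<And>k \<nu>. k \<in> K \<Longrightarrow> quasi \<nu> \<Longrightarrow> \<nu> (f k) \<le> ennreal C * G k \<nu>"
proof -
  obtain C where C: "\<And>k \<nu>. k \<in> K \<Longrightarrow> quasi \<nu> \<Longrightarrow> \<nu> (f k) \<le> ennreal C * G k \<nu>"
    using assms by (auto simp: bounded_by_def)
  have "\<nu> (f k) \<le> ennreal (max C 1) * G k \<nu>" if "k \<in> K" "quasi \<nu>" for k \<nu>
    using C[OF that] by (rule order_trans) (intro mult_right_mono ennreal_leI, auto)
  then show ?thesis
    by (intro that[of "max C 1"]) auto
qed

lemma bounded_by_mono: "bounded_by K f G \<Longrightarrow> K' \<subseteq> K \<Longrightarrow> bounded_by K' f G"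
  by (auto simp: bounded_by_def)

lemma bounded_by_cong:
  "bounded_by K f G \<Longrightarrow> (\<And>k. k \<in> K \<Longrightarrow> f k = f' k) \<Longrightarrow> bounded_by K f' G"
  by (auto simp: bounded_by_def)

lemma bounded_by_le:
  assumes "bounded_by K f G" "\<And>k \<nu>. k \<in> K \<Longrightarrow> quasi \<nu> \<Longrightarrow> G k \<nu> \<le> G' k \<nu>"
  shows "bounded_by K f G'"
proof -
  obtain C where "C > 0" and C: "\<And>k \<nu>. k \<in> K \<Longrightarrow> quasi \<nu> \<Longrightarrow> \<nu> (f k) \<le> ennreal C * G k \<nu>"
    using assms(1) by (rule bounded_byE) blast
  show ?thesis
    using C assms(2) by (intro bounded_byI[where C = C]) (meson mult_left_mono order_trans zero_le)
qed

lemma bounded_by_add: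
  assumes "bounded_by K f G" "bounded_by K g G"
  shows "bounded_by K (\<lambda>k. f k + g k) G"
proof -
  obtain C where "C > 0" and C: "\<And>k \<nu>. k \<in> K \<Longrightarrow> quasi \<nu> \<Longrightarrow> \<nu> (f k) \<le> ennreal C * G k \<nu>"
    using assms(1) by (rule bounded_byE) blast
  obtain D where "D > 0" and D: "\<And>k \<nu>. k \<in> K \<Longrightarrow> quasi \<nu> \<Longrightarrow> \<nu> (g k) \<le> ennreal D * G k \<nu>"
    using assms(2) by (rule bounded_byE) blast
  show ?thesis
  proof (rule bounded_byI)
    fix k \<nu> assume k: "k \<in> K" and \<nu>: "quasi \<nu>"
    have "\<nu> (f k + g k) \<le> 2 * (ennreal C * G k \<nu> + ennreal D * G k \<nu>)"
      by (rule order_trans[OF quasi_add[OF \<nu>]]) (intro mult_left_mono add_mono C D k \<nu>, simp)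
    also have "\<dots> = ennreal (2 * (C + D)) * G k \<nu>"
      using \<open>C > 0\<close> \<open>D > 0\<close> by (simp add: ennreal_mult'' ennreal_plus algebra_simps flip: ennreal_numeral)
    finally show "\<nu> (f k + g k) \<le> \<dots>" .
  qed
qed

text \<open>Coefficients may vary with \<open>k\<close> as long as they stay bounded; the recursions
  for large modes owe their uniformity to this rule.\<close>

lemma bounded_by_smult:
  assumes "bounded_by K f G" "\<And>k. k \<in> K \<Longrightarrow> cmod (c k) \<le> M"
  shows "bounded_by K (\<lambda>k. smult (c k) (f k)) G"
proof -
  obtain C where "C > 0" and C: "\<And>k \<nu>. k \<in> K \<Longrightarrow> quasi \<nu> \<Longrightarrow> \<nu> (f k) \<le> ennreal C * G k \<nu>"
    using assms(1) by (rule bounded_byE) blast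
  show ?thesis
  proof (rule bounded_byI)
    fix k \<nu> assume k: "k \<in> K" and \<nu>: "quasi \<nu>"
    have "\<nu> (smult (c k) (f k)) \<le> ennreal ((cmod (c k))\<^sup>2) * \<nu> (f k)"
      by (rule quasi_smult[OF \<nu>])
    also have "\<dots> \<le> ennreal (M\<^sup>2) * (ennreal C * G k \<nu>)"
      using assms(2)[OF k] by (intro mult_mono C k \<nu> ennreal_leI power_mono) auto
    also have "\<dots> = ennreal (M\<^sup>2 * C) * G k \<nu>"
      using \<open>C > 0\<close> by (simp add: ennreal_mult' mult.assoc)
    finally show "\<nu> (smult (c k) (f k)) \<le> \<dots>" .
  qed
qed

lemma bounded_by_diff:
  assumes "bounded_by K f G" "bounded_by K g G"
  shows "bounded_by K (\<lambda>k. f k - g k) G"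
  using bounded_by_add[OF assms(1) bounded_by_smult[OF assms(2), of "\<lambda>_. -1" 1]] by simp

text \<open>The index set may depend on \<open>k\<close>, but stays inside a fixed finite
  \<open>B\<close>: the constants of the single indices are added, and each index has to be handled
  only for those \<open>k\<close> for which it occurs.\<close>

lemma bounded_by_sum:
  assumes "finite B" "\<And>k. k \<in> K \<Longrightarrow> A k \<subseteq> B"
    and P: "\<And>a. a \<in> B \<Longrightarrow> bounded_by {k \<in> K. a \<in> A k} (P a) G"
  obtains C where "C > 0"
    "\<And>k \<nu>. k \<in> K \<Longrightarrow> quasi \<nu> \<Longrightarrow> (\<Sum>a\<in>A k. \<nu> (P a k)) \<le> ennreal C * G k \<nu>"
proof -
  have "\<forall>a\<in>B. \<exists>C>0. \<forall>k \<nu>. k \<in> K \<longrightarrow> a \<in> A k \<longrightarrow> quasi \<nu> \<longrightarrow> \<nu> (P a k) \<le> ennreal C * G k \<nu>"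
  proof
    fix a assume "a \<in> B"
    from P[OF this] obtain C where "C > 0"
      "\<And>k \<nu>. k \<in> {k \<in> K. a \<in> A k} \<Longrightarrow> quasi \<nu> \<Longrightarrow> \<nu> (P a k) \<le> ennreal C * G k \<nu>"
      by (rule bounded_byE) blast
    then show "\<exists>C>0. \<forall>k \<nu>. k \<in> K \<longrightarrow> a \<in> A k \<longrightarrow> quasi \<nu> \<longrightarrow> \<nu> (P a k) \<le> ennreal C * G k \<nu>"
      by auto
  qed
  then obtain D where D0: "\<And>a. a \<in> B \<Longrightarrow> D a > 0"
    and D: "\<And>a k \<nu>. a \<in> B \<Longrightarrow> k \<in> K \<Longrightarrow> a \<in> A k \<Longrightarrow> quasi \<nu> \<Longrightarrow> \<nu> (P a k) \<le> ennreal (D a) * G k \<nu>"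
    using bchoice[of B "\<lambda>a C. C > 0 \<and> (\<forall>k \<nu>. k \<in> K \<longrightarrow> a \<in> A k \<longrightarrow> quasi \<nu> \<longrightarrow> \<nu> (P a k) \<le> ennreal C * G k \<nu>)"]
    by blast
  \<comment> \<open>The summand 1 keeps the constant positive when \<open>B\<close> is
    empty.\<close>
  have E: "(\<Sum>a\<in>A k. \<nu> (P a k)) \<le> ennreal (1 + (\<Sum>a\<in>B. D a)) * G k \<nu>" if k: "k \<in> K" and \<nu>: "quasi \<nu>" for k \<nu>
  proof -
    have "(\<Sum>a\<in>A k. \<nu> (P a k)) \<le> (\<Sum>a\<in>A k. ennreal (D a) * G k \<nu>)"
      using assms(2)[OF k] by (intro sum_mono D k \<nu>) auto
    also have "\<dots> \<le> (\<Sum>a\<in>B. ennreal (D a) * G k \<nu>)"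
      using assms(1) assms(2)[OF k] by (intro sum_mono2) auto
    also have "\<dots> = ennreal (\<Sum>a\<in>B. D a) * G k \<nu>"
      using D0 by (simp add: sum_distrib_right[symmetric] less_imp_le)
    also have "\<dots> \<le> ennreal (1 + (\<Sum>a\<in>B. D a)) * G k \<nu>"
      by (intro mult_right_mono ennreal_leI) auto
    finally show ?thesis .
  qed
  have "1 + (\<Sum>a\<in>B. D a) > 0"
    using D0 by (intro add_pos_nonneg sum_nonneg) (auto simp: less_imp_le)
  from that[OF this E] show ?thesis .
qed

text \<open>Transitivity through a linear map: the bound on \<open>f\<close> is applied to \<nu>
  composed with \<open>L k\<close>, which is again \<open>quasi\<close>, and the images of the
  generators are bounded in turn.\<close>

lemma bounded_by_compose:
  assumes f: "bounded_by K f (\<lambda>k \<nu>. \<Sum>a\<in>A k. \<nu> (P a k))"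
    and fin: "finite B" "\<And>k. k \<in> K \<Longrightarrow> A k \<subseteq> B"
    and P: "\<And>a. a \<in> B \<Longrightarrow> bounded_by {k \<in> K. a \<in> A k} (\<lambda>k. L k (P a k)) G"
    and L: "\<And>k f g. L k (f + g) = L k f + L k g" "\<And>k c f. L k (smult c f) = smult c (L k f)"
  shows "bounded_by K (\<lambda>k. L k (f k)) G"
proof -
  obtain C where "C > 0"
    and C: "\<And>k \<nu>. k \<in> K \<Longrightarrow> quasi \<nu> \<Longrightarrow> \<nu> (f k) \<le> ennreal C * (\<Sum>a\<in>A k. \<nu> (P a k))"
    using f by (rule bounded_byE) blast
  obtain D where "D > 0"
    and D: "\<And>k \<nu>. k \<in> K \<Longrightarrow> quasi \<nu> \<Longrightarrow> (\<Sum>a\<in>A k. \<nu> (L k (P a k))) \<le> ennreal D * G k \<nu>"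
    using bounded_by_sum[OF fin P] by blast
  show ?thesis
  proof (rule bounded_byI)
    fix k \<nu> assume k: "k \<in> K" and \<nu>: "quasi \<nu>"
    have "\<nu> (L k (f k)) \<le> ennreal C * (\<Sum>a\<in>A k. \<nu> (L k (P a k)))"
      using C[OF k quasi_compose[OF \<nu>, of "L k"]] L by simp
    also have "\<dots> \<le> ennreal C * (ennreal D * G k \<nu>)"
      by (intro mult_left_mono D k \<nu>) auto
    also have "\<dots> = ennreal (C * D) * G k \<nu>"
      using \<open>C > 0\<close> \<open>D > 0\<close> by (simp add: ennreal_mult mult.assoc)
    finally show "\<nu> (L k (f k)) \<le> \<dots>" .
  qed
qed

text \<open>For finitely many \<open>k\<close> the constants may be chosen separately; this is how
  small modes are treated.\<close>

lemma bounded_by_finite: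
  assumes "finite K" "\<And>k. k \<in> K \<Longrightarrow> bounded_by {k} f G"
  shows "bounded_by K f G"
proof -
  have "\<forall>k\<in>K. \<exists>C>0. \<forall>\<nu>. quasi \<nu> \<longrightarrow> \<nu> (f k) \<le> ennreal C * G k \<nu>"
    using assms(2) by (meson bounded_byE singletonI)
  then obtain C where C0: "\<And>k. k \<in> K \<Longrightarrow> C k > 0"
    and C: "\<And>k \<nu>. k \<in> K \<Longrightarrow> quasi \<nu> \<Longrightarrow> \<nu> (f k) \<le> ennreal (C k) * G k \<nu>"
    by metis
  have "C k \<le> (\<Sum>k\<in>K. C k)" if "k \<in> K" for k
    using that assms(1) C0 by (intro member_le_sum) (auto simp: less_imp_le)
  then have "ennreal (C k) * G k \<nu> \<le> ennreal (\<Sum>k\<in>K. C k) * G k \<nu>" if "k \<in> K" for k \<nu>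
    using that by (intro mult_right_mono ennreal_leI) auto
  with C show ?thesis
    by (intro bounded_byI[where C = "\<Sum>k\<in>K. C k"]) (meson order_trans)
qed

lemma bounded_by_Un:
  assumes "bounded_by K f G" "bounded_by K' f G"
  shows "bounded_by (K \<union> K') f G"
proof -
  obtain C where "C > 0" and C: "\<And>k \<nu>. k \<in> K \<Longrightarrow> quasi \<nu> \<Longrightarrow> \<nu> (f k) \<le> ennreal C * G k \<nu>"
    using assms(1) by (rule bounded_byE) blast
  obtain D where "D > 0" and D: "\<And>k \<nu>. k \<in> K' \<Longrightarrow> quasi \<nu> \<Longrightarrow> \<nu> (f k) \<le> ennreal D * G k \<nu>"
    using assms(2) by (rule bounded_byE) blast
  show ?thesis
  proof (rule bounded_byI[where C = "max C D"])
    fix k \<nu> assume k: "k \<in> K \<union> K'" and \<nu>: "quasi \<nu>"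
    have "ennreal C * G k \<nu> \<le> ennreal (max C D) * G k \<nu>" "ennreal D * G k \<nu> \<le> ennreal (max C D) * G k \<nu>"
      by (auto intro!: mult_right_mono ennreal_leI)
    with C D k \<nu> show "\<nu> (f k) \<le> ennreal (max C D) * G k \<nu>"
      by (meson Un_iff order_trans)
  qed
qed


text \<open>With \<open>X = r d/dr\<close> and \<open>a + b = j\<close>, the distribution \<open>(\<partial>\<^sub>x + \<i>\<partial>\<^sub>y)\<^sup>a (\<partial>\<^sub>x - \<i>\<partial>\<^sub>y)\<^sup>b (w exp (\<i>\<kappa>\<theta>))\<close> has
  the radial part \<open>r\<^sup>-\<^sup>j (hpoly \<kappa> a b)(X) w\<close>; \<open>\<partial>\<^sub>r\<^sup>(\<^sup>j\<^sup>-\<^sup>l\<^sup>) (w / r\<^sup>l)\<close> is \<open>r\<^sup>-\<^sup>j (fall l j)(X) w\<close>, and \<open>spoly k l j\<close> belongs in the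
  same way to the summands of order \<open>j\<close> in the second sum of the weighted norm.\<close>

definition hpoly :: "complex \<Rightarrow> nat \<Rightarrow> nat \<Rightarrow> complex poly" where
  "hpoly \<kappa> a b = (\<Prod>i<a. [:- (\<kappa> + 2 * of_nat i), 1:]) * (\<Prod>i<b. [:\<kappa> - 2 * of_nat i, 1:])"

definition fall :: "nat \<Rightarrow> nat \<Rightarrow> complex poly" where
  "fall l j = (\<Prod>i=l..<j. [:- of_nat i, 1:])"

definition spoly :: "nat \<Rightarrow> nat \<Rightarrow> nat \<Rightarrow> complex poly" where
  "spoly k l j = (\<Prod>i<l. [:- of_nat (k + 2 * i), 1:]) * fall (k + 2 * l) j"

text \<open>\<open>Hsum\<close> and \<open>Csum\<close> collect the terms of a single order
  \<open>j\<close>, the number of derivatives plus the number of factors 1/r. Sums over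
  \<open>j \<le> m\<close> recover the squared norms, up to constants for \<open>Hsum\<close> and
  exactly for \<open>Csum\<close>.\<close>

definition Hsum :: "nat \<Rightarrow> nat \<Rightarrow> (complex poly \<Rightarrow> ennreal) \<Rightarrow> ennreal" where
  "Hsum j k \<nu> = (\<Sum>a\<le>j. \<nu> (hpoly (of_nat k) a (j - a)))"

definition Csum :: "nat \<Rightarrow> nat \<Rightarrow> (complex poly \<Rightarrow> ennreal) \<Rightarrow> ennreal" where
  "Csum j k \<nu> = (\<Sum>l\<in>{..min k j}. \<nu> (smult (of_nat k ^ l) (fall l j)))
     + (\<Sum>l\<in>{1..(j - k) div 2}. \<nu> (spoly k l j))"

section \<open>Recursions for the polynomial families\<close>

lemma hpoly_Suc: "hpoly \<kappa> (Suc a) b = hpoly \<kappa> a b * [:- (\<kappa> + 2 * of_nat a), 1:]"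
  "hpoly \<kappa> a (Suc b) = hpoly \<kappa> a b * [:\<kappa> - 2 * of_nat b, 1:]"
  by (simp_all only: hpoly_def prod.lessThan_Suc mult_ac)

lemma hpoly_0: "hpoly \<kappa> 0 0 = 1"
  by (simp add: hpoly_def)

lemma hpoly_uminus: "hpoly (- \<kappa>) a b = hpoly \<kappa> b a"
  by (simp add: hpoly_def algebra_simps)

text \<open>The linear factors gained in the two mode shifts have the mean X - (a + b), which is the
  factor gained in a radial derivative of a term of order a + b.\<close>

lemma hpoly_average:
  "hpoly \<kappa> a b * [:- of_nat (a + b), 1:] = smult (1/2) (hpoly \<kappa> (Suc a) b + hpoly \<kappa> a (Suc b))"
proof -
  have *: "smult (1/2) ([:- (\<kappa> + 2 * of_nat a), 1:] + [:\<kappa> - 2 * of_nat b, 1:]) = [:- of_nat (a + b), 1:]"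
    by (simp add: field_simps)
  show ?thesis
    unfolding hpoly_Suc distrib_left[symmetric] mult_smult_right[symmetric] * by (rule refl)
qed

text \<open>The two new linear factors differ by a constant, twice the current mode number \<kappa>
  + a - b; this is the tangential derivative of a pure mode.\<close>

lemma hpoly_difference:
  "smult (\<kappa> + of_nat a - of_nat b) (hpoly \<kappa> a b)
     = smult (1/2) (hpoly \<kappa> a (Suc b) - hpoly \<kappa> (Suc a) b)"
proof -
  have *: "smult (1/2) ([:\<kappa> - 2 * of_nat b, 1:] - [:- (\<kappa> + 2 * of_nat a), 1:]) = [:\<kappa> + of_nat a - of_nat b:]"
    by (simp add: field_simps)
  then show ?thesis
    unfolding hpoly_Suc right_diff_distrib[symmetric] mult_smult_right[symmetric] * by simp
qed

lemma fall_refl [simp]: "fall j j = 1"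
  by (simp add: fall_def)

lemma fall_Suc: "l \<le> j \<Longrightarrow> fall l (Suc j) = fall l j * [:- of_nat j, 1:]"
  by (simp only: fall_def prod.atLeastLessThan_Suc)

lemma fall_rec: "l < j \<Longrightarrow> fall l j = [:- of_nat l, 1:] * fall (Suc l) j"
  by (simp only: fall_def prod.atLeast_Suc_lessThan)

section \<open>The weighted family bounded by the Sobolev family\<close>

lemma bounded_by_hpoly:
  assumes "a + b = j"
  shows "bounded_by K (\<lambda>k. hpoly (of_nat k) a b) (Hsum j)"
proof (rule bounded_byI[where C = 1])
  fix k and \<nu> :: "complex poly \<Rightarrow> ennreal"
  show "\<nu> (hpoly (of_nat k) a b) \<le> ennreal 1 * Hsum j k \<nu>"
    unfolding Hsum_def using member_le_sum[of a "{..j}" "\<lambda>a. \<nu> (hpoly (of_nat k) a (j - a))"] assms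
    by auto
qed

text \<open>The factor X - j is one more radial derivative; it turns each generator of order
  \<open>j\<close> into the mean of two generators of order \<open>j + 1\<close>.\<close>

lemma bounded_by_Hsum_deriv:
  assumes "bounded_by K f (Hsum j)"
  shows "bounded_by K (\<lambda>k. f k * [:- of_nat j, 1:]) (Hsum (Suc j))"
proof (rule bounded_by_compose[where A = "\<lambda>_. {..j}" and B = "{..j}"
      and P = "\<lambda>a k. hpoly (of_nat k) a (j - a)" and L = "\<lambda>k f. f * [:- of_nat j, 1:]"])
  fix a assume a: "a \<in> {..j}"
  have "bounded_by {k \<in> K. a \<in> {..j}}
      (\<lambda>k. smult (1/2) (hpoly (of_nat k) (Suc a) (j - a) + hpoly (of_nat k) a (Suc (j - a)))) (Hsum (Suc j))"
    using a by (intro bounded_by_smult[where M = "1/2"] bounded_by_add bounded_by_hpoly) auto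
  then show "bounded_by {k \<in> K. a \<in> {..j}} (\<lambda>k. hpoly (of_nat k) a (j - a) * [:- of_nat j, 1:]) (Hsum (Suc j))"
    using a hpoly_average[of _ a "j - a"] by simp
qed (use assms in \<open>simp_all only: Hsum_def[abs_def] distrib_right mult_smult_left finite_atMost order.refl\<close>)

text \<open>Solve \<open>hpoly_difference\<close> for the polynomial on its left: for a + b = j < k
  the number k + a - b is at least k - j > 0, and the quotient of k by it is bounded in terms of
  \<open>j\<close> alone.\<close>

lemma bounded_by_Hsum_times:
  assumes "bounded_by {k. Suc j \<le> k} f (Hsum j)"
  shows "bounded_by {k. Suc j \<le> k} (\<lambda>k. smult (of_nat k) (f k)) (Hsum (Suc j))"
proof (rule bounded_by_compose[where A = "\<lambda>_. {..j}" and B = "{..j}"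
      and P = "\<lambda>a k. hpoly (of_nat k) a (j - a)" and L = "\<lambda>k. smult (of_nat k)"])
  fix a assume a: "a \<in> {..j}"
  have M: "cmod (of_nat k / (2 * (of_nat k + of_nat a - of_nat (j - a)))) \<le> real (Suc j)" and
    nz: "of_nat k + of_nat a - of_nat (j - a) \<noteq> (0 :: complex)"
    if k: "Suc j \<le> k" for k
  proof -
    have *: "of_nat k + of_nat a - of_nat (j - a) = (of_nat (k + a - (j - a)) :: complex)"
      using that by (subst of_nat_diff) auto
    have pos: "k + a - (j - a) \<ge> 1" using that by auto
    show "of_nat k + of_nat a - of_nat (j - a) \<noteq> (0 :: complex)"
      unfolding * of_nat_eq_0_iff using pos by linarith
    \<comment> \<open>With k = j + 1 + d the divisor is at least d + 1, and k is at most (j + 1)(d +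
      1).\<close>
    obtain d where d: "k = Suc j + d" using le_Suc_ex[OF k] by blast
    have "k \<le> Suc j * (2 * (k + a - (j - a)))"
    proof -
      have "k + a - (j - a) \<ge> Suc d" using d by auto
      then have "Suc j * Suc d \<le> Suc j * (2 * (k + a - (j - a)))" by (intro mult_left_mono) auto
      moreover have "k \<le> Suc j * Suc d" using d by simp
      ultimately show ?thesis by linarith
    qed
    then have "real k \<le> real (Suc j) * (2 * real (k + a - (j - a)))"
      by (metis of_nat_le_iff of_nat_mult of_nat_numeral)
    then show "cmod (of_nat k / (2 * (of_nat k + of_nat a - of_nat (j - a)))) \<le> real (Suc j)"
      unfolding * norm_divide norm_mult norm_of_nat using pos by (simp add: divide_le_eq del: of_nat_Suc)
  qed
  have "bounded_by {k. Suc j \<le> k} (\<lambda>k. smult (of_nat k / (2 * (of_nat k + of_nat a - of_nat (j - a))))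
      (hpoly (of_nat k) a (Suc (j - a)) - hpoly (of_nat k) (Suc a) (j - a))) (Hsum (Suc j))"
    using a M by (intro bounded_by_smult[where M = "real (Suc j)"] bounded_by_diff bounded_by_hpoly) auto
  then show "bounded_by {k \<in> {k. Suc j \<le> k}. a \<in> {..j}} (\<lambda>k. smult (of_nat k) (hpoly (of_nat k) a (j - a))) (Hsum (Suc j))"
  proof (rule bounded_by_mono[OF bounded_by_cong])
    fix k assume "k \<in> {k. Suc j \<le> k}"
    then have nz': "of_nat k + of_nat a - of_nat (j - a) \<noteq> (0 :: complex)" using nz by simp
    have "smult (of_nat k / (2 * (of_nat k + of_nat a - of_nat (j - a))))
      (hpoly (of_nat k) a (Suc (j - a)) - hpoly (of_nat k) (Suc a) (j - a))
      = smult (of_nat k / (of_nat k + of_nat a - of_nat (j - a)))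
          (smult (1/2) (hpoly (of_nat k) a (Suc (j - a)) - hpoly (of_nat k) (Suc a) (j - a)))"
      by (simp add: mult.commute)
    also have "\<dots> = smult (of_nat k) (hpoly (of_nat k) a (j - a))"
      unfolding hpoly_difference[symmetric] smult_smult using nz' by simp
    finally show "smult (of_nat k / (2 * (of_nat k + of_nat a - of_nat (j - a))))
      (hpoly (of_nat k) a (Suc (j - a)) - hpoly (of_nat k) (Suc a) (j - a)) = \<dots>" .
  qed auto
qed (use assms in \<open>simp_all only: Hsum_def[abs_def] smult_add_right smult_smult mult_ac finite_atMost order.refl\<close>)

lemma bounded_by_Hsum_power: "bounded_by {k. l \<le> k} (\<lambda>k. [:of_nat k ^ l:]) (Hsum l)"
proof (induction l)
  case 0
  then show ?case using bounded_by_hpoly[of 0 0 0] by (simp add: hpoly_0 one_pCons)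
next
  case (Suc l)
  have "bounded_by {k. Suc l \<le> k} (\<lambda>k. smult (of_nat k) [:of_nat k ^ l:]) (Hsum (Suc l))"
    by (intro bounded_by_Hsum_times bounded_by_mono[OF Suc]) auto
  then show ?case by simp
qed

text \<open>Powers of \<open>k\<close> do not help here, since \<open>k\<close> may be 0 and the
  order exceeds it. Raise the mode first: \<open>l\<close> plus shifts turn w into r^-l g(X) w of
  mode K = k + l, where g is the product below. To this function
  \<open>bounded_by_Hsum_power\<close> applies at order K, and K > 0 can be divided out. Moving r^-l
  past X replaces X by X - l, whence the composition with \<open>[:- of_nat l, 1:]\<close>.\<close>

lemma bounded_by_Hsum_spoly_top:
  assumes "l \<ge> 1"
  shows "bounded_by {k} (\<lambda>_. spoly k l (k + 2 * l)) (Hsum (k + 2 * l))"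
proof -
  define K where "K = k + l"
  define g :: "complex poly" where "g = (\<Prod>i<l. [:- of_nat (k + 2 * i), 1:])"
  obtain C where "C > 0" and C: "\<And>\<nu>. quasi \<nu> \<Longrightarrow> \<nu> [:of_nat K ^ K:] \<le> ennreal C * Hsum K K \<nu>"
    using bounded_by_Hsum_power[of K] by (rule bounded_byE) auto
  have h: "g * pcompose (hpoly (of_nat K) a (K - a)) [:- of_nat l, 1:] = hpoly (of_nat k) (l + a) (K - a)" for a
  proof -
    have "g * (\<Prod>i<a. [:- of_nat l - (of_nat K + 2 * of_nat i), 1:]) = (\<Prod>i<l + a. [:- (of_nat k + 2 * of_nat i), 1:])"
    proof (induction a)
      case 0 then show ?case by (simp add: g_def)
    next
      case (Suc a)
      show ?case
        by (simp only: prod.lessThan_Suc add_Suc_right mult.assoc[symmetric] Suc) (simp add: K_def algebra_simps)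
    qed
    moreover have "[:of_nat K - 2 * of_nat i - of_nat l, 1:] = [:of_nat k - 2 * of_nat i, (1::complex):]" for i
      by (simp add: K_def)
    moreover have "pcompose (hpoly (of_nat K) a (K - a)) [:- of_nat l, 1:] =
        (\<Prod>i<a. [:- of_nat l - (of_nat K + 2 * of_nat i), 1:]) * (\<Prod>i<K - a. [:of_nat K - 2 * of_nat i - of_nat l, 1:])"
      unfolding hpoly_def pcompose_mult pcompose_prod
      by (intro arg_cong2[where f = "(*)"] prod.cong) (simp_all add: pcompose_pCons)
    ultimately show ?thesis
      by (simp only: hpoly_def mult.assoc[symmetric])
  qed
  have "bounded_by {k} (\<lambda>k'. smult (of_nat K ^ K) g) (Hsum (k + 2 * l))"
  proof (rule bounded_byI[where C = C])
    fix k' \<nu> assume k': "k' \<in> {k}" and \<nu>: "quasi \<nu>"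
    let ?\<nu> = "\<lambda>f. \<nu> (g * pcompose f [:- of_nat l, 1:])"
    have "quasi ?\<nu>"
      by (rule quasi_compose[OF \<nu>]) (simp_all add: pcompose_add pcompose_smult distrib_left)
    from C[OF this] have "\<nu> (smult (of_nat K ^ K) g) \<le> ennreal C * Hsum K K ?\<nu>"
      by (simp add: pcompose_const)
    \<comment> \<open>Only the generators with index l, ..., l + K among those of order k + 2 l
      occur.\<close>
    also have "Hsum K K ?\<nu> = (\<Sum>a\<in>(+) l ` {..K}. \<nu> (hpoly (of_nat k) a (k + 2 * l - a)))"
      unfolding Hsum_def h by (subst sum.reindex) (auto simp: K_def add.commute intro!: sum.cong)
    also have "\<dots> \<le> Hsum (k + 2 * l) k' \<nu>"
      unfolding Hsum_def using k' by (auto simp: K_def intro!: sum_mono2)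
    finally show "\<nu> (smult (of_nat K ^ K) g) \<le> ennreal C * Hsum (k + 2 * l) k' \<nu>"
      by (simp add: mult_left_mono)
  qed
  then have "bounded_by {k} (\<lambda>k'. smult (1 / of_nat K ^ K) (smult (of_nat K ^ K) g)) (Hsum (k + 2 * l))"
    by (rule bounded_by_smult) blast
  moreover have "of_nat K \<noteq> (0 :: complex)"
    using assms unfolding K_def of_nat_eq_0_iff by simp
  then have "smult (1 / of_nat K ^ K) (smult (of_nat K ^ K) g) = spoly k l (k + 2 * l)"
    by (simp add: g_def spoly_def)
  ultimately show ?thesis
    by (simp only:)
qed

lemma bounded_by_Hsum_derivs:
  assumes "bounded_by K f (Hsum l)" "l \<le> j"
  shows "bounded_by K (\<lambda>k. f k * fall l j) (Hsum j)"
  using assms(2)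
proof (induction j rule: dec_induct)
  case base
  then show ?case using assms(1) by simp
next
  case (step j)
  from bounded_by_Hsum_deriv[OF step.IH] show ?case
    using step by (simp only: fall_Suc mult.assoc)
qed

text \<open>The first sum is uniform in \<open>k\<close>: the constant k^l is available at order l
  for every k \<ge> l, and radial derivatives lift it to order j. The second sum is nonempty only if
  k + 2 l \<le> j for some l \<ge> 1, hence for finitely many \<open>k\<close>.\<close>

lemma Csum_le_Hsum: "\<exists>C>0. \<forall>k \<nu>. quasi \<nu> \<longrightarrow> Csum j k \<nu> \<le> ennreal C * Hsum j k \<nu>"
proof -
  obtain C where C: "C > 0" "\<And>k \<nu>. k \<in> UNIV \<Longrightarrow> quasi \<nu> \<Longrightarrow>
      (\<Sum>l\<in>{..min k j}. \<nu> (smult (of_nat k ^ l) (fall l j))) \<le> ennreal C * Hsum j k \<nu>"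
  proof (rule bounded_by_sum[where A = "\<lambda>k. {..min k j}" and B = "{..j}" and K = UNIV
        and P = "\<lambda>l k. smult (of_nat k ^ l) (fall l j)" and G = "Hsum j"])
    fix l assume "l \<in> {..j}"
    moreover have "[:of_nat k ^ l:] * fall l j = smult (of_nat k ^ l) (fall l j)" for k by simp
    ultimately have "bounded_by {k. l \<le> k} (\<lambda>k. smult (of_nat k ^ l) (fall l j)) (Hsum j)"
      using bounded_by_Hsum_derivs[OF bounded_by_Hsum_power, of l j] by (simp only: atMost_iff)
    then show "bounded_by {k \<in> UNIV. l \<in> {..min k j}} (\<lambda>k. smult (of_nat k ^ l) (fall l j)) (Hsum j)"
      by (rule bounded_by_mono) auto
  qed auto
  obtain D where D: "D > 0" "\<And>k \<nu>. k \<in> UNIV \<Longrightarrow> quasi \<nu> \<Longrightarrow>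
      (\<Sum>l\<in>{1..(j - k) div 2}. \<nu> (spoly k l j)) \<le> ennreal D * Hsum j k \<nu>"
  proof (rule bounded_by_sum[where A = "\<lambda>k. {1..(j - k) div 2}" and B = "{..j}" and K = UNIV
        and P = "\<lambda>l k. spoly k l j" and G = "Hsum j"])
    fix l
    show "bounded_by {k \<in> UNIV. l \<in> {1..(j - k) div 2}} (\<lambda>k. spoly k l j) (Hsum j)"
    proof (rule bounded_by_finite)
      fix k assume "k \<in> {k \<in> UNIV. l \<in> {1..(j - k) div 2}}"
      then have l: "1 \<le> l" "k + 2 * l \<le> j" by auto
      have "bounded_by {k} (\<lambda>_. spoly k l (k + 2 * l) * fall (k + 2 * l) j) (Hsum j)"
        by (rule bounded_by_Hsum_derivs[OF bounded_by_Hsum_spoly_top[OF l(1), of k] l(2)])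
      moreover have "spoly k l (k + 2 * l) * fall (k + 2 * l) j = spoly k l j"
        by (simp add: spoly_def)
      ultimately have "bounded_by {k} (\<lambda>_. spoly k l j) (Hsum j)"
        by (simp only:)
      then show "bounded_by {k} (\<lambda>k. spoly k l j) (Hsum j)"
        by (rule bounded_by_cong) simp
    qed (auto intro: finite_subset[of _ "{..j}"])
  qed auto
  have "Csum j k \<nu> \<le> ennreal (C + D) * Hsum j k \<nu>" if "quasi \<nu>" for k \<nu>
    using C D that unfolding Csum_def by (simp add: ennreal_plus distrib_right add_mono)
  then show ?thesis using C(1) D(1) by (intro exI[of _ "C + D"]) simp
qed

section \<open>The Sobolev family bounded by the weighted family: large modes\<close>

lemma bounded_by_Csum_fall: "l \<le> j \<Longrightarrow> K \<subseteq> {k. l \<le> k} \<Longrightarrow> bounded_by K (\<lambda>k. smult (of_nat k ^ l) (fall l j)) (Csum j)"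
  unfolding Csum_def
  by (rule bounded_byI[where C = 1], simp, rule add_increasing2, simp)
    (rule member_le_sum, auto)

lemma bounded_by_Csum_spoly: "1 \<le> l \<Longrightarrow> K \<subseteq> {k. k + 2 * l \<le> j} \<Longrightarrow> bounded_by K (\<lambda>k. spoly k l j) (Csum j)"
  unfolding Csum_def
  by (rule bounded_byI[where C = 1], simp, rule add_increasing, simp)
    (rule member_le_sum, auto)

text \<open>For j \<le> k the second sum of \<open>Csum\<close> is empty and the first runs over all
  l \<le> j, so it suffices to extend each \<open>fall l j\<close> by one factor.\<close>

lemma bounded_by_Csum_deriv:
  assumes "bounded_by {k. j \<le> k} f (Csum j)"
  shows "bounded_by {k. j \<le> k} (\<lambda>k. f k * [:- of_nat j, 1:]) (Csum (Suc j))"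
proof (rule bounded_by_compose[where A = "\<lambda>k. {..j}" and B = "{..j}"
      and P = "\<lambda>l k. smult (of_nat k ^ l) (fall l j)" and L = "\<lambda>k f. f * [:- of_nat j, 1:]"])
  show "bounded_by {k. j \<le> k} f (\<lambda>k \<nu>. \<Sum>l\<in>{..j}. \<nu> (smult (of_nat k ^ l) (fall l j)))"
    by (rule bounded_by_le[OF assms]) (auto simp: Csum_def min_absorb2)
  fix l assume l: "l \<in> {..j}"
  then have "bounded_by {k. j \<le> k} (\<lambda>k. smult (of_nat k ^ l) (fall l (Suc j))) (Csum (Suc j))"
    by (intro bounded_by_Csum_fall) auto
  then show "bounded_by {k \<in> {k. j \<le> k}. l \<in> {..j}} (\<lambda>k. smult (of_nat k ^ l) (fall l j) * [:- of_nat j, 1:]) (Csum (Suc j))"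
    by (rule bounded_by_mono[OF bounded_by_cong]) (use l in \<open>auto simp only: fall_Suc mult_smult_left\<close>)
qed (auto simp only: distrib_right mult_smult_left)

text \<open>The extra power of \<open>k\<close> must be absorbed at order j + 1, where k^(l+1) comes
  with \<open>fall (l + 1) (j + 1)\<close> and not with \<open>fall l j\<close>. Descending
  induction on \<open>l\<close> trades one for the other, starting from the pure power at l =
  j.\<close>

lemma bounded_by_Csum_times:
  assumes "bounded_by {k. Suc j \<le> k} f (Csum j)"
  shows "bounded_by {k. Suc j \<le> k} (\<lambda>k. smult (of_nat k) (f k)) (Csum (Suc j))"
proof (rule bounded_by_compose[where A = "\<lambda>k. {..j}" and B = "{..j}"
      and P = "\<lambda>l k. smult (of_nat k ^ l) (fall l j)" and L = "\<lambda>k f. smult (of_nat k) f"])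
  show "bounded_by {k. Suc j \<le> k} f (\<lambda>k \<nu>. \<Sum>l\<in>{..j}. \<nu> (smult (of_nat k ^ l) (fall l j)))"
    by (rule bounded_by_le[OF assms]) (auto simp: Csum_def min_absorb2)
  have *: "bounded_by {k. Suc j \<le> k} (\<lambda>k. smult (of_nat k ^ Suc l) (fall l j)) (Csum (Suc j))" if "l \<le> j" for l
    using that
  proof (induction l rule: inc_induct)
    case base
    have "bounded_by {k. Suc j \<le> k} (\<lambda>k. smult (of_nat k ^ Suc j) (fall (Suc j) (Suc j))) (Csum (Suc j))"
      by (rule bounded_by_Csum_fall) auto
    then show ?case by simp
  next
    case (step l)
    \<comment> \<open>From X - l = (X - j) + (j - l). The correction has one power of
      \<open>k\<close> less than the induction hypothesis offers, which leaves the coefficient (j -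
      l) / k, at most 1.\<close>
    have eq: "fall l j = fall (Suc l) (Suc j) + smult (of_nat (j - l)) (fall (Suc l) j)"
    proof -
      have "fall (Suc l) (Suc j) + smult (of_nat (j - l)) (fall (Suc l) j)
          = ([:- of_nat j, 1:] + [:of_nat (j - l):]) * fall (Suc l) j"
        using step.hyps by (simp only: fall_Suc Suc_le_eq distrib_right) (simp add: mult.commute)
      also have "[:- of_nat j, 1:] + [:of_nat (j - l):] = [:- of_nat l, (1 :: complex):]"
        using step.hyps by (simp add: of_nat_diff)
      also have "[:- of_nat l, 1:] * fall (Suc l) j = fall l j"
        using step.hyps by (simp only: fall_rec)
      finally show ?thesis ..
    qed
    have "bounded_by {k. Suc j \<le> k} (\<lambda>k. smult (of_nat k ^ Suc l) (fall (Suc l) (Suc j))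
        + smult (of_nat (j - l) / of_nat k) (smult (of_nat k ^ Suc (Suc l)) (fall (Suc l) j))) (Csum (Suc j))"
    proof (intro bounded_by_add bounded_by_smult[OF step.IH, where M = 1] bounded_by_Csum_fall)
      fix k assume "k \<in> {k. Suc j \<le> k}"
      then show "cmod (of_nat (j - l) / of_nat k) \<le> 1"
        unfolding norm_divide norm_of_nat by (auto simp: divide_le_eq)
    qed (use step.hyps in auto)
    then show ?case
    proof (rule bounded_by_cong)
      fix k assume "k \<in> {k. Suc j \<le> k}"
      then show "smult (of_nat k ^ Suc l) (fall (Suc l) (Suc j))
        + smult (of_nat (j - l) / of_nat k) (smult (of_nat k ^ Suc (Suc l)) (fall (Suc l) j))
        = smult (of_nat k ^ Suc l) (fall l j)"
        unfolding eq smult_add_right smult_smult by (simp add: field_simps)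
    qed
  qed
  fix l assume l: "l \<in> {..j}"
  then have "bounded_by {k. Suc j \<le> k} (\<lambda>k. smult (of_nat k ^ Suc l) (fall l j)) (Csum (Suc j))"
    by (intro *) auto
  then show "bounded_by {k \<in> {k. Suc j \<le> k}. l \<in> {..j}} (\<lambda>k. smult (of_nat k) (smult (of_nat k ^ l) (fall l j))) (Csum (Suc j))"
    by (rule bounded_by_mono[OF bounded_by_cong]) (use l in auto)
qed (auto simp: smult_add_right mult_ac)

text \<open>The factor gained in a mode shift is X - j minus or plus the mode number k + a - b: a
  radial derivative and a multiplication by \<open>k\<close> up to a bounded ratio.\<close>

lemma bounded_by_Csum_large: "a + b = j \<Longrightarrow> bounded_by {k. j \<le> k} (\<lambda>k. hpoly (of_nat k) a b) (Csum j)"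
proof (induction j arbitrary: a b)
  case 0
  have "bounded_by {k. 0 \<le> k} (\<lambda>k. smult (of_nat k ^ 0) (fall 0 0)) (Csum 0)"
    by (rule bounded_by_Csum_fall) auto
  then show ?case using 0 by (simp add: hpoly_0 one_pCons)
next
  case (Suc j)
  \<comment> \<open>c = -1 yields the shift in \<open>a\<close> and c = 1 the shift in
    \<open>b\<close>.\<close>
  have step: "bounded_by {k. Suc j \<le> k} (\<lambda>k. hpoly (of_nat k) a b * [:- of_nat j, 1:]
      + smult ((c * (of_nat k + of_nat a - of_nat b)) / of_nat k) (smult (of_nat k) (hpoly (of_nat k) a b))) (Csum (Suc j))"
    if "a + b = j" "cmod c \<le> 1" for a b c
  proof (rule bounded_by_add)
    show "bounded_by {k. Suc j \<le> k} (\<lambda>k. hpoly (of_nat k) a b * [:- of_nat j, 1:]) (Csum (Suc j))"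
      by (rule bounded_by_mono[OF bounded_by_Csum_deriv[OF Suc.IH[OF that(1)]]]) auto
    show "bounded_by {k. Suc j \<le> k} (\<lambda>k. smult ((c * (of_nat k + of_nat a - of_nat b)) / of_nat k) (smult (of_nat k) (hpoly (of_nat k) a b))) (Csum (Suc j))"
    proof (rule bounded_by_smult[where M = "real (2 * j + 1)"])
      show "bounded_by {k. Suc j \<le> k} (\<lambda>k. smult (of_nat k) (hpoly (of_nat k) a b)) (Csum (Suc j))"
        by (intro bounded_by_Csum_times bounded_by_mono[OF Suc.IH[OF that(1)]]) auto
      fix k assume k: "k \<in> {k. Suc j \<le> k}"
      have "cmod (of_nat k + of_nat a - of_nat b) \<le> real k + real a + real b"
        using norm_triangle_ineq4[of "of_nat k + of_nat a" "of_nat b :: complex"]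
          norm_triangle_ineq[of "of_nat k" "of_nat a :: complex"] by simp
      then have "cmod c * cmod (of_nat k + of_nat a - of_nat b) \<le> 1 * (real k + real j)"
        using that by (intro mult_mono) auto
      also have "\<dots> \<le> real (2 * j + 1) * real k"
      proof -
        have "1 * (k + j) \<le> (2 * j + 1) * k" using k by (cases k) auto
        then have "real (1 * (k + j)) \<le> real ((2 * j + 1) * k)" by (simp only: of_nat_le_iff)
        then show ?thesis by (simp only: of_nat_mult of_nat_add of_nat_1)
      qed
      finally show "cmod (c * (of_nat k + of_nat a - of_nat b) / of_nat k) \<le> real (2 * j + 1)"
        using k by (simp add: norm_divide norm_mult divide_le_eq)
    qed
  qed
  have nz: "of_nat k \<noteq> (0::complex)" if "k \<in> {k. Suc j \<le> k}" for k using that by auto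
  show ?case
  proof (cases a)
    case (Suc a')
    then have ab: "a' + b = j" using Suc.prems by simp
    show ?thesis unfolding \<open>a = Suc a'\<close>
    proof (rule bounded_by_cong[OF step[OF ab, of "-1"]])
      fix k assume k: "k \<in> {k. Suc j \<le> k}"
      show "hpoly (of_nat k) a' b * [:- of_nat j, 1:] + smult (- 1 * (of_nat k + of_nat a' - of_nat b) / of_nat k)
            (smult (of_nat k) (hpoly (of_nat k) a' b)) = hpoly (of_nat k) (Suc a') b"
      proof -
        have "smult (- 1 * (of_nat k + of_nat a' - of_nat b) / of_nat k) (smult (of_nat k) (hpoly (of_nat k) a' b))
          = hpoly (of_nat k) a' b * [:- (of_nat k + of_nat a' - of_nat b):]"
          using nz[OF k] by simp
        then show ?thesis
          by (simp only: distrib_left[symmetric] hpoly_Suc) (simp add: ab[symmetric] algebra_simps)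
      qed
    qed simp
  next
    case 0
    then obtain b' where b': "b = Suc b'" using Suc.prems by (cases b) auto
    then have ab: "a + b' = j" using Suc.prems by simp
    show ?thesis unfolding b'
    proof (rule bounded_by_cong[OF step[OF ab, of 1]])
      fix k assume k: "k \<in> {k. Suc j \<le> k}"
      show "hpoly (of_nat k) a b' * [:- of_nat j, 1:] + smult (1 * (of_nat k + of_nat a - of_nat b') / of_nat k)
            (smult (of_nat k) (hpoly (of_nat k) a b')) = hpoly (of_nat k) a (Suc b')"
      proof -
        have "smult (1 * (of_nat k + of_nat a - of_nat b') / of_nat k) (smult (of_nat k) (hpoly (of_nat k) a b'))
          = hpoly (of_nat k) a b' * [:of_nat k + of_nat a - of_nat b':]"
          using nz[OF k] by simp
        then show ?thesis
          by (simp only: distrib_left[symmetric] hpoly_Suc) (simp add: ab[symmetric] algebra_simps)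
      qed
    qed simp
  qed
qed

section \<open>Small modes: polynomials with prescribed zeros\<close>

text \<open>These are the linear combinations of the polynomials in \<open>Csum j k\<close>, and among them those
  in \<open>Hsum j k\<close>.\<close>

definition admissible :: "nat \<Rightarrow> nat \<Rightarrow> complex poly \<Rightarrow> bool" where
  "admissible k j p \<longleftrightarrow> degree p \<le> j \<and> (\<forall>i. k + 2 * i < j \<longrightarrow> poly p (of_nat (k + 2 * i)) = 0)"

lemma admissible_diff_smult:
  "admissible k j p \<Longrightarrow> admissible k j e \<Longrightarrow> admissible k j (p - smult c e)"
  by (auto simp: admissible_def intro!: degree_diff_le degree_smult_le[THEN order_trans])

lemma poly_fall: "poly (fall l j) x = (\<Prod>i=l..<j. x - of_nat i)"
  by (simp add: fall_def poly_prod)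

lemma poly_fall_eq_0: "poly (fall l j) (of_nat n) = 0 \<longleftrightarrow> l \<le> n \<and> n < j"
  by (auto simp: poly_fall)

lemma monic_prod_linear: "finite A \<Longrightarrow> lead_coeff (\<Prod>i\<in>A. [:c i, 1 :: complex:]) = 1"
  and degree_prod_linear: "finite A \<Longrightarrow> degree (\<Prod>i\<in>A. [:c i, 1 :: complex:]) = card A"
  by (simp add: lead_coeff_prod, subst degree_prod_eq_sum_degree) auto

lemma degree_fall [simp]: "degree (fall l j) = j - l"
  by (simp only: fall_def degree_prod_linear finite_atLeastLessThan card_atLeastLessThan)

lemma lead_coeff_fall: "lead_coeff (fall l j) = 1"
  unfolding fall_def by (intro monic_prod_linear finite_atLeastLessThan)

lemma fall_nonzero [simp]: "fall l j \<noteq> 0"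
  using lead_coeff_fall[of l j] by auto

lemma lead_coeff_spoly: "lead_coeff (spoly k l j) = 1"
  by (simp only: spoly_def lead_coeff_mult monic_prod_linear finite_lessThan lead_coeff_fall mult_1)

lemma degree_spoly: "degree (spoly k l j) = l + (j - (k + 2 * l))"
proof -
  define P :: "complex poly" where "P = (\<Prod>i<l. [:- of_nat (k + 2 * i), 1:])"
  have 1: "lead_coeff P = 1" unfolding P_def by (intro monic_prod_linear finite_lessThan)
  have 2: "P \<noteq> 0" using 1 by force
  have 3: "degree (spoly k l j) = degree P + degree (fall (k + 2 * l) j)"
    unfolding spoly_def P_def[symmetric] by (rule degree_mult_eq[OF 2 fall_nonzero])
  have 4: "degree P = card {..<l}" unfolding P_def by (intro degree_prod_linear finite_lessThan)
  show ?thesis unfolding 3 4 degree_fall card_lessThan by (rule refl)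
qed

lemma admissible_fall: "l \<le> k \<Longrightarrow> admissible k j (smult c (fall l j))"
  unfolding admissible_def
  by (auto simp: poly_fall_eq_0 simp del: of_nat_add of_nat_mult intro!: degree_smult_le[THEN order_trans])

lemma admissible_spoly: "k + 2 * l \<le> j \<Longrightarrow> admissible k j (spoly k l j)"
  unfolding admissible_def
proof (intro conjI allI impI)
  fix i assume "k + 2 * l \<le> j" "k + 2 * i < j"
  then show "poly (spoly k l j) (of_nat (k + 2 * i)) = 0"
    by (cases "i < l") (auto simp: spoly_def poly_prod poly_fall_eq_0 simp del: of_nat_add of_nat_mult intro!: prod_zero)
qed (simp add: degree_spoly)

text \<open>A zero k + 2 i below a + b comes from the first product if i < a; otherwise a \<le> i
  forces k + i < b, and the factor of index i + k in the second product vanishes there.\<close>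

lemma admissible_hpoly: "a + b = j \<Longrightarrow> admissible k j (hpoly (of_nat k) a b)"
  unfolding admissible_def
proof (intro conjI allI impI)
  assume ab: "a + b = j"
  have "degree (hpoly (of_nat k) a b) \<le> degree (\<Prod>i<a. [:- (of_nat k + 2 * of_nat i), 1 :: complex:])
      + degree (\<Prod>i<b. [:of_nat k - 2 * of_nat i, 1 :: complex:])"
    unfolding hpoly_def by (rule degree_mult_le)
  also have "\<dots> = j"
    using ab by (simp only: degree_prod_linear finite_lessThan card_lessThan)
  finally show "degree (hpoly (of_nat k) a b) \<le> j" .
  fix i assume i: "k + 2 * i < j"
  show "poly (hpoly (of_nat k) a b) (of_nat (k + 2 * i)) = 0"
  proof (cases "i < a")
    case True
    then show ?thesis by (auto simp: hpoly_def poly_prod intro!: prod_zero bexI[of _ i])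
  next
    case False
    then have "i + k < b" using i ab by auto
    then show ?thesis by (auto simp: hpoly_def poly_prod intro!: prod_zero bexI[of _ "i + k"])
  qed
qed

text \<open>Descent on the degree: every degree that an admissible polynomial can have is attained
  by a member of the weighted family, itself admissible, so the leading term can be removed without
  leaving the space.\<close>

lemma bounded_by_Csum_admissible:
  assumes "admissible k j p"
  shows "bounded_by {k} (\<lambda>_. p) (Csum j)"
  using assms
proof (induction "degree p" arbitrary: p rule: less_induct)
  case less
  show ?case
  proof (cases "p = 0")
    case True
    then show ?thesis by (intro bounded_byI[where C = 0]) (simp add: quasi_0)
  next
    case False
    define n where "n = degree p"
    have n: "n \<le> j" using less.prems by (simp add: admissible_def n_def)
    obtain e where e: "bounded_by {k} (\<lambda>_. e) (Csum j)" "admissible k j e" "degree e = n" "e \<noteq> 0"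
    proof (cases "j - n \<le> k")
      case True
      let ?e = "smult (of_nat k ^ (j - n)) (fall (j - n) j)"
      \<comment> \<open>For k = 0 the case assumption makes the exponent 0, and 0^0 = 1.\<close>
      have nz: "of_nat k ^ (j - n) \<noteq> (0 :: complex)" using True \<open>n \<le> j\<close> by (cases "k = 0") auto
      have "bounded_by {k} (\<lambda>k. smult (of_nat k ^ (j - n)) (fall (j - n) j)) (Csum j)"
        using True by (intro bounded_by_Csum_fall) auto
      then have "bounded_by {k} (\<lambda>_. ?e) (Csum j)" by (rule bounded_by_cong) simp
      then show ?thesis
        using True nz n by (intro that[of ?e]) (auto intro!: admissible_fall)
    next
      case False
      \<comment> \<open>Counting the prescribed zeros bounds the degree n from below; hence l = j -
        k - n satisfies k + 2 l \<le> j, and \<open>spoly k l j\<close> has degree n.\<close>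
      let ?Z = "(\<lambda>i. of_nat (k + 2 * i)) ` {..<(j - k + 1) div 2} :: complex set"
      have "card ?Z = (j - k + 1) div 2" by (subst card_image) (auto simp: inj_on_def)
      moreover have "card ?Z \<le> card {x. poly p x = 0}"
        using less.prems \<open>p \<noteq> 0\<close> by (intro card_mono poly_roots_finite) (auto simp: admissible_def simp del: of_nat_add of_nat_mult)
      moreover have "card {x. poly p x = 0} \<le> n"
        unfolding n_def using \<open>p \<noteq> 0\<close> by (rule card_poly_roots_bound)
      ultimately have "(j - k + 1) div 2 \<le> n" by linarith
      then have l: "1 \<le> j - k - n" "k + 2 * (j - k - n) \<le> j" "j - k - n + (j - (k + 2 * (j - k - n))) = n"
        using False by auto
      have "bounded_by {k} (\<lambda>k'. spoly k' (j - k - n) j) (Csum j)"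
        using l by (intro bounded_by_Csum_spoly) auto
      then have "bounded_by {k} (\<lambda>_. spoly k (j - k - n) j) (Csum j)"
        by (rule bounded_by_cong) simp
      then show ?thesis
        using l lead_coeff_spoly[of k "j - k - n" j]
        by (intro that[of "spoly k (j - k - n) j"]) (auto intro!: admissible_spoly simp: degree_spoly)
    qed
    define c where "c = lead_coeff p / lead_coeff e"
    define q where "q = p - smult c e"
    have q: "admissible k j q" unfolding q_def by (intro admissible_diff_smult less.prems e)
    have "coeff e n \<noteq> 0" using e(3,4) by auto
    then have "coeff q n = 0" using e(3) by (simp add: q_def c_def n_def)
    moreover have "degree q \<le> n"
      unfolding q_def using e by (intro degree_diff_le degree_smult_le[THEN order_trans]) (auto simp: n_def)
    ultimately have "q = 0 \<or> degree q < n"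
      by (metis le_neq_implies_less leading_coeff_0_iff)
    then have "bounded_by {k} (\<lambda>_. q) (Csum j)"
      using less.hyps[of q] q by (auto simp: n_def intro: bounded_byI[where C = 0] simp: quasi_0)
    then have "bounded_by {k} (\<lambda>_. q + smult c e) (Csum j)"
      by (intro bounded_by_add bounded_by_smult[OF e(1), where M = "cmod c"]) auto
    then show ?thesis by (simp add: q_def)
  qed
qed

text \<open>The recursion covers j \<le> k with one constant; the finitely many k < j follow from
  admissibility, each with its own.\<close>

lemma Hsum_le_Csum: "\<exists>C>0. \<forall>k \<nu>. quasi \<nu> \<longrightarrow> Hsum j k \<nu> \<le> ennreal C * Csum j k \<nu>"
proof -
  obtain C where C: "C > 0" "\<And>k \<nu>. k \<in> UNIV \<Longrightarrow> quasi \<nu> \<Longrightarrow>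
      (\<Sum>a\<in>{..j}. \<nu> (hpoly (of_nat k) a (j - a))) \<le> ennreal C * Csum j k \<nu>"
  proof (rule bounded_by_sum[where A = "\<lambda>k. {..j}" and B = "{..j}" and K = UNIV
        and P = "\<lambda>a k. hpoly (of_nat k) a (j - a)" and G = "Csum j"])
    fix a assume a: "a \<in> {..j}"
    have "bounded_by ({k. j \<le> k} \<union> {..<j}) (\<lambda>k. hpoly (of_nat k) a (j - a)) (Csum j)"
    proof (rule bounded_by_Un[OF bounded_by_Csum_large bounded_by_finite])
      fix k
      have "bounded_by {k} (\<lambda>_. hpoly (of_nat k) a (j - a)) (Csum j)"
        using a by (intro bounded_by_Csum_admissible admissible_hpoly) auto
      then show "bounded_by {k} (\<lambda>k. hpoly (of_nat k) a (j - a)) (Csum j)"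
        by (rule bounded_by_cong) simp
    qed (use a in auto)
    then show "bounded_by {k \<in> UNIV. a \<in> {..j}} (\<lambda>k. hpoly (of_nat k) a (j - a)) (Csum j)"
      by (rule bounded_by_mono) auto
  qed auto
  then show ?thesis by (intro exI[of _ C]) (auto simp: Hsum_def)
qed

text \<open>What the coupled norm controls, at order \<open>j\<close>, for the combination w of the
  larger mode k + 1: the family of mode k - 1 and the radial derivatives of r^-k w. The guard
  \<open>k \<le> j\<close> matters, because \<open>fall k j\<close> is the empty product 1 for j <
  k.\<close>

definition Vsum :: "nat \<Rightarrow> nat \<Rightarrow> (complex poly \<Rightarrow> ennreal) \<Rightarrow> ennreal" where
  "Vsum j k \<nu> = Csum j (k - 1) \<nu> + (if k \<le> j then \<nu> (fall k j) else 0)"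

text \<open>The mode is fixed and the constant may depend on it. The dominating family has its own
  index \<open>k'\<close>, so that modes can be exchanged.\<close>

lemma Csum_le_of_admissible:
  assumes "\<And>p. admissible k j p \<Longrightarrow> bounded_by {k'} (\<lambda>_. p) G"
  shows "\<exists>C>0. \<forall>\<nu>. quasi \<nu> \<longrightarrow> Csum j k \<nu> \<le> ennreal C * G k' \<nu>"
proof -
  obtain C where C: "C > 0" "\<And>k'' \<nu>. k'' \<in> {k'} \<Longrightarrow> quasi \<nu> \<Longrightarrow>
      (\<Sum>l\<in>{..min k j}. \<nu> (smult (of_nat k ^ l) (fall l j))) \<le> ennreal C * G k'' \<nu>"
    by (rule bounded_by_sum[where A = "\<lambda>_. {..min k j}" and B = "{..min k j}" and K = "{k'}"
        and P = "\<lambda>l _. smult (of_nat k ^ l) (fall l j)" and G = G])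
      (auto intro!: bounded_by_mono[OF assms] admissible_fall)
  obtain D where D: "D > 0" "\<And>k'' \<nu>. k'' \<in> {k'} \<Longrightarrow> quasi \<nu> \<Longrightarrow>
      (\<Sum>l\<in>{1..(j - k) div 2}. \<nu> (spoly k l j)) \<le> ennreal D * G k'' \<nu>"
    by (rule bounded_by_sum[where A = "\<lambda>_. {1..(j - k) div 2}" and B = "{1..(j - k) div 2}" and K = "{k'}"
        and P = "\<lambda>l _. spoly k l j" and G = G])
      (auto intro!: bounded_by_mono[OF assms] admissible_spoly)
  have "Csum j k \<nu> \<le> ennreal (C + D) * G k' \<nu>" if "quasi \<nu>" for \<nu>
    using C D that unfolding Csum_def by (simp add: ennreal_plus distrib_right add_mono)
  then show ?thesis using C(1) D(1) by (intro exI[of _ "C + D"]) simp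
qed

text \<open>\<open>fall k j\<close> vanishes at k + 1, k + 3, ... below j but not at k - 1, so it
  spans the one dimension that is gained when the zero at k - 1 is given up.\<close>

lemma Csum_le_Vsum:
  assumes "1 \<le> k"
  shows "\<exists>C>0. \<forall>\<nu>. quasi \<nu> \<longrightarrow> Csum j (k + 1) \<nu> \<le> ennreal C * Vsum j k \<nu>"
proof (rule Csum_le_of_admissible)
  fix p assume p: "admissible (k + 1) j p"
  have Vsum: "bounded_by {k} (\<lambda>_. q) (Vsum j)" if q: "admissible (k - 1) j q" for q
  proof -
    obtain C where "C > 0" and C: "\<And>k' \<nu>. k' \<in> {k - 1} \<Longrightarrow> quasi \<nu> \<Longrightarrow> \<nu> q \<le> ennreal C * Csum j k' \<nu>"
      using bounded_by_Csum_admissible[OF q] by (rule bounded_byE) blast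
    show ?thesis
    proof (rule bounded_byI[where C = C])
      fix k' \<nu> assume "k' \<in> {k}" "quasi \<nu>"
      then have "\<nu> q \<le> ennreal C * Csum j (k' - 1) \<nu>" using C by simp
      also have "\<dots> \<le> ennreal C * Vsum j k' \<nu>" by (intro mult_left_mono) (auto simp: Vsum_def)
      finally show "\<nu> q \<le> ennreal C * Vsum j k' \<nu>" .
    qed
  qed
  show "bounded_by {k} (\<lambda>_. p) (Vsum j)"
  proof (cases "k \<le> j")
    \<comment> \<open>For j < k no point k - 1 + 2 i lies below j, so admissibility for k - 1 is
      just the degree bound.\<close>
    case False
    then show ?thesis using p by (intro Vsum) (auto simp: admissible_def)
  next
    case True
    define c where "c = poly p (of_nat (k - 1)) / poly (fall k j) (of_nat (k - 1))"
    have f0: "poly (fall k j) (of_nat (k - 1)) \<noteq> 0"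
      unfolding poly_fall_eq_0 using assms by auto
    have ad: "admissible (k + 1) j (p - smult c (fall k j))"
      by (rule admissible_diff_smult[OF p]) (use admissible_fall[of k "k + 1" j 1] in simp)
    have "admissible (k - 1) j (p - smult c (fall k j))"
      unfolding admissible_def
    proof (intro conjI allI impI)
      fix i assume i: "k - 1 + 2 * i < j"
      show "poly (p - smult c (fall k j)) (of_nat (k - 1 + 2 * i)) = 0"
      proof (cases i)
        case 0
        then show ?thesis using f0 by (simp add: c_def)
      next
        case (Suc i')
        then have "k - 1 + 2 * i = k + 1 + 2 * i'" using assms by simp
        then show ?thesis using ad i unfolding admissible_def by metis
      qed
    qed (use ad in \<open>simp add: admissible_def\<close>)
    then have "bounded_by {k} (\<lambda>_. p - smult c (fall k j)) (Vsum j)" by (rule Vsum)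
    moreover have "bounded_by {k} (\<lambda>_. fall k j) (Vsum j)"
      using True by (intro bounded_byI[where C = 1]) (auto simp: Vsum_def)
    ultimately have "bounded_by {k} (\<lambda>_. (p - smult c (fall k j)) + smult c (fall k j)) (Vsum j)"
      by (intro bounded_by_add bounded_by_smult[where M = "cmod c"]) auto
    then show ?thesis by simp
  qed
qed

text \<open>Giving up a zero enlarges the space of admissible polynomials, and
  \<open>fall k j\<close> lies in the larger one because it vanishes at all integers from k to j -
  1.\<close>

lemma Vsum_le_Csum:
  assumes "1 \<le> k"
  shows "\<exists>C>0. \<forall>\<nu>. quasi \<nu> \<longrightarrow> Vsum j k \<nu> \<le> ennreal C * Csum j (k + 1) \<nu>"
proof -
  have "bounded_by {k + 1} (\<lambda>_. p) (Csum j)" if "admissible (k - 1) j p" for p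
  proof (rule bounded_by_Csum_admissible)
    have "poly p (of_nat (k + 1 + 2 * i)) = 0" if "k + 1 + 2 * i < j" for i
    proof -
      have "k + 1 + 2 * i = k - 1 + 2 * Suc i" using assms by simp
      then show ?thesis using that \<open>admissible (k - 1) j p\<close> unfolding admissible_def by metis
    qed
    then show "admissible (k + 1) j p" using that by (simp add: admissible_def)
  qed
  from Csum_le_of_admissible[OF this] obtain C where C: "C > 0"
    "\<And>\<nu>. quasi \<nu> \<Longrightarrow> Csum j (k - 1) \<nu> \<le> ennreal C * Csum j (k + 1) \<nu>"
    by blast
  have "admissible (k + 1) j (fall k j)" using admissible_fall[of k "k + 1" j 1] by simp
  from bounded_by_Csum_admissible[OF this] obtain D where D: "D > 0"
    "\<And>k' \<nu>. k' \<in> {k + 1} \<Longrightarrow> quasi \<nu> \<Longrightarrow> \<nu> (fall k j) \<le> ennreal D * Csum j k' \<nu>"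
    by (rule bounded_byE) blast
  have "Vsum j k \<nu> \<le> ennreal (C + D) * Csum j (k + 1) \<nu>" if "quasi \<nu>" for \<nu>
  proof -
    have "Vsum j k \<nu> \<le> ennreal C * Csum j (k + 1) \<nu> + ennreal D * Csum j (k + 1) \<nu>"
      unfolding Vsum_def using C(2) D(2) that by (intro add_mono) auto
    then show ?thesis using C D by (simp add: ennreal_plus distrib_right)
  qed
  then show ?thesis using C(1) D(1) by (intro exI[of _ "C + D"]) simp
qed

section \<open>Smooth functions and test functions\<close>

lemma dir_derivI: "(f has_derivative f') (at x) \<Longrightarrow> dir_deriv v f x = f' v"
  unfolding dir_deriv_def by (metis frechet_derivative_at)

lemma dir_deriv_has_derivative:
  "f differentiable (at x) \<Longrightarrow> (f has_derivative (\<lambda>v. dir_deriv v f x)) (at x)"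
  unfolding dir_deriv_def using frechet_derivative_works by blast

lemma dir_deriv_vector_derivative:
  assumes "f differentiable (at (\<gamma> t))" "(\<gamma> has_vector_derivative v) (at t within S)"
  shows "((\<lambda>t. f (\<gamma> t)) has_vector_derivative dir_deriv v f (\<gamma> t)) (at t within S)"
proof -
  interpret D: bounded_linear "\<lambda>v. dir_deriv v f (\<gamma> t)"
    using dir_deriv_has_derivative[OF assms(1)] by (rule has_derivative_bounded_linear)
  have "((\<lambda>t. f (\<gamma> t)) has_derivative (\<lambda>h. dir_deriv (h *\<^sub>R v) f (\<gamma> t))) (at t within S)"
    using has_derivative_compose[OF assms(2)[unfolded has_vector_derivative_def] dir_deriv_has_derivative[OF assms(1)]] .
  then show ?thesis by (simp add: has_vector_derivative_def D.scaleR)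
qed

lemma dir_deriv_1I: "(f has_vector_derivative d) (at x) \<Longrightarrow> dir_deriv 1 f x = d"
  unfolding has_vector_derivative_def by (drule dir_derivI[where v = 1]) simp

lemma dir_deriv_1: "f differentiable (at x) \<Longrightarrow> (f has_vector_derivative dir_deriv 1 f x) (at x)"
  using dir_deriv_vector_derivative[of f "\<lambda>t. t" x 1 UNIV] by simp

lemma dir_deriv_Pair:
  fixes f :: "real \<times> real \<Rightarrow> complex"
  assumes "f differentiable (at x)"
  shows "dir_deriv (a, b) f x = of_real a * dir_deriv (1, 0) f x + of_real b * dir_deriv (0, 1) f x"
proof -
  interpret D: bounded_linear "\<lambda>v. dir_deriv v f x"
    using dir_deriv_has_derivative[OF assms] by (rule has_derivative_bounded_linear)
  have "(a, b) = a *\<^sub>R (1, 0) + b *\<^sub>R (0, 1)" by simp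
  then show ?thesis by (simp only: D.add D.scaleR scaleR_conv_of_real)
qed

lemma dir_deriv_add:
  "f differentiable (at x) \<Longrightarrow> g differentiable (at x) \<Longrightarrow>
    dir_deriv v (\<lambda>x. f x + g x) x = dir_deriv v f x + dir_deriv v g x"
  using dir_derivI[OF has_derivative_add[OF dir_deriv_has_derivative dir_deriv_has_derivative]] .

lemma dir_deriv_cmult:
  "f differentiable (at x) \<Longrightarrow> dir_deriv v (\<lambda>x. c * f x) x = c * dir_deriv v f x"
  using dir_derivI[OF has_derivative_mult_right[OF dir_deriv_has_derivative]] .

lemma dir_deriv_mult:
  "f differentiable (at x) \<Longrightarrow> g differentiable (at x) \<Longrightarrow>
    dir_deriv v (\<lambda>x. f x * g x) x = f x * dir_deriv v g x + dir_deriv v f x * g x"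
  using dir_derivI[OF has_derivative_mult[OF dir_deriv_has_derivative dir_deriv_has_derivative]] .

lemma dir_deriv_cong_open:
  assumes "open S" "x \<in> S" "\<And>y. y \<in> S \<Longrightarrow> f y = g y"
  shows "dir_deriv v f x = dir_deriv v g x" "f differentiable (at x) \<longleftrightarrow> g differentiable (at x)"
proof -
  have *: "(f has_derivative D) (at x) \<longleftrightarrow> (g has_derivative D) (at x)" for D
    using has_derivative_transform_within_open[OF _ assms(1,2), of f D UNIV g]
      has_derivative_transform_within_open[OF _ assms(1,2), of g D UNIV f] assms(3) by auto
  show "dir_deriv v f x = dir_deriv v g x" "f differentiable (at x) \<longleftrightarrow> g differentiable (at x)"
    by (simp_all add: dir_deriv_def frechet_derivative_def differentiable_def *)
qed

lemma dir_deriv_eq_0: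
  assumes "open S" "x \<in> S" "\<And>y. y \<in> S \<Longrightarrow> f y = 0"
  shows "dir_deriv v f x = 0" "f differentiable (at x)"
  using dir_deriv_cong_open[OF assms(1,2), of f "\<lambda>_. 0"] assms(3) dir_derivI[of "\<lambda>_. 0" "\<lambda>_. 0" x v] by auto


text \<open>\<open>smooth_fun\<close> ranges over finite lists of basis directions, so an invariant
  that is stable under one partial derivative and implies differentiability is stable under all of
  them.\<close>

lemma smooth_fun_coinduct:
  assumes "X f" "\<And>g x. X g \<Longrightarrow> g differentiable (at x)"
    "\<And>g b. X g \<Longrightarrow> b \<in> Basis \<Longrightarrow> X (dir_deriv b g)"
  shows "smooth_fun f"
proof -
  have "X (fold dir_deriv vs g)" if "X g" "set vs \<subseteq> Basis" for vs g
    using that by (induction vs arbitrary: g) (auto intro: assms(3))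
  with assms(1,2) show ?thesis unfolding smooth_fun_def by blast
qed

lemma smooth_fun_differentiable: "smooth_fun f \<Longrightarrow> f differentiable (at x)"
  unfolding smooth_fun_def by (elim allE[of _ "[]"]) simp

lemma smooth_fun_dir_deriv: 
  assumes "smooth_fun f" "b \<in> Basis" shows "smooth_fun (dir_deriv b f)"
  unfolding smooth_fun_def
proof (intro allI impI)
  fix vs :: "'a list" and x assume "set vs \<subseteq> Basis"
  then have "set (b # vs) \<subseteq> Basis" using assms(2) by simp
  with assms(1) have "fold dir_deriv (b # vs) f differentiable (at x)"
    unfolding smooth_fun_def by blast
  then show "fold dir_deriv vs (dir_deriv b f) differentiable (at x)" by simp
qed

lemma smooth_fun_continuous_on: "smooth_fun f \<Longrightarrow> continuous_on S f"
  by (meson continuous_at_imp_continuous_on differentiable_imp_continuous_within smooth_fun_differentiable)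

text \<open>Smoothness is shown by coinduction: it suffices that the derivatives of the functions in a set are
  linear combinations of functions in that set.\<close>

inductive_set lspan :: "('a \<Rightarrow> complex) set \<Rightarrow> ('a \<Rightarrow> complex) set" for G where
  base: "f \<in> G \<Longrightarrow> f \<in> lspan G"
| add: "f \<in> lspan G \<Longrightarrow> g \<in> lspan G \<Longrightarrow> (\<lambda>x. f x + g x) \<in> lspan G"
| cmult: "f \<in> lspan G \<Longrightarrow> (\<lambda>x. c * f x) \<in> lspan G"

lemma smooth_fun_lspan:
  fixes G :: "('a::euclidean_space \<Rightarrow> complex) set"
  assumes "f \<in> lspan G" and d: "\<And>g x. g \<in> G \<Longrightarrow> g differentiable (at x)"
    and D: "\<And>g b. g \<in> G \<Longrightarrow> b \<in> Basis \<Longrightarrow> dir_deriv b g \<in> lspan G"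
  shows "smooth_fun f"
proof (rule smooth_fun_coinduct[where X = "\<lambda>f. f \<in> lspan G"])
  have "(\<forall>x. g differentiable (at x)) \<and> (\<forall>b\<in>Basis. dir_deriv b g \<in> lspan G)" if "g \<in> lspan G" for g
    using that
  proof induction
    case (add f g)
    then have "dir_deriv b (\<lambda>x. f x + g x) = (\<lambda>x. dir_deriv b f x + dir_deriv b g x)" for b
      by (intro ext dir_deriv_add) auto
    then show ?case using add by (auto intro: lspan.add differentiable_add)
  next
    case (cmult f c)
    then have "dir_deriv b (\<lambda>x. c * f x) = (\<lambda>x. c * dir_deriv b f x)" for b
      by (intro ext dir_deriv_cmult) auto
    then show ?case using cmult by (auto intro: lspan.cmult differentiable_mult)
  qed (auto intro: d D)
  then show "\<And>g x. g \<in> lspan G \<Longrightarrow> g differentiable (at x)"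
    "\<And>g b. g \<in> lspan G \<Longrightarrow> b \<in> Basis \<Longrightarrow> dir_deriv b g \<in> lspan G" by blast+
qed fact

lemma smooth_fun_add: "smooth_fun f \<Longrightarrow> smooth_fun g \<Longrightarrow> smooth_fun (\<lambda>x. f x + g x)"
  and smooth_fun_cmult: "smooth_fun f \<Longrightarrow> smooth_fun (\<lambda>x. c * f x)"
proof -
  have *: "smooth_fun h" if "h \<in> lspan (Collect smooth_fun)" for h :: "'a \<Rightarrow> complex"
    by (rule smooth_fun_lspan[OF that])
      (auto intro: smooth_fun_differentiable lspan.base smooth_fun_dir_deriv)
  show "smooth_fun f \<Longrightarrow> smooth_fun g \<Longrightarrow> smooth_fun (\<lambda>x. f x + g x)" "smooth_fun f \<Longrightarrow> smooth_fun (\<lambda>x. c * f x)"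
    using *[OF lspan.add[OF lspan.base lspan.base]] *[OF lspan.cmult[OF lspan.base]] by simp_all
qed

lemma smooth_fun_const: "smooth_fun (\<lambda>_. c)"
proof (rule smooth_fun_lspan)
  show "(\<lambda>_. c) \<in> lspan (range (\<lambda>c _. c))" by (auto intro: lspan.base)
  fix g :: "'a \<Rightarrow> complex" and b assume "g \<in> range (\<lambda>c _. c)"
  then have "dir_deriv b g = (\<lambda>_. 0)" by (auto intro!: dir_derivI)
  then show "dir_deriv b g \<in> lspan (range (\<lambda>c _. c))" by (auto intro: lspan.base)
qed auto

text \<open>The generators are all products of two smooth functions; the Leibniz rule writes the
  derivative of one as a sum of two others.\<close>

lemma smooth_fun_mult:
  fixes f g :: "'a::euclidean_space \<Rightarrow> complex"
  assumes "smooth_fun f" "smooth_fun g" shows "smooth_fun (\<lambda>x. f x * g x)"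
proof (rule smooth_fun_lspan)
  let ?G = "{\<lambda>x::'a. f x * g x |f g. smooth_fun f \<and> smooth_fun g}"
  show "(\<lambda>x. f x * g x) \<in> lspan ?G" using assms by (auto intro: lspan.base)
  fix h assume "h \<in> ?G"
  then obtain f g where h: "h = (\<lambda>x. f x * g x)" and fg: "smooth_fun f" "smooth_fun g" by blast
  show "h differentiable (at x)" for x unfolding h using fg by (auto intro: differentiable_mult smooth_fun_differentiable)
  fix b :: 'a assume b: "b \<in> Basis"
  have *: "dir_deriv b h = (\<lambda>x. f x * dir_deriv b g x + dir_deriv b f x * g x)"
    unfolding h using fg by (intro ext dir_deriv_mult smooth_fun_differentiable)
  show "dir_deriv b h \<in> lspan ?G"
    unfolding * using fg b by (intro lspan.add lspan.base) (auto intro: smooth_fun_dir_deriv)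
qed

lemma smooth_fun_power: "smooth_fun f \<Longrightarrow> smooth_fun (\<lambda>x. f x ^ n)"
  by (induction n) (auto intro: smooth_fun_const smooth_fun_mult)

lemma smooth_fun_inner: "smooth_fun (\<lambda>x. of_real (x \<bullet> c))"
proof (rule smooth_fun_coinduct[where X = "\<lambda>f. f = (\<lambda>x. of_real (x \<bullet> c)) \<or> smooth_fun f"])
  fix g b assume g: "g = (\<lambda>x. complex_of_real (x \<bullet> c)) \<or> smooth_fun g" and "b \<in> (Basis :: 'a set)"
  have "dir_deriv b (\<lambda>x. complex_of_real (x \<bullet> c)) = (\<lambda>_. of_real (b \<bullet> c))"
    by (intro ext dir_derivI derivative_intros)
  then have "smooth_fun (dir_deriv b (\<lambda>x. complex_of_real (x \<bullet> c)))" by (simp add: smooth_fun_const)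
  with g \<open>b \<in> Basis\<close> show "dir_deriv b g = (\<lambda>x. complex_of_real (x \<bullet> c)) \<or> smooth_fun (dir_deriv b g)"
    by (auto intro: smooth_fun_dir_deriv)
next
  fix g x assume "g = (\<lambda>x. complex_of_real (x \<bullet> c)) \<or> smooth_fun g"
  moreover have "(\<lambda>x. complex_of_real (x \<bullet> c)) differentiable (at x)"
    by (intro bounded_linear_imp_differentiable bounded_linear_compose[OF bounded_linear_of_real] bounded_linear_inner_left)
  ultimately show "g differentiable (at x)" by (auto intro: smooth_fun_differentiable)
qed auto

lemma smooth_fun_of_real: "smooth_fun (\<lambda>x::real. of_real x)"
  using smooth_fun_inner[of "1::real"] by simp

text \<open>The chain rule puts a derivative of s beside F'(s), so the generators are the functions
  F(s) q with smooth F and q. Smoothness is defined for complex values, hence the embedding of the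
  real function s.\<close>

lemma smooth_fun_compose:
  fixes s :: "'a::euclidean_space \<Rightarrow> real"
  assumes F: "smooth_fun F" and s: "smooth_fun (\<lambda>x. of_real (s x))"
  shows "smooth_fun (\<lambda>x. F (s x))"
    "dir_deriv v (\<lambda>x. F (s x)) x = dir_deriv 1 F (s x) * dir_deriv v (\<lambda>x. of_real (s x)) x"
proof -
  let ?G = "{\<lambda>x. F (s x) * q x |F q. smooth_fun F \<and> smooth_fun q}"
  have D: "((\<lambda>x. F (s x)) has_derivative (\<lambda>v. dir_deriv 1 F (s x) * dir_deriv v (\<lambda>x. of_real (s x)) x)) (at x)"
    if F: "smooth_fun F" for F x
  proof -
    have d: "((\<lambda>x. complex_of_real (s x)) has_derivative (\<lambda>v. dir_deriv v (\<lambda>x. of_real (s x)) x)) (at x)"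
      by (intro dir_deriv_has_derivative smooth_fun_differentiable s)
    have re: "(s has_derivative (\<lambda>v. Re (dir_deriv v (\<lambda>x. of_real (s x)) x))) (at x)"
      using has_derivative_Re[OF d] by simp
    \<comment> \<open>The imaginary part of the embedded s is constantly 0, so the derivative is
      real and can serve as an increment of the real argument of F.\<close>
    have im: "Im (dir_deriv v (\<lambda>x. of_real (s x)) x) = 0" for v
    proof -
      have "((\<lambda>_::'a. 0::real) has_derivative (\<lambda>v. Im (dir_deriv v (\<lambda>x. of_real (s x)) x))) (at x)"
        using has_derivative_Im[OF d] by simp
      from has_derivative_unique[OF this has_derivative_const] show ?thesis by meson
    qed
    have "(F has_derivative (\<lambda>h. h *\<^sub>R dir_deriv 1 F (s x))) (at (s x))"
      using dir_deriv_1[OF smooth_fun_differentiable[OF F]] by (simp add: has_vector_derivative_def)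
    from has_derivative_compose[OF re this]
    have "((\<lambda>x. F (s x)) has_derivative (\<lambda>v. Re (dir_deriv v (\<lambda>x. of_real (s x)) x) *\<^sub>R dir_deriv 1 F (s x))) (at x)" .
    moreover have "Re (dir_deriv v (\<lambda>x. of_real (s x)) x) *\<^sub>R dir_deriv 1 F (s x) = dir_deriv 1 F (s x) * dir_deriv v (\<lambda>x. of_real (s x)) x" for v
      using im[of v] by (simp add: scaleR_conv_of_real complex_is_Real_iff[symmetric] of_real_Re mult.commute)
    ultimately show ?thesis by simp
  qed
  show "dir_deriv v (\<lambda>x. F (s x)) x = dir_deriv 1 F (s x) * dir_deriv v (\<lambda>x. of_real (s x)) x"
    by (rule dir_derivI[OF D[OF F]])
  have GI: "(\<lambda>x. F (s x) * q x) \<in> ?G" if "smooth_fun F" "smooth_fun q" for F q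
    using that by blast
  have "(\<lambda>x. F (s x)) \<in> lspan ?G"
    using lspan.base[OF GI[OF F smooth_fun_const[of 1]]] by simp
  then show "smooth_fun (\<lambda>x. F (s x))"
  proof (rule smooth_fun_lspan)
    fix h assume "h \<in> ?G"
    then obtain F q where h: "h = (\<lambda>x. F (s x) * q x)" and Fq: "smooth_fun F" "smooth_fun q" by blast
    have dF: "(\<lambda>x. F (s x)) differentiable (at x)" for x using D[OF Fq(1)] by (auto simp: differentiable_def)
    show "h differentiable (at x)" for x unfolding h using Fq dF by (auto intro: differentiable_mult smooth_fun_differentiable)
    fix b :: 'a assume b: "b \<in> Basis"
    have *: "dir_deriv b h = (\<lambda>x. F (s x) * dir_deriv b q x + dir_deriv 1 F (s x) * (dir_deriv b (\<lambda>x. of_real (s x)) x * q x))"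
    proof
      fix x
      show "dir_deriv b h x = F (s x) * dir_deriv b q x + dir_deriv 1 F (s x) * (dir_deriv b (\<lambda>x. of_real (s x)) x * q x)"
        unfolding h using dir_deriv_mult[OF dF smooth_fun_differentiable[OF Fq(2)], of b x] dir_derivI[OF D[OF Fq(1)], of b x]
        by (simp add: mult.assoc)
    qed
    show "dir_deriv b h \<in> lspan ?G"
      unfolding * using Fq b s by (intro lspan.add lspan.base GI)
        (auto intro!: smooth_fun_dir_deriv smooth_fun_mult)
  qed
qed

section \<open>Test functions\<close>

lemma test_functionsI:
  assumes "smooth_fun \<phi>" "compact K" "K \<subseteq> U" "\<And>x. x \<notin> K \<Longrightarrow> \<phi> x = 0"
  shows "\<phi> \<in> test_functions U"
proof -
  have "closure {x. \<phi> x \<noteq> 0} \<subseteq> K"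
    using assms by (intro closure_minimal compact_imp_closed) auto
  moreover from this have "compact (closure {x. \<phi> x \<noteq> 0})"
    using assms(2) by (metis closed_closure compact_Int_closed inf.absorb2)
  ultimately show ?thesis using assms by (auto simp: test_functions_def)
qed

lemma test_functionsE:
  assumes "\<phi> \<in> test_functions U"
  obtains K where "smooth_fun \<phi>" "compact K" "K \<subseteq> U" "\<And>x. x \<notin> K \<Longrightarrow> \<phi> x = 0"
proof (rule that[of "closure {x. \<phi> x \<noteq> 0}"])
  fix x assume "x \<notin> closure {x. \<phi> x \<noteq> 0}"
  then show "\<phi> x = 0" using closure_subset[of "{x. \<phi> x \<noteq> 0}"] by blast
qed (use assms in \<open>auto simp: test_functions_def\<close>)

lemma test_functions_smooth: "\<phi> \<in> test_functions U \<Longrightarrow> smooth_fun \<phi>"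
  by (simp add: test_functions_def)

lemma test_functions_mono: "U \<subseteq> V \<Longrightarrow> test_functions U \<subseteq> test_functions V"
  by (auto simp: test_functions_def)

lemma test_functions_zero: "\<phi> \<in> test_functions U \<Longrightarrow> x \<notin> U \<Longrightarrow> \<phi> x = 0"
  by (erule test_functionsE) auto

lemma test_functions_add:
  assumes "\<phi> \<in> test_functions U" "\<psi> \<in> test_functions U"
  shows "(\<lambda>x. \<phi> x + \<psi> x) \<in> test_functions U"
proof -
  obtain K L where "smooth_fun \<phi>" "compact K" "K \<subseteq> U" "\<And>x. x \<notin> K \<Longrightarrow> \<phi> x = 0"
    "smooth_fun \<psi>" "compact L" "L \<subseteq> U" "\<And>x. x \<notin> L \<Longrightarrow> \<psi> x = 0"
    using assms by (meson test_functionsE)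
  then show ?thesis
    by (intro test_functionsI[of _ "K \<union> L"] smooth_fun_add compact_Un) auto
qed

lemma test_functions_mult:
  assumes "\<phi> \<in> test_functions U" "smooth_fun f"
  shows "(\<lambda>x. f x * \<phi> x) \<in> test_functions U"
  using assms(1) by (rule test_functionsE) (auto intro!: test_functionsI smooth_fun_mult assms(2))

lemma test_functions_cmult:
  "\<phi> \<in> test_functions U \<Longrightarrow> (\<lambda>x. c * \<phi> x) \<in> test_functions U"
  by (rule test_functions_mult[OF _ smooth_fun_const])

lemma dir_deriv_support:
  assumes "compact K" "\<And>x. x \<notin> K \<Longrightarrow> \<phi> x = 0" "x \<notin> K"
  shows "dir_deriv b \<phi> x = 0"
  using assms compact_imp_closed by (intro dir_deriv_eq_0(1)[of "- K"]) auto

lemma test_functions_dir_deriv: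
  assumes "\<phi> \<in> test_functions U" "b \<in> Basis"
  shows "dir_deriv b \<phi> \<in> test_functions U"
proof -
  obtain K where K: "smooth_fun \<phi>" "compact K" "K \<subseteq> U" "\<And>x. x \<notin> K \<Longrightarrow> \<phi> x = 0"
    using assms(1) by (rule test_functionsE) blast
  show ?thesis
    by (rule test_functionsI[OF smooth_fun_dir_deriv[OF K(1) assms(2)] K(2,3)])
      (use dir_deriv_support[OF K(2)] K(4) in blast)
qed

lemma test_functions_bounded:
  assumes "\<phi> \<in> test_functions U"
  obtains M where "0 < M" "\<And>x. cmod (\<phi> x) \<le> M"
proof -
  obtain K where K: "smooth_fun \<phi>" "compact K" "K \<subseteq> U" "\<And>x. x \<notin> K \<Longrightarrow> \<phi> x = 0"
    using assms(1) by (rule test_functionsE) blast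
  have "bounded (\<phi> ` K)"
    using K by (intro compact_imp_bounded compact_continuous_image smooth_fun_continuous_on)
  then obtain M where M: "0 < M" "\<forall>x\<in>K. cmod (\<phi> x) \<le> M" by (auto simp: bounded_pos)
  then have "cmod (\<phi> x) \<le> M" for x using K(4)[of x] by (cases "x \<in> K") auto
  with M(1) show ?thesis using that by blast
qed

lemma continuous_on_smooth_compose:
  "smooth_fun f \<Longrightarrow> continuous_on S g \<Longrightarrow> continuous_on S (\<lambda>x. f (g x))"
  by (rule continuous_on_compose2[of UNIV]) (auto intro: smooth_fun_continuous_on)

text \<open>Write f(x, y) as its value at height y0 - 1 plus the integral of its y-derivative, take
  the x-derivative under the integral sign, and differentiate the result in y.\<close>

lemma dir_deriv_commute:
  fixes f :: "real \<times> real \<Rightarrow> complex"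
  assumes f: "smooth_fun f"
  shows "dir_deriv (1, 0) (dir_deriv (0, 1) f) = dir_deriv (0, 1) (dir_deriv (1, 0) f)"
proof
  fix p :: "real \<times> real"
  obtain x0 y0 where p: "p = (x0, y0)" by force
  have B: "(1, 0) \<in> (Basis :: (real \<times> real) set)" "(0, 1) \<in> (Basis :: (real \<times> real) set)"
    by (auto simp: Basis_prod_def)
  define fx where "fx = dir_deriv (1, 0) f"
  define fy where "fy = dir_deriv (0, 1) f"
  define fxy where "fxy = dir_deriv (1, 0) fy"
  have sm: "smooth_fun fx" "smooth_fun fy" "smooth_fun fxy"
    unfolding fx_def fy_def fxy_def using f B by (auto intro: smooth_fun_dir_deriv)
  have dx: "((\<lambda>x. g (x, y)) has_vector_derivative dir_deriv (1, 0) g (x, y)) (at x within S)"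
    and dy: "((\<lambda>y. g (x, y)) has_vector_derivative dir_deriv (0, 1) g (x, y)) (at y within S)"
    if "smooth_fun g" for g x y S
  proof -
    have "((\<lambda>x. (x, y)) has_vector_derivative (1, 0)) (at x within S)"
      "((\<lambda>y. (x, y)) has_vector_derivative (0, 1)) (at y within S)"
      unfolding has_vector_derivative_def by (auto intro!: derivative_eq_intros)
    then show "((\<lambda>x. g (x, y)) has_vector_derivative dir_deriv (1, 0) g (x, y)) (at x within S)"
      "((\<lambda>y. g (x, y)) has_vector_derivative dir_deriv (0, 1) g (x, y)) (at y within S)"
      using smooth_fun_differentiable[OF that] by (auto intro!: dir_deriv_vector_derivative)
  qed
  have eq: "fx (x0, y) = fx (x0, y0 - 1) + integral {y0 - 1..y} (\<lambda>t. fxy (x0, t))" if y: "y0 - 1 \<le> y" for y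
  proof -
    have 1: "f (x, y) = f (x, y0 - 1) + integral (cbox (y0 - 1) y) (\<lambda>t. fy (x, t))" for x
    proof -
      have "((\<lambda>t. fy (x, t)) has_integral (f (x, y) - f (x, y0 - 1))) {y0 - 1..y}"
        unfolding fy_def by (rule fundamental_theorem_of_calculus[OF y]) (rule dy[OF f])
      then show ?thesis by (simp add: integral_unique)
    qed
    have 2: "((\<lambda>x. integral (cbox (y0 - 1) y) (\<lambda>t. fy (x, t))) has_vector_derivative
        integral (cbox (y0 - 1) y) (\<lambda>t. fxy (x0, t))) (at x0 within UNIV)"
    proof (rule leibniz_rule_vector_derivative)
      show "((\<lambda>x. fy (x, t)) has_vector_derivative fxy (x, t)) (at x within UNIV)" for x t
        unfolding fxy_def by (rule dx[OF sm(2)])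
      show "(\<lambda>t. fy (x, t)) integrable_on cbox (y0 - 1) y" for x
        by (intro integrable_continuous continuous_on_smooth_compose[OF sm(2)] continuous_intros)
      show "continuous_on (UNIV \<times> cbox (y0 - 1) y) (\<lambda>(x, t). fxy (x, t))"
        using smooth_fun_continuous_on[OF sm(3)] by simp
    qed simp_all
    have "((\<lambda>x. f (x, y0 - 1) + integral (cbox (y0 - 1) y) (\<lambda>t. fy (x, t))) has_vector_derivative
        fx (x0, y0 - 1) + integral (cbox (y0 - 1) y) (\<lambda>t. fxy (x0, t))) (at x0)"
      unfolding fx_def by (intro has_vector_derivative_add 2 dx[OF f])
    then have "((\<lambda>x. f (x, y)) has_vector_derivative
        fx (x0, y0 - 1) + integral (cbox (y0 - 1) y) (\<lambda>t. fxy (x0, t))) (at x0)"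
      by (simp only: 1[symmetric])
    with dx[OF f, where y = y and x = x0 and S = UNIV] show ?thesis
      unfolding fx_def cbox_interval by (blast intro: vector_derivative_unique_at)
  qed
  \<comment> \<open>Starting at y0 - 1 puts y0 into the interior of the interval, so the derivative
    within the interval is the full derivative.\<close>
  have "((\<lambda>y. integral {y0 - 1..y} (\<lambda>t. fxy (x0, t))) has_vector_derivative fxy (x0, y0)) (at y0 within {y0 - 1..y0 + 1})"
    by (intro integral_has_vector_derivative continuous_on_smooth_compose[OF sm(3)] continuous_intros) auto
  then have "((\<lambda>y. fx (x0, y0 - 1) + integral {y0 - 1..y} (\<lambda>t. fxy (x0, t))) has_vector_derivative fxy (x0, y0)) (at y0 within {y0 - 1..y0 + 1})"
    by (auto intro!: derivative_eq_intros)
  then have "((\<lambda>y. fx (x0, y)) has_vector_derivative fxy (x0, y0)) (at y0 within {y0 - 1..y0 + 1})"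
  proof (rule has_vector_derivative_transform[rotated 2])
    show "fx (x0, y) = fx (x0, y0 - 1) + integral {y0 - 1..y} (\<lambda>t. fxy (x0, t))" if "y \<in> {y0 - 1..y0 + 1}" for y
      using that by (intro eq) simp
  qed simp
  moreover have "at y0 within {y0 - 1..y0 + 1} = at y0"
    by (rule at_within_interior) (simp add: interior_atLeastAtMost_real)
  ultimately have "((\<lambda>y. fx (x0, y)) has_vector_derivative fxy (x0, y0)) (at y0)"
    by (simp only:)
  then show "dir_deriv (1, 0) (dir_deriv (0, 1) f) p = dir_deriv (0, 1) (dir_deriv (1, 0) f) p"
    using dy[OF sm(1), where x = x0 and y = y0 and S = UNIV]
    unfolding p fx_def fy_def fxy_def by (blast intro: vector_derivative_unique_at)
qed

lemma inverse_power_mult_vector_derivative: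
  assumes "r \<noteq> 0" "smooth_fun \<phi>"
  shows "((\<lambda>r. of_real ((1 / r) ^ n) * \<phi> r) has_vector_derivative
    - of_nat n * (of_real ((1 / r) ^ Suc n) * \<phi> r) + of_real ((1 / r) ^ n) * dir_deriv 1 \<phi> r) (at r)"
proof -
  have "((\<lambda>r. (1 / r) ^ n) has_real_derivative - (of_nat n * (1 / r) ^ Suc n)) (at r)"
    using assms(1) by (auto intro!: derivative_eq_intros simp: divide_simps power2_eq_square) (cases n; simp add: field_simps)
  then have "((\<lambda>r. of_real ((1 / r) ^ n)) has_vector_derivative complex_of_real (- (of_nat n * (1 / r) ^ Suc n))) (at r)"
    by (rule has_vector_derivative_of_real)
  from has_vector_derivative_mult[OF this dir_deriv_1[OF smooth_fun_differentiable[OF assms(2)]]]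
  show ?thesis by (simp add: algebra_simps)
qed

text \<open>The support keeps a distance from 0, so the product vanishes near 0, where 1 / r only
  has a default value. The functions r^-n \<phi> with all n and all test functions \<phi> on
  \<open>U\<close> are closed under differentiation up to linear combinations.\<close>

lemma test_functions_inverse:
  assumes \<phi>: "\<phi> \<in> test_functions U" and U: "U \<subseteq> {0<..}"
  shows "(\<lambda>r. of_real ((1 / r) ^ n) * \<phi> r) \<in> test_functions U"
proof -
  let ?G = "{\<lambda>r::real. of_real ((1 / r) ^ n) * \<phi> r |n \<phi>. \<phi> \<in> test_functions U}"
  have GI: "(\<lambda>r::real. of_real ((1 / r) ^ n) * \<phi> r) \<in> ?G" if "\<phi> \<in> test_functions U" for n \<phi>
    using that by blast
  have "smooth_fun (\<lambda>r. of_real ((1 / r) ^ n) * \<phi> r)"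
  proof (rule smooth_fun_lspan)
    show "(\<lambda>r. of_real ((1 / r) ^ n) * \<phi> r) \<in> lspan ?G" by (intro lspan.base GI \<phi>)
    fix h assume "h \<in> ?G"
    then obtain n \<phi> where h: "h = (\<lambda>r. of_real ((1 / r) ^ n) * \<phi> r)" and \<phi>: "\<phi> \<in> test_functions U" by blast
    obtain K where K: "smooth_fun \<phi>" "compact K" "K \<subseteq> U" "\<And>x. x \<notin> K \<Longrightarrow> \<phi> x = 0"
      using \<phi> by (rule test_functionsE) blast
    let ?d = "\<lambda>r. - of_nat n * (of_real ((1 / r) ^ Suc n) * \<phi> r) + of_real ((1 / r) ^ n) * dir_deriv 1 \<phi> r"
    have d: "(h has_vector_derivative ?d r) (at r)" for r
    proof (cases "r = 0")
      case True
      have o: "open (- K)" "r \<in> - K" using K U True by (auto intro: compact_imp_closed)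
      have "dir_deriv 1 \<phi> r = 0" using dir_deriv_support[of K \<phi> r 1] K(2,4) o by auto
      moreover have "\<phi> r = 0" using K(4) o by auto
      moreover have "(h has_vector_derivative 0) (at r)"
        by (rule has_vector_derivative_transform_within_open[OF has_vector_derivative_const[of 0] o])
          (simp add: h K(4))
      ultimately show ?thesis by simp
    next
      case False
      from inverse_power_mult_vector_derivative[OF this K(1)] show ?thesis unfolding h .
    qed
    show "h differentiable (at x)" for x using d[of x] by (auto simp: has_vector_derivative_def differentiable_def)
    fix b :: real assume "b \<in> Basis"
    then have b: "b = 1" by simp
    have *: "dir_deriv b h = ?d" unfolding b by (intro ext dir_deriv_1I d)
    show "dir_deriv b h \<in> lspan ?G" unfolding *
      by (intro lspan.add[OF lspan.cmult[OF lspan.base] lspan.base] GI \<phi> test_functions_dir_deriv) simp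
  qed
  then show ?thesis
    using \<phi> by (elim test_functionsE) (auto intro!: test_functionsI)
qed

section \<open>Radial test functions\<close>

lemma has_derivative_norm_inner:
  fixes p :: "'a::real_inner"
  assumes "p \<noteq> 0"
  shows "(norm has_derivative (\<lambda>v. (v \<bullet> p) / norm p)) (at p)"
  using has_derivative_norm[OF assms] by (simp add: sgn_div_norm inner_commute divide_inverse mult.commute)

text \<open>The derivative of \<psi>(|p|) in direction b is \<psi>'(|p|) (p . b) / |p|. The factor 1
  / |p| is absorbed by the radial test function and p . b by the smooth factor, so products of this
  shape suffice as generators.\<close>

lemma radial_smooth:
  fixes q :: "'a::euclidean_space \<Rightarrow> complex"
  assumes \<psi>: "\<psi> \<in> test_functions U" and U: "U \<subseteq> {0<..}" and q: "smooth_fun q"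
  shows "smooth_fun (\<lambda>p. \<psi> (norm p) * q p)"
proof (rule smooth_fun_lspan)
  let ?G = "{\<lambda>p::'a. \<psi> (norm p) * q p |\<psi> q. \<psi> \<in> test_functions U \<and> smooth_fun q}"
  have GI: "(\<lambda>p. \<psi> (norm p) * q p) \<in> ?G" if "\<psi> \<in> test_functions U" "smooth_fun q" for \<psi> q
    using that by blast
  show "(\<lambda>p. \<psi> (norm p) * q p) \<in> lspan ?G" by (intro lspan.base GI \<psi> q)
  fix h assume "h \<in> ?G"
  then obtain \<psi> q where h: "h = (\<lambda>p. \<psi> (norm p) * q p)" and \<psi>: "\<psi> \<in> test_functions U" and q: "smooth_fun q" by blast
  obtain K where K: "smooth_fun \<psi>" "compact K" "K \<subseteq> U" "\<And>x. x \<notin> K \<Longrightarrow> \<psi> x = 0"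
    using \<psi> by (rule test_functionsE) blast
  let ?d = "\<lambda>b p. (of_real ((1 / norm p) ^ 1) * dir_deriv 1 \<psi> (norm p)) * (of_real (p \<bullet> b) * q p) + \<psi> (norm p) * dir_deriv b q p"
  have d: "(h has_derivative (\<lambda>b. ?d b p)) (at p)" for p
  proof (cases "p = 0")
    case True
    have "0 \<notin> K" using K(3) U by auto
    then have "0 \<in> - K" "open (- K)" using K(2) by (auto intro: compact_imp_closed)
    then obtain e where e: "e > 0" "ball 0 e \<subseteq> - K" using open_contains_ball by blast
    have z: "\<psi> (norm x) = 0" if "x \<in> ball 0 e" for x :: 'a
      using e(2) that K(4) by (auto simp: subset_iff)
    have "(h has_derivative (\<lambda>_. 0)) (at p)"
      by (rule has_derivative_transform_within_open[OF has_derivative_const[of 0], of "ball 0 e"])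
        (use e z True in \<open>auto simp: h\<close>)
    moreover have "dir_deriv 1 \<psi> 0 = 0" using dir_deriv_support[OF K(2,4) \<open>0 \<notin> K\<close>] .
    ultimately show ?thesis using z[of 0] e(1) True by simp
  next
    case False
    have 1: "((\<lambda>p. \<psi> (norm p)) has_derivative (\<lambda>v. ((v \<bullet> p) / norm p) *\<^sub>R dir_deriv 1 \<psi> (norm p))) (at p)"
      using has_derivative_compose[OF has_derivative_norm_inner[OF False]
          dir_deriv_1[OF smooth_fun_differentiable[OF K(1)], unfolded has_vector_derivative_def]] .
    from has_derivative_mult[OF this dir_deriv_has_derivative[OF smooth_fun_differentiable[OF q]]]
    show ?thesis unfolding h by (rule has_derivative_eq_rhs) (auto simp: scaleR_conv_of_real inner_commute)
  qed
  show "h differentiable (at x)" for x using d[of x] by (auto simp: differentiable_def)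
  fix b :: 'a assume b: "b \<in> Basis"
  have *: "dir_deriv b h = ?d b" by (intro ext dir_derivI d)
  show "dir_deriv b h \<in> lspan ?G" unfolding *
    by (intro lspan.add lspan.base)
      (rule GI[OF test_functions_inverse[OF test_functions_dir_deriv[OF \<psi>] U, of 1 1] smooth_fun_mult[OF smooth_fun_inner q]]
        GI[OF \<psi> smooth_fun_dir_deriv[OF q b]] | simp)+
qed

lemma radial_test_function:
  fixes q :: "'a::euclidean_space \<Rightarrow> complex"
  assumes \<psi>: "\<psi> \<in> test_functions U" and U: "U \<subseteq> {0<..}" and q: "smooth_fun q"
  shows "(\<lambda>p. \<psi> (norm p) * q p) \<in> test_functions {p. norm p \<in> U}"
proof -
  obtain K where K: "smooth_fun \<psi>" "compact K" "K \<subseteq> U" "\<And>x. x \<notin> K \<Longrightarrow> \<psi> x = 0"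
    using \<psi> by (rule test_functionsE) blast
  have "closed (norm -` K :: 'a set)"
    using K(2) by (intro closed_vimage compact_imp_closed) (auto intro: continuous_intros)
  moreover have "bounded (norm -` K :: 'a set)"
    using compact_imp_bounded[OF K(2)] unfolding bounded_iff by force
  ultimately have "compact (norm -` K :: 'a set)" by (simp add: compact_eq_bounded_closed)
  then show ?thesis
    using K by (intro test_functionsI[OF radial_smooth[OF assms]]) auto
qed


text \<open>A family that contains the flat function \<open>exp (-1/x)\<close> and is closed under differentiation up to linear
  combinations.\<close>

definition flat_fun :: "nat \<Rightarrow> real \<Rightarrow> complex" where
  "flat_fun n x = (if x > 0 then of_real ((1 / x) ^ n * exp (- 1 / x)) else 0)"

text \<open>Quadratic decay is what gives the derivative 0 at the origin. It results from keeping
  only the term of degree n + 2 in the series of exp (1/x).\<close>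

lemma flat_fun_bound: "cmod (flat_fun n x) \<le> fact (n + 2) * x\<^sup>2"
proof (cases "x > 0")
  case True
  have "(1 / x) ^ (n + 2) / fact (n + 2) \<le> exp (1 / x)"
  proof -
    have "(1 / x) ^ (n + 2) /\<^sub>R fact (n + 2) \<le> (\<Sum>k. (1 / x) ^ k /\<^sub>R fact k)"
      using sum_le_suminf[OF summable_exp_generic[of "1 / x"], of "{n + 2}"] True by simp
    then show ?thesis by (simp add: exp_def divide_inverse mult.commute)
  qed
  then have le: "(1 / x) ^ (n + 2) \<le> fact (n + 2) * exp (1 / x)"
    by (simp only: pos_divide_le_eq[OF fact_gt_zero] mult.commute)
  have x2: "(1 / x)\<^sup>2 * x\<^sup>2 = 1"
    using True by (simp add: power_mult_distrib[symmetric])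
  have ex: "exp (1 / x) * exp (- 1 / x) = 1"
    by (simp add: exp_add[symmetric])
  have "cmod (flat_fun n x) = (1 / x) ^ n * exp (- 1 / x)"
    using True by (simp only: flat_fun_def if_True norm_of_real) simp
  also have "\<dots> = (1 / x) ^ (n + 2) * (x\<^sup>2 * exp (- 1 / x))"
    by (simp only: power_add mult.assoc mult.assoc[symmetric, of "(1 / x)\<^sup>2" "x\<^sup>2"] x2 mult_1)
  also have "\<dots> \<le> (fact (n + 2) * exp (1 / x)) * (x\<^sup>2 * exp (- 1 / x))"
    by (intro mult_right_mono le) auto
  also have "\<dots> = fact (n + 2) * x\<^sup>2 * (exp (1 / x) * exp (- 1 / x))"
    by (simp only: mult_ac)
  finally show ?thesis by (simp only: ex mult_1_right)
qed (simp add: flat_fun_def)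

lemma flat_fun_deriv:
  "(flat_fun n has_vector_derivative (- of_nat n * flat_fun (n + 1) x + flat_fun (n + 2) x)) (at x)"
proof -
  consider "x > 0" | "x < 0" | "x = 0" by linarith
  then show ?thesis
  proof cases
    case 1
    have "((\<lambda>x. (1 / x) ^ n * exp (- 1 / x)) has_real_derivative
        ((1 / x) ^ n * (exp (- 1 / x) * (1 / x)^2) + - (of_nat n * (1 / x) ^ (n + 1)) * exp (- 1 / x))) (at x)"
    proof (rule DERIV_mult')
      show "((\<lambda>r. (1 / r) ^ n) has_real_derivative - (of_nat n * (1 / x) ^ (n + 1))) (at x)"
        using 1 by (auto intro!: derivative_eq_intros simp: divide_simps power2_eq_square) (cases n; simp add: field_simps)
      show "((\<lambda>x. exp (- 1 / x)) has_real_derivative exp (- 1 / x) * (1 / x)\<^sup>2) (at x)"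
        using 1 by (auto intro!: derivative_eq_intros simp: divide_simps power2_eq_square)
    qed
    then have "((\<lambda>x. of_real ((1 / x) ^ n * exp (- 1 / x))) has_vector_derivative
        complex_of_real ((1 / x) ^ n * (exp (- 1 / x) * (1 / x)^2) + - (of_nat n * (1 / x) ^ (n + 1)) * exp (- 1 / x))) (at x)"
      by (rule has_vector_derivative_of_real)
    moreover have "complex_of_real ((1 / x) ^ n * (exp (- 1 / x) * (1 / x)^2) + - (of_nat n * (1 / x) ^ (n + 1)) * exp (- 1 / x))
        = - of_nat n * flat_fun (n + 1) x + flat_fun (n + 2) x"
      using 1 by (simp add: flat_fun_def power_add power2_eq_square algebra_simps)
    ultimately have "((\<lambda>x. of_real ((1 / x) ^ n * exp (- 1 / x))) has_vector_derivative
        - of_nat n * flat_fun (n + 1) x + flat_fun (n + 2) x) (at x)"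
      by (simp only:)
    then show ?thesis
    proof (rule has_vector_derivative_transform_within_open)
      show "open {0::real<..}" "x \<in> {0<..}" using 1 by auto
      show "of_real ((1 / x) ^ n * exp (- 1 / x)) = flat_fun n x" if "x \<in> {0<..}" for x
        using that by (simp only: flat_fun_def greaterThan_iff if_True)
    qed
  next
    case 2
    have "(flat_fun n has_vector_derivative 0) (at x)"
    proof (rule has_vector_derivative_transform_within_open[OF has_vector_derivative_const])
      show "open {..<0::real}" "x \<in> {..<0}" using 2 by auto
      show "0 = flat_fun n x" if "x \<in> {..<0}" for x
        using that by (simp add: flat_fun_def)
    qed
    then show ?thesis using 2 by (simp add: flat_fun_def)
  next
    case 3
    have "(flat_fun n has_derivative (\<lambda>h. 0)) (at 0)"
      unfolding has_derivative_at
    proof (intro conjI)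
      show "(\<lambda>h. norm (flat_fun n (0 + h) - flat_fun n 0 - 0) / norm h) \<midarrow>0\<rightarrow> 0"
      proof (rule Lim_null_comparison)
        show "\<forall>\<^sub>F h in at 0. norm (norm (flat_fun n (0 + h) - flat_fun n 0 - 0) / norm h) \<le> fact (n + 2) * \<bar>h\<bar>"
          unfolding eventually_at
        proof (intro exI[of _ 1] conjI ballI impI)
          fix h :: real assume h: "h \<noteq> 0 \<and> dist h 0 < 1"
          have "cmod (flat_fun n h) \<le> fact (n + 2) * \<bar>h\<bar> * \<bar>h\<bar>"
            using flat_fun_bound[of n h] by (simp add: power2_eq_square mult.assoc)
          then show "norm (norm (flat_fun n (0 + h) - flat_fun n 0 - 0) / norm h) \<le> fact (n + 2) * \<bar>h\<bar>"
            using h by (simp add: flat_fun_def[of n 0] divide_le_eq)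
        qed simp
        show "(\<lambda>h. fact (n + 2) * \<bar>h\<bar>) \<midarrow>0\<rightarrow> (0::real)"
          by (auto intro!: tendsto_eq_intros)
      qed
    qed simp
    then show ?thesis using 3 by (simp add: has_vector_derivative_def flat_fun_def)
  qed
qed

lemma smooth_fun_flat: "smooth_fun (flat_fun n)"
proof (rule smooth_fun_lspan)
  show "flat_fun n \<in> lspan (range flat_fun)" by (auto intro: lspan.base)
  fix g and b :: real assume g: "g \<in> range flat_fun" and "b \<in> Basis"
  then obtain n where g: "g = flat_fun n" and b: "b = 1" by auto
  have *: "dir_deriv b g = (\<lambda>x. - of_nat n * flat_fun (n + 1) x + flat_fun (n + 2) x)"
    unfolding g b by (intro ext dir_deriv_1I flat_fun_deriv)
  show "dir_deriv b g \<in> lspan (range flat_fun)"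
    unfolding * by (intro lspan.add[OF lspan.cmult[OF lspan.base] lspan.base] rangeI)
next
  fix g x assume "g \<in> range flat_fun"
  then show "g differentiable (at x)"
    using flat_fun_deriv by (auto simp: has_vector_derivative_def differentiable_def)
qed

text \<open>The normalised primitive of exp (-1/x) exp (-1/(1 - x)), a bump supported in
  [0, 1].\<close>

lemma smooth_step_exists:
  obtains S :: "real \<Rightarrow> complex" where "smooth_fun S" "\<And>x. x \<le> 0 \<Longrightarrow> S x = 0" "\<And>x. x \<ge> 1 \<Longrightarrow> S x = 1"
proof -
  define b where "b x = flat_fun 0 x * flat_fun 0 (1 - x)" for x
  have lin: "smooth_fun (\<lambda>x::real. complex_of_real (1 - x))"
    using smooth_fun_add[OF smooth_fun_const[of 1] smooth_fun_cmult[OF smooth_fun_of_real, of "-1"]] by simp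
  have b: "smooth_fun b" unfolding b_def[abs_def]
    by (intro smooth_fun_mult smooth_fun_flat smooth_fun_compose(1)[OF smooth_fun_flat lin])
  have b0: "b x = 0" if "x \<le> 0 \<or> x \<ge> 1" for x using that by (auto simp: b_def flat_fun_def)
  \<comment> \<open>Starting at -1 and not at 0 makes 0 an interior point of the interval of
    integration.\<close>
  define I where "I x = integral {-1..x} b" for x
  have I0: "I x = 0" if "x \<le> 0" for x
    unfolding I_def using that b0 by (intro integral_unique has_integral_is_0) auto
  have int: "b integrable_on {c..d}" for c d
    by (intro integrable_continuous_real smooth_fun_continuous_on b)
  have I1: "I x = I 1" if "x \<ge> 1" for x
  proof -
    have "I x = I 1 + integral {1..x} b"
      unfolding I_def using that by (intro Henstock_Kurzweil_Integration.integral_combine[symmetric] int) auto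
    also have "integral {1..x} b = 0" using b0 by (intro integral_unique has_integral_is_0) auto
    finally show ?thesis by simp
  qed
  have dI: "(I has_vector_derivative b x) (at x)" for x
  proof (cases "x < 0")
    case True
    have "(I has_vector_derivative 0) (at x)"
      by (rule has_vector_derivative_transform_within_open[where S = "{..<0}" and f = "\<lambda>x. 0"])
        (use True I0 in auto)
    then show ?thesis using b0[of x] True by simp
  next
    case False
    then have "(I has_vector_derivative b x) (at x within {-1..x + 1})"
      unfolding I_def[abs_def] by (intro integral_has_vector_derivative smooth_fun_continuous_on b) auto
    then show ?thesis using at_within_interior[of x "{-1..x + 1}"] False by simp
  qed
  have dI': "dir_deriv 1 I = b" by (intro ext dir_deriv_1I dI)
  have smI: "smooth_fun I"
  proof (rule smooth_fun_coinduct[where X = "\<lambda>f. f = I \<or> smooth_fun f"])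
    have "I differentiable (at x)" for x
      using dI[of x] by (auto simp: has_vector_derivative_def differentiable_def)
    then show "\<And>g x. g = I \<or> smooth_fun g \<Longrightarrow> g differentiable (at x)"
      using smooth_fun_differentiable by blast
    show "\<And>g c. g = I \<or> smooth_fun g \<Longrightarrow> c \<in> Basis \<Longrightarrow> dir_deriv c g = I \<or> smooth_fun (dir_deriv c g)"
      using dI' b by (auto intro: smooth_fun_dir_deriv)
  qed auto
  \<comment> \<open>The bump is continuous, nonnegative and positive at 1/2.\<close>
  have nz: "I 1 \<noteq> 0"
  proof
    assume "I 1 = 0"
    define c where "c x = Re (b x)" for x
    have "integral {-1..1} c = Re (integral {-1..1} b)"
      unfolding c_def using integral_linear[OF int bounded_linear_Re, of "-1" 1] by (simp add: o_def)
    then have "integral {-1..1} c = 0" using \<open>I 1 = 0\<close> by (simp add: I_def)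
    moreover have "continuous_on {-1..1} c"
      unfolding c_def by (intro continuous_intros smooth_fun_continuous_on b)
    moreover have "c x \<ge> 0" for x by (simp add: c_def b_def flat_fun_def)
    ultimately have "\<forall>x\<in>{-1..1}. c x = 0" by (subst (asm) integral_eq_0_iff) auto
    then have "c (1/2) = 0" by auto
    then show False by (simp add: c_def b_def flat_fun_def)
  qed
  show ?thesis
  proof (rule that[of "\<lambda>x. (1 / I 1) * I x"])
    show "smooth_fun (\<lambda>x. (1 / I 1) * I x)" by (rule smooth_fun_cmult[OF smI])
    show "(1 / I 1) * I x = 0" if "x \<le> 0" for x using I0[OF that] by simp
    show "(1 / I 1) * I x = 1" if "x \<ge> 1" for x using I1[OF that] nz by (simp only: divide_self_if) simp
  qed
qed

section \<open>Polar coordinates\<close>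

text \<open>The slope substitution t = tan \<theta>, verified on intervals by the fundamental
  theorem of calculus. It reduces polar coordinates to substitutions in one variable at a
  time.\<close>

lemma lborel_tan:
  "(lborel :: real measure) =
     distr (density lborel (\<lambda>\<theta>. ennreal (inverse ((cos \<theta>)\<^sup>2)) * indicator {-pi/2<..<pi/2} \<theta>)) borel tan"
proof (rule lborel_eqI)
  fix l u :: real
  assume "\<And>b. b \<in> Basis \<Longrightarrow> l \<bullet> b \<le> u \<bullet> b"
  then have lu: "l \<le> u" by simp
  have [measurable]: "(tan :: real \<Rightarrow> real) \<in> borel_measurable borel"
    unfolding tan_def[abs_def] by measurable
  have "emeasure (distr (density lborel (\<lambda>\<theta>. ennreal (inverse ((cos \<theta>)\<^sup>2)) * indicator {-pi/2<..<pi/2} \<theta>)) borel tan) (box l u)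
      = (\<integral>\<^sup>+\<theta>. ennreal (inverse ((cos \<theta>)\<^sup>2)) * indicator {-pi/2<..<pi/2} \<theta> * indicator (tan -` box l u) \<theta> \<partial>lborel)"
    using measurable_sets_borel[of tan borel "box l u"]
    by (subst emeasure_distr) (auto simp: emeasure_density)
  also have "\<dots> = (\<integral>\<^sup>+\<theta>. ennreal (inverse ((cos \<theta>)\<^sup>2)) * indicator {arctan l..arctan u} \<theta> \<partial>lborel)"
  proof (rule nn_integral_cong_AE)
    have "AE \<theta> in lborel. \<theta> \<noteq> arctan l" "AE \<theta> in lborel. \<theta> \<noteq> arctan u"
      using AE_lborel_singleton[of "arctan l"] AE_lborel_singleton[of "arctan u"] by auto
    then show "AE \<theta> in lborel. ennreal (inverse ((cos \<theta>)\<^sup>2)) * indicator {-pi/2<..<pi/2} \<theta> * indicator (tan -` box l u) \<theta>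
        = ennreal (inverse ((cos \<theta>)\<^sup>2)) * indicator {arctan l..arctan u} \<theta>"
    proof eventually_elim
      case (elim \<theta>)
      have "\<theta> \<in> {-pi/2<..<pi/2} \<and> tan \<theta> \<in> {l<..<u} \<longleftrightarrow> \<theta> \<in> {arctan l..arctan u}"
      proof
        assume a: "\<theta> \<in> {-pi/2<..<pi/2} \<and> tan \<theta> \<in> {l<..<u}"
        then have "arctan (tan \<theta>) = \<theta>" by (intro arctan_tan) auto
        with a arctan_le_iff[of l "tan \<theta>"] arctan_le_iff[of "tan \<theta>" u] show "\<theta> \<in> {arctan l..arctan u}"
          by (auto simp: less_imp_le)
      next
        assume a: "\<theta> \<in> {arctan l..arctan u}"
        then have b: "arctan l < \<theta>" "\<theta> < arctan u" using elim by auto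
        then have c: "-pi/2 < \<theta>" "\<theta> < pi/2" using arctan_lbound[of l] arctan_ubound[of u] by auto
        then have "arctan (tan \<theta>) = \<theta>" by (intro arctan_tan) auto
        then show "\<theta> \<in> {-pi/2<..<pi/2} \<and> tan \<theta> \<in> {l<..<u}"
          using b c arctan_less_iff[of l "tan \<theta>"] arctan_less_iff[of "tan \<theta>" u] by auto
      qed
      then show ?case by (auto simp: indicator_def)
    qed
  qed
  also have "\<dots> = ennreal (tan (arctan u) - tan (arctan l))"
  proof (rule nn_integral_FTC_Icc)
    fix \<theta> assume "\<theta> \<in> {arctan l..arctan u}"
    then have "-pi/2 < \<theta>" "\<theta> < pi/2" using arctan_lbound[of l] arctan_ubound[of u] by auto
    then have "cos \<theta> > 0" by (intro cos_gt_zero_pi) auto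
    then show "(tan has_real_derivative inverse ((cos \<theta>)\<^sup>2)) (at \<theta>)"
      by (intro DERIV_tan) auto
  qed (use lu in \<open>auto simp: arctan_le_iff\<close>)
  finally show "emeasure (distr (density lborel (\<lambda>\<theta>. ennreal (inverse ((cos \<theta>)\<^sup>2)) * indicator {-pi/2<..<pi/2} \<theta>)) borel tan) (box l u)
      = ennreal (\<Prod>b\<in>Basis. (u - l) \<bullet> b)"
    by (simp add: tan_arctan)
qed simp

definition polar :: "real \<times> real \<Rightarrow> real \<times> real" where
  "polar = (\<lambda>(r, \<theta>). (r * cos \<theta>, r * sin \<theta>))"

lemma polar_measurable [measurable]: "polar \<in> borel_measurable borel"
  unfolding polar_def borel_prod[symmetric] by measurable

text \<open>Three substitutions y = x t, t = tan \<theta>, x = r cos \<theta>, with the Jacobians x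
  = r cos \<theta>, 1 / cos^2 \<theta> and cos \<theta>, whose product is r.\<close>

lemma nn_integral_right_half_plane:
  fixes g :: "real \<times> real \<Rightarrow> ennreal"
  assumes [measurable]: "g \<in> borel_measurable borel"
  shows "(\<integral>\<^sup>+x. \<integral>\<^sup>+y. g (x, y) * indicator {0<..} x \<partial>lborel \<partial>lborel) =
    (\<integral>\<^sup>+\<theta>. (\<integral>\<^sup>+r. g (polar (r, \<theta>)) * ennreal r * indicator {0<..} r \<partial>lborel) * indicator {-pi/2<..<pi/2} \<theta> \<partial>lborel)"
proof -
  have [measurable]: "(tan :: real \<Rightarrow> real) \<in> borel_measurable borel"
    unfolding tan_def[abs_def] by measurable
  have gm[measurable]: "g \<in> borel_measurable (borel \<Otimes>\<^sub>M borel)"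
    using assms by (simp add: borel_prod)
  define h where "h t = (\<integral>\<^sup>+x. g (x, x * t) * ennreal x * indicator {0<..} x \<partial>lborel)" for t
  have [measurable]: "h \<in> borel_measurable borel"
    unfolding h_def by measurable
  have "(\<integral>\<^sup>+x. \<integral>\<^sup>+y. g (x, y) * indicator {0<..} x \<partial>lborel \<partial>lborel) =
      (\<integral>\<^sup>+x. \<integral>\<^sup>+t. g (x, x * t) * ennreal x * indicator {0<..} x \<partial>lborel \<partial>lborel)"
  proof (rule nn_integral_cong)
    fix x :: real
    show "(\<integral>\<^sup>+y. g (x, y) * indicator {0<..} x \<partial>lborel) = (\<integral>\<^sup>+t. g (x, x * t) * ennreal x * indicator {0<..} x \<partial>lborel)"
    proof (cases "x > 0")
      case True
      then have "(\<integral>\<^sup>+y. g (x, y) \<partial>lborel) = ennreal x * (\<integral>\<^sup>+t. g (x, x * t) \<partial>lborel)"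
        using nn_integral_real_affine[of "\<lambda>y. g (x, y)" x 0] by simp
      also have "\<dots> = (\<integral>\<^sup>+t. g (x, x * t) * ennreal x \<partial>lborel)"
        by (subst nn_integral_cmult[symmetric]) (auto simp: mult.commute)
      finally show ?thesis using True by simp
    qed simp
  qed
  also have "\<dots> = (\<integral>\<^sup>+t. h t \<partial>lborel)"
    unfolding h_def by (rule lborel_pair.Fubini') measurable
  also have "\<dots> = (\<integral>\<^sup>+\<theta>. (ennreal (inverse ((cos \<theta>)\<^sup>2)) * indicator {-pi/2<..<pi/2} \<theta>) * h (tan \<theta>) \<partial>lborel)"
    by (subst lborel_tan) (simp add: nn_integral_distr nn_integral_density)
  also have "\<dots> = (\<integral>\<^sup>+\<theta>. (\<integral>\<^sup>+r. g (polar (r, \<theta>)) * ennreal r * indicator {0<..} r \<partial>lborel) * indicator {-pi/2<..<pi/2} \<theta> \<partial>lborel)"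
  proof (rule nn_integral_cong)
    fix \<theta> :: real
    show "ennreal (inverse ((cos \<theta>)\<^sup>2)) * indicator {-pi/2<..<pi/2} \<theta> * h (tan \<theta>)
      = (\<integral>\<^sup>+r. g (polar (r, \<theta>)) * ennreal r * indicator {0<..} r \<partial>lborel) * indicator {-pi/2<..<pi/2} \<theta>"
    proof (cases "\<theta> \<in> {-pi/2<..<pi/2}")
      case True
      then have c: "cos \<theta> > 0" by (intro cos_gt_zero_pi) auto
      have "h (tan \<theta>) = ennreal (cos \<theta>) * (\<integral>\<^sup>+r. g (cos \<theta> * r, cos \<theta> * r * tan \<theta>) * ennreal (cos \<theta> * r) * indicator {0<..} (cos \<theta> * r) \<partial>lborel)"
        unfolding h_def using c by (subst nn_integral_real_affine[of _ "cos \<theta>" 0]) auto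
      also have "\<dots> = ennreal (cos \<theta>) * (\<integral>\<^sup>+r. ennreal (cos \<theta>) * (g (polar (r, \<theta>)) * ennreal r * indicator {0<..} r) \<partial>lborel)"
      proof (rule arg_cong[where f = "(*) (ennreal (cos \<theta>))"], rule nn_integral_cong)
        fix r :: real
        have A: "g (cos \<theta> * r, cos \<theta> * r * tan \<theta>) = g (polar (r, \<theta>))"
          using c by (simp add: polar_def tan_def mult.commute)
        have B: "ennreal (cos \<theta> * r) * indicator {0<..} (cos \<theta> * r) = ennreal (cos \<theta>) * (ennreal r * indicator {0<..} r)"
          using c by (auto simp: indicator_def zero_less_mult_iff ennreal_mult)
        show "g (cos \<theta> * r, cos \<theta> * r * tan \<theta>) * ennreal (cos \<theta> * r) * indicator {0<..} (cos \<theta> * r)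
            = ennreal (cos \<theta>) * (g (polar (r, \<theta>)) * ennreal r * indicator {0<..} r)"
          unfolding A unfolding mult.assoc B by (simp only: mult_ac)
      qed
      also have "\<dots> = ennreal ((cos \<theta>)\<^sup>2) * (\<integral>\<^sup>+r. g (polar (r, \<theta>)) * ennreal r * indicator {0<..} r \<partial>lborel)"
        using c by (subst nn_integral_cmult) (auto simp: power2_eq_square ennreal_mult mult.assoc)
      finally show ?thesis using True c
        by (simp add: mult.assoc[symmetric] ennreal_mult[symmetric])
    qed simp
  qed
  finally show ?thesis .
qed

text \<open>The first half of this interval parametrises the right half plane, the second half its
  point reflection; the rays in between are null sets.\<close>

abbreviation angles :: "real set" where "angles \<equiv> {-pi/2<..<3*pi/2}"

lemma nn_integral_polar:
  fixes g :: "real \<times> real \<Rightarrow> ennreal"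
  assumes [measurable]: "g \<in> borel_measurable borel"
  shows "(\<integral>\<^sup>+p. g p \<partial>lborel) =
    (\<integral>\<^sup>+\<theta>. (\<integral>\<^sup>+r. g (polar (r, \<theta>)) * ennreal r * indicator {0<..} r \<partial>lborel) * indicator angles \<theta> \<partial>lborel)"
proof -
  have gm[measurable]: "g \<in> borel_measurable (borel \<Otimes>\<^sub>M borel)"
    using assms by (simp add: borel_prod)
  define I where "I \<theta> = (\<integral>\<^sup>+r. g (polar (r, \<theta>)) * ennreal r * indicator {0<..} r \<partial>lborel)" for \<theta>
  have [measurable]: "I \<in> borel_measurable borel"
    unfolding I_def polar_def by measurable
  have refl: "(\<integral>\<^sup>+x. f x \<partial>lborel) = (\<integral>\<^sup>+x. f (- x) \<partial>lborel)" if "f \<in> borel_measurable borel" for f :: "real \<Rightarrow> ennreal"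
    using nn_integral_real_affine[OF that, of "-1" 0] by simp
  have "(\<integral>\<^sup>+p. g p \<partial>lborel) = (\<integral>\<^sup>+x. \<integral>\<^sup>+y. g (x, y) \<partial>lborel \<partial>lborel)"
    by (subst lborel_prod[symmetric]) (simp add: lborel.nn_integral_fst)
  also have "\<dots> = (\<integral>\<^sup>+x. (\<integral>\<^sup>+y. g (x, y) * indicator {0<..} x \<partial>lborel) + (\<integral>\<^sup>+y. g (x, y) * indicator {..<0} x \<partial>lborel) \<partial>lborel)"
    using AE_lborel_singleton[of "0::real"]
    by (intro nn_integral_cong_AE) (auto elim!: eventually_mono simp: indicator_def)
  also have "\<dots> = (\<integral>\<^sup>+x. \<integral>\<^sup>+y. g (x, y) * indicator {0<..} x \<partial>lborel \<partial>lborel) + (\<integral>\<^sup>+x. \<integral>\<^sup>+y. g (x, y) * indicator {..<0} x \<partial>lborel \<partial>lborel)"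
    by (rule nn_integral_add) measurable
  \<comment> \<open>The left half plane is reflected through the origin, which in polar coordinates
    shifts \<theta> by \<pi>.\<close>
  also have "(\<integral>\<^sup>+x. \<integral>\<^sup>+y. g (x, y) * indicator {..<0} x \<partial>lborel \<partial>lborel) =
      (\<integral>\<^sup>+x. \<integral>\<^sup>+y. g (- x, - y) * indicator {0<..} x \<partial>lborel \<partial>lborel)"
  proof -
    have "(\<integral>\<^sup>+x. \<integral>\<^sup>+y. g (x, y) * indicator {..<0} x \<partial>lborel \<partial>lborel) =
        (\<integral>\<^sup>+x. \<integral>\<^sup>+y. g (- x, y) * indicator {..<0} (- x) \<partial>lborel \<partial>lborel)"
      by (rule refl) measurable
    also have "\<dots> = (\<integral>\<^sup>+x. \<integral>\<^sup>+y. g (- x, - y) * indicator {..<0} (- x) \<partial>lborel \<partial>lborel)"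
      by (intro nn_integral_cong refl) measurable
    finally show ?thesis by (simp add: indicator_def)
  qed
  also have "(\<integral>\<^sup>+x. \<integral>\<^sup>+y. g (- x, - y) * indicator {0<..} x \<partial>lborel \<partial>lborel) =
      (\<integral>\<^sup>+\<theta>. (\<integral>\<^sup>+r. g (- polar (r, \<theta>)) * ennreal r * indicator {0<..} r \<partial>lborel) * indicator {-pi/2<..<pi/2} \<theta> \<partial>lborel)"
    using nn_integral_right_half_plane[of "\<lambda>p. g (- p)"] by simp
  also have "\<dots> = (\<integral>\<^sup>+\<theta>. I (\<theta> + pi) * indicator {-pi/2<..<pi/2} \<theta> \<partial>lborel)"
    unfolding I_def by (simp add: polar_def)
  also have "\<dots> = (\<integral>\<^sup>+\<theta>. I (pi + \<theta>) * indicator {pi/2<..<3*pi/2} (pi + \<theta>) \<partial>lborel)"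
    by (intro nn_integral_cong) (auto simp: indicator_def add.commute)
  also have "\<dots> = (\<integral>\<^sup>+\<theta>. I \<theta> * indicator {pi/2<..<3*pi/2} \<theta> \<partial>lborel)"
    by (subst nn_integral_real_affine[of _ 1 pi]) auto
  also have "(\<integral>\<^sup>+x. \<integral>\<^sup>+y. g (x, y) * indicator {0<..} x \<partial>lborel \<partial>lborel) =
      (\<integral>\<^sup>+\<theta>. I \<theta> * indicator {-pi/2<..<pi/2} \<theta> \<partial>lborel)"
    unfolding I_def by (rule nn_integral_right_half_plane) fact
  also have "(\<integral>\<^sup>+\<theta>. I \<theta> * indicator {-pi/2<..<pi/2} \<theta> \<partial>lborel) + (\<integral>\<^sup>+\<theta>. I \<theta> * indicator {pi/2<..<3*pi/2} \<theta> \<partial>lborel) =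
      (\<integral>\<^sup>+\<theta>. I \<theta> * indicator {-pi/2<..<pi/2} \<theta> + I \<theta> * indicator {pi/2<..<3*pi/2} \<theta> \<partial>lborel)"
    by (rule nn_integral_add[symmetric]) measurable
  also have "\<dots> = (\<integral>\<^sup>+\<theta>. I \<theta> * indicator angles \<theta> \<partial>lborel)"
    using AE_lborel_singleton[of "pi/2"]
    by (intro nn_integral_cong_AE) (auto elim!: eventually_mono simp: indicator_def)
  finally show ?thesis by (simp add: I_def)
qed

text \<open>The measure r dr d\<theta>. As a measure in its own right, with
  \<open>lborel_polar\<close> as an image formula, it also transports integrals of complex
  functions.\<close>

definition polar_measure :: "(real \<times> real) measure" where
  "polar_measure = density lborel (\<lambda>x. ennreal (fst x * indicator ({0<..} \<times> angles) x))"

lemma sets_polar_measure [measurable_cong, simp]: "sets polar_measure = sets borel"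
  and space_polar_measure [simp]: "space polar_measure = UNIV"
  by (simp_all add: polar_measure_def)

lemma polar_domain_measurable [measurable]: "({0<..} \<times> angles) \<in> sets (borel :: (real \<times> real) measure)"
  by (intro borel_open open_Times) auto

lemma fst_snd_borel_measurable [measurable]:
  "fst \<in> borel_measurable (borel :: (real \<times> real) measure)" "snd \<in> borel_measurable (borel :: (real \<times> real) measure)"
  by (auto intro!: borel_measurable_continuous_onI continuous_intros)

lemma nn_integral_polar_measure:
  assumes [measurable]: "f \<in> borel_measurable borel"
  shows "(\<integral>\<^sup>+x. f x \<partial>polar_measure) = (\<integral>\<^sup>+\<theta>. (\<integral>\<^sup>+r. f (r, \<theta>) * ennreal r * indicator {0<..} r \<partial>lborel) * indicator angles \<theta> \<partial>lborel)"
    "(\<integral>\<^sup>+x. f x \<partial>polar_measure) = (\<integral>\<^sup>+r. (\<integral>\<^sup>+\<theta>. f (r, \<theta>) * indicator angles \<theta> \<partial>lborel) * ennreal r * indicator {0<..} r \<partial>lborel)"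
proof -
  have [measurable]: "f \<in> borel_measurable (borel \<Otimes>\<^sub>M borel)"
    using assms by (simp add: borel_prod)
  define F where "F r \<theta> = f (r, \<theta>) * ennreal r * indicator {0<..} r * indicator angles \<theta>" for r \<theta>
  have [measurable]: "case_prod F \<in> borel_measurable (borel \<Otimes>\<^sub>M borel)" unfolding F_def by measurable
  have "(\<integral>\<^sup>+x. f x \<partial>polar_measure) = (\<integral>\<^sup>+x. case_prod F x \<partial>(lborel \<Otimes>\<^sub>M lborel))"
    unfolding polar_measure_def lborel_prod
    by (subst nn_integral_density) (measurable, auto intro!: nn_integral_cong simp: F_def indicator_def mult.commute)
  also have "\<dots> = (\<integral>\<^sup>+\<theta>. \<integral>\<^sup>+r. F r \<theta> \<partial>lborel \<partial>lborel)"
    by (subst lborel_pair.nn_integral_snd[symmetric]) auto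
  finally have 1: "(\<integral>\<^sup>+x. f x \<partial>polar_measure) = (\<integral>\<^sup>+\<theta>. \<integral>\<^sup>+r. F r \<theta> \<partial>lborel \<partial>lborel)" .
  have 2: "\<dots> = (\<integral>\<^sup>+r. \<integral>\<^sup>+\<theta>. F r \<theta> \<partial>lborel \<partial>lborel)"
    by (rule lborel_pair.Fubini'[symmetric]) measurable
  show "(\<integral>\<^sup>+x. f x \<partial>polar_measure) = (\<integral>\<^sup>+\<theta>. (\<integral>\<^sup>+r. f (r, \<theta>) * ennreal r * indicator {0<..} r \<partial>lborel) * indicator angles \<theta> \<partial>lborel)"
    unfolding 1 by (intro nn_integral_cong) (simp add: F_def nn_integral_multc)
  show "(\<integral>\<^sup>+x. f x \<partial>polar_measure) = (\<integral>\<^sup>+r. (\<integral>\<^sup>+\<theta>. f (r, \<theta>) * indicator angles \<theta> \<partial>lborel) * ennreal r * indicator {0<..} r \<partial>lborel)"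
    unfolding 1 2
  proof (rule nn_integral_cong)
    fix r :: real
    have *: "F r = (\<lambda>\<theta>. (f (r, \<theta>) * indicator angles \<theta>) * (ennreal r * indicator {0<..} r))"
      unfolding F_def by (simp only: mult_ac)
    show "(\<integral>\<^sup>+\<theta>. F r \<theta> \<partial>lborel) = (\<integral>\<^sup>+\<theta>. f (r, \<theta>) * indicator angles \<theta> \<partial>lborel) * ennreal r * indicator {0<..} r"
      unfolding * by (subst nn_integral_multc) (measurable, simp only: mult.assoc)
  qed
qed

lemma lborel_polar: "lborel = distr polar_measure borel polar"
proof (rule measure_eqI)
  fix A :: "(real \<times> real) set" assume "A \<in> sets lborel"
  then have [measurable]: "A \<in> sets borel" by simp
  have "emeasure lborel A = (\<integral>\<^sup>+p. indicator A p \<partial>lborel)" by simp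
  also have "\<dots> = (\<integral>\<^sup>+x. indicator A (polar x) \<partial>polar_measure)"
    by (subst nn_integral_polar, measurable, subst nn_integral_polar_measure(1), measurable)
  also have "\<dots> = (\<integral>\<^sup>+x. indicator A x \<partial>distr polar_measure borel polar)"
    by (subst nn_integral_distr) auto
  finally show "emeasure lborel A = emeasure (distr polar_measure borel polar) A" by simp
qed simp

section \<open>Distributions represented by square integrable functions\<close>

text \<open>Elements of the \<open>L2\<close> spaces are only Lebesgue measurable on
  \<open>U\<close>. Exchanging them for Borel functions that vanish outside \<open>U\<close> lets
  every integral be taken over \<open>lborel\<close>, where Fubini and polar coordinates
  apply.\<close>

lemma borel_representative:
  fixes f :: "'a::euclidean_space \<Rightarrow> complex"
  assumes f: "f \<in> borel_measurable (lebesgue_on U)" and U: "open U"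
  obtains g where "g \<in> borel_measurable borel" "\<And>x. x \<notin> U \<Longrightarrow> g x = 0" "AE x in lebesgue_on U. f x = g x"
    "AE x in lborel. x \<in> U \<longrightarrow> f x = g x"
proof -
  define h where "h x = (if x \<in> U then f x else 0)" for x
  have h: "h \<in> borel_measurable lebesgue"
    unfolding h_def using f U by (simp add: borel_measurable_if)
  have "(\<lambda>x. Re (h x)) \<in> borel_measurable lebesgue" "(\<lambda>x. Im (h x)) \<in> borel_measurable lebesgue"
    using h by measurable
  from completion_ex_borel_measurable_real[OF this(1)] completion_ex_borel_measurable_real[OF this(2)]
  obtain a b where [measurable]: "a \<in> borel_measurable lborel" "b \<in> borel_measurable lborel"
    and ab: "AE x in lborel. Re (h x) = a x" "AE x in lborel. Im (h x) = b x" by auto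
  have [measurable]: "U \<in> sets borel" using U by simp
  define g where "g x = indicator U x *\<^sub>R Complex (a x) (b x)" for x
  have eq: "AE x in lborel. x \<in> U \<longrightarrow> f x = g x"
    using ab by eventually_elim (auto simp: g_def h_def complex_eq_iff)
  have g_eq: "g = (\<lambda>x. indicator U x *\<^sub>R (complex_of_real (a x) + \<i> * complex_of_real (b x)))"
    by (auto simp: g_def complex_eq_iff)
  show ?thesis
  proof (rule that)
    show "g \<in> borel_measurable borel" unfolding g_eq by measurable
    have "AE x in lebesgue. x \<in> U \<longrightarrow> f x = g x" using eq by (rule AE_completion)
    then show "AE x in lebesgue_on U. f x = g x" using U by (simp add: AE_restrict_space_iff)
  qed (use eq in \<open>auto simp: g_def\<close>)
qed

text \<open>Integrability against test functions is supplied by a finite \<open>sqnorm\<close>,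
  through \<open>integrable_test\<close>.\<close>

definition represents :: "'a::euclidean_space set \<Rightarrow> 'a distrib \<Rightarrow> ('a \<Rightarrow> complex) \<Rightarrow> bool" where
  "represents U T f \<longleftrightarrow> f \<in> borel_measurable borel \<and> (\<forall>x. x \<notin> U \<longrightarrow> f x = 0) \<and>
     (\<forall>\<phi>\<in>test_functions U. T \<phi> = (\<integral>x. f x * \<phi> x \<partial>lborel))"

definition sqnorm :: "('a::euclidean_space \<Rightarrow> real) \<Rightarrow> ('a \<Rightarrow> complex) \<Rightarrow> ennreal" where
  "sqnorm \<rho> f = (\<integral>\<^sup>+x. ennreal (\<rho> x * (cmod (f x))\<^sup>2) \<partial>lborel)"

text \<open>The lower bounds on compact sets make weighted square integrable functions locally
  integrable on \<open>U\<close>. The instances are the constant 1, and \<open>axi_weight\<close> on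
  subsets of the positive axis.\<close>

definition good_weight :: "('a::euclidean_space \<Rightarrow> real) \<Rightarrow> 'a set \<Rightarrow> bool" where
  "good_weight \<rho> U \<longleftrightarrow> open U \<and> \<rho> \<in> borel_measurable borel \<and> (\<forall>x\<in>U. 0 \<le> \<rho> x) \<and>
     (\<forall>K. compact K \<longrightarrow> K \<subseteq> U \<longrightarrow> (\<exists>c>0. \<forall>x\<in>K. c \<le> \<rho> x))"

lemma borel_imp_lebesgue_on:
  "f \<in> borel_measurable borel \<Longrightarrow> f \<in> borel_measurable (lebesgue_on U)"
  by (intro measurable_restrict_space1 measurable_completion) simp

lemma test_functions_measurable: "\<phi> \<in> test_functions U \<Longrightarrow> \<phi> \<in> borel_measurable borel"
  by (intro borel_measurable_continuous_onI smooth_fun_continuous_on test_functions_smooth)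

lemma dist_of_borel:
  assumes "open U" "f \<in> borel_measurable borel" "\<And>x. x \<notin> U \<Longrightarrow> f x = 0" "\<phi> \<in> borel_measurable borel"
  shows "dist_of U f \<phi> = (\<integral>x. f x * \<phi> x \<partial>lborel)"
proof -
  have "dist_of U f \<phi> = (\<integral>x. indicator U x *\<^sub>R (f x * \<phi> x) \<partial>lebesgue)"
    unfolding dist_of_def using assms(1) by (subst integral_restrict_space) auto
  also have "\<dots> = (\<integral>x. f x * \<phi> x \<partial>lebesgue)"
    using assms(3) by (intro Bochner_Integration.integral_cong refl) (auto simp: indicator_def)
  also have "\<dots> = (\<integral>x. f x * \<phi> x \<partial>lborel)"
    using assms by (intro integral_completion) auto
  finally show ?thesis .
qed

lemma L2_sqnorm_borel:
  assumes "open U" "f \<in> borel_measurable borel" "\<And>x. x \<notin> U \<Longrightarrow> f x = 0" "\<rho> \<in> borel_measurable borel"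
  shows "L2_sqnorm \<rho> U f = sqnorm \<rho> f"
proof -
  have "L2_sqnorm \<rho> U f = (\<integral>\<^sup>+x. ennreal (\<rho> x * (cmod (f x))\<^sup>2) * indicator U x \<partial>lebesgue)"
    unfolding L2_sqnorm_def using assms(1) by (subst nn_integral_restrict_space) auto
  also have "\<dots> = (\<integral>\<^sup>+x. ennreal (\<rho> x * (cmod (f x))\<^sup>2) \<partial>lebesgue)"
    using assms(3) by (intro nn_integral_cong) (auto simp: indicator_def)
  also have "\<dots> = sqnorm \<rho> f"
    unfolding sqnorm_def using assms by (intro nn_integral_completion)
  finally show ?thesis .
qed

lemma dist_of_cong_AE:
  assumes "f \<in> borel_measurable (lebesgue_on U)" "g \<in> borel_measurable (lebesgue_on U)"
    "AE x in lebesgue_on U. f x = g x" "\<phi> \<in> borel_measurable borel"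
  shows "dist_of U f \<phi> = dist_of U g \<phi>"
  unfolding dist_of_def using assms borel_imp_lebesgue_on[OF assms(4), of U]
  by (intro integral_cong_AE) auto

lemma dist_L2_sqnorm_le:
  assumes \<rho>: "good_weight \<rho> U" and f: "represents U T f"
  shows "dist_L2_sqnorm \<rho> U T \<le> sqnorm \<rho> f"
proof (cases "sqnorm \<rho> f < \<infinity>")
  case True
  have *: "L2_sqnorm \<rho> U f = sqnorm \<rho> f"
    using \<rho> f by (intro L2_sqnorm_borel) (auto simp: good_weight_def represents_def)
  have "f \<in> L2_space \<rho> U"
    unfolding L2_space_def using True f * by (auto simp: represents_def intro: borel_imp_lebesgue_on)
  moreover have "T \<phi> = dist_of U f \<phi>" if "\<phi> \<in> test_functions U" for \<phi>
    using \<rho> f that test_functions_measurable[OF that]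
    by (subst dist_of_borel) (auto simp: good_weight_def represents_def)
  ultimately show ?thesis
    unfolding dist_L2_sqnorm_def *[symmetric] by (intro Inf_lower) blast
qed (simp add: not_less top_unique)

lemma dist_L2_sqnorm_less:
  assumes \<rho>: "good_weight \<rho> U" and T: "dist_L2_sqnorm \<rho> U T < a"
  obtains f where "represents U T f" "sqnorm \<rho> f < a"
proof -
  obtain f where f: "L2_sqnorm \<rho> U f < a" "f \<in> L2_space \<rho> U" "\<And>\<phi>. \<phi> \<in> test_functions U \<Longrightarrow> T \<phi> = dist_of U f \<phi>"
    using T unfolding dist_L2_sqnorm_def Inf_less_iff by blast
  have U: "open U" and m: "\<rho> \<in> borel_measurable borel" using \<rho> by (auto simp: good_weight_def)
  have fm: "f \<in> borel_measurable (lebesgue_on U)" using f(2) by (simp add: L2_space_def)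
  obtain g where g: "g \<in> borel_measurable borel" "\<And>x. x \<notin> U \<Longrightarrow> g x = 0" "AE x in lebesgue_on U. f x = g x"
    using borel_representative[OF fm U] by metis
  show ?thesis
  proof (rule that)
    have "sqnorm \<rho> g = L2_sqnorm \<rho> U g" using L2_sqnorm_borel[OF U g(1,2) m] by simp
    also have "\<dots> = L2_sqnorm \<rho> U f"
      unfolding L2_sqnorm_def using g(3) by (intro nn_integral_cong_AE) (auto elim!: eventually_mono)
    finally show "sqnorm \<rho> g < a" using f(1) by simp
    have "T \<phi> = (\<integral>x. g x * \<phi> x \<partial>lborel)" if "\<phi> \<in> test_functions U" for \<phi>
      using f(3)[OF that] dist_of_cong_AE[OF fm borel_imp_lebesgue_on[OF g(1)] g(3) test_functions_measurable[OF that]]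
        dist_of_borel[OF U g(1,2) test_functions_measurable[OF that]] by simp
    then show "represents U T g" using g by (auto simp: represents_def)
  qed
qed

text \<open>Near minimisers of the infimum take the place of a representing function that is unique
  almost everywhere.\<close>

lemma dist_L2_sqnorm_approx:
  assumes "good_weight \<rho> U" "dist_L2_sqnorm \<rho> U T < \<infinity>" "0 < e"
  obtains f where "represents U T f" "sqnorm \<rho> f \<le> dist_L2_sqnorm \<rho> U T + ennreal e" "sqnorm \<rho> f < \<infinity>"
proof -
  have "dist_L2_sqnorm \<rho> U T < dist_L2_sqnorm \<rho> U T + ennreal e"
    using assms by (cases "dist_L2_sqnorm \<rho> U T") (auto simp flip: ennreal_plus simp: ennreal_less_iff)
  then obtain f where "represents U T f" "sqnorm \<rho> f < dist_L2_sqnorm \<rho> U T + ennreal e"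
    by (rule dist_L2_sqnorm_less[OF assms(1)])
  with that show ?thesis using less_le_trans top_greatest by (metis infinity_ennreal_def less_imp_le)
qed

text \<open>Carries an estimate on representing functions over to the infimum. The last assumption
  guards against 0 times \<infinity>, which is 0 in \<open>ennreal\<close>.\<close>

lemma dist_L2_sqnorm_mono:
  assumes \<rho>: "good_weight \<rho> U" and \<rho>': "good_weight \<rho>' U'" and "0 \<le> C"
    and step: "\<And>f. represents U T f \<Longrightarrow> sqnorm \<rho> f < \<infinity> \<Longrightarrow> \<exists>g. represents U' T' g \<and> sqnorm \<rho>' g \<le> ennreal C * sqnorm \<rho> f"
    and "C = 0 \<Longrightarrow> dist_L2_sqnorm \<rho> U T < \<infinity>"
  shows "dist_L2_sqnorm \<rho>' U' T' \<le> ennreal C * dist_L2_sqnorm \<rho> U T"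
proof (cases "dist_L2_sqnorm \<rho> U T < \<infinity>")
  case True
  show ?thesis
  proof (rule ennreal_le_epsilon)
    fix e :: real assume e: "0 < e"
    obtain f where f: "represents U T f" "sqnorm \<rho> f \<le> dist_L2_sqnorm \<rho> U T + ennreal (e / (C + 1))" "sqnorm \<rho> f < \<infinity>"
      using dist_L2_sqnorm_approx[OF \<rho> True, of "e / (C + 1)"] e \<open>0 \<le> C\<close> by auto
    obtain g where g: "represents U' T' g" "sqnorm \<rho>' g \<le> ennreal C * sqnorm \<rho> f"
      using step[OF f(1,3)] by blast
    have "dist_L2_sqnorm \<rho>' U' T' \<le> ennreal C * sqnorm \<rho> f"
      using dist_L2_sqnorm_le[OF \<rho>' g(1)] g(2) by (rule order_trans)
    also have "\<dots> \<le> ennreal C * (dist_L2_sqnorm \<rho> U T + ennreal (e / (C + 1)))"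
      by (intro mult_left_mono f) auto
    also have "\<dots> = ennreal C * dist_L2_sqnorm \<rho> U T + ennreal (C * (e / (C + 1)))"
      using \<open>0 \<le> C\<close> e by (subst ennreal_mult) (auto simp: distrib_left)
    also have "\<dots> \<le> ennreal C * dist_L2_sqnorm \<rho> U T + ennreal e"
      using \<open>0 \<le> C\<close> e by (intro add_left_mono ennreal_leI) (simp add: field_simps)
    finally show "dist_L2_sqnorm \<rho>' U' T' \<le> ennreal C * dist_L2_sqnorm \<rho> U T + ennreal e" .
  qed
next
  case False
  then have "C > 0" using assms(5) \<open>0 \<le> C\<close> by (cases "C = 0") auto
  then show ?thesis using False by (simp add: less_top[symmetric] ennreal_mult_top)
qed

lemma dist_L2_sqnorm_cong:
  "(\<And>\<phi>. \<phi> \<in> test_functions U \<Longrightarrow> T \<phi> = T' \<phi>) \<Longrightarrow> dist_L2_sqnorm \<rho> U T = dist_L2_sqnorm \<rho> U T'"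
  by (simp add: dist_L2_sqnorm_def)

lemma sqnorm_cmult: "f \<in> borel_measurable borel \<Longrightarrow> \<rho> \<in> borel_measurable borel \<Longrightarrow>
    sqnorm \<rho> (\<lambda>x. c * f x) = ennreal ((cmod c)\<^sup>2) * sqnorm \<rho> f"
  unfolding sqnorm_def
  by (subst nn_integral_cmult[symmetric]) (auto intro!: nn_integral_cong simp: norm_mult power_mult_distrib ennreal_mult'[symmetric] mult_ac)

lemma dist_L2_sqnorm_cmult:
  assumes \<rho>: "good_weight \<rho> U"
  shows "dist_L2_sqnorm \<rho> U (\<lambda>\<phi>. c * T \<phi>) \<le> ennreal ((cmod c)\<^sup>2) * dist_L2_sqnorm \<rho> U T"
proof (cases "c = 0")
  \<comment> \<open>The right side is 0 even if \<open>T\<close> has infinite norm, so the zero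
    function is exhibited as a representative.\<close>
  case True
  have "represents U (\<lambda>\<phi>. 0) (\<lambda>x. 0)" by (simp add: represents_def)
  from dist_L2_sqnorm_le[OF \<rho> this] show ?thesis using True by (simp add: sqnorm_def)
next
  case False
  show ?thesis
  proof (rule dist_L2_sqnorm_mono[OF \<rho> \<rho>])
    fix f assume f: "represents U T f"
    have "represents U (\<lambda>\<phi>. c * T \<phi>) (\<lambda>x. c * f x)"
      using f by (auto simp: represents_def mult.assoc)
    then show "\<exists>g. represents U (\<lambda>\<phi>. c * T \<phi>) g \<and> sqnorm \<rho> g \<le> ennreal ((cmod c)\<^sup>2) * sqnorm \<rho> f"
      using f \<rho> by (intro exI[of _ "\<lambda>x. c * f x"]) (auto simp: sqnorm_cmult represents_def good_weight_def)
  qed (use False in auto)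
qed

text \<open>On a compact K carrying \<phi>, |f| \<le> 1 + |f|^2 \<le> 1 + \<rho> |f|^2 / c, where c
  is a lower bound of the weight on K.\<close>

lemma integrable_test:
  assumes \<rho>: "good_weight \<rho> U" and f: "f \<in> borel_measurable borel" "\<And>x. x \<notin> U \<Longrightarrow> f x = 0" "sqnorm \<rho> f < \<infinity>"
    and \<phi>: "\<phi> \<in> test_functions U"
  shows "integrable lborel (\<lambda>x. f x * \<phi> x)"
proof -
  obtain K where K: "smooth_fun \<phi>" "compact K" "K \<subseteq> U" "\<And>x. x \<notin> K \<Longrightarrow> \<phi> x = 0"
    using \<phi> by (rule test_functionsE) blast
  obtain M where M: "0 < M" "\<And>x. cmod (\<phi> x) \<le> M" using \<phi> by (rule test_functions_bounded) blast
  have "\<exists>c>0. \<forall>x\<in>K. c \<le> \<rho> x" using \<rho> K(2,3) by (simp add: good_weight_def)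
  then obtain c where c: "c > 0" "\<And>x. x \<in> K \<Longrightarrow> c \<le> \<rho> x" by blast
  have [measurable]: "f \<in> borel_measurable borel" "\<phi> \<in> borel_measurable borel" "\<rho> \<in> borel_measurable borel"
    using f(1) test_functions_measurable[OF \<phi>] \<rho> by (auto simp: good_weight_def)
  have "integrable lborel (\<lambda>x. \<rho> x * (cmod (f x))\<^sup>2)"
  proof (rule integrableI_nonneg)
    have "0 \<le> \<rho> x * (cmod (f x))\<^sup>2" for x
      using \<rho> f(2)[of x] by (cases "x \<in> U") (simp_all add: good_weight_def)
    then show "AE x in lborel. 0 \<le> \<rho> x * (cmod (f x))\<^sup>2" by simp
  qed (use f(3) in \<open>auto simp: sqnorm_def\<close>)
  moreover have "integrable lborel (indicator K :: 'a \<Rightarrow> real)"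
    using K(2) emeasure_bounded_finite[OF compact_imp_bounded[OF K(2)]]
    by (intro integrable_real_indicator) (auto intro: borel_compact)
  ultimately have "integrable lborel (\<lambda>x. M * (indicator K x + (\<rho> x * (cmod (f x))\<^sup>2) / c))"
    by (intro integrable_mult_right Bochner_Integration.integrable_add integrable_divide)
  then show ?thesis
  proof (rule Bochner_Integration.integrable_bound)
    show "AE x in lborel. norm (f x * \<phi> x) \<le> norm (M * (indicator K x + (\<rho> x * (cmod (f x))\<^sup>2) / c))"
    proof (rule AE_I2)
      fix x
      show "norm (f x * \<phi> x) \<le> norm (M * (indicator K x + (\<rho> x * (cmod (f x))\<^sup>2) / c))"
      proof (cases "x \<in> K")
        case True
        have "c * (cmod (f x))\<^sup>2 \<le> \<rho> x * (cmod (f x))\<^sup>2" using c(2)[OF True] by (intro mult_right_mono) auto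
        then have "(cmod (f x))\<^sup>2 \<le> \<rho> x * (cmod (f x))\<^sup>2 / c" using c(1) by (simp add: field_simps)
        moreover have "cmod (f x) \<le> 1 + (cmod (f x))\<^sup>2"
        proof -
          have "2 * cmod (f x) \<le> (cmod (f x))\<^sup>2 + 1"
            using zero_le_power2[of "cmod (f x) - 1"] unfolding power2_diff by simp
          then show ?thesis using norm_ge_zero[of "f x"] by linarith
        qed
        ultimately have le: "cmod (f x) \<le> 1 + \<rho> x * (cmod (f x))\<^sup>2 / c" by linarith
        have "cmod (f x) * cmod (\<phi> x) \<le> (1 + \<rho> x * (cmod (f x))\<^sup>2 / c) * M"
          using M order_trans[OF norm_ge_zero le] by (intro mult_mono le) auto
        also have "\<dots> \<le> norm ((1 + \<rho> x * (cmod (f x))\<^sup>2 / c) * M)" unfolding real_norm_def by (rule abs_ge_self)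
        finally show ?thesis using True by (simp add: norm_mult mult.commute)
      qed (simp add: K(4))
    qed
  qed simp
qed

lemma sqnorm_add_le:
  assumes "good_weight \<rho> U" "f \<in> borel_measurable borel" "g \<in> borel_measurable borel"
    "\<And>x. x \<notin> U \<Longrightarrow> f x = 0" "\<And>x. x \<notin> U \<Longrightarrow> g x = 0"
  shows "sqnorm \<rho> (\<lambda>x. f x + g x) \<le> 2 * (sqnorm \<rho> f + sqnorm \<rho> g)"
proof -
  have [measurable]: "f \<in> borel_measurable borel" "g \<in> borel_measurable borel" "\<rho> \<in> borel_measurable borel"
    using assms by (auto simp: good_weight_def)
  have "sqnorm \<rho> (\<lambda>x. f x + g x) \<le> (\<integral>\<^sup>+x. 2 * (ennreal (\<rho> x * (cmod (f x))\<^sup>2) + ennreal (\<rho> x * (cmod (g x))\<^sup>2)) \<partial>lborel)"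
    unfolding sqnorm_def
  proof (rule nn_integral_mono)
    fix x
    show "ennreal (\<rho> x * (cmod (f x + g x))\<^sup>2) \<le> 2 * (ennreal (\<rho> x * (cmod (f x))\<^sup>2) + ennreal (\<rho> x * (cmod (g x))\<^sup>2))"
    proof (cases "x \<in> U")
      case True
      then have \<rho>: "0 \<le> \<rho> x" using assms(1) by (auto simp: good_weight_def)
      have "(cmod (f x + g x))\<^sup>2 \<le> (cmod (f x) + cmod (g x))\<^sup>2"
        by (intro power_mono norm_triangle_ineq) auto
      also have "\<dots> \<le> 2 * ((cmod (f x))\<^sup>2 + (cmod (g x))\<^sup>2)"
        using zero_le_power2[of "cmod (f x) - cmod (g x)"] by (simp add: power2_sum power2_diff)
      finally have "\<rho> x * (cmod (f x + g x))\<^sup>2 \<le> 2 * (\<rho> x * (cmod (f x))\<^sup>2 + \<rho> x * (cmod (g x))\<^sup>2)"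
        using mult_left_mono[OF _ \<rho>] by (fastforce simp: algebra_simps)
      then have "ennreal (\<rho> x * (cmod (f x + g x))\<^sup>2) \<le> ennreal (2 * (\<rho> x * (cmod (f x))\<^sup>2 + \<rho> x * (cmod (g x))\<^sup>2))"
        by (rule ennreal_leI)
      also have "\<dots> = 2 * (ennreal (\<rho> x * (cmod (f x))\<^sup>2) + ennreal (\<rho> x * (cmod (g x))\<^sup>2))"
        using \<rho> by (simp add: ennreal_mult' ennreal_plus)
      finally show ?thesis .
    qed (simp add: assms)
  qed
  also have "\<dots> = 2 * (sqnorm \<rho> f + sqnorm \<rho> g)"
    unfolding sqnorm_def by (simp add: nn_integral_cmult nn_integral_add)
  finally show ?thesis .
qed

lemma dist_L2_sqnorm_add:
  assumes \<rho>: "good_weight \<rho> U"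
  shows "dist_L2_sqnorm \<rho> U (\<lambda>\<phi>. S \<phi> + T \<phi>) \<le> 2 * (dist_L2_sqnorm \<rho> U S + dist_L2_sqnorm \<rho> U T)"
proof (cases "dist_L2_sqnorm \<rho> U S < \<infinity> \<and> dist_L2_sqnorm \<rho> U T < \<infinity>")
  case True
  show ?thesis
  proof (rule ennreal_le_epsilon)
    fix e :: real assume e: "0 < e"
    obtain f where f: "represents U S f" "sqnorm \<rho> f \<le> dist_L2_sqnorm \<rho> U S + ennreal (e / 4)" "sqnorm \<rho> f < \<infinity>"
      using dist_L2_sqnorm_approx[OF \<rho>, of S "e / 4"] e True by auto
    obtain g where g: "represents U T g" "sqnorm \<rho> g \<le> dist_L2_sqnorm \<rho> U T + ennreal (e / 4)" "sqnorm \<rho> g < \<infinity>"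
      using dist_L2_sqnorm_approx[OF \<rho>, of T "e / 4"] e True by auto
    have "represents U (\<lambda>\<phi>. S \<phi> + T \<phi>) (\<lambda>x. f x + g x)"
      unfolding represents_def
    proof (intro conjI ballI)
      fix \<phi> assume \<phi>: "\<phi> \<in> test_functions U"
      have "integrable lborel (\<lambda>x. f x * \<phi> x)" "integrable lborel (\<lambda>x. g x * \<phi> x)"
        using f g by (auto intro!: integrable_test[OF \<rho> _ _ _ \<phi>] simp: represents_def)
      then show "S \<phi> + T \<phi> = (\<integral>x. (f x + g x) * \<phi> x \<partial>lborel)"
        using f(1) g(1) \<phi> by (simp add: represents_def distrib_right)
    qed (use f g in \<open>auto simp: represents_def\<close>)
    then have "dist_L2_sqnorm \<rho> U (\<lambda>\<phi>. S \<phi> + T \<phi>) \<le> sqnorm \<rho> (\<lambda>x. f x + g x)"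
      by (rule dist_L2_sqnorm_le[OF \<rho>])
    also have "\<dots> \<le> 2 * (sqnorm \<rho> f + sqnorm \<rho> g)"
      using f g by (intro sqnorm_add_le[OF \<rho>]) (auto simp: represents_def)
    also have "\<dots> \<le> 2 * ((dist_L2_sqnorm \<rho> U S + ennreal (e / 4)) + (dist_L2_sqnorm \<rho> U T + ennreal (e / 4)))"
      by (intro mult_left_mono add_mono f g) auto
    also have "\<dots> = 2 * (dist_L2_sqnorm \<rho> U S + dist_L2_sqnorm \<rho> U T) + 2 * (ennreal (e / 4) + ennreal (e / 4))"
      by (simp add: distrib_left add_ac)
    also have "2 * (ennreal (e / 4) + ennreal (e / 4)) = ennreal e"
      using e by (simp add: ennreal_plus[symmetric] ennreal_mult'[symmetric] flip: ennreal_numeral del: ennreal_plus)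
    finally show "dist_L2_sqnorm \<rho> U (\<lambda>\<phi>. S \<phi> + T \<phi>) \<le> 2 * (dist_L2_sqnorm \<rho> U S + dist_L2_sqnorm \<rho> U T) + ennreal e" .
  qed
next
  case False
  then show ?thesis by (auto simp: less_top[symmetric] ennreal_mult_top)
qed

lemma dist_L2_sqnorm_linear:
  assumes \<rho>: "good_weight \<rho> U"
  shows "dist_L2_sqnorm \<rho> U (\<lambda>\<phi>. x * S \<phi> + y * T \<phi>)
    \<le> ennreal (2 * ((cmod x)\<^sup>2 + (cmod y)\<^sup>2)) * (dist_L2_sqnorm \<rho> U S + dist_L2_sqnorm \<rho> U T)"
proof -
  let ?N = "dist_L2_sqnorm \<rho> U"
  have "?N (\<lambda>\<phi>. x * S \<phi> + y * T \<phi>) \<le> 2 * (ennreal ((cmod x)\<^sup>2) * ?N S + ennreal ((cmod y)\<^sup>2) * ?N T)"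
    by (rule order_trans[OF dist_L2_sqnorm_add[OF \<rho>]]) (intro mult_left_mono add_mono dist_L2_sqnorm_cmult[OF \<rho>], simp)
  also have "\<dots> \<le> 2 * (ennreal ((cmod x)\<^sup>2 + (cmod y)\<^sup>2) * ?N S + ennreal ((cmod x)\<^sup>2 + (cmod y)\<^sup>2) * ?N T)"
    by (intro mult_left_mono add_mono mult_right_mono ennreal_leI) auto
  also have "\<dots> = ennreal (2 * ((cmod x)\<^sup>2 + (cmod y)\<^sup>2)) * (?N S + ?N T)"
  proof -
    have "2 * (e * s + e * t) = (2 * e) * (s + t)" for e s t :: ennreal by (simp add: distrib_left mult.assoc)
    then show ?thesis by (simp add: ennreal_mult')
  qed
  finally show ?thesis .
qed

text \<open>The type \<open>distrib\<close> consists of arbitrary functionals, so linearity has to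
  be carried along; it is asked for on test functions only, as other values have no meaning.\<close>

definition linear_dist :: "'a::euclidean_space set \<Rightarrow> 'a distrib \<Rightarrow> bool" where
  "linear_dist U T \<longleftrightarrow>
     (\<forall>\<phi>\<in>test_functions U. \<forall>\<psi>\<in>test_functions U. T (\<lambda>x. \<phi> x + \<psi> x) = T \<phi> + T \<psi>) \<and>
     (\<forall>\<phi>\<in>test_functions U. \<forall>c. T (\<lambda>x. c * \<phi> x) = c * T \<phi>)"

lemma linear_dist_of:
  assumes \<rho>: "good_weight \<rho> U" and f: "f \<in> borel_measurable borel" "\<And>x. x \<notin> U \<Longrightarrow> f x = 0" "sqnorm \<rho> f < \<infinity>"
  shows "linear_dist U (dist_of U f)"
proof -
  have U: "open U" using \<rho> by (simp add: good_weight_def)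
  have eq: "dist_of U f \<phi> = (\<integral>x. f x * \<phi> x \<partial>lborel)" if "\<phi> \<in> test_functions U" for \<phi>
    by (rule dist_of_borel[OF U f(1) f(2) test_functions_measurable[OF that]])
  show ?thesis
    unfolding linear_dist_def
  proof (intro conjI ballI allI)
    fix \<phi> \<psi> assume \<phi>: "\<phi> \<in> test_functions U" and \<psi>: "\<psi> \<in> test_functions U"
    show "dist_of U f (\<lambda>x. \<phi> x + \<psi> x) = dist_of U f \<phi> + dist_of U f \<psi>"
      unfolding eq[OF \<phi>] eq[OF \<psi>] eq[OF test_functions_add[OF \<phi> \<psi>]] distrib_left
      by (intro Bochner_Integration.integral_add integrable_test[OF \<rho> f] \<phi> \<psi>)
  next
    fix \<phi> and c :: complex assume \<phi>: "\<phi> \<in> test_functions U"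
    show "dist_of U f (\<lambda>x. c * \<phi> x) = c * dist_of U f \<phi>"
      unfolding eq[OF \<phi>] eq[OF test_functions_cmult[OF \<phi>]] mult.left_commute[of _ c] by simp
  qed
qed

lemma good_weight_1: "open U \<Longrightarrow> good_weight (\<lambda>_. 1) U"
  by (auto simp: good_weight_def intro: exI[of _ 1])

lemma good_weight_axi:
  assumes "open U" "U \<subseteq> {0<..}" shows "good_weight axi_weight U"
proof -
  have "\<exists>c>0. \<forall>x\<in>K. c \<le> axi_weight x" if K: "compact K" "K \<subseteq> U" for K
  proof (cases "K = {}")
    case False
    then obtain a where a: "a \<in> K" "\<And>x. x \<in> K \<Longrightarrow> a \<le> x"
      using compact_attains_inf[OF K(1)] by blast
    then have "a > 0" using K(2) assms(2) by auto
    then show ?thesis using a by (intro exI[of _ "2 * pi * a"]) (auto simp: axi_weight_def)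
  qed (auto intro: exI[of _ 1])
  moreover have "axi_weight \<in> borel_measurable borel" unfolding axi_weight_def[abs_def] by measurable
  ultimately show ?thesis using assms by (auto simp: good_weight_def axi_weight_def)
qed

definition dist_eq :: "'a::euclidean_space set \<Rightarrow> 'a distrib \<Rightarrow> 'a distrib \<Rightarrow> bool" where
  "dist_eq U T T' \<longleftrightarrow> (\<forall>\<phi>\<in>test_functions U. T \<phi> = T' \<phi>)"

lemma dist_eq_refl [simp]: "dist_eq U T T"
  and dist_eq_trans: "dist_eq U T T' \<Longrightarrow> dist_eq U T' T'' \<Longrightarrow> dist_eq U T T''"
  by (auto simp: dist_eq_def)

lemma dist_eq_sqnorm: "dist_eq U T T' \<Longrightarrow> dist_L2_sqnorm \<rho> U T = dist_L2_sqnorm \<rho> U T'"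
  by (intro dist_L2_sqnorm_cong) (simp add: dist_eq_def)

lemma dist_eq_deriv: "dist_eq U T T' \<Longrightarrow> b \<in> Basis \<Longrightarrow> dist_eq U (dist_deriv b T) (dist_deriv b T')"
  by (auto simp: dist_eq_def dist_deriv_def intro: test_functions_dir_deriv)

lemma linear_dist_add: "linear_dist U T \<Longrightarrow> \<phi> \<in> test_functions U \<Longrightarrow> \<psi> \<in> test_functions U \<Longrightarrow>
    T (\<lambda>x. \<phi> x + \<psi> x) = T \<phi> + T \<psi>"
  and linear_dist_cmult: "linear_dist U T \<Longrightarrow> \<phi> \<in> test_functions U \<Longrightarrow> T (\<lambda>x. c * \<phi> x) = c * T \<phi>"
  by (auto simp: linear_dist_def)

section \<open>Euler operators\<close>

text \<open>The transpose of \<open>r d/dr\<close>, so that \<open>euler_dist S j p\<close> below is \<open>r\<^sup>-\<^sup>j p(r d/dr) S\<close>.\<close>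

definition euler_adj :: "(real \<Rightarrow> complex) \<Rightarrow> real \<Rightarrow> complex" where
  "euler_adj \<phi> r = - (\<phi> r + of_real r * dir_deriv 1 \<phi> r)"

lemma euler_adj_test:
  assumes "\<phi> \<in> test_functions U" shows "euler_adj \<phi> \<in> test_functions U"
proof -
  have "(\<lambda>r. (-1) * (\<phi> r + of_real r * dir_deriv 1 \<phi> r)) \<in> test_functions U"
    using assms by (intro test_functions_cmult test_functions_add test_functions_mult smooth_fun_of_real
        test_functions_dir_deriv) auto
  moreover have "(\<lambda>r. (-1) * (\<phi> r + of_real r * dir_deriv 1 \<phi> r)) = euler_adj \<phi>"
    by (auto simp: euler_adj_def)
  ultimately show ?thesis by simp
qed

lemma euler_adj_pow_test: "\<phi> \<in> test_functions U \<Longrightarrow> (euler_adj ^^ i) \<phi> \<in> test_functions U"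
  by (induction i) (auto intro: euler_adj_test)

lemma euler_adj_add: "smooth_fun \<phi> \<Longrightarrow> smooth_fun \<psi> \<Longrightarrow> euler_adj (\<lambda>x. \<phi> x + \<psi> x) = (\<lambda>x. euler_adj \<phi> x + euler_adj \<psi> x)"
  by (rule ext) (simp add: euler_adj_def dir_deriv_add smooth_fun_differentiable algebra_simps)

lemma euler_adj_cmult: "smooth_fun \<phi> \<Longrightarrow> euler_adj (\<lambda>x. c * \<phi> x) = (\<lambda>x. c * euler_adj \<phi> x)"
  by (rule ext) (simp add: euler_adj_def dir_deriv_cmult smooth_fun_differentiable algebra_simps)

lemma euler_adj_pow_add: "\<phi> \<in> test_functions U \<Longrightarrow> \<psi> \<in> test_functions U \<Longrightarrow>
    (euler_adj ^^ i) (\<lambda>x. \<phi> x + \<psi> x) = (\<lambda>x. (euler_adj ^^ i) \<phi> x + (euler_adj ^^ i) \<psi> x)"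
  by (induction i) (simp_all add: euler_adj_add test_functions_smooth[OF euler_adj_pow_test])

lemma euler_adj_pow_cmult: "\<phi> \<in> test_functions U \<Longrightarrow>
    (euler_adj ^^ i) (\<lambda>x. c * \<phi> x) = (\<lambda>x. c * (euler_adj ^^ i) \<phi> x)"
  by (induction i) (simp_all add: euler_adj_cmult test_functions_smooth[OF euler_adj_pow_test])

definition euler_dist :: "real distrib \<Rightarrow> nat \<Rightarrow> complex poly \<Rightarrow> real distrib" where
  "euler_dist S j p \<phi> = (\<Sum>i\<le>degree p. coeff p i * S ((euler_adj ^^ i) (\<lambda>r. of_real ((1 / r) ^ j) * \<phi> r)))"

lemma euler_dist_eq_sum:
  "degree p \<le> n \<Longrightarrow> euler_dist S j p \<phi> = (\<Sum>i\<le>n. coeff p i * S ((euler_adj ^^ i) (\<lambda>r. of_real ((1 / r) ^ j) * \<phi> r)))"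
  unfolding euler_dist_def by (rule sum.mono_neutral_left) (auto simp: coeff_eq_0)

lemma euler_dist_poly_add: "euler_dist S j (p + q) \<phi> = euler_dist S j p \<phi> + euler_dist S j q \<phi>"
proof -
  let ?n = "max (degree p) (degree q)"
  show ?thesis
    using euler_dist_eq_sum[OF degree_add_le_max, of S j p q \<phi>] euler_dist_eq_sum[of p ?n S j \<phi>] euler_dist_eq_sum[of q ?n S j \<phi>]
    by (simp add: distrib_right sum.distrib)
qed

lemma euler_dist_poly_smult: "euler_dist S j (smult c p) \<phi> = c * euler_dist S j p \<phi>"
  using euler_dist_eq_sum[OF degree_smult_le, of S j c p \<phi>]
  by (simp add: euler_dist_def sum_distrib_left mult.assoc)

lemma euler_dist_poly_diff: "euler_dist S j (p - q) \<phi> = euler_dist S j p \<phi> - euler_dist S j q \<phi>"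
  using euler_dist_poly_add[of S j p "smult (-1) q" \<phi>] euler_dist_poly_smult[of S j "-1" q \<phi>] by simp

lemma euler_dist_pCons_0:
  "euler_dist S j (pCons 0 p) \<phi> = (\<Sum>i\<le>degree p. coeff p i * S ((euler_adj ^^ i) (euler_adj (\<lambda>r. of_real ((1 / r) ^ j) * \<phi> r))))"
proof -
  have "euler_dist S j (pCons 0 p) \<phi> = (\<Sum>i\<le>Suc (degree p). coeff (pCons 0 p) i * S ((euler_adj ^^ i) (\<lambda>r. of_real ((1 / r) ^ j) * \<phi> r)))"
    by (rule euler_dist_eq_sum) (simp add: degree_pCons_le)
  also have "\<dots> = (\<Sum>i\<le>degree p. coeff p i * S ((euler_adj ^^ Suc i) (\<lambda>r. of_real ((1 / r) ^ j) * \<phi> r)))"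
    by (subst sum.atMost_Suc_shift) simp
  finally show ?thesis by (simp only: funpow_Suc_right o_apply)
qed

lemma euler_dist_1: "euler_dist S 0 1 \<phi> = S \<phi>"
  by (simp add: euler_dist_def)

lemma euler_dist_linear:
  assumes S: "linear_dist U S" and U: "U \<subseteq> {0<..}"
  shows "linear_dist U (euler_dist S j p)"
  unfolding linear_dist_def
proof (intro conjI ballI allI)
  fix \<phi> \<psi> assume \<phi>: "\<phi> \<in> test_functions U" and \<psi>: "\<psi> \<in> test_functions U"
  note i = test_functions_inverse[OF \<phi> U] test_functions_inverse[OF \<psi> U]
  show "euler_dist S j p (\<lambda>x. \<phi> x + \<psi> x) = euler_dist S j p \<phi> + euler_dist S j p \<psi>"
    unfolding euler_dist_def distrib_left euler_adj_pow_add[OF i]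
      linear_dist_add[OF S euler_adj_pow_test[OF i(1)] euler_adj_pow_test[OF i(2)]] by (rule sum.distrib)
next
  fix \<phi> and c :: complex assume \<phi>: "\<phi> \<in> test_functions U"
  note i = test_functions_inverse[OF \<phi> U]
  show "euler_dist S j p (\<lambda>x. c * \<phi> x) = c * euler_dist S j p \<phi>"
    unfolding euler_dist_def mult.left_commute[of _ c] euler_adj_pow_cmult[OF i]
      linear_dist_cmult[OF S euler_adj_pow_test[OF i]] by (simp only: sum_distrib_left mult.left_commute)
qed

text \<open>The transposed form of d/dr (r^-j f) = r^-(j+1) (r d/dr - j) f.\<close>

lemma euler_adj_inverse_power:
  assumes \<phi>: "\<phi> \<in> test_functions U" and U: "U \<subseteq> {0<..}"
  shows "(\<lambda>r. euler_adj (\<lambda>r. of_real ((1 / r) ^ Suc j) * \<phi> r) r + (- of_nat j) * (of_real ((1 / r) ^ Suc j) * \<phi> r))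
    = (\<lambda>r. (-1) * (of_real ((1 / r) ^ j) * dir_deriv 1 \<phi> r))"
proof
  fix r :: real
  show "euler_adj (\<lambda>r. of_real ((1 / r) ^ Suc j) * \<phi> r) r + (- of_nat j) * (of_real ((1 / r) ^ Suc j) * \<phi> r)
    = (-1) * (of_real ((1 / r) ^ j) * dir_deriv 1 \<phi> r)"
  \<comment> \<open>Inside \<open>U\<close> the quotient 1 / r is genuine; outside all terms
    vanish.\<close>
  proof (cases "r \<in> U")
    case True
    then have r: "r \<noteq> 0" using U by auto
    have rr: "of_real r * complex_of_real ((1 / r) ^ Suc n) = of_real ((1 / r) ^ n)" for n
      using r by simp
    have "of_real r * dir_deriv 1 (\<lambda>r. of_real ((1 / r) ^ Suc j) * \<phi> r) r
        = of_real r * (- of_nat (Suc j) * (of_real ((1 / r) ^ Suc (Suc j)) * \<phi> r) + of_real ((1 / r) ^ Suc j) * dir_deriv 1 \<phi> r)"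
      unfolding dir_deriv_1I[OF inverse_power_mult_vector_derivative[OF r test_functions_smooth[OF \<phi>]]] ..
    also have "\<dots> = - of_nat (Suc j) * ((of_real r * of_real ((1 / r) ^ Suc (Suc j))) * \<phi> r) + (of_real r * of_real ((1 / r) ^ Suc j)) * dir_deriv 1 \<phi> r"
      by (simp only: distrib_left mult_ac)
    also have "\<dots> = - of_nat (Suc j) * (of_real ((1 / r) ^ Suc j) * \<phi> r) + of_real ((1 / r) ^ j) * dir_deriv 1 \<phi> r"
      unfolding rr ..
    finally have E: "of_real r * dir_deriv 1 (\<lambda>r. of_real ((1 / r) ^ Suc j) * \<phi> r) r
        = - of_nat (Suc j) * (of_real ((1 / r) ^ Suc j) * \<phi> r) + of_real ((1 / r) ^ j) * dir_deriv 1 \<phi> r" .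
    have "- (a + (- of_nat (Suc j) * a + X)) + - of_nat j * a = (-1) * X" for a X :: complex
      by (simp add: algebra_simps)
    then show ?thesis unfolding euler_adj_def E .
  next
    case False
    have "euler_adj (\<lambda>r. of_real ((1 / r) ^ Suc j) * \<phi> r) r = 0" "\<phi> r = 0" "dir_deriv 1 \<phi> r = 0"
      by (rule test_functions_zero[OF euler_adj_test[OF test_functions_inverse[OF \<phi> U]] False],
          rule test_functions_zero[OF \<phi> False], rule test_functions_zero[OF test_functions_dir_deriv[OF \<phi>] False]) simp
    then show ?thesis by simp
  qed
qed

text \<open>The source of the factors of \<open>fall\<close>: a radial derivative of a term of order
  j raises the order by one and contributes X - j.\<close>

lemma dist_deriv_euler:
  assumes S: "linear_dist U S" and U: "U \<subseteq> {0<..}"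
  shows "dist_eq U (dist_deriv 1 (euler_dist S j p)) (euler_dist S (Suc j) (p * [:- of_nat j, 1:]))"
  unfolding dist_eq_def
proof
  fix \<phi> assume \<phi>: "\<phi> \<in> test_functions U"
  note i = test_functions_inverse[OF \<phi> U, of "Suc j"]
  have d: "(\<lambda>r. of_real ((1 / r) ^ j) * dir_deriv 1 \<phi> r) \<in> test_functions U"
    by (intro test_functions_inverse test_functions_dir_deriv \<phi> U) auto
  have "euler_dist S (Suc j) (p * [:- of_nat j, 1:]) \<phi> = euler_dist S (Suc j) (pCons 0 p) \<phi> - of_nat j * euler_dist S (Suc j) p \<phi>"
    using euler_dist_poly_diff[of S "Suc j" "pCons 0 p" "smult (of_nat j) p" \<phi>] by (simp add: euler_dist_poly_smult)
  also have "\<dots> = (\<Sum>i\<le>degree p. coeff p i * (S ((euler_adj ^^ i) (euler_adj (\<lambda>r. of_real ((1 / r) ^ Suc j) * \<phi> r)))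
      + (- of_nat j) * S ((euler_adj ^^ i) (\<lambda>r. of_real ((1 / r) ^ Suc j) * \<phi> r))))"
    unfolding euler_dist_pCons_0 unfolding euler_dist_def distrib_left sum.distrib
    by (simp add: sum_distrib_left sum_negf mult.left_commute)
  also have "\<dots> = (\<Sum>i\<le>degree p. coeff p i * S ((euler_adj ^^ i) (\<lambda>r. (-1) * (of_real ((1 / r) ^ j) * dir_deriv 1 \<phi> r))))"
    unfolding euler_adj_inverse_power[OF \<phi> U, symmetric]
    unfolding euler_adj_pow_add[OF euler_adj_test[OF i] test_functions_cmult[OF i]]
      euler_adj_pow_cmult[OF i]
      linear_dist_add[OF S euler_adj_pow_test[OF euler_adj_test[OF i]] test_functions_cmult[OF euler_adj_pow_test[OF i]]]
      linear_dist_cmult[OF S euler_adj_pow_test[OF i]] ..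
  also have "\<dots> = - (\<Sum>i\<le>degree p. coeff p i * S ((euler_adj ^^ i) (\<lambda>r. of_real ((1 / r) ^ j) * dir_deriv 1 \<phi> r)))"
    unfolding euler_adj_pow_cmult[OF d] linear_dist_cmult[OF S euler_adj_pow_test[OF d]] by (simp add: sum_negf)
  finally show "dist_deriv 1 (euler_dist S j p) \<phi> = euler_dist S (Suc j) (p * [:- of_nat j, 1:]) \<phi>"
    by (simp only: dist_deriv_def euler_dist_def)
qed

lemma dist_mult_euler: "dist_mult (\<lambda>r. 1 / r) (euler_dist S j p) = euler_dist S (Suc j) p"
  unfolding dist_mult_def euler_dist_def by (simp only: power_Suc2 of_real_mult mult.assoc)

lemma dist_derivs_euler:
  assumes S: "linear_dist U S" and U: "U \<subseteq> {0<..}" and T: "dist_eq U T (euler_dist S j p)"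
  shows "dist_eq U ((dist_deriv 1 ^^ a) T) (euler_dist S (j + a) (p * fall j (j + a)))"
proof (induction a)
  case 0
  then show ?case using T by simp
next
  case (Suc a)
  from dist_eq_trans[OF dist_eq_deriv[OF Suc] dist_deriv_euler[OF S U]]
  show ?case by (simp only: fall_Suc[OF le_add1] mult.assoc add_Suc_right funpow.simps o_apply) simp
qed

lemma H1_sqnorm_euler:
  assumes S: "linear_dist U S" and U: "U \<subseteq> {0<..}" and T: "dist_eq U T (euler_dist S j p)"
  shows "H1_sqnorm n U T = (\<Sum>a\<le>n. dist_L2_sqnorm axi_weight U (euler_dist S (j + a) (p * fall j (j + a))))"
  unfolding H1_sqnorm_def atLeast0AtMost by (intro sum.cong refl dist_eq_sqnorm dist_derivs_euler assms)

text \<open>The link to the comparison of polynomials: this is the functional \<nu> to which those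
  bounds are applied.\<close>

lemma quasi_euler:
  assumes \<rho>: "good_weight \<rho> U"
  shows "quasi (\<lambda>p. dist_L2_sqnorm \<rho> U (euler_dist S j p))"
  unfolding quasi_def
proof (intro conjI allI)
  fix f g
  have "euler_dist S j (f + g) = (\<lambda>\<phi>. euler_dist S j f \<phi> + euler_dist S j g \<phi>)"
    by (intro ext euler_dist_poly_add)
  then show "dist_L2_sqnorm \<rho> U (euler_dist S j (f + g)) \<le> 2 * (dist_L2_sqnorm \<rho> U (euler_dist S j f) + dist_L2_sqnorm \<rho> U (euler_dist S j g))"
    using dist_L2_sqnorm_add[OF \<rho>] by simp
next
  fix c f
  have "euler_dist S j (smult c f) = (\<lambda>\<phi>. c * euler_dist S j f \<phi>)"
    by (intro ext euler_dist_poly_smult)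
  then show "dist_L2_sqnorm \<rho> U (euler_dist S j (smult c f)) \<le> ennreal ((cmod c)\<^sup>2) * dist_L2_sqnorm \<rho> U (euler_dist S j f)"
    using dist_L2_sqnorm_cmult[OF \<rho>] by simp
qed

abbreviation euler_sqnorm :: "real set \<Rightarrow> (real \<Rightarrow> complex) \<Rightarrow> nat \<Rightarrow> complex poly \<Rightarrow> ennreal" where
  "euler_sqnorm U w j p \<equiv> dist_L2_sqnorm axi_weight U (euler_dist (dist_of U w) j p)"

lemma dist_of_mult_inverse_power:
  "dist_of U (\<lambda>r. of_real ((c / r) ^ l) * w r) = euler_dist (dist_of U w) l [:of_real c ^ l:]"
proof
  fix \<phi>
  have "dist_of U (\<lambda>r. of_real ((c / r) ^ l) * w r) \<phi> = (\<integral>r. of_real c ^ l * (w r * (of_real ((1 / r) ^ l) * \<phi> r)) \<partial>lebesgue_on U)"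
    unfolding dist_of_def by (intro Bochner_Integration.integral_cong) (auto simp: power_divide)
  then show "dist_of U (\<lambda>r. of_real ((c / r) ^ l) * w r) \<phi> = euler_dist (dist_of U w) l [:of_real c ^ l:] \<phi>"
    by (simp add: euler_dist_def dist_of_def)
qed

text \<open>A derivative of a term of order k + 2 i contributes the factor X - (k + 2 i) and one
  order, the factor 1 / r one further order.\<close>

lemma scal_C_iterate:
  assumes S: "linear_dist U S" and U: "U \<subseteq> {0<..}"
  shows "dist_eq U (((\<lambda>T. dist_mult (\<lambda>r. 1 / r) (dist_deriv 1 T)) ^^ l) (euler_dist S k 1))
    (euler_dist S (k + 2 * l) (\<Prod>i<l. [:- of_nat (k + 2 * i), 1:]))"
proof (induction l)
  case (Suc l)
  let ?P = "\<Prod>i<l. [:- of_nat (k + 2 * i), 1:]"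
  have "dist_eq U (dist_deriv 1 (((\<lambda>T. dist_mult (\<lambda>r. 1 / r) (dist_deriv 1 T)) ^^ l) (euler_dist S k 1)))
      (euler_dist S (Suc (k + 2 * l)) (?P * [:- of_nat (k + 2 * l), 1:]))"
    by (rule dist_eq_trans[OF dist_eq_deriv[OF Suc] dist_deriv_euler[OF S U]]) simp
  then have "dist_eq U (dist_mult (\<lambda>r. 1 / r) (dist_deriv 1 (((\<lambda>T. dist_mult (\<lambda>r. 1 / r) (dist_deriv 1 T)) ^^ l) (euler_dist S k 1))))
      (dist_mult (\<lambda>r. 1 / r) (euler_dist S (Suc (k + 2 * l)) (?P * [:- of_nat (k + 2 * l), 1:])))"
    using test_functions_inverse[OF _ U, of _ 1] by (simp add: dist_eq_def dist_mult_def)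
  then show ?case by (simp only: dist_mult_euler prod.lessThan_Suc funpow.simps o_apply) simp
qed simp

text \<open>Regroups by total order: \<open>d l\<close> is the order that summand \<open>l\<close>
  has before the derivatives of the Sobolev norm are taken, \<open>a\<close> counts these
  derivatives, and j = d l + a.\<close>

lemma sum_triangle_shift:
  fixes f :: "nat \<Rightarrow> nat \<Rightarrow> ennreal"
  assumes "\<And>l j. j \<le> m \<Longrightarrow> l \<in> A j \<longleftrightarrow> l \<in> B \<and> d l \<le> j" "\<And>l. l \<in> B \<Longrightarrow> d l \<le> m"
    "finite B" "\<And>j. j \<le> m \<Longrightarrow> finite (A j)"
  shows "(\<Sum>l\<in>B. \<Sum>a\<le>m - d l. f l (d l + a)) = (\<Sum>j\<le>m. \<Sum>l\<in>A j. f l j)"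
proof -
  have "(\<Sum>l\<in>B. \<Sum>a\<le>m - d l. f l (d l + a)) = (\<Sum>(l, a)\<in>Sigma B (\<lambda>l. {..m - d l}). f l (d l + a))"
    using assms(3) by (subst sum.Sigma) auto
  also have "\<dots> = (\<Sum>(j, l)\<in>Sigma {..m} A. f l j)"
    by (rule sum.reindex_bij_witness[where i = "\<lambda>(j, l). (l, j - d l)" and j = "\<lambda>(l, a). (d l + a, l)"])
      (use assms(1,2) in \<open>force+\<close>)
  also have "\<dots> = (\<Sum>j\<le>m. \<Sum>l\<in>A j. f l j)"
    using assms(4) by (subst sum.Sigma) auto
  finally show ?thesis .
qed

lemma scal_C_sqnorm_eq:
  assumes S: "linear_dist U (dist_of U w)" and U: "U \<subseteq> {0<..}"
  shows "scal_C_sqnorm m \<kappa> U w = (\<Sum>j\<le>m. Csum j (nat \<bar>\<kappa>\<bar>) (euler_sqnorm U w j))"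
proof -
  define k where "k = nat \<bar>\<kappa>\<bar>"
  have k: "\<bar>real_of_int \<kappa>\<bar> = real k" by (simp add: k_def)
  define \<nu> where "\<nu> = euler_sqnorm U w"
  have 1: "H1_sqnorm (m - l) U (dist_of U (\<lambda>r. of_real ((\<bar>of_int \<kappa>\<bar> / r) ^ l) * w r))
      = (\<Sum>a\<le>m - l. \<nu> (l + a) (smult (of_nat k ^ l) (fall l (l + a))))" for l
    unfolding k dist_of_mult_inverse_power \<nu>_def
    by (subst H1_sqnorm_euler[OF S U dist_eq_refl]) simp
  have 2: "H1_sqnorm (m - k - 2 * l) U (((\<lambda>T. dist_mult (\<lambda>r. 1 / r) (dist_deriv 1 T)) ^^ l)
             (dist_of U (\<lambda>r. of_real ((1 / r) ^ k) * w r)))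
      = (\<Sum>a\<le>m - (k + 2 * l). \<nu> (k + 2 * l + a) (spoly k l (k + 2 * l + a)))" for l
  proof -
    have "dist_of U (\<lambda>r. of_real ((1 / r) ^ k) * w r) = euler_dist (dist_of U w) k 1"
      using dist_of_mult_inverse_power[of U 1 k w] by (simp add: one_pCons)
    then show ?thesis
      using H1_sqnorm_euler[OF S U scal_C_iterate[OF S U], of "m - k - 2 * l" l k]
      by (simp only: spoly_def \<nu>_def diff_diff_left)
  qed
  have "scal_C_sqnorm m \<kappa> U w = (\<Sum>l\<in>{..min k m}. \<Sum>a\<le>m - l. \<nu> (l + a) (smult (of_nat k ^ l) (fall l (l + a))))
     + (\<Sum>l\<in>{1..(m - k) div 2}. \<Sum>a\<le>m - (k + 2 * l). \<nu> (k + 2 * l + a) (spoly k l (k + 2 * l + a)))"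
    unfolding scal_C_sqnorm_def k_def[symmetric] 1 2 atLeast0AtMost ..
  also have "(\<Sum>l\<in>{..min k m}. \<Sum>a\<le>m - l. \<nu> (l + a) (smult (of_nat k ^ l) (fall l (l + a))))
      = (\<Sum>j\<le>m. \<Sum>l\<in>{..min k j}. \<nu> j (smult (of_nat k ^ l) (fall l j)))"
    by (rule sum_triangle_shift[where d = "\<lambda>l. l" and f = "\<lambda>l j. \<nu> j (smult (of_nat k ^ l) (fall l j))"]) auto
  also have "(\<Sum>l\<in>{1..(m - k) div 2}. \<Sum>a\<le>m - (k + 2 * l). \<nu> (k + 2 * l + a) (spoly k l (k + 2 * l + a)))
      = (\<Sum>j\<le>m. \<Sum>l\<in>{1..(j - k) div 2}. \<nu> j (spoly k l j))"
    by (rule sum_triangle_shift[where d = "\<lambda>l. k + 2 * l" and f = "\<lambda>l j. \<nu> j (spoly k l j)"]) auto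
  finally show ?thesis
    by (simp only: Csum_def sum.distrib \<nu>_def k_def)
qed

section \<open>Angular modes\<close>

text \<open>r^|k| e^(i k \<theta>) as a polynomial in x and y, smooth at the origin and independent
  of any choice of the angle.\<close>

definition zpow :: "int \<Rightarrow> real \<times> real \<Rightarrow> complex" where
  "zpow k p = (if k \<ge> 0 then Complex (fst p) (snd p) ^ nat k else cnj (Complex (fst p) (snd p)) ^ nat (- k))"

lemma norm_polar: "r \<ge> 0 \<Longrightarrow> norm (polar (r, \<theta>)) = r"
  by (simp add: polar_def norm_Pair power_mult_distrib distrib_left[symmetric])

lemma zpow_polar: "zpow k (polar (r, \<theta>)) = of_real r ^ nat \<bar>k\<bar> * cis (of_int k * \<theta>)"
proof -
  have 1: "Complex (fst (polar (r, \<theta>))) (snd (polar (r, \<theta>))) = of_real r * cis \<theta>"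
    by (simp add: polar_def complex_eq_iff)
  have 2: "cnj (of_real r * cis \<theta>) = of_real r * cis (- \<theta>)" by (simp add: cis_cnj)
  have "(of_real r * cis \<theta>) ^ nat k = of_real r ^ nat \<bar>k\<bar> * cis (of_int k * \<theta>)" if "k \<ge> 0"
    unfolding power_mult_distrib Complex.DeMoivre using that by (simp only: abs_of_nonneg of_nat_nat)
  moreover have "(of_real r * cis (- \<theta>)) ^ nat (- k) = of_real r ^ nat \<bar>k\<bar> * cis (of_int k * \<theta>)" if "\<not> k \<ge> 0"
  proof -
    have "real (nat (- k)) * - \<theta> = of_int k * \<theta>" "nat \<bar>k\<bar> = nat (- k)" using that by simp_all
    then show ?thesis unfolding power_mult_distrib Complex.DeMoivre by (simp only:)
  qed
  ultimately show ?thesis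
    unfolding zpow_def 1 2 by (cases "k \<ge> 0") (simp_all only: if_True if_False not_False_eq_True)
qed

lemma smooth_fun_zpow: "smooth_fun (zpow k)"
proof -
  have x: "smooth_fun (\<lambda>p::real \<times> real. complex_of_real (fst p))"
    and y: "smooth_fun (\<lambda>p::real \<times> real. complex_of_real (snd p))"
    using smooth_fun_inner[of "(1::real, 0::real)"] smooth_fun_inner[of "(0::real, 1::real)"] by (simp_all add: inner_prod_def)
  have "smooth_fun (\<lambda>p. complex_of_real (fst p) + c * complex_of_real (snd p))" for c
    by (intro smooth_fun_add smooth_fun_cmult x y)
  then have *: "smooth_fun (\<lambda>p. (complex_of_real (fst p) + c * complex_of_real (snd p)) ^ n)" for c n
    by (rule smooth_fun_power)
  have "zpow k = (\<lambda>p. (complex_of_real (fst p) + (if k \<ge> 0 then \<i> else -\<i>) * complex_of_real (snd p)) ^ nat \<bar>k\<bar>)"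
    by (rule ext) (auto simp: zpow_def Complex_eq)
  then show ?thesis using * by simp
qed

lemma zpow_measurable [measurable]: "zpow k \<in> borel_measurable borel"
  by (intro borel_measurable_continuous_onI smooth_fun_continuous_on smooth_fun_zpow)

text \<open>The function f(r) e^(i k \<theta>). Expressing the exponential through
  \<open>zpow\<close> gives measurability without a branch of the angle.\<close>

definition lift :: "int \<Rightarrow> (real \<Rightarrow> complex) \<Rightarrow> real \<times> real \<Rightarrow> complex" where
  "lift k f p = f (norm p) * (zpow k p / of_real (norm p) ^ nat \<bar>k\<bar>)"

lemma lift_polar: "r > 0 \<Longrightarrow> lift k f (polar (r, \<theta>)) = f r * cis (of_int k * \<theta>)"
  by (simp add: lift_def norm_polar zpow_polar)

lemma lift_measurable [measurable]:
  assumes "f \<in> borel_measurable borel" shows "lift k f \<in> borel_measurable borel"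
proof -
  have n: "(\<lambda>p::real \<times> real. norm p) \<in> borel_measurable borel"
    by (intro borel_measurable_continuous_onI continuous_intros)
  have "(\<lambda>p::real \<times> real. f (norm p)) \<in> borel_measurable borel"
    by (rule measurable_compose[OF n assms])
  moreover have "(\<lambda>p::real \<times> real. complex_of_real (norm p) ^ nat \<bar>k\<bar>) \<in> borel_measurable borel"
    by (intro borel_measurable_continuous_onI continuous_intros)
  ultimately show ?thesis
    unfolding lift_def[abs_def] by (intro borel_measurable_times borel_measurable_divide zpow_measurable)
qed

text \<open>The pairing of \<phi> with e^(i k \<theta>) on the circle of radius r, which is 2 \<pi>
  times the Fourier coefficient of \<phi> of index -k.\<close>

definition angular :: "int \<Rightarrow> (real \<times> real \<Rightarrow> complex) \<Rightarrow> real \<Rightarrow> complex" where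
  "angular k \<phi> r = integral {-pi/2..3*pi/2} (\<lambda>\<theta>. \<phi> (polar (r, \<theta>)) * cis (of_int k * \<theta>))"

lemma continuous_on_polar [continuous_intros]:
  fixes f g :: "'a::real_normed_vector \<Rightarrow> real"
  shows "continuous_on S f \<Longrightarrow> continuous_on S g \<Longrightarrow> continuous_on S (\<lambda>x. polar (f x, g x))"
  unfolding polar_def prod.case
  by (intro continuous_on_Pair continuous_on_mult continuous_on_cos continuous_on_sin)

lemma continuous_on_angular_integrand:
  fixes f g :: "'a::real_normed_vector \<Rightarrow> real"
  assumes "smooth_fun \<phi>" "continuous_on S f" "continuous_on S g"
  shows "continuous_on S (\<lambda>x. \<phi> (polar (f x, g x)) * cis (c * g x))"
  unfolding cis_conv_exp
  by (rule continuous_on_mult[OF continuous_on_smooth_compose[OF assms(1) continuous_on_polar[OF assms(2,3)]]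
        continuous_on_exp[OF continuous_on_mult_left[OF continuous_on_of_real[OF continuous_on_mult_left[OF assms(3)]]]]])

lemma angular_integrand_integrable:
  assumes "smooth_fun \<phi>"
  shows "(\<lambda>\<theta>. \<phi> (polar (r, \<theta>)) * cis (of_int k * \<theta>)) integrable_on {-pi/2..3*pi/2}"
  by (rule integrable_continuous_real[OF continuous_on_angular_integrand[OF assms continuous_on_const continuous_on_id]])

lemma Basis_real2: "(1, 0) \<in> (Basis :: (real \<times> real) set)" "(0, 1) \<in> (Basis :: (real \<times> real) set)"
  by (auto simp: Basis_prod_def)

definition dpm :: "complex \<Rightarrow> (real \<times> real \<Rightarrow> complex) \<Rightarrow> real \<times> real \<Rightarrow> complex" where
  "dpm s \<phi> p = dir_deriv (1, 0) \<phi> p + s * dir_deriv (0, 1) \<phi> p"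

lemma smooth_fun_dpm: "smooth_fun \<phi> \<Longrightarrow> smooth_fun (dpm s \<phi>)"
  unfolding dpm_def[abs_def] by (intro smooth_fun_add smooth_fun_cmult smooth_fun_dir_deriv Basis_real2)

lemma polar_derivatives:
  assumes "smooth_fun \<phi>"
  shows "((\<lambda>r. \<phi> (polar (r, \<theta>))) has_vector_derivative
      (of_real (cos \<theta>) * dir_deriv (1, 0) \<phi> (polar (r, \<theta>)) + of_real (sin \<theta>) * dir_deriv (0, 1) \<phi> (polar (r, \<theta>)))) (at r within S)"
    "((\<lambda>\<theta>. \<phi> (polar (r, \<theta>))) has_vector_derivative
      of_real r * (- of_real (sin \<theta>) * dir_deriv (1, 0) \<phi> (polar (r, \<theta>)) + of_real (cos \<theta>) * dir_deriv (0, 1) \<phi> (polar (r, \<theta>)))) (at \<theta> within S)"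
proof -
  have 1: "((\<lambda>r. polar (r, \<theta>)) has_vector_derivative (cos \<theta>, sin \<theta>)) (at r within S)"
    unfolding polar_def by (auto intro!: derivative_eq_intros has_vector_derivative_Pair simp: has_real_derivative_iff_has_vector_derivative[symmetric])
  have 2: "((\<lambda>\<theta>. polar (r, \<theta>)) has_vector_derivative (- r * sin \<theta>, r * cos \<theta>)) (at \<theta> within S)"
    unfolding polar_def by (auto intro!: derivative_eq_intros has_vector_derivative_Pair simp: has_real_derivative_iff_has_vector_derivative[symmetric])
  note d = smooth_fun_differentiable[OF assms]
  show "((\<lambda>r. \<phi> (polar (r, \<theta>))) has_vector_derivative
      (of_real (cos \<theta>) * dir_deriv (1, 0) \<phi> (polar (r, \<theta>)) + of_real (sin \<theta>) * dir_deriv (0, 1) \<phi> (polar (r, \<theta>)))) (at r within S)"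
    using dir_deriv_vector_derivative[where \<gamma> = "\<lambda>r. polar (r, \<theta>)", OF d 1] by (simp add: dir_deriv_Pair[OF d, of "cos \<theta>"])
  show "((\<lambda>\<theta>. \<phi> (polar (r, \<theta>))) has_vector_derivative
      of_real r * (- of_real (sin \<theta>) * dir_deriv (1, 0) \<phi> (polar (r, \<theta>)) + of_real (cos \<theta>) * dir_deriv (0, 1) \<phi> (polar (r, \<theta>)))) (at \<theta> within S)"
    using dir_deriv_vector_derivative[where \<gamma> = "\<lambda>\<theta>. polar (r, \<theta>)", OF d 2] by (simp add: dir_deriv_Pair[OF d, of "- (r * sin \<theta>)"] algebra_simps)
qed

text \<open>The radial and the angular derivative are the half sum and, up to the factor \<open>\<i> / r\<close>, the half
  difference of \<open>exp (\<mp>\<i>\<theta>) (\<partial>\<^sub>x \<pm> \<i>\<partial>\<^sub>y)\<close>.\<close>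

lemma angular_dpm_sum:
  assumes \<phi>: "smooth_fun \<phi>"
  shows "(angular k \<phi> has_vector_derivative
    (1/2) * (angular (k - 1) (dpm \<i> \<phi>) r + angular (k + 1) (dpm (-\<i>) \<phi>) r)) (at r)"
proof -
  let ?I = "{-pi/2..3*pi/2}"
  let ?D = "\<lambda>r \<theta>. (of_real (cos \<theta>) * dir_deriv (1, 0) \<phi> (polar (r, \<theta>)) + of_real (sin \<theta>) * dir_deriv (0, 1) \<phi> (polar (r, \<theta>))) * cis (of_int k * \<theta>)"
  have eq: "?D r \<theta> = (1/2) * (dpm \<i> \<phi> (polar (r, \<theta>)) * cis (of_int (k - 1) * \<theta>) + dpm (-\<i>) \<phi> (polar (r, \<theta>)) * cis (of_int (k + 1) * \<theta>))" for r \<theta>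
  proof -
    have c: "cis (of_int (k - 1) * \<theta>) = cis (- \<theta>) * cis (of_int k * \<theta>)" "cis (of_int (k + 1) * \<theta>) = cis \<theta> * cis (of_int k * \<theta>)"
      by (simp_all add: cis_mult algebra_simps)
    have cs: "of_real (cos \<theta>) = (1/2) * (cis \<theta> + cis (- \<theta>))" "of_real (sin \<theta>) = (1/2) * (\<i> * cis (- \<theta>) - \<i> * cis \<theta>)"
      by (simp_all add: complex_eq_iff)
    show ?thesis unfolding c cs dpm_def by (simp add: algebra_simps)
  qed
  have "((\<lambda>r. integral (cbox (-pi/2) (3*pi/2)) (\<lambda>\<theta>. \<phi> (polar (r, \<theta>)) * cis (of_int k * \<theta>))) has_vector_derivative
      integral (cbox (-pi/2) (3*pi/2)) (?D r)) (at r within UNIV)"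
  proof (rule leibniz_rule_vector_derivative)
    show "((\<lambda>r. \<phi> (polar (r, \<theta>)) * cis (of_int k * \<theta>)) has_vector_derivative ?D r \<theta>) (at r within UNIV)" for r \<theta>
      by (intro has_vector_derivative_mult_left polar_derivatives \<phi>)
    show "(\<lambda>\<theta>. \<phi> (polar (r, \<theta>)) * cis (of_int k * \<theta>)) integrable_on cbox (-pi/2) (3*pi/2)" for r
      using angular_integrand_integrable[OF \<phi>] by simp
    have "continuous_on S (\<lambda>x. ?D (fst x) (snd x))" for S
      unfolding eq
      by (rule continuous_on_mult_left[OF continuous_on_add[OF continuous_on_angular_integrand continuous_on_angular_integrand]])
        (intro smooth_fun_dpm \<phi> continuous_on_fst continuous_on_snd continuous_on_id)+
    then show "continuous_on (UNIV \<times> cbox (-pi/2) (3*pi/2)) (\<lambda>(r, \<theta>). ?D r \<theta>)"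
      by (simp add: case_prod_beta')
  qed simp_all
  moreover have "integral (cbox (-pi/2) (3*pi/2)) (?D r) = (1/2) * (angular (k - 1) (dpm \<i> \<phi>) r + angular (k + 1) (dpm (-\<i>) \<phi>) r)"
    unfolding eq angular_def cbox_interval
    by (subst integral_mult_right, subst Henstock_Kurzweil_Integration.integral_add)
      (intro angular_integrand_integrable smooth_fun_dpm \<phi> refl)+
  ultimately show ?thesis
    by (simp only: angular_def[abs_def] cbox_interval)
qed

lemma angular_dpm_difference:
  assumes \<phi>: "smooth_fun \<phi>"
  shows "of_real r * (angular (k - 1) (dpm \<i> \<phi>) r - angular (k + 1) (dpm (-\<i>) \<phi>) r) = 2 * of_int k * angular k \<phi> r"
proof -
  let ?I = "{-pi/2..3*pi/2}"
  let ?F = "\<lambda>\<theta>. \<phi> (polar (r, \<theta>)) * cis (of_int k * \<theta>)"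
  let ?P = "\<lambda>\<theta>. dpm \<i> \<phi> (polar (r, \<theta>)) * cis (of_int (k - 1) * \<theta>)"
  let ?M = "\<lambda>\<theta>. dpm (-\<i>) \<phi> (polar (r, \<theta>)) * cis (of_int (k + 1) * \<theta>)"
  have d: "(?F has_vector_derivative (\<i> * of_int k * ?F \<theta> - (\<i> * of_real r / 2) * (?P \<theta> - ?M \<theta>))) (at \<theta> within ?I)" for \<theta>
  proof -
    have "((\<lambda>\<theta>. cis (of_int k * \<theta>)) has_vector_derivative \<i> * of_int k * cis (of_int k * \<theta>)) (at \<theta> within ?I)"
    proof -
      have "((\<lambda>z. exp (\<i> * of_int k * z)) has_field_derivative \<i> * of_int k * exp (\<i> * of_int k * of_real \<theta>)) (at (of_real \<theta>))"
        by (auto intro!: derivative_eq_intros)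
      from has_vector_derivative_real_field[OF this] show ?thesis
        by (simp add: cis_conv_exp mult.assoc)
    qed
    from has_vector_derivative_mult[OF polar_derivatives(2)[OF \<phi>] this]
    have A: "(?F has_vector_derivative \<phi> (polar (r, \<theta>)) * (\<i> * of_int k * cis (of_int k * \<theta>)) +
       of_real r * (- of_real (sin \<theta>) * dir_deriv (1, 0) \<phi> (polar (r, \<theta>)) + of_real (cos \<theta>) * dir_deriv (0, 1) \<phi> (polar (r, \<theta>))) * cis (of_int k * \<theta>)) (at \<theta> within ?I)" .
    have B: "\<phi> (polar (r, \<theta>)) * (\<i> * of_int k * cis (of_int k * \<theta>)) +
       of_real r * (- of_real (sin \<theta>) * dir_deriv (1, 0) \<phi> (polar (r, \<theta>)) + of_real (cos \<theta>) * dir_deriv (0, 1) \<phi> (polar (r, \<theta>))) * cis (of_int k * \<theta>)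
       = \<i> * of_int k * ?F \<theta> - (\<i> * of_real r / 2) * (?P \<theta> - ?M \<theta>)"
    proof -
      have c: "cis (of_int (k - 1) * \<theta>) = cis (- \<theta>) * cis (of_int k * \<theta>)" "cis (of_int (k + 1) * \<theta>) = cis \<theta> * cis (of_int k * \<theta>)"
        by (simp_all add: cis_mult algebra_simps)
      have cs: "of_real (cos \<theta>) = (1/2) * (cis \<theta> + cis (- \<theta>))" "of_real (sin \<theta>) = (1/2) * (\<i> * cis (- \<theta>) - \<i> * cis \<theta>)"
        by (simp_all add: complex_eq_iff)
      show ?thesis unfolding c cs dpm_def by (simp add: algebra_simps)
    qed
    show ?thesis using A unfolding B .
  qed
  have "((\<lambda>\<theta>. \<i> * of_int k * ?F \<theta> - (\<i> * of_real r / 2) * (?P \<theta> - ?M \<theta>)) has_integral ?F (3*pi/2) - ?F (-pi/2)) ?I"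
    by (rule fundamental_theorem_of_calculus[OF _ d]) simp
  \<comment> \<open>Boundary terms cancel by periodicity; this is where \<open>k\<close> has to be
    an integer.\<close>
  moreover have "?F (3*pi/2) = ?F (-pi/2)"
  proof -
    have *: "3*pi/2 = -pi/2 + 2*pi" by simp
    have "polar (r, 3*pi/2) = polar (r, -pi/2)"
      unfolding * polar_def by (simp only: cos_periodic sin_periodic prod.case)
    moreover have "cis (of_int k * (3*pi/2)) = cis (of_int k * (-pi/2)) * cis (2 * pi * of_int k)"
      unfolding * cis_mult by (simp add: algebra_simps)
    ultimately show ?thesis by (simp add: cis_multiple_2pi)
  qed
  ultimately have 0: "integral ?I (\<lambda>\<theta>. \<i> * of_int k * ?F \<theta> - (\<i> * of_real r / 2) * (?P \<theta> - ?M \<theta>)) = 0"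
    by (simp add: integral_unique)
  have "\<i> * of_int k * angular k \<phi> r - (\<i> * of_real r / 2) * (angular (k - 1) (dpm \<i> \<phi>) r - angular (k + 1) (dpm (-\<i>) \<phi>) r) = 0"
  proof -
    note int = angular_integrand_integrable[OF \<phi>, of r k] angular_integrand_integrable[OF smooth_fun_dpm[OF \<phi>], of \<i> r "k - 1"]
      angular_integrand_integrable[OF smooth_fun_dpm[OF \<phi>], of "-\<i>" r "k + 1"]
    have "integral ?I (\<lambda>\<theta>. \<i> * of_int k * ?F \<theta> - (\<i> * of_real r / 2) * (?P \<theta> - ?M \<theta>))
       = \<i> * of_int k * angular k \<phi> r - (\<i> * of_real r / 2) * (angular (k - 1) (dpm \<i> \<phi>) r - angular (k + 1) (dpm (-\<i>) \<phi>) r)"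
      unfolding angular_def
      by (subst Henstock_Kurzweil_Integration.integral_diff[OF integrable_on_mult_right[OF int(1)]
            integrable_on_mult_right[OF integrable_diff[OF int(2,3)]]])
        (simp only: integral_mult_right Henstock_Kurzweil_Integration.integral_diff[OF int(2,3)])
    with 0 show ?thesis by (simp only:)
  qed
  then have "\<i> * (2 * of_int k * angular k \<phi> r - of_real r * (angular (k - 1) (dpm \<i> \<phi>) r - angular (k + 1) (dpm (-\<i>) \<phi>) r)) = 0"
    by (simp add: algebra_simps)
  then show ?thesis by simp
qed

text \<open>By \<open>angular_dpm_sum\<close> a derivative of such a function is a combination of
  two others, with neighbouring modes.\<close>

lemma smooth_fun_angular: 
  assumes "smooth_fun \<phi>" shows "smooth_fun (angular k \<phi>)"
proof (rule smooth_fun_lspan)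
  let ?G = "{angular k \<phi> |k \<phi>. smooth_fun \<phi>}"
  have GI: "angular k \<phi> \<in> ?G" if "smooth_fun \<phi>" for k \<phi> using that by blast
  show "angular k \<phi> \<in> lspan ?G" by (intro lspan.base GI assms)
  fix g assume "g \<in> ?G"
  then obtain k \<phi> where g: "g = angular k \<phi>" and \<phi>: "smooth_fun \<phi>" by blast
  show "g differentiable (at x)" for x
    using angular_dpm_sum[OF \<phi>] unfolding g has_vector_derivative_def differentiable_def by blast
  fix b :: real assume "b \<in> Basis"
  then have b: "b = 1" by simp
  have *: "dir_deriv b g = (\<lambda>r. (1/2) * (angular (k - 1) (dpm \<i> \<phi>) r + angular (k + 1) (dpm (-\<i>) \<phi>) r))"
    unfolding b g by (intro ext dir_deriv_1I angular_dpm_sum \<phi>)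
  show "dir_deriv b g \<in> lspan ?G"
    unfolding * by (rule lspan.cmult[OF lspan.add[OF lspan.base[OF GI] lspan.base[OF GI]]]) (intro smooth_fun_dpm \<phi>)+
qed

text \<open>The factor r is the Jacobian of polar coordinates. The cut at 0 is needed because
  \<open>angular\<close> does not vanish for negative r, where \<open>polar\<close> runs through the
  same circle again.\<close>

definition radial_test :: "int \<Rightarrow> (real \<times> real \<Rightarrow> complex) \<Rightarrow> real \<Rightarrow> complex" where
  "radial_test k \<phi> r = (if r > 0 then of_real r * angular k \<phi> r else 0)"

lemma smooth_fun_cut:
  assumes "smooth_fun f" "a > 0" "\<And>r. 0 < r \<Longrightarrow> r < a \<Longrightarrow> f r = 0"
  shows "smooth_fun (\<lambda>r::real. if r > 0 then f r else 0)"
proof (rule smooth_fun_coinduct[where X = "\<lambda>g. \<exists>f a. smooth_fun f \<and> a > 0 \<and> (\<forall>r. 0 < r \<longrightarrow> r < a \<longrightarrow> f r = 0) \<and> g = (\<lambda>r. if r > 0 then f r else 0)"])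
  have d: "((\<lambda>r. if r > 0 then f r else 0) has_vector_derivative (if r > 0 then dir_deriv 1 f r else 0)) (at r)"
    if f: "smooth_fun f" "a > 0" "\<forall>r. 0 < r \<longrightarrow> r < a \<longrightarrow> f r = 0" for f a and r :: real
  proof (cases "r > 0")
    case True
    from dir_deriv_1[OF smooth_fun_differentiable[OF f(1)], of r]
    have "((\<lambda>r. if r > 0 then f r else 0) has_vector_derivative dir_deriv 1 f r) (at r)"
      by (rule has_vector_derivative_transform_within_open[where S = "{0<..}"]) (use True in auto)
    then show ?thesis using True by simp
  next
    case False
    have "((\<lambda>r. if r > 0 then f r else 0) has_vector_derivative 0) (at r)"
      by (rule has_vector_derivative_transform_within_open[OF has_vector_derivative_const, where S = "{..<a}"]) (use False f in auto)
    then show ?thesis using False by simp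
  qed
  fix g assume "\<exists>f a. smooth_fun f \<and> a > 0 \<and> (\<forall>r. 0 < r \<longrightarrow> r < a \<longrightarrow> f r = 0) \<and> g = (\<lambda>r::real. if r > 0 then f r else 0)"
  then obtain f a where f: "smooth_fun f" "a > 0" "\<forall>r. 0 < r \<longrightarrow> r < a \<longrightarrow> f r = 0" and g: "g = (\<lambda>r::real. if r > 0 then f r else 0)" by blast
  show "g differentiable (at x)" for x using d[OF f, of x] unfolding g has_vector_derivative_def differentiable_def by blast
  fix b :: real assume "b \<in> Basis"
  then have b: "b = 1" by simp
  have "dir_deriv b g = (\<lambda>r. if r > 0 then dir_deriv 1 f r else 0)" unfolding b g by (intro ext dir_deriv_1I d[OF f])
  moreover have "dir_deriv 1 f r = 0" if "0 < r" "r < a" for r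
    by (rule dir_deriv_eq_0(1)[of "{0<..<a}"]) (use f that in auto)
  ultimately show "\<exists>f a. smooth_fun f \<and> a > 0 \<and> (\<forall>r. 0 < r \<longrightarrow> r < a \<longrightarrow> f r = 0) \<and> dir_deriv b g = (\<lambda>r::real. if r > 0 then f r else 0)"
    using f by (intro exI[of _ "dir_deriv 1 f"] exI[of _ a]) (auto intro: smooth_fun_dir_deriv)
qed (use assms in blast)

lemma radial_test_test_functions:
  assumes \<phi>: "\<phi> \<in> test_functions {p. norm p \<in> U}" and U: "U \<subseteq> {0<..}"
  shows "radial_test k \<phi> \<in> test_functions U"
proof -
  obtain K where K: "smooth_fun \<phi>" "compact K" "K \<subseteq> {p. norm p \<in> U}" "\<And>x. x \<notin> K \<Longrightarrow> \<phi> x = 0"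
    using \<phi> by (rule test_functionsE) blast
  have zero: "angular k \<phi> r = 0" if "r \<notin> norm ` K" "r > 0" for r
  proof -
    have "\<phi> (polar (r, \<theta>)) = 0" for \<theta>
      using that norm_polar[of r \<theta>] K(4)[of "polar (r, \<theta>)"] by (cases "polar (r, \<theta>) \<in> K") (force)+
    then show ?thesis by (simp add: angular_def)
  qed
  have cpt: "compact (norm ` K)" by (intro compact_continuous_image K(2) continuous_intros)
  have "0 \<notin> norm ` K" using K(3) U by auto
  then have "0 \<in> - (norm ` K)" "open (- (norm ` K))" using cpt by (auto intro: compact_imp_closed)
  then obtain a where a: "a > 0" "ball 0 a \<subseteq> - (norm ` K)" using open_contains_ball by blast
  have "smooth_fun (\<lambda>r. if r > 0 then of_real r * angular k \<phi> r else 0)"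
  proof (rule smooth_fun_cut[OF _ a(1)])
    show "smooth_fun (\<lambda>r. of_real r * angular k \<phi> r)"
      by (intro smooth_fun_mult smooth_fun_of_real smooth_fun_angular K(1))
    show "of_real r * angular k \<phi> r = 0" if "0 < r" "r < a" for r
    proof -
      have "r \<in> ball 0 a" using that by simp
      then have "r \<notin> norm ` K" using a(2) by blast
      then show ?thesis using zero that by simp
    qed
  qed
  moreover have "radial_test k \<phi> = (\<lambda>r. if r > 0 then of_real r * angular k \<phi> r else 0)"
    by (auto simp: radial_test_def)
  ultimately have "smooth_fun (radial_test k \<phi>)" by simp
  then show ?thesis
    using cpt K(3) zero by (intro test_functionsI[where K = "norm ` K"]) (auto simp: radial_test_def)
qed

text \<open>The half sum and the half difference of the angular identities are added or subtracted;
  the derivative of the Jacobian r accounts for the shift of \<open>k\<close> by one in the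
  coefficients.\<close>

lemma radial_test_dpm:
  assumes \<phi>: "\<phi> \<in> test_functions {p. norm p \<in> U}" and U: "U \<subseteq> {0<..}"
  shows "radial_test (k - 1) (dpm \<i> \<phi>) = (\<lambda>r. dir_deriv 1 (radial_test k \<phi>) r + of_int (k - 1) * (of_real (1 / r) * radial_test k \<phi> r))"
    "radial_test (k + 1) (dpm (-\<i>) \<phi>) = (\<lambda>r. dir_deriv 1 (radial_test k \<phi>) r + (- of_int (k + 1)) * (of_real (1 / r) * radial_test k \<phi> r))"
proof -
  have sm: "smooth_fun \<phi>" using \<phi> by (rule test_functions_smooth)
  have "radial_test (k - 1) (dpm \<i> \<phi>) r = dir_deriv 1 (radial_test k \<phi>) r + of_int (k - 1) * (of_real (1 / r) * radial_test k \<phi> r)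
    \<and> radial_test (k + 1) (dpm (-\<i>) \<phi>) r = dir_deriv 1 (radial_test k \<phi>) r + (- of_int (k + 1)) * (of_real (1 / r) * radial_test k \<phi> r)" for r
  proof (cases "r > 0")
    case True
    let ?p = "angular (k - 1) (dpm \<i> \<phi>) r" and ?m = "angular (k + 1) (dpm (-\<i>) \<phi>) r"
    have "(radial_test k \<phi> has_vector_derivative (of_real r * ((1/2) * (?p + ?m)) + angular k \<phi> r)) (at r)"
    proof (rule has_vector_derivative_transform_within_open[where S = "{0<..}"])
      show "((\<lambda>r. of_real r * angular k \<phi> r) has_vector_derivative (of_real r * ((1/2) * (?p + ?m)) + angular k \<phi> r)) (at r)"
        using has_vector_derivative_mult[OF has_vector_derivative_of_real[OF DERIV_ident] angular_dpm_sum[OF sm, of k r]]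
        by simp
      show "r \<in> {0<..}" using True by simp
      show "of_real s * angular k \<phi> s = radial_test k \<phi> s" if "s \<in> {0<..}" for s
        using that by (simp only: radial_test_def greaterThan_iff if_True)
    qed simp
    then have "dir_deriv 1 (radial_test k \<phi>) r = of_real r * ((1/2) * (?p + ?m)) + angular k \<phi> r"
      by (rule dir_deriv_1I)
    moreover have R: "of_real (1 / r) * radial_test k \<phi> r = angular k \<phi> r"
      using True by (simp add: radial_test_def)
    moreover have "2 * (of_int k * angular k \<phi> r) = of_real r * ?p - of_real r * ?m"
      using angular_dpm_difference[OF sm, of r k] by (simp add: algebra_simps)
    then have K: "of_int k * angular k \<phi> r = of_real r * ?p / 2 - of_real r * ?m / 2"
      by (simp add: field_simps)
    have "of_int (k - 1) * angular k \<phi> r = of_real r * ?p / 2 - of_real r * ?m / 2 - angular k \<phi> r"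
      "- of_int (k + 1) * angular k \<phi> r = - (of_real r * ?p / 2 - of_real r * ?m / 2) - angular k \<phi> r"
      unfolding K[symmetric] by (simp_all add: algebra_simps)
    moreover have "radial_test (k - 1) (dpm \<i> \<phi>) r = of_real r * ?p" "radial_test (k + 1) (dpm (-\<i>) \<phi>) r = of_real r * ?m"
      using True by (simp_all add: radial_test_def)
    moreover have "x = y * ((1/2) * (?p + ?m)) + a + (y * ?p / 2 - y * ?m / 2 - a) \<longleftrightarrow> x = y * ?p"
      "x = y * ((1/2) * (?p + ?m)) + a + (- (y * ?p / 2 - y * ?m / 2) - a) \<longleftrightarrow> x = y * ?m" for x y a
      by (simp_all add: field_simps)
    ultimately show ?thesis by (simp only: simp_thms)
  next
    case False
    then have "r \<notin> U" using U by auto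
    then have "dir_deriv 1 (radial_test k \<phi>) r = 0"
      by (intro test_functions_zero[OF test_functions_dir_deriv[OF radial_test_test_functions[OF \<phi> U]]]) auto
    then show ?thesis using False by (simp add: radial_test_def)
  qed
  then show "radial_test (k - 1) (dpm \<i> \<phi>) = (\<lambda>r. dir_deriv 1 (radial_test k \<phi>) r + of_int (k - 1) * (of_real (1 / r) * radial_test k \<phi> r))"
    "radial_test (k + 1) (dpm (-\<i>) \<phi>) = (\<lambda>r. dir_deriv 1 (radial_test k \<phi>) r + (- of_int (k + 1)) * (of_real (1 / r) * radial_test k \<phi> r))"
    by auto
qed

section \<open>Integrals of modes in polar coordinates\<close>

lemma nn_integral_polar_iterated:
  fixes g :: "real \<times> real \<Rightarrow> ennreal"
  assumes [measurable]: "g \<in> borel_measurable borel"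
  shows "(\<integral>\<^sup>+p. g p \<partial>lborel) =
    (\<integral>\<^sup>+r. (\<integral>\<^sup>+\<theta>. g (polar (r, \<theta>)) * indicator angles \<theta> \<partial>lborel) * ennreal r * indicator {0<..} r \<partial>lborel)"
proof -
  have "(\<integral>\<^sup>+p. g p \<partial>lborel) = (\<integral>\<^sup>+x. g (polar x) \<partial>polar_measure)"
    by (subst lborel_polar) (simp add: nn_integral_distr)
  also have "\<dots> = (\<integral>\<^sup>+r. (\<integral>\<^sup>+\<theta>. g (polar (r, \<theta>)) * indicator angles \<theta> \<partial>lborel) * ennreal r * indicator {0<..} r \<partial>lborel)"
    by (rule nn_integral_polar_measure(2)) measurable
  finally show ?thesis .
qed

lemma integral_polar_iterated:
  fixes G :: "real \<times> real \<Rightarrow> complex"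
  assumes G: "integrable lborel G"
  shows "(\<integral>p. G p \<partial>lborel) =
    (\<integral>r. (indicator {0<..} r * r) *\<^sub>R (\<integral>\<theta>. indicator angles \<theta> *\<^sub>R G (polar (r, \<theta>)) \<partial>lborel) \<partial>lborel)"
proof -
  have Gm[measurable]: "G \<in> borel_measurable borel" using borel_measurable_integrable[OF G] by simp
  have Gp[measurable]: "(\<lambda>x. G (polar x)) \<in> borel_measurable borel" by measurable
  let ?\<rho> = "\<lambda>x. fst x * indicator ({0<..} \<times> angles) x :: real"
  have \<rho>[measurable]: "?\<rho> \<in> borel_measurable borel" by measurable
  have \<rho>0: "?\<rho> x \<ge> 0" for x by (auto simp: indicator_def)
  have "integrable (distr polar_measure borel polar) G" using G by (simp add: lborel_polar[symmetric])
  then have "integrable polar_measure (\<lambda>x. G (polar x))" by (subst (asm) integrable_distr_eq) auto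
  then have int: "integrable (lborel \<Otimes>\<^sub>M lborel) (\<lambda>x. ?\<rho> x *\<^sub>R G (polar x))"
    unfolding polar_measure_def lborel_prod using \<rho> \<rho>0 by (subst (asm) integrable_density) auto
  have "(\<integral>p. G p \<partial>lborel) = (\<integral>p. G p \<partial>distr polar_measure borel polar)"
    by (simp add: lborel_polar[symmetric])
  also have "\<dots> = (\<integral>x. G (polar x) \<partial>polar_measure)"
    by (rule integral_distr) auto
  also have "\<dots> = (\<integral>x. ?\<rho> x *\<^sub>R G (polar x) \<partial>(lborel \<Otimes>\<^sub>M lborel))"
    unfolding polar_measure_def lborel_prod using \<rho> \<rho>0 by (intro integral_density) auto
  also have "\<dots> = (\<integral>r. \<integral>\<theta>. ?\<rho> (r, \<theta>) *\<^sub>R G (polar (r, \<theta>)) \<partial>lborel \<partial>lborel)"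
    by (rule lborel_pair.integral_fst'[OF int, symmetric])
  also have "\<dots> = (\<integral>r. (indicator {0<..} r * r) *\<^sub>R (\<integral>\<theta>. indicator angles \<theta> *\<^sub>R G (polar (r, \<theta>)) \<partial>lborel) \<partial>lborel)"
  proof (rule Bochner_Integration.integral_cong[OF refl])
    fix r :: real
    have "(\<lambda>\<theta>. ?\<rho> (r, \<theta>) *\<^sub>R G (polar (r, \<theta>))) = (\<lambda>\<theta>. (indicator {0<..} r * r) *\<^sub>R (indicator angles \<theta> *\<^sub>R G (polar (r, \<theta>))))"
      by (rule ext) (simp add: indicator_def)
    then show "(\<integral>\<theta>. ?\<rho> (r, \<theta>) *\<^sub>R G (polar (r, \<theta>)) \<partial>lborel) = (indicator {0<..} r * r) *\<^sub>R (\<integral>\<theta>. indicator angles \<theta> *\<^sub>R G (polar (r, \<theta>)) \<partial>lborel)"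
      by (simp only: integral_scaleR_right)
  qed
  finally show ?thesis .
qed

lemma angular_lebesgue:
  assumes "smooth_fun \<phi>"
  shows "angular k \<phi> r = (\<integral>\<theta>. indicator angles \<theta> *\<^sub>R (\<phi> (polar (r, \<theta>)) * cis (of_int k * \<theta>)) \<partial>lborel)"
proof -
  let ?h = "\<lambda>\<theta>. \<phi> (polar (r, \<theta>)) * cis (of_int k * \<theta>)"
  have "continuous_on {-pi/2..3*pi/2} ?h"
    by (rule continuous_on_angular_integrand[OF assms continuous_on_const continuous_on_id])
  then have "set_integrable lborel {-pi/2..3*pi/2} ?h" by (rule borel_integrable_atLeastAtMost')
  then have "set_integrable lborel angles ?h" by (rule set_integrable_subset) auto
  from set_borel_integral_eq_integral(2)[OF this]
  have "(LINT \<theta>:angles|lborel. ?h \<theta>) = integral angles ?h" .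
  then show ?thesis
    by (simp add: angular_def set_lebesgue_integral_def integral_open_interval_real)
qed

section \<open>Isometry between the meridian and the pure modes in the plane\<close>

definition annulus :: "real set \<Rightarrow> (real \<times> real) set" where
  "annulus U = {p. norm p \<in> U}"

lemma open_annulus:
  assumes "open U" shows "open (annulus U)"
proof -
  have "open ((norm :: real \<times> real \<Rightarrow> real) -` U)"
    by (rule open_vimage[OF assms continuous_on_norm_id])
  then show ?thesis by (simp add: annulus_def vimage_def)
qed

text \<open>The distribution \<open>S(r) exp (\<i>k\<theta>)\<close>.\<close>

definition lift_dist :: "int \<Rightarrow> real distrib \<Rightarrow> (real \<times> real) distrib" where
  "lift_dist k S \<phi> = S (radial_test k \<phi>)"

text \<open>The exponential has modulus 1, the integral over \<theta> supplies the 2 \<pi> of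
  \<open>axi_weight\<close>, and the Jacobian supplies its r.\<close>

lemma sqnorm_lift:
  assumes U: "U \<subseteq> {0<..}" and f: "f \<in> borel_measurable borel" "\<And>x. x \<notin> U \<Longrightarrow> f x = 0"
  shows "sqnorm (\<lambda>_. 1) (lift k f) = sqnorm axi_weight f"
proof -
  have [measurable]: "f \<in> borel_measurable borel" "lift k f \<in> borel_measurable borel" using f by auto
  have len: "(\<integral>\<^sup>+\<theta>. c * indicator angles \<theta> \<partial>lborel) = c * ennreal (2 * pi)" for c
    by (subst nn_integral_cmult) auto
  have "sqnorm (\<lambda>_. 1) (lift k f) = (\<integral>\<^sup>+r. (\<integral>\<^sup>+\<theta>. ennreal (1 * (cmod (lift k f (polar (r, \<theta>))))\<^sup>2) * indicator angles \<theta> \<partial>lborel) * ennreal r * indicator {0<..} r \<partial>lborel)"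
    unfolding sqnorm_def by (rule nn_integral_polar_iterated) measurable
  also have "\<dots> = (\<integral>\<^sup>+r. ennreal (axi_weight r * (cmod (f r))\<^sup>2) \<partial>lborel)"
  proof (rule nn_integral_cong)
    fix r :: real
    show "(\<integral>\<^sup>+\<theta>. ennreal (1 * (cmod (lift k f (polar (r, \<theta>))))\<^sup>2) * indicator angles \<theta> \<partial>lborel) * ennreal r * indicator {0<..} r
        = ennreal (axi_weight r * (cmod (f r))\<^sup>2)"
    proof (cases "r > 0")
      case True
      have "(\<integral>\<^sup>+\<theta>. ennreal (1 * (cmod (lift k f (polar (r, \<theta>))))\<^sup>2) * indicator angles \<theta> \<partial>lborel) = ennreal ((cmod (f r))\<^sup>2) * ennreal (2 * pi)"
        by (simp only: lift_polar[OF True] norm_mult norm_cis mult_1_right mult_1 len)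
      then show ?thesis using True
        by (simp add: axi_weight_def ennreal_mult'[symmetric] mult_ac)
    next
      case False
      then have "f r = 0" using f(2) U by auto
      then show ?thesis using False by simp
    qed
  qed
  finally show ?thesis by (simp add: sqnorm_def)
qed

lemma represents_lift:
  assumes U: "open U" "U \<subseteq> {0<..}" and f: "represents U S f" "sqnorm axi_weight f < \<infinity>"
  shows "represents (annulus U) (lift_dist k S) (lift k f)"
proof -
  have fm: "f \<in> borel_measurable borel" and f0: "\<And>x. x \<notin> U \<Longrightarrow> f x = 0"
    and fS: "\<And>\<phi>. \<phi> \<in> test_functions U \<Longrightarrow> S \<phi> = (\<integral>x. f x * \<phi> x \<partial>lborel)"
    using f(1) by (auto simp: represents_def)
  show ?thesis
    unfolding represents_def
  proof (intro conjI ballI allI impI)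
    show "lift k f \<in> borel_measurable borel" using fm by (rule lift_measurable)
    show z: "lift k f p = 0" if "p \<notin> annulus U" for p using that f0 by (simp add: lift_def annulus_def)
    fix \<phi> assume \<phi>: "\<phi> \<in> test_functions (annulus U)"
    note sm = test_functions_smooth[OF \<phi>]
    have int: "integrable lborel (\<lambda>p. lift k f p * \<phi> p)"
      by (rule integrable_test[OF good_weight_1[OF open_annulus[OF U(1)]] lift_measurable[OF fm] z _ \<phi>])
        (use f(2) in \<open>simp_all add: sqnorm_lift[OF U(2) fm f0]\<close>)
    have "(\<integral>p. lift k f p * \<phi> p \<partial>lborel) = (\<integral>r. f r * radial_test k \<phi> r \<partial>lborel)"
      unfolding integral_polar_iterated[OF int]
    proof (rule Bochner_Integration.integral_cong[OF refl])
      fix r :: real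
      show "(indicator {0<..} r * r) *\<^sub>R (\<integral>\<theta>. indicator angles \<theta> *\<^sub>R (lift k f (polar (r, \<theta>)) * \<phi> (polar (r, \<theta>))) \<partial>lborel) = f r * radial_test k \<phi> r"
      proof (cases "r > 0")
        case True
        have "(\<integral>\<theta>. indicator angles \<theta> *\<^sub>R (lift k f (polar (r, \<theta>)) * \<phi> (polar (r, \<theta>))) \<partial>lborel)
          = (\<integral>\<theta>. f r * (indicator angles \<theta> *\<^sub>R (\<phi> (polar (r, \<theta>)) * cis (of_int k * \<theta>))) \<partial>lborel)"
          by (intro Bochner_Integration.integral_cong refl) (simp add: lift_polar[OF True] mult_ac)
        also have "\<dots> = f r * angular k \<phi> r"
          unfolding angular_lebesgue[OF sm] by (rule integral_mult_right_zero)
        finally show ?thesis using True by (simp add: radial_test_def scaleR_conv_of_real)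
      qed (simp add: radial_test_def)
    qed
    also have "\<dots> = S (radial_test k \<phi>)"
      using fS[OF radial_test_test_functions[OF \<phi>[unfolded annulus_def] U(2)]] by simp
    finally show "lift_dist k S \<phi> = (\<integral>p. lift k f p * \<phi> p \<partial>lborel)"
      by (simp add: lift_dist_def)
  qed
qed

text \<open>The Fourier coefficient of g of index \<open>k\<close> on the circle of radius r; it
  undoes \<open>lift\<close>. The sign in the exponent is opposite to that of
  \<open>angular\<close>, which pairs with the mode instead of extracting it.\<close>

definition angular_mean :: "int \<Rightarrow> real set \<Rightarrow> (real \<times> real \<Rightarrow> complex) \<Rightarrow> real \<Rightarrow> complex" where
  "angular_mean k U g r = indicator U r *\<^sub>R ((1 / (2 * pi)) *\<^sub>R (\<integral>\<theta>. indicator angles \<theta> *\<^sub>R (g (polar (r, \<theta>)) * cis (- of_int k * \<theta>)) \<partial>lborel))"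

lemma cis_measurable [measurable]: "cis \<in> borel_measurable borel"
  unfolding cis_conv_exp[abs_def] by (intro borel_measurable_continuous_onI continuous_intros)

lemma angular_mean_measurable:
  assumes "open U" and gm: "g \<in> borel_measurable borel"
  shows "angular_mean k U g \<in> borel_measurable borel"
proof -
  have [measurable]: "U \<in> sets borel" using assms(1) by simp
  have "(\<lambda>x. g (polar x)) \<in> borel_measurable borel" using gm by measurable
  then have [measurable]: "(\<lambda>x. g (polar x)) \<in> borel_measurable (borel \<Otimes>\<^sub>M borel)" by (simp add: borel_prod)
  have "(\<lambda>(r, \<theta>). indicator angles \<theta> *\<^sub>R (g (polar (r, \<theta>)) * cis (- of_int k * \<theta>))) \<in> borel_measurable (borel \<Otimes>\<^sub>M lborel)"
    by measurable
  then have "(\<lambda>r. \<integral>\<theta>. indicator angles \<theta> *\<^sub>R (g (polar (r, \<theta>)) * cis (- of_int k * \<theta>)) \<partial>lborel) \<in> borel_measurable borel"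
    by (rule lborel.borel_measurable_lebesgue_integral)
  then show ?thesis
    unfolding angular_mean_def[abs_def] by measurable
qed

text \<open>Cauchy-Schwarz on an angular interval of length 2 \<pi>.\<close>

lemma sqnorm_angular_mean:
  assumes "open U" "U \<subseteq> {0<..}" and gm: "g \<in> borel_measurable borel"
  shows "sqnorm axi_weight (angular_mean k U g) \<le> sqnorm (\<lambda>_. 1) g"
proof -
  note [measurable] = gm
  have [measurable]: "(\<lambda>x. g (polar x)) \<in> borel_measurable (borel \<Otimes>\<^sub>M borel)"
    using measurable_compose[OF polar_measurable gm] by (simp add: borel_prod)
  have "sqnorm axi_weight (angular_mean k U g) \<le> (\<integral>\<^sup>+r. (\<integral>\<^sup>+\<theta>. ennreal (1 * (cmod (g (polar (r, \<theta>))))\<^sup>2) * indicator angles \<theta> \<partial>lborel) * ennreal r * indicator {0<..} r \<partial>lborel)"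
    unfolding sqnorm_def
  proof (rule nn_integral_mono)
    fix r :: real
    show "ennreal (axi_weight r * (cmod (angular_mean k U g r))\<^sup>2)
      \<le> (\<integral>\<^sup>+\<theta>. ennreal (1 * (cmod (g (polar (r, \<theta>))))\<^sup>2) * indicator angles \<theta> \<partial>lborel) * ennreal r * indicator {0<..} r"
    proof (cases "r \<in> U")
      case True
      then have r: "r > 0" using assms(2) by auto
      have [measurable]: "(\<lambda>\<theta>. g (polar (r, \<theta>))) \<in> borel_measurable borel"
        using measurable_Pair2[of "\<lambda>x. g (polar x)" borel borel borel r] by simp
      let ?I = "\<integral>\<theta>. indicator angles \<theta> *\<^sub>R (g (polar (r, \<theta>)) * cis (- of_int k * \<theta>)) \<partial>lborel"
      let ?N = "\<integral>\<^sup>+\<theta>. ennreal ((cmod (g (polar (r, \<theta>))))\<^sup>2) * indicator angles \<theta> \<partial>lborel"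
      have "ennreal (cmod ?I) \<le> (\<integral>\<^sup>+\<theta>. ennreal (cmod (g (polar (r, \<theta>)))) * indicator angles \<theta> \<partial>lborel)"
      \<comment> \<open>A Bochner integral of a non-integrable function is 0 by convention, and the
        bound is then trivial.\<close>
      proof (cases "integrable lborel (\<lambda>\<theta>. indicator angles \<theta> *\<^sub>R (g (polar (r, \<theta>)) * cis (- of_int k * \<theta>)))")
        case True
        from integral_norm_bound_ennreal[OF this] show ?thesis
          by (rule order_trans) (auto intro!: nn_integral_mono simp: norm_mult indicator_def)
      qed (simp add: not_integrable_integral_eq)
      also have "\<dots> = (\<integral>\<^sup>+\<theta>. (ennreal (cmod (g (polar (r, \<theta>)))) * indicator angles \<theta>) * indicator angles \<theta> \<partial>lborel)"
        by (intro nn_integral_cong) (auto simp: indicator_def)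
      finally have "(ennreal (cmod ?I))\<^sup>2 \<le> (\<integral>\<^sup>+\<theta>. (ennreal (cmod (g (polar (r, \<theta>)))) * indicator angles \<theta>) * indicator angles \<theta> \<partial>lborel)\<^sup>2"
        by (intro power_mono) auto
      also have "\<dots> \<le> (\<integral>\<^sup>+\<theta>. (ennreal (cmod (g (polar (r, \<theta>)))) * indicator angles \<theta>)\<^sup>2 \<partial>lborel) * (\<integral>\<^sup>+\<theta>. (indicator angles \<theta>)\<^sup>2 \<partial>lborel)"
        by (rule Cauchy_Schwarz_nn_integral) measurable
      also have "(\<integral>\<^sup>+\<theta>. (indicator angles \<theta>)\<^sup>2 \<partial>lborel) = (\<integral>\<^sup>+\<theta>. indicator angles \<theta> \<partial>lborel)"
        by (intro nn_integral_cong) (auto simp: indicator_def)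
      also have "\<dots> = ennreal (2 * pi)" by simp
      also have "(\<integral>\<^sup>+\<theta>. (ennreal (cmod (g (polar (r, \<theta>)))) * indicator angles \<theta>)\<^sup>2 \<partial>lborel) = ?N"
        by (intro nn_integral_cong) (auto simp: indicator_def ennreal_power)
      finally have N: "ennreal ((cmod ?I)\<^sup>2) \<le> ?N * ennreal (2 * pi)" by (simp add: ennreal_power)
      have "ennreal (axi_weight r * (cmod (angular_mean k U g r))\<^sup>2) = ennreal (r / (2 * pi)) * ennreal ((cmod ?I)\<^sup>2)"
        using True r by (simp add: angular_mean_def axi_weight_def norm_mult power_mult_distrib power2_eq_square ennreal_mult'[symmetric])
      also have "\<dots> \<le> ennreal (r / (2 * pi)) * (?N * ennreal (2 * pi))"
        by (intro mult_left_mono N) auto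
      also have "\<dots> = ?N * (ennreal (r / (2 * pi)) * ennreal (2 * pi))" by (simp only: mult_ac)
      also have "\<dots> = ?N * ennreal r" using r by (simp add: ennreal_mult'[symmetric])
      finally show ?thesis using r by simp
    qed (simp add: angular_mean_def)
  qed
  also have "\<dots> = sqnorm (\<lambda>_. 1) g"
    unfolding sqnorm_def by (rule nn_integral_polar_iterated[symmetric]) measurable
  finally show ?thesis .
qed

text \<open>A right inverse of \<open>radial_test\<close>, namely \<psi>(r) e^(-i k \<theta>) / (2
  \<pi> r). In the exponent \<open>Suc (nat \<bar>k\<bar>)\<close> the powers of \<open>zpow\<close>
  are cancelled, and one more power for the Jacobian.\<close>

lemma radial_test_zpow:
  fixes k :: int
  assumes \<psi>: "\<psi> \<in> test_functions U" and U: "U \<subseteq> {0<..}"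
  defines "\<phi> \<equiv> \<lambda>p. (of_real (1 / (2 * pi)) * (of_real ((1 / norm p) ^ Suc (nat \<bar>k\<bar>)) * \<psi> (norm p))) * zpow (- k) p"
  shows "\<phi> \<in> test_functions (annulus U)" "radial_test k \<phi> = \<psi>"
    "\<And>r \<theta>. r > 0 \<Longrightarrow> \<phi> (polar (r, \<theta>)) = of_real (1 / (2 * pi * r)) * \<psi> r * cis (- of_int k * \<theta>)"
proof -
  show tf: "\<phi> \<in> test_functions (annulus U)"
    unfolding \<phi>_def annulus_def
    using radial_test_function[OF test_functions_cmult[OF test_functions_inverse[OF \<psi> U]] U smooth_fun_zpow] .
  show pol: "\<phi> (polar (r, \<theta>)) = of_real (1 / (2 * pi * r)) * \<psi> r * cis (- of_int k * \<theta>)" if r: "r > 0" for r \<theta>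
  proof -
    have "of_real ((1 / r) ^ Suc (nat \<bar>k\<bar>)) * of_real r ^ nat \<bar>k\<bar> = (of_real (1 / r) :: complex)"
      using r by (simp add: power_divide)
    moreover have "(c * (A * x)) * (B * E) = c * (A * B) * x * E" for c A B x E :: complex by (simp only: mult_ac)
    ultimately have "of_real (1 / (2 * pi)) * (of_real ((1 / r) ^ Suc (nat \<bar>k\<bar>)) * \<psi> r) * (of_real r ^ nat \<bar>k\<bar> * cis (- of_int k * \<theta>))
      = of_real (1 / (2 * pi)) * of_real (1 / r) * \<psi> r * cis (- of_int k * \<theta>)"
      by (simp only:)
    moreover have "of_real (1 / (2 * pi)) * of_real (1 / r) = (of_real (1 / (2 * pi * r)) :: complex)"
      by simp
    ultimately show ?thesis
      unfolding \<phi>_def zpow_polar norm_polar[OF less_imp_le[OF r]] by simp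
  qed
  show "radial_test k \<phi> = \<psi>"
  proof
    fix r :: real
    show "radial_test k \<phi> r = \<psi> r"
    proof (cases "r > 0")
      case True
      have "angular k \<phi> r = integral {-pi/2..3*pi/2} (\<lambda>\<theta>. of_real (1 / (2 * pi * r)) * \<psi> r)"
        unfolding angular_def pol[OF True]
        by (intro Henstock_Kurzweil_Integration.integral_cong) (simp add: mult.assoc cis_mult)
      also have "\<dots> = of_real (1 / r) * \<psi> r" using True by (simp add: scaleR_conv_of_real field_simps)
      finally show ?thesis using True by (simp add: radial_test_def)
    next
      case False
      then show ?thesis using test_functions_zero[OF \<psi>, of r] U by (auto simp: radial_test_def)
    qed
  qed
qed

lemma represents_angular_mean:
  assumes U: "open U" "U \<subseteq> {0<..}" and g: "represents (annulus U) (lift_dist k S) g" "sqnorm (\<lambda>_. 1) g < \<infinity>"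
  shows "represents U S (angular_mean k U g)"
  unfolding represents_def
proof (intro conjI ballI allI impI)
  have gm: "g \<in> borel_measurable borel" and g0: "\<And>x. x \<notin> annulus U \<Longrightarrow> g x = 0"
    using g(1) by (auto simp: represents_def)
  show "angular_mean k U g \<in> borel_measurable borel" by (rule angular_mean_measurable[OF U(1) gm])
  show "angular_mean k U g x = 0" if "x \<notin> U" for x using that by (simp add: angular_mean_def)
  fix \<psi> assume \<psi>: "\<psi> \<in> test_functions U"
  define \<phi> where "\<phi> = (\<lambda>p. (of_real (1 / (2 * pi)) * (of_real ((1 / norm p) ^ Suc (nat \<bar>k\<bar>)) * \<psi> (norm p))) * zpow (- k) p)"
  note R = radial_test_zpow[OF \<psi> U(2), where k = k, folded \<phi>_def]
  have pol: "\<phi> (polar (r, \<theta>)) = of_real (1 / (2 * pi * r)) * \<psi> r * cis (- of_int k * \<theta>)" if "r > 0" for r \<theta>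
    unfolding \<phi>_def by (rule radial_test_zpow(3)[OF \<psi> U(2) that])
  have int: "integrable lborel (\<lambda>p. g p * \<phi> p)"
    by (rule integrable_test[OF good_weight_1[OF open_annulus[OF U(1)]] gm g0 g(2) R(1)])
  have "S \<psi> = lift_dist k S \<phi>" by (simp add: lift_dist_def R(2))
  also have "\<dots> = (\<integral>p. g p * \<phi> p \<partial>lborel)" using g(1) R(1) by (simp add: represents_def)
  also have "\<dots> = (\<integral>r. angular_mean k U g r * \<psi> r \<partial>lborel)"
    unfolding integral_polar_iterated[OF int]
  proof (rule Bochner_Integration.integral_cong[OF refl])
    fix r :: real
    show "(indicator {0<..} r * r) *\<^sub>R (\<integral>\<theta>. indicator angles \<theta> *\<^sub>R (g (polar (r, \<theta>)) * \<phi> (polar (r, \<theta>))) \<partial>lborel) = angular_mean k U g r * \<psi> r"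
    proof (cases "r \<in> U")
      case True
      then have r: "r > 0" using U(2) by auto
      have "(\<integral>\<theta>. indicator angles \<theta> *\<^sub>R (g (polar (r, \<theta>)) * \<phi> (polar (r, \<theta>))) \<partial>lborel)
        = (\<integral>\<theta>. (of_real (1 / (2 * pi * r)) * \<psi> r) * (indicator angles \<theta> *\<^sub>R (g (polar (r, \<theta>)) * cis (- of_int k * \<theta>))) \<partial>lborel)"
        by (intro Bochner_Integration.integral_cong refl) (simp only: pol[OF r] scaleR_conv_of_real mult_ac)
      also have "\<dots> = (of_real (1 / (2 * pi * r)) * \<psi> r) * (\<integral>\<theta>. indicator angles \<theta> *\<^sub>R (g (polar (r, \<theta>)) * cis (- of_int k * \<theta>)) \<partial>lborel)"
        by (rule integral_mult_right_zero)
      finally show ?thesis using r True by (simp add: angular_mean_def scaleR_conv_of_real field_simps)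
    next
      case False
      then show ?thesis using g0 by (auto simp: angular_mean_def annulus_def norm_polar indicator_def)
    qed
  qed
  finally show "S \<psi> = (\<integral>r. angular_mean k U g r * \<psi> r \<partial>lborel)" .
qed

text \<open>One inequality lifts representing functions. For the other, a function representing the
  lifted distribution is not known to be a pure mode, so it is projected by
  \<open>angular_mean\<close>, which does not increase the norm.\<close>

lemma dist_L2_sqnorm_lift:
  assumes U: "open U" "U \<subseteq> {0<..}"
  shows "dist_L2_sqnorm (\<lambda>_. 1) (annulus U) (lift_dist k S) = dist_L2_sqnorm axi_weight U S"
proof (rule antisym)
  note g1 = good_weight_1[OF open_annulus[OF U(1)]] and g2 = good_weight_axi[OF U]
  have "dist_L2_sqnorm (\<lambda>_. 1) (annulus U) (lift_dist k S) \<le> ennreal 1 * dist_L2_sqnorm axi_weight U S"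
  proof (rule dist_L2_sqnorm_mono[OF g2 g1])
    fix f assume f: "represents U S f" "sqnorm axi_weight f < \<infinity>"
    then show "\<exists>g. represents (annulus U) (lift_dist k S) g \<and> sqnorm (\<lambda>_. 1) g \<le> ennreal 1 * sqnorm axi_weight f"
      using represents_lift[OF U f, of k] sqnorm_lift[OF U(2), of f k]
      by (intro exI[of _ "lift k f"]) (auto simp: represents_def)
  qed auto
  then show "dist_L2_sqnorm (\<lambda>_. 1) (annulus U) (lift_dist k S) \<le> dist_L2_sqnorm axi_weight U S" by simp
  have "dist_L2_sqnorm axi_weight U S \<le> ennreal 1 * dist_L2_sqnorm (\<lambda>_. 1) (annulus U) (lift_dist k S)"
  proof (rule dist_L2_sqnorm_mono[OF g1 g2])
    fix g assume g: "represents (annulus U) (lift_dist k S) g" "sqnorm (\<lambda>_. 1) g < \<infinity>"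
    then show "\<exists>f. represents U S f \<and> sqnorm axi_weight f \<le> ennreal 1 * sqnorm (\<lambda>_. 1) g"
      using represents_angular_mean[OF U g] sqnorm_angular_mean[OF U, of g k]
      by (intro exI[of _ "angular_mean k U g"]) (auto simp: represents_def)
  qed auto
  then show "dist_L2_sqnorm axi_weight U S \<le> dist_L2_sqnorm (\<lambda>_. 1) (annulus U) (lift_dist k S)" by simp
qed

lemma radial_test_add:
  assumes "smooth_fun \<phi>" "smooth_fun \<psi>"
  shows "radial_test k (\<lambda>x. \<phi> x + \<psi> x) = (\<lambda>r. radial_test k \<phi> r + radial_test k \<psi> r)"
  unfolding radial_test_def angular_def
  using Henstock_Kurzweil_Integration.integral_add[OF angular_integrand_integrable[OF assms(1)] angular_integrand_integrable[OF assms(2)]]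
  by (auto simp: distrib_right distrib_left)

lemma radial_test_cmult: "radial_test k (\<lambda>x. c * \<phi> x) = (\<lambda>r. c * radial_test k \<phi> r)"
  unfolding radial_test_def angular_def mult.assoc[of c] integral_mult_right by auto

lemma linear_dist_lift:
  assumes S: "linear_dist U S" and U: "U \<subseteq> {0<..}"
  shows "linear_dist (annulus U) (lift_dist k S)"
  unfolding linear_dist_def lift_dist_def
proof (intro conjI ballI allI)
  fix \<phi> \<psi> assume \<phi>: "\<phi> \<in> test_functions (annulus U)" and \<psi>: "\<psi> \<in> test_functions (annulus U)"
  show "S (radial_test k (\<lambda>x. \<phi> x + \<psi> x)) = S (radial_test k \<phi>) + S (radial_test k \<psi>)"
    unfolding radial_test_add[OF test_functions_smooth[OF \<phi>] test_functions_smooth[OF \<psi>]]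
    by (intro linear_dist_add[OF S] radial_test_test_functions \<phi>[unfolded annulus_def] \<psi>[unfolded annulus_def] U)
next
  fix \<phi> and c :: complex assume \<phi>: "\<phi> \<in> test_functions (annulus U)"
  show "S (radial_test k (\<lambda>x. c * \<phi> x)) = c * S (radial_test k \<phi>)"
    unfolding radial_test_cmult
    by (intro linear_dist_cmult[OF S] radial_test_test_functions \<phi>[unfolded annulus_def] U)
qed

section \<open>Mode shifting derivatives\<close>

definition dist_comb :: "complex \<Rightarrow> complex \<Rightarrow> (real \<times> real) distrib \<Rightarrow> (real \<times> real) distrib" where
  "dist_comb a b T = (\<lambda>\<phi>. a * dist_deriv (1, 0) T \<phi> + b * dist_deriv (0, 1) T \<phi>)"

lemma dist_comb_eq:
  "dist_eq U T T' \<Longrightarrow> dist_eq U (dist_comb a b T) (dist_comb a b T')"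
  using dist_eq_deriv[OF _ Basis_real2(1), of U T T'] dist_eq_deriv[OF _ Basis_real2(2), of U T T']
  by (simp add: dist_eq_def dist_comb_def)

lemma dist_comb_dpm:
  assumes "linear_dist U T" "\<phi> \<in> test_functions U"
  shows "dist_comb 1 s T \<phi> = - T (dpm s \<phi>)"
proof -
  have t: "dir_deriv (1, 0) \<phi> \<in> test_functions U" "(\<lambda>x. s * dir_deriv (0, 1) \<phi> x) \<in> test_functions U"
    "dir_deriv (0, 1) \<phi> \<in> test_functions U"
    using assms(2) by (auto intro!: test_functions_dir_deriv test_functions_cmult Basis_real2)
  show ?thesis
    unfolding dpm_def[abs_def] linear_dist_add[OF assms(1) t(1,2)] linear_dist_cmult[OF assms(1) t(3)]
    by (simp add: dist_comb_def dist_deriv_def)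
qed

text \<open>The operator with sign + or - maps f e^(i k \<theta>) to e^(i (k + 1) \<theta>) (f' - k
  f / r) or e^(i (k - 1) \<theta>) (f' + k f / r). For f = r^-j p(X) S this contributes the factor X
  - j - k or X - j + k.\<close>

lemma dist_comb_lift:
  assumes S: "linear_dist U S" and U: "U \<subseteq> {0<..}"
  shows "dist_eq (annulus U) (dist_comb 1 \<i> (lift_dist k (euler_dist S j p)))
      (lift_dist (k + 1) (euler_dist S (Suc j) (p * [:- (of_nat j + of_int k), 1:])))"
    "dist_eq (annulus U) (dist_comb 1 (-\<i>) (lift_dist k (euler_dist S j p)))
      (lift_dist (k - 1) (euler_dist S (Suc j) (p * [:- (of_nat j - of_int k), 1:])))"
proof -
  let ?E = "euler_dist S j p"
  note E = euler_dist_linear[OF S U, of j p]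
  \<comment> \<open>Used with c = k for the plus shift and c = -k for the minus shift.\<close>
  have key: "- ?E (\<lambda>r. dir_deriv 1 R r + c * (of_real (1 / r) * R r)) = euler_dist S (Suc j) (p * [:- (of_nat j + c), 1:]) R"
    if R: "R \<in> test_functions U" for R and c :: complex
  proof -
    have t: "dir_deriv 1 R \<in> test_functions U" "(\<lambda>r. of_real (1 / r) * R r) \<in> test_functions U"
      using test_functions_dir_deriv[OF R, of 1] test_functions_inverse[OF R U, of 1] by simp_all
    have 1: "- ?E (dir_deriv 1 R) = euler_dist S (Suc j) (p * [:- of_nat j, 1:]) R"
      using dist_deriv_euler[OF S U, of j p] R by (simp add: dist_eq_def dist_deriv_def)
    have 2: "?E (\<lambda>r. of_real (1 / r) * R r) = euler_dist S (Suc j) p R"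
      using fun_cong[OF dist_mult_euler[of S j p], of R] by (simp add: dist_mult_def)
    have "[:- (of_nat j + c), 1:] = [:- of_nat j, 1:] - [:c:]" by simp
    then have "p * [:- (of_nat j + c), 1:] = p * [:- of_nat j, 1:] - p * [:c:]"
      by (simp only: right_diff_distrib)
    moreover have "p * [:c:] = smult c p" by simp
    ultimately have "p * [:- (of_nat j + c), 1:] = p * [:- of_nat j, 1:] - smult c p"
      by (simp only:)
    then have "euler_dist S (Suc j) (p * [:- (of_nat j + c), 1:]) R = - ?E (dir_deriv 1 R) - c * ?E (\<lambda>r. of_real (1 / r) * R r)"
      by (simp only: euler_dist_poly_diff euler_dist_poly_smult 1 2)
    then show ?thesis
      by (simp only: linear_dist_add[OF E t(1) test_functions_cmult[OF t(2)]] linear_dist_cmult[OF E t(2)]) simp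
  qed
  have "dist_comb 1 \<i> (lift_dist k ?E) \<phi> = lift_dist (k + 1) (euler_dist S (Suc j) (p * [:- (of_nat j + of_int k), 1:])) \<phi>"
    "dist_comb 1 (-\<i>) (lift_dist k ?E) \<phi> = lift_dist (k - 1) (euler_dist S (Suc j) (p * [:- (of_nat j - of_int k), 1:])) \<phi>"
    if \<phi>: "\<phi> \<in> test_functions (annulus U)" for \<phi>
  proof -
    note \<phi>' = \<phi>[unfolded annulus_def]
    show "dist_comb 1 \<i> (lift_dist k ?E) \<phi> = lift_dist (k + 1) (euler_dist S (Suc j) (p * [:- (of_nat j + of_int k), 1:])) \<phi>"
      unfolding dist_comb_dpm[OF linear_dist_lift[OF E U] \<phi>] lift_dist_def
      using radial_test_dpm(1)[OF \<phi>' U, of "k + 1"] key[OF radial_test_test_functions[OF \<phi>' U], of "k + 1" "of_int k"] by simp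
    show "dist_comb 1 (-\<i>) (lift_dist k ?E) \<phi> = lift_dist (k - 1) (euler_dist S (Suc j) (p * [:- (of_nat j - of_int k), 1:])) \<phi>"
      unfolding dist_comb_dpm[OF linear_dist_lift[OF E U] \<phi>] lift_dist_def
      using radial_test_dpm(2)[OF \<phi>' U, of "k - 1"] key[OF radial_test_test_functions[OF \<phi>' U], of "k - 1" "- of_int k"] by simp
  qed
  then show "dist_eq (annulus U) (dist_comb 1 \<i> (lift_dist k ?E))
      (lift_dist (k + 1) (euler_dist S (Suc j) (p * [:- (of_nat j + of_int k), 1:])))"
    "dist_eq (annulus U) (dist_comb 1 (-\<i>) (lift_dist k ?E))
      (lift_dist (k - 1) (euler_dist S (Suc j) (p * [:- (of_nat j - of_int k), 1:])))"
    by (auto simp: dist_eq_def)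
qed

text \<open>Runs over all words of length \<open>j\<close> in the two operators, not over multi-indices, so that linear changes
  of the pair of operators can be handled one letter at a time.\<close>

primrec wnorm :: "(real \<times> real) set \<Rightarrow> complex \<Rightarrow> complex \<Rightarrow> complex \<Rightarrow> complex \<Rightarrow> nat \<Rightarrow> (real \<times> real) distrib \<Rightarrow> ennreal" where
  "wnorm U a b c d 0 T = dist_L2_sqnorm (\<lambda>_. 1) U T"
| "wnorm U a b c d (Suc j) T = wnorm U a b c d j (dist_comb a b T) + wnorm U a b c d j (dist_comb c d T)"

lemma wnorm_cong: "dist_eq U T T' \<Longrightarrow> wnorm U a b c d j T = wnorm U a b c d j T'"
proof (induction j arbitrary: T T')
  case 0
  then show ?case by (simp add: dist_eq_sqnorm)
next
  case (Suc j)
  show ?case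
    using Suc.IH[OF dist_comb_eq[OF Suc.prems, of a b]] Suc.IH[OF dist_comb_eq[OF Suc.prems, of c d]] by simp
qed

lemma dist_comb_linear: "dist_comb a b (\<lambda>\<phi>. x * S \<phi> + y * T \<phi>) = (\<lambda>\<phi>. x * dist_comb a b S \<phi> + y * dist_comb a b T \<phi>)"
  by (rule ext) (simp add: dist_comb_def dist_deriv_def algebra_simps)

lemma wnorm_linear:
  assumes U: "open U"
  shows "wnorm U a b c d j (\<lambda>\<phi>. x * S \<phi> + y * T \<phi>)
    \<le> ennreal (2 * ((cmod x)\<^sup>2 + (cmod y)\<^sup>2)) * (wnorm U a b c d j S + wnorm U a b c d j T)"
proof (induction j arbitrary: S T)
  case 0
  show ?case using dist_L2_sqnorm_linear[OF good_weight_1[OF U]] by simp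
next
  case (Suc j)
  show ?case
    unfolding wnorm.simps dist_comb_linear
    by (rule order_trans[OF add_mono[OF Suc Suc]]) (simp add: distrib_left add_ac)
qed

text \<open>The primed operators are combinations of the unprimed ones with the coefficients p and
  q. The last letters of a word are exchanged by the induction hypothesis, the first one by
  linearity.\<close>

lemma wnorm_change:
  assumes inv: "a' = p1 * a + q1 * c" "b' = p1 * b + q1 * d" "c' = p2 * a + q2 * c" "d' = p2 * b + q2 * d"
  shows "\<exists>C>0. \<forall>U T. open U \<longrightarrow> wnorm U a' b' c' d' j T \<le> ennreal C * wnorm U a b c d j T"
proof (induction j)
  case 0
  show ?case by (intro exI[of _ 1]) simp
next
  case (Suc j)
  then obtain C where C: "C > 0" "\<And>U T. open U \<Longrightarrow> wnorm U a' b' c' d' j T \<le> ennreal C * wnorm U a b c d j T" by blast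
  define M where "M = 2 * ((cmod p1)\<^sup>2 + (cmod q1)\<^sup>2) + 2 * ((cmod p2)\<^sup>2 + (cmod q2)\<^sup>2)"
  have M: "M \<ge> 0" by (simp add: M_def)
  have "wnorm U a' b' c' d' (Suc j) T \<le> ennreal (C * (M + 1)) * wnorm U a b c d (Suc j) T" if U: "open U" for U T
  proof -
    let ?W = "wnorm U a b c d j" and ?A = "dist_comb a b T" and ?B = "dist_comb c d T"
    have e: "dist_comb a' b' T = (\<lambda>\<phi>. p1 * ?A \<phi> + q1 * ?B \<phi>)" "dist_comb c' d' T = (\<lambda>\<phi>. p2 * ?A \<phi> + q2 * ?B \<phi>)"
      by (auto simp: dist_comb_def inv algebra_simps)
    have "wnorm U a' b' c' d' (Suc j) T \<le> ennreal C * ?W (dist_comb a' b' T) + ennreal C * ?W (dist_comb c' d' T)"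
      by (simp add: add_mono C U)
    also have "\<dots> \<le> ennreal C * (ennreal (2 * ((cmod p1)\<^sup>2 + (cmod q1)\<^sup>2)) * (?W ?A + ?W ?B))
        + ennreal C * (ennreal (2 * ((cmod p2)\<^sup>2 + (cmod q2)\<^sup>2)) * (?W ?A + ?W ?B))"
      unfolding e by (intro add_mono mult_left_mono wnorm_linear U) auto
    also have "\<dots> = ennreal (C * M) * (?W ?A + ?W ?B)"
      unfolding M_def using C(1) by (simp add: ennreal_mult' ennreal_plus distrib_left distrib_right mult.assoc)
    also have "\<dots> \<le> ennreal (C * (M + 1)) * (?W ?A + ?W ?B)"
      using C(1) by (intro mult_right_mono ennreal_leI) auto
    finally show ?thesis by simp
  qed
  moreover have "C * (M + 1) > 0" using C(1) M by simp
  ultimately show ?case by blast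
qed

section \<open>Cartesian against mode shifting derivatives\<close>

abbreviation "xynorm U \<equiv> wnorm U 1 0 0 1"
abbreviation "pmnorm U \<equiv> wnorm U 1 \<i> 1 (-\<i>)"

lemma xynorm_pmnorm:
  "\<exists>C>0. \<forall>U T. open U \<longrightarrow> xynorm U j T \<le> ennreal C * pmnorm U j T"
  "\<exists>C>0. \<forall>U T. open U \<longrightarrow> pmnorm U j T \<le> ennreal C * xynorm U j T"
  by (rule wnorm_change[where ?p1.0 = "1/2" and ?q1.0 = "1/2" and ?p2.0 = "-\<i>/2" and ?q2.0 = "\<i>/2"]; simp)
    (rule wnorm_change[where ?p1.0 = 1 and ?q1.0 = \<i> and ?p2.0 = 1 and ?q2.0 = "-\<i>"]; simp)

abbreviation mixed :: "nat \<Rightarrow> nat \<Rightarrow> (real \<times> real) distrib \<Rightarrow> (real \<times> real) distrib" where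
  "mixed a b T \<equiv> (dist_deriv (1, 0) ^^ a) ((dist_deriv (0, 1) ^^ b) T)"

lemma dist_comb_simps: "dist_comb 1 0 T = dist_deriv (1, 0) T" "dist_comb 0 1 T = dist_deriv (0, 1) T"
  by (simp_all add: dist_comb_def)

lemma dist_deriv_pow_eq: "dist_eq U T T' \<Longrightarrow> b \<in> Basis \<Longrightarrow> dist_eq U ((dist_deriv b ^^ n) T) ((dist_deriv b ^^ n) T')"
  by (induction n) (auto intro: dist_eq_deriv)

lemma dist_deriv_commute:
  fixes T :: "(real \<times> real) distrib"
  shows "dist_eq U (dist_deriv (0, 1) (dist_deriv (1, 0) T)) (dist_deriv (1, 0) (dist_deriv (0, 1) T))"
  unfolding dist_eq_def dist_deriv_def using dir_deriv_commute test_functions_smooth by metis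

lemma dist_deriv_pow_commute:
  fixes T :: "(real \<times> real) distrib"
  shows "dist_eq U ((dist_deriv (0, 1) ^^ b) (dist_deriv (1, 0) T)) (dist_deriv (1, 0) ((dist_deriv (0, 1) ^^ b) T))"
proof (induction b)
  case (Suc b)
  from dist_eq_trans[OF dist_eq_deriv[OF Suc Basis_real2(2)] dist_deriv_commute]
  show ?case by simp
qed simp

lemma sqnorm_mixed_le_xynorm: "dist_L2_sqnorm (\<lambda>_. 1) U (mixed a b T) \<le> xynorm U (a + b) T"
proof (induction "a + b" arbitrary: a b T)
  case (Suc n)
  show ?case
  proof (cases b)
    case 0
    then obtain a' where a: "a = Suc a'" using Suc.hyps by (cases a) auto
    then have "dist_L2_sqnorm (\<lambda>_. 1) U (mixed a' 0 (dist_deriv (1, 0) T)) \<le> xynorm U (a' + 0) (dist_deriv (1, 0) T)"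
      using 0 Suc.hyps by (intro Suc.hyps(1)) auto
    then show ?thesis unfolding a 0 by (auto simp: funpow_swap1 dist_comb_simps intro: add_increasing2)
  next
    case (Suc b')
    then have "dist_L2_sqnorm (\<lambda>_. 1) U (mixed a b' (dist_deriv (0, 1) T)) \<le> xynorm U (a + b') (dist_deriv (0, 1) T)"
      using Suc.hyps by (intro Suc.hyps(1)) auto
    then show ?thesis unfolding Suc by (auto simp: funpow_swap1 dist_comb_simps intro: add_increasing)
  qed
qed simp

text \<open>The 2^j words of length j reduce, as partial derivatives commute, to the j + 1 mixed
  derivatives of that order.\<close>

lemma xynorm_le_sqnorm_mixed:
  "xynorm U j T \<le> 2 ^ j * (\<Sum>a\<le>j. dist_L2_sqnorm (\<lambda>_. 1) U (mixed a (j - a) T))"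
proof (induction j arbitrary: T)
  case (Suc j)
  let ?N = "dist_L2_sqnorm (\<lambda>_. 1) U"
  let ?S = "\<Sum>a\<le>Suc j. ?N (mixed a (Suc j - a) T)"
  have "(\<Sum>a\<le>j. ?N (mixed a (j - a) (dist_deriv (1, 0) T))) = (\<Sum>a\<le>j. ?N (mixed (Suc a) (Suc j - Suc a) T))"
  proof (rule sum.cong[OF refl])
    fix a
    have "dist_eq U (mixed a (j - a) (dist_deriv (1, 0) T)) ((dist_deriv (1, 0) ^^ a) (dist_deriv (1, 0) ((dist_deriv (0, 1) ^^ (j - a)) T)))"
      by (intro dist_deriv_pow_eq dist_deriv_pow_commute Basis_real2)
    from dist_eq_sqnorm[OF this] show "?N (mixed a (j - a) (dist_deriv (1, 0) T)) = ?N (mixed (Suc a) (Suc j - Suc a) T)"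
      by (simp add: funpow_swap1)
  qed
  also have "\<dots> \<le> ?S" by (subst sum.atMost_Suc_shift) simp
  finally have 1: "(\<Sum>a\<le>j. ?N (mixed a (j - a) (dist_deriv (1, 0) T))) \<le> ?S" .
  have "(\<Sum>a\<le>j. ?N (mixed a (j - a) (dist_deriv (0, 1) T))) = (\<Sum>a\<le>j. ?N (mixed a (Suc j - a) T))"
    by (intro sum.cong refl) (simp add: Suc_diff_le funpow_swap1)
  also have "\<dots> \<le> ?S" by (intro sum_mono2) auto
  finally have 2: "(\<Sum>a\<le>j. ?N (mixed a (j - a) (dist_deriv (0, 1) T))) \<le> ?S" .
  have "xynorm U (Suc j) T \<le> 2 ^ j * ?S + 2 ^ j * ?S"
    unfolding wnorm.simps dist_comb_simps
    by (intro add_mono order_trans[OF Suc.IH] mult_left_mono 1 2) auto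
  also have "\<dots> = 2 ^ Suc j * ?S"
    unfolding power_Suc mult.assoc by (rule mult_2[symmetric])
  finally show ?case .
qed simp

text \<open>Closed form of the mode \<kappa> lift of \<open>S\<close> after \<open>a\<close> plus
  and \<open>b\<close> minus shifts. With mode \<kappa> + a - b and order a + b, the next shift
  multiplies \<open>hpoly\<close> by exactly its next factor.\<close>

definition tdist :: "int \<Rightarrow> real distrib \<Rightarrow> nat \<Rightarrow> nat \<Rightarrow> (real \<times> real) distrib" where
  "tdist \<kappa> S a b = lift_dist (\<kappa> + int a - int b) (euler_dist S (a + b) (hpoly (of_int \<kappa>) a b))"

lemma dist_comb_tdist:
  assumes S: "linear_dist U S" and U: "U \<subseteq> {0<..}"
  shows "dist_eq (annulus U) (dist_comb 1 \<i> (tdist \<kappa> S a b)) (tdist \<kappa> S (Suc a) b)"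
    "dist_eq (annulus U) (dist_comb 1 (-\<i>) (tdist \<kappa> S a b)) (tdist \<kappa> S a (Suc b))"
proof -
  have "[:- (of_nat (a + b) + of_int (\<kappa> + int a - int b)), 1:] = [:- (of_int \<kappa> + 2 * of_nat a), 1 :: complex:]"
    "[:- (of_nat (a + b) - of_int (\<kappa> + int a - int b)), 1:] = [:of_int \<kappa> - 2 * of_nat b, 1 :: complex:]"
    by simp_all
  moreover have "\<kappa> + int a - int b + 1 = \<kappa> + int (Suc a) - int b" "\<kappa> + int a - int b - 1 = \<kappa> + int a - int (Suc b)"
    by simp_all
  ultimately show "dist_eq (annulus U) (dist_comb 1 \<i> (tdist \<kappa> S a b)) (tdist \<kappa> S (Suc a) b)"
    "dist_eq (annulus U) (dist_comb 1 (-\<i>) (tdist \<kappa> S a b)) (tdist \<kappa> S a (Suc b))"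
    using dist_comb_lift[OF S U, of "\<kappa> + int a - int b" "a + b" "hpoly (of_int \<kappa>) a b"]
    by (simp_all only: tdist_def hpoly_Suc add_Suc add_Suc_right)
qed

text \<open>A word with n plus letters leads to the same place whatever their order, so the 2^i
  words give only i + 1 values. The starting pair (a, b) is left general for the induction.\<close>

lemma pmnorm_tdist:
  assumes S: "linear_dist U S" and U: "open U" "U \<subseteq> {0<..}"
  defines "\<nu> \<equiv> \<lambda>j p. dist_L2_sqnorm axi_weight U (euler_dist S j p)"
  shows "n \<le> i \<Longrightarrow> \<nu> (a + b + i) (hpoly (of_int \<kappa>) (a + n) (b + (i - n))) \<le> pmnorm (annulus U) i (tdist \<kappa> S a b)"
    "pmnorm (annulus U) i (tdist \<kappa> S a b) \<le> 2 ^ i * (\<Sum>n\<le>i. \<nu> (a + b + i) (hpoly (of_int \<kappa>) (a + n) (b + (i - n))))"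
proof -
  have step: "pmnorm (annulus U) (Suc i) (tdist \<kappa> S a b) = pmnorm (annulus U) i (tdist \<kappa> S (Suc a) b) + pmnorm (annulus U) i (tdist \<kappa> S a (Suc b))" for i a b
    using wnorm_cong[OF dist_comb_tdist(1)[OF S U(2)]] wnorm_cong[OF dist_comb_tdist(2)[OF S U(2)]] by simp
  have base: "pmnorm (annulus U) 0 (tdist \<kappa> S a b) = \<nu> (a + b) (hpoly (of_int \<kappa>) a b)" for a b
    by (simp add: tdist_def dist_L2_sqnorm_lift[OF U] \<nu>_def)
  show "\<nu> (a + b + i) (hpoly (of_int \<kappa>) (a + n) (b + (i - n))) \<le> pmnorm (annulus U) i (tdist \<kappa> S a b)" if "n \<le> i"
    using that
  proof (induction i arbitrary: a b n)
    case 0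
    then show ?case using base[of a b] by simp
  next
    case (Suc i)
    show ?case
    proof (cases n)
      case 0
      have "\<nu> (a + b + Suc i) (hpoly (of_int \<kappa>) (a + n) (b + (Suc i - n))) \<le> pmnorm (annulus U) i (tdist \<kappa> S a (Suc b))"
        using Suc.IH[of 0 a "Suc b"] 0 by simp
      then show ?thesis unfolding step by (rule add_increasing[rotated]) simp
    next
      case (Suc n')
      have "\<nu> (a + b + Suc i) (hpoly (of_int \<kappa>) (a + n) (b + (Suc i - n))) \<le> pmnorm (annulus U) i (tdist \<kappa> S (Suc a) b)"
        using Suc.IH[of n' "Suc a" b] Suc.prems \<open>n = Suc n'\<close> by simp
      then show ?thesis unfolding step by (rule add_increasing2[rotated]) simp
    qed
  qed
  show "pmnorm (annulus U) i (tdist \<kappa> S a b) \<le> 2 ^ i * (\<Sum>n\<le>i. \<nu> (a + b + i) (hpoly (of_int \<kappa>) (a + n) (b + (i - n))))"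
  proof (induction i arbitrary: a b)
    case 0
    then show ?case using base[of a b] by simp
  next
    case (Suc i)
    let ?S = "\<Sum>n\<le>Suc i. \<nu> (a + b + Suc i) (hpoly (of_int \<kappa>) (a + n) (b + (Suc i - n)))"
    have "(\<Sum>n\<le>i. \<nu> (Suc a + b + i) (hpoly (of_int \<kappa>) (Suc a + n) (b + (i - n)))) \<le> ?S"
      by (subst sum.atMost_Suc_shift) simp
    moreover have "(\<Sum>n\<le>i. \<nu> (a + Suc b + i) (hpoly (of_int \<kappa>) (a + n) (Suc b + (i - n)))) \<le> ?S"
    proof -
      have "(\<Sum>n\<le>i. \<nu> (a + Suc b + i) (hpoly (of_int \<kappa>) (a + n) (Suc b + (i - n))))
        = (\<Sum>n\<le>i. \<nu> (a + b + Suc i) (hpoly (of_int \<kappa>) (a + n) (b + (Suc i - n))))"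
        by (intro sum.cong refl) (simp add: Suc_diff_le)
      also have "\<dots> \<le> ?S" by (intro sum_mono2) auto
      finally show ?thesis .
    qed
    ultimately have "pmnorm (annulus U) (Suc i) (tdist \<kappa> S a b) \<le> 2 ^ i * ?S + 2 ^ i * ?S"
      unfolding step by (intro add_mono order_trans[OF Suc.IH] mult_left_mono) auto
    also have "\<dots> = 2 ^ Suc i * ?S"
      unfolding power_Suc mult.assoc by (rule mult_2[symmetric])
    finally show ?case .
  qed
qed

section \<open>Removing the origin\<close>

lemma smooth_fun_norm_square: "smooth_fun (\<lambda>p::real \<times> real. complex_of_real ((norm p)\<^sup>2))"
proof -
  have "(\<lambda>p::real \<times> real. complex_of_real ((norm p)\<^sup>2)) = (\<lambda>p. complex_of_real (p \<bullet> (1, 0)) ^ 2 + complex_of_real (p \<bullet> (0, 1)) ^ 2)"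
    by (rule ext) (simp add: norm_Pair inner_prod_def norm_prod_def)
  then show ?thesis
    by (simp only:) (intro smooth_fun_add smooth_fun_power smooth_fun_inner)
qed

text \<open>Contains the disc of radius 2 / (n + 1), outside of which the cutoff has no gradient. A
  square makes its measure a product of lengths.\<close>

definition small_square :: "nat \<Rightarrow> (real \<times> real) set" where
  "small_square n = {- (2 / real (Suc n))..2 / real (Suc n)} \<times> {- (2 / real (Suc n))..2 / real (Suc n)}"

text \<open>A smooth step applied to (n + 1)^2 |p|^2 - 1, where the square keeps the argument
  polynomial at the origin. It rises from 0 to 1 between the radii 1 / (n + 1) and sqrt 2 / (n + 1),
  so its gradient is of size n + 1.\<close>

lemma cutoff_exists:
  obtains \<eta> :: "nat \<Rightarrow> real \<times> real \<Rightarrow> complex" and M C where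
    "0 < M" "0 < C" "\<And>n. smooth_fun (\<eta> n)" "\<And>n p. cmod (\<eta> n p) \<le> M"
    "\<And>n p. norm p \<le> 1 / real (Suc n) \<Longrightarrow> \<eta> n p = 0"
    "\<And>p. p \<noteq> 0 \<Longrightarrow> eventually (\<lambda>n. \<eta> n p = 1) sequentially"
    "\<And>n p b. b \<in> Basis \<Longrightarrow> cmod (dir_deriv b (\<eta> n) p) \<le> C * (real (Suc n) * indicator (small_square n) p)"
proof -
  obtain S :: "real \<Rightarrow> complex" where S: "smooth_fun S" "\<And>x. x \<le> 0 \<Longrightarrow> S x = 0" "\<And>x. x \<ge> 1 \<Longrightarrow> S x = 1"
    by (rule smooth_step_exists) blast
  have d0: "dir_deriv 1 S x = 0" if "x < 0 \<or> x > 1" for x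
    using that
  proof
    assume "x < 0"
    then show ?thesis using S(2) by (intro dir_deriv_eq_0(1)[of "{..<0}"]) auto
  next
    assume x: "x > 1"
    have "dir_deriv 1 S x = dir_deriv 1 (\<lambda>_. 1) x"
      using x S(3) by (intro dir_deriv_cong_open(1)[of "{1<..}"]) auto
    also have "\<dots> = 0" by (rule dir_derivI) simp
    finally show ?thesis .
  qed
  have "bounded (S ` {0..1})" "bounded (dir_deriv 1 S ` {0..1})"
    using S(1) by (auto intro!: compact_imp_bounded compact_continuous_image smooth_fun_continuous_on smooth_fun_dir_deriv)
  then obtain M0 M1 where M: "M0 > 0" "M1 > 0" "\<And>x. x \<in> {0..1} \<Longrightarrow> cmod (S x) \<le> M0" "\<And>x. x \<in> {0..1} \<Longrightarrow> cmod (dir_deriv 1 S x) \<le> M1"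
    unfolding bounded_pos by blast
  have bS: "cmod (S x) \<le> M0 + 1" for x
  proof -
    consider "x < 0" | "x > 1" | "x \<in> {0..1}" by fastforce
    then show ?thesis using S(2)[of x] S(3)[of x] M(1) M(3)[of x] by cases auto
  qed
  have bD: "cmod (dir_deriv 1 S x) \<le> M1" for x
    using d0[of x] M(2) M(4)[of x] by (cases "x < 0 \<or> x > 1") auto
  define s where "s n p = (real (Suc n))\<^sup>2 * (norm p)\<^sup>2 - 1" for n and p :: "real \<times> real"
  have s: "smooth_fun (\<lambda>p. complex_of_real (s n p))" for n
    using smooth_fun_add[OF smooth_fun_cmult[OF smooth_fun_norm_square, of "of_real ((real (Suc n))\<^sup>2)"] smooth_fun_const[of "-1"]]
    by (simp add: s_def)
  have ds: "dir_deriv b (\<lambda>p. complex_of_real (s n p)) p = of_real ((real (Suc n))\<^sup>2 * (2 * (p \<bullet> b)))" for n b p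
  proof (rule dir_derivI)
    have e: "(\<lambda>p. complex_of_real (s n p)) = (\<lambda>p. of_real ((real (Suc n))\<^sup>2 * (p \<bullet> p) - 1))"
      by (simp add: s_def power2_norm_eq_inner)
    show "((\<lambda>p. complex_of_real (s n p)) has_derivative (\<lambda>b. of_real ((real (Suc n))\<^sup>2 * (2 * (p \<bullet> b))))) (at p)"
      unfolding e by (rule derivative_eq_intros refl | simp add: inner_commute)+
  qed
  define \<eta> where "\<eta> n p = S (s n p)" for n p
  show ?thesis
  proof (rule that[of "M0 + 1" "4 * M1" \<eta>])
    show "0 < M0 + 1" "0 < 4 * M1" using M by auto
    show "smooth_fun (\<eta> n)" for n unfolding \<eta>_def[abs_def] by (rule smooth_fun_compose(1)[OF S(1) s])
    show "cmod (\<eta> n p) \<le> M0 + 1" for n p unfolding \<eta>_def by (rule bS)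
    show "\<eta> n p = 0" if p: "norm p \<le> 1 / real (Suc n)" for n p
    proof -
      have "real (Suc n) * norm p \<le> 1" using p by (simp add: field_simps)
      then have "(real (Suc n) * norm p)\<^sup>2 \<le> 1\<^sup>2" by (intro power_mono) auto
      then show ?thesis unfolding \<eta>_def by (intro S(2)) (simp add: s_def power_mult_distrib)
    qed
    show "eventually (\<lambda>n. \<eta> n p = 1) sequentially" if p: "p \<noteq> 0" for p
    proof -
      obtain N :: nat where N: "2 / norm p < real N" using reals_Archimedean2 by blast
      have "\<eta> n p = 1" if n: "n \<ge> N" for n
      proof -
        have "2 / norm p < real (Suc n)" using N n by linarith
        then have "2 \<le> real (Suc n) * norm p" using p by (simp add: field_simps)
        then have "2\<^sup>2 \<le> (real (Suc n) * norm p)\<^sup>2" by (intro power_mono) auto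
        then show ?thesis unfolding \<eta>_def by (intro S(3)) (simp add: s_def power_mult_distrib)
      qed
      then show ?thesis by (auto simp: eventually_sequentially)
    qed
    fix n p and b :: "real \<times> real" assume b: "b \<in> Basis"
    have de: "dir_deriv b (\<eta> n) p = dir_deriv 1 S (s n p) * of_real ((real (Suc n))\<^sup>2 * (2 * (p \<bullet> b)))"
      unfolding \<eta>_def[abs_def] using smooth_fun_compose(2)[OF S(1) s] by (simp only: ds)
    show "cmod (dir_deriv b (\<eta> n) p) \<le> 4 * M1 * (real (Suc n) * indicator (small_square n) p)"
    proof (cases "s n p > 1")
      case True
      then show ?thesis using d0[of "s n p"] M(2) by (simp add: de)
    next
      case False
      then have "(real (Suc n) * norm p)\<^sup>2 \<le> 2\<^sup>2" by (simp add: s_def power_mult_distrib)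
      then have le: "real (Suc n) * norm p \<le> 2" by (rule power2_le_imp_le) simp
      then have "norm p \<le> 2 / real (Suc n)" by (simp add: field_simps)
      moreover have "\<bar>fst p\<bar> \<le> norm p" "\<bar>snd p\<bar> \<le> norm p"
        using norm_fst_le[of "fst p" "snd p"] norm_snd_le[of "snd p" "fst p"] by simp_all
      ultimately have sq: "p \<in> small_square n"
        by (cases p) (auto simp: small_square_def simp del: of_nat_Suc)
      have pb: "\<bar>p \<bullet> b\<bar> \<le> norm p" using Cauchy_Schwarz_ineq2[of p b] b by simp
      \<comment> \<open>The chain rule gives 2 (n + 1)^2 |p . b|, and (n + 1) |p| \<le> 2 here: one
        power of n + 1 and the constant 4 remain.\<close>
      have "cmod (dir_deriv b (\<eta> n) p) = cmod (dir_deriv 1 S (s n p)) * (real (Suc n) * (real (Suc n) * (2 * \<bar>p \<bullet> b\<bar>)))"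
        unfolding de norm_mult norm_of_real by (simp add: abs_mult power2_eq_square)
      also have "\<dots> \<le> M1 * (real (Suc n) * (2 * 2))"
      proof -
        have "real (Suc n) * \<bar>p \<bullet> b\<bar> \<le> real (Suc n) * norm p" by (intro mult_left_mono pb) simp
        then have "real (Suc n) * (2 * \<bar>p \<bullet> b\<bar>) \<le> 2 * 2" using le by linarith
        then have "real (Suc n) * (real (Suc n) * (2 * \<bar>p \<bullet> b\<bar>)) \<le> real (Suc n) * (2 * 2)"
          by (rule mult_left_mono) simp
        then show ?thesis by (rule mult_mono[OF bD]) (use M in auto)
      qed
      finally show ?thesis using sq by (simp add: algebra_simps)
    qed
  qed
qed

lemma emeasure_small_square: "emeasure lborel (small_square n) = ennreal (16 / (real (Suc n))\<^sup>2)"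
proof -
  have "emeasure lborel (small_square n) = emeasure (lborel \<Otimes>\<^sub>M lborel) (small_square n)" by (simp add: lborel_prod)
  also have "\<dots> = ennreal (4 / real (Suc n)) * ennreal (4 / real (Suc n))"
    unfolding small_square_def by (subst lborel.emeasure_pair_measure_Times) (auto simp del: of_nat_Suc)
  also have "\<dots> = ennreal (16 / (real (Suc n))\<^sup>2)"
    by (subst ennreal_mult[symmetric]) (auto simp: power2_eq_square simp del: of_nat_Suc)
  finally show ?thesis .
qed

lemma small_square_measurable [measurable]: "small_square n \<in> sets borel"
  unfolding small_square_def by (intro borel_closed closed_Times closed_atLeastAtMost)

lemma eventually_not_small_square:
  assumes "p \<noteq> 0" shows "eventually (\<lambda>n. p \<notin> small_square n) sequentially"
proof -
  define c where "c = max \<bar>fst p\<bar> \<bar>snd p\<bar>"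
  have c: "c > 0" using assms by (cases p) (auto simp: c_def zero_prod_def)
  obtain N :: nat where N: "2 / c < real N" using reals_Archimedean2 by blast
  have "p \<notin> small_square n" if n: "n \<ge> N" for n
  proof
    assume "p \<in> small_square n"
    then have "c \<le> 2 / real (Suc n)" by (cases p) (auto simp: small_square_def c_def simp del: of_nat_Suc)
    then have "real (Suc n) * c \<le> 2" by (simp add: field_simps)
    moreover have "2 / c < real (Suc n)" using N n by linarith
    then have "2 < real (Suc n) * c" using c by (simp add: field_simps)
    ultimately show False by simp
  qed
  then show ?thesis by (auto simp: eventually_sequentially)
qed

lemma cutoff_test_functions:
  fixes D :: "(real \<times> real) set"
  assumes \<phi>: "\<phi> \<in> test_functions D" and \<eta>: "smooth_fun \<eta>" "\<And>p. norm p \<le> e \<Longrightarrow> \<eta> p = 0" "e > 0"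
  shows "(\<lambda>p. \<eta> p * \<phi> p) \<in> test_functions (D - {0})"
proof -
  obtain K where K: "smooth_fun \<phi>" "compact K" "K \<subseteq> D" "\<And>x. x \<notin> K \<Longrightarrow> \<phi> x = 0"
    using \<phi> by (rule test_functionsE) blast
  show ?thesis
  proof (rule test_functionsI[where K = "K - ball 0 e"])
    show "smooth_fun (\<lambda>p. \<eta> p * \<phi> p)" by (intro smooth_fun_mult \<eta> K)
    show "compact (K - ball 0 e)" using K(2) by (intro compact_diff) auto
    show "K - ball 0 e \<subseteq> D - {0}" using K(3) \<eta>(3) by auto
    show "\<eta> p * \<phi> p = 0" if "p \<notin> K - ball 0 e" for p
      using that K(4)[of p] \<eta>(2)[of p] by (cases "p \<in> K") auto
  qed
qed

lemma cutoff_limit: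
  fixes f :: "real \<times> real \<Rightarrow> complex"
  assumes f: "integrable lborel f" and \<eta>: "\<And>n. smooth_fun (\<eta> n)" "\<And>n p. cmod (\<eta> n p) \<le> M"
    "\<And>p. p \<noteq> 0 \<Longrightarrow> eventually (\<lambda>n. \<eta> n p = 1) sequentially"
  shows "(\<lambda>n. \<integral>p. \<eta> n p * f p \<partial>lborel) \<longlonglongrightarrow> (\<integral>p. f p \<partial>lborel)"
proof (rule integral_dominated_convergence[where w = "\<lambda>p. M * cmod (f p)"])
  have \<eta>m: "\<eta> n \<in> borel_measurable borel" for n
    by (intro borel_measurable_continuous_onI smooth_fun_continuous_on \<eta>)
  show "(\<lambda>p. \<eta> n p * f p) \<in> borel_measurable lborel" for n
    using \<eta>m[of n] borel_measurable_integrable[OF f] by simp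
  show "integrable lborel (\<lambda>p. M * cmod (f p))" using f by simp
  show "AE p in lborel. (\<lambda>n. \<eta> n p * f p) \<longlonglongrightarrow> f p"
    using AE_lborel_singleton[of "0 :: real \<times> real"]
  proof eventually_elim
    case (elim p)
    from \<eta>(3)[OF this] have "eventually (\<lambda>n. \<eta> n p * f p = f p) sequentially" by eventually_elim simp
    then show ?case by (rule tendsto_eventually)
  qed
  show "AE p in lborel. norm (\<eta> n p * f p) \<le> M * cmod (f p)" for n
    using \<eta>(2) by (intro AE_I2) (simp add: norm_mult mult_right_mono)
qed (use borel_measurable_integrable[OF f] in simp)

lemma ennreal_power2_le_imp_le:
  fixes x :: ennreal
  assumes "x\<^sup>2 \<le> ennreal (y\<^sup>2)" "0 \<le> y"
  shows "x \<le> ennreal y"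
proof (cases x)
  case (real z)
  then show ?thesis using assms by (auto simp: ennreal_power intro: power2_le_imp_le ennreal_leI)
next
  case top
  then show ?thesis using assms by (simp add: power2_eq_square ennreal_top_mult top_unique)
qed

text \<open>The gradients of the cutoff functions grow like \<open>n\<close> on squares of side \<open>1/n\<close>: bounded in \<open>L\<^sup>2\<close>, hence
  harmless against the vanishing \<open>L\<^sup>2\<close> mass of \<open>g\<close> there.\<close>

lemma cutoff_remainder:
  fixes g \<phi> :: "real \<times> real \<Rightarrow> complex"
  assumes g: "g \<in> borel_measurable borel" "sqnorm (\<lambda>_. 1) g < \<infinity>" and \<phi>: "\<And>p. cmod (\<phi> p) \<le> L"
    and \<zeta>: "\<And>n p. cmod (\<zeta> n p) \<le> C * (real (Suc n) * indicator (small_square n) p)" and "0 \<le> C" "0 \<le> L"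
  shows "(\<lambda>n. \<integral>p. g p * \<phi> p * \<zeta> n p \<partial>lborel) \<longlonglongrightarrow> 0"
proof -
  note [measurable] = g(1)
  define I where "I n = (\<integral>p. indicator (small_square n) p * (cmod (g p))\<^sup>2 \<partial>lborel)" for n
  have int: "integrable lborel (\<lambda>p. (cmod (g p))\<^sup>2)"
    using g(2) by (intro integrableI_nonneg) (auto simp: sqnorm_def)
  have I0: "I \<longlonglongrightarrow> 0"
  proof -
    have "(\<lambda>n. I n) \<longlonglongrightarrow> integral\<^sup>L lborel (\<lambda>p::real \<times> real. 0)"
      unfolding I_def
    proof (rule integral_dominated_convergence[where w = "\<lambda>p. (cmod (g p))\<^sup>2"])
      show "AE p in lborel. (\<lambda>n. indicator (small_square n) p * (cmod (g p))\<^sup>2) \<longlonglongrightarrow> 0"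
        using AE_lborel_singleton[of "0 :: real \<times> real"]
      proof eventually_elim
        case (elim p)
        from eventually_not_small_square[OF this]
        have "eventually (\<lambda>n. indicator (small_square n) p * (cmod (g p))\<^sup>2 = 0) sequentially"
          by eventually_elim simp
        then show ?case by (rule tendsto_eventually)
      qed
      show "AE p in lborel. norm (indicator (small_square n) p * (cmod (g p))\<^sup>2) \<le> (cmod (g p))\<^sup>2" for n
        by (intro AE_I2) (simp add: indicator_def)
    qed (use int in auto)
    then show ?thesis by simp
  qed
  have bound: "cmod (\<integral>p. g p * \<phi> p * \<zeta> n p \<partial>lborel) \<le> L * C * 4 * sqrt (I n)" for n
  proof (cases "integrable lborel (\<lambda>p. g p * \<phi> p * \<zeta> n p)")
    case True
    have In: "I n \<ge> 0" by (simp add: I_def)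
    let ?k = "ennreal (real (Suc n))" and ?i = "\<lambda>p. indicator (small_square n) p :: ennreal"
    let ?J = "\<integral>\<^sup>+p. (ennreal (cmod (g p)) * ?i p) * (?k * ?i p) \<partial>lborel"
    have "ennreal (cmod (\<integral>p. g p * \<phi> p * \<zeta> n p \<partial>lborel)) \<le> (\<integral>\<^sup>+p. ennreal (cmod (g p * \<phi> p * \<zeta> n p)) \<partial>lborel)"
      by (rule integral_norm_bound_ennreal[OF True])
    also have "\<dots> \<le> (\<integral>\<^sup>+p. ennreal (L * C) * ((ennreal (cmod (g p)) * ?i p) * (?k * ?i p)) \<partial>lborel)"
    proof (rule nn_integral_mono)
      fix p
      have "cmod (g p * \<phi> p * \<zeta> n p) \<le> cmod (g p) * L * (C * (real (Suc n) * indicator (small_square n) p))"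
        unfolding norm_mult using \<open>0 \<le> L\<close> by (intro mult_mono \<phi> \<zeta> order.refl) auto
      then have "ennreal (cmod (g p * \<phi> p * \<zeta> n p)) \<le> ennreal (cmod (g p) * L * (C * (real (Suc n) * indicator (small_square n) p)))"
        by (rule ennreal_leI)
      also have "\<dots> = ennreal (L * C) * ((ennreal (cmod (g p)) * ?i p) * (?k * ?i p))"
        using \<open>0 \<le> C\<close> \<open>0 \<le> L\<close> by (simp add: indicator_def ennreal_mult'[symmetric] mult_ac del: of_nat_Suc)
      finally show "ennreal (cmod (g p * \<phi> p * \<zeta> n p)) \<le> ennreal (L * C) * ((ennreal (cmod (g p)) * ?i p) * (?k * ?i p))" .
    qed
    also have "\<dots> = ennreal (L * C) * ?J" by (rule nn_integral_cmult) measurable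
    finally have 1: "ennreal (cmod (\<integral>p. g p * \<phi> p * \<zeta> n p \<partial>lborel)) \<le> ennreal (L * C) * ?J" .
    have "?J\<^sup>2 \<le> (\<integral>\<^sup>+p. (ennreal (cmod (g p)) * ?i p)\<^sup>2 \<partial>lborel) * (\<integral>\<^sup>+p. (?k * ?i p)\<^sup>2 \<partial>lborel)"
      by (rule Cauchy_Schwarz_nn_integral) measurable
    also have "(\<integral>\<^sup>+p. (ennreal (cmod (g p)) * ?i p)\<^sup>2 \<partial>lborel) = ennreal (I n)"
    proof -
      have "integrable lborel (\<lambda>p. indicator (small_square n) p * (cmod (g p))\<^sup>2)"
        using int integrable_mult_indicator[OF _ int, of "small_square n"] by simp
      then have "ennreal (I n) = (\<integral>\<^sup>+p. ennreal (indicator (small_square n) p * (cmod (g p))\<^sup>2) \<partial>lborel)"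
        unfolding I_def by (intro nn_integral_eq_integral[symmetric]) auto
      also have "\<dots> = (\<integral>\<^sup>+p. (ennreal (cmod (g p)) * ?i p)\<^sup>2 \<partial>lborel)"
        by (intro nn_integral_cong) (auto simp: indicator_def ennreal_power)
      finally show ?thesis by simp
    qed
    \<comment> \<open>The square (n + 1)^2 of the gradient bound times the area 16 / (n + 1)^2, a
      balance peculiar to dimension two.\<close>
    also have "(\<integral>\<^sup>+p. (?k * ?i p)\<^sup>2 \<partial>lborel) = ennreal 16"
    proof -
      have "(\<integral>\<^sup>+p. (?k * ?i p)\<^sup>2 \<partial>lborel) = (\<integral>\<^sup>+p. ?k\<^sup>2 * ?i p \<partial>lborel)"
        by (intro nn_integral_cong) (auto simp: indicator_def)
      also have "\<dots> = ?k\<^sup>2 * emeasure lborel (small_square n)" by (rule nn_integral_cmult_indicator) simp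
      also have "\<dots> = ennreal 16"
        unfolding emeasure_small_square by (simp add: ennreal_power ennreal_mult'[symmetric] del: of_nat_Suc)
      finally show ?thesis .
    qed
    also have "ennreal (I n) * ennreal 16 = ennreal ((4 * sqrt (I n))\<^sup>2)"
      using In by (subst ennreal_mult[symmetric]) (auto simp: power_mult_distrib)
    finally have J: "?J\<^sup>2 \<le> ennreal ((4 * sqrt (I n))\<^sup>2)" .
    have "?J \<le> ennreal (4 * sqrt (I n))"
      by (rule ennreal_power2_le_imp_le[OF J]) (use In in simp)
    then have "ennreal (L * C) * ?J \<le> ennreal (L * C) * ennreal (4 * sqrt (I n))" by (intro mult_left_mono) auto
    also have "\<dots> = ennreal (L * C * (4 * sqrt (I n)))"
      using \<open>0 \<le> C\<close> \<open>0 \<le> L\<close> In by (intro ennreal_mult[symmetric]) auto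
    finally have "ennreal (cmod (\<integral>p. g p * \<phi> p * \<zeta> n p \<partial>lborel)) \<le> ennreal (L * C * (4 * sqrt (I n)))"
      by (rule order_trans[OF 1])
    then show ?thesis
      by (subst (asm) ennreal_le_iff) (use \<open>0 \<le> C\<close> \<open>0 \<le> L\<close> In in \<open>auto simp: mult.assoc\<close>)
  next
    case False
    then show ?thesis using \<open>0 \<le> C\<close> \<open>0 \<le> L\<close> by (simp add: not_integrable_integral_eq I_def)
  qed
  show ?thesis
  proof (rule Lim_null_comparison)
    show "eventually (\<lambda>n. norm (\<integral>p. g p * \<phi> p * \<zeta> n p \<partial>lborel) \<le> L * C * 4 * sqrt (I n)) sequentially"
      using bound by simp
    have "(\<lambda>n. L * C * 4 * sqrt (I n)) \<longlonglongrightarrow> L * C * 4 * sqrt 0"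
      by (intro tendsto_intros I0)
    then show "(\<lambda>n. L * C * 4 * sqrt (I n)) \<longlonglongrightarrow> 0" by simp
  qed
qed

text \<open>The test function is multiplied by a cutoff and so avoids the origin. The product rule
  leaves one term with the gradient of the cutoff, which tends to 0 because g is square integrable.
  Higher derivatives of the cutoffs are not bounded in L^2, so orders are raised one at a
  time.\<close>

lemma represents_origin_removable_deriv:
  fixes T :: "(real \<times> real) distrib"
  assumes D: "open D" and b: "b \<in> Basis"
    and g: "represents D T g" "sqnorm (\<lambda>_. 1) g < \<infinity>"
    and h: "represents (D - {0}) (dist_deriv b T) h" "sqnorm (\<lambda>_. 1) h < \<infinity>"
  shows "represents D (dist_deriv b T) h"
proof -
  obtain \<eta> M C where MC: "0 < M" "0 < C" and \<eta>: "\<And>n. smooth_fun (\<eta> n)" "\<And>n p. cmod (\<eta> n p) \<le> M"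
    "\<And>n p. norm p \<le> 1 / real (Suc n) \<Longrightarrow> \<eta> n p = (0::complex)"
    "\<And>p. p \<noteq> 0 \<Longrightarrow> eventually (\<lambda>n. \<eta> n p = 1) sequentially"
    "\<And>n p b. b \<in> Basis \<Longrightarrow> cmod (dir_deriv b (\<eta> n) p) \<le> C * (real (Suc n) * indicator (small_square n) p)"
    by (rule cutoff_exists) blast
  have gm: "g \<in> borel_measurable borel" and g0: "\<And>p. p \<notin> D \<Longrightarrow> g p = 0"
    and hm: "h \<in> borel_measurable borel" and h0: "\<And>p. p \<notin> D \<Longrightarrow> h p = 0"
    using g h by (auto simp: represents_def)
  note w = good_weight_1[OF D]
  show ?thesis
    unfolding represents_def
  proof (intro conjI ballI)
    fix \<phi> assume \<phi>: "\<phi> \<in> test_functions D"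
    note d\<phi> = test_functions_dir_deriv[OF \<phi> b]
    obtain L where L: "0 < L" "\<And>p. cmod (\<phi> p) \<le> L" using \<phi> by (rule test_functions_bounded) blast
    have eq: "- (\<integral>p. \<eta> n p * (g p * dir_deriv b \<phi> p) \<partial>lborel) - (\<integral>p. g p * \<phi> p * dir_deriv b (\<eta> n) p \<partial>lborel)
        = (\<integral>p. \<eta> n p * (h p * \<phi> p) \<partial>lborel)" for n
    proof -
      have e: "1 / real (Suc n) > 0" by simp
      have \<psi>: "(\<lambda>p. \<eta> n p * \<phi> p) \<in> test_functions (D - {0})"
        by (rule cutoff_test_functions[OF \<phi> \<eta>(1) \<eta>(3) e])
      have dd: "dir_deriv b (\<lambda>p. \<eta> n p * \<phi> p) = (\<lambda>p. \<eta> n p * dir_deriv b \<phi> p + dir_deriv b (\<eta> n) p * \<phi> p)"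
        by (intro ext dir_deriv_mult smooth_fun_differentiable \<eta>(1) test_functions_smooth[OF \<phi>])
      have "dir_deriv b (\<lambda>p. \<eta> n p * \<phi> p) \<in> test_functions D"
        using test_functions_dir_deriv[OF \<psi> b] test_functions_mono[of "D - {0}" D] by blast
      then have "T (dir_deriv b (\<lambda>p. \<eta> n p * \<phi> p)) = (\<integral>p. g p * (\<eta> n p * dir_deriv b \<phi> p + dir_deriv b (\<eta> n) p * \<phi> p) \<partial>lborel)"
        using g(1) by (simp add: represents_def dd)
      also have "\<dots> = (\<integral>p. g p * (\<eta> n p * dir_deriv b \<phi> p) \<partial>lborel) + (\<integral>p. g p * (dir_deriv b (\<eta> n) p * \<phi> p) \<partial>lborel)"
        unfolding distrib_left
        by (intro Bochner_Integration.integral_add integrable_test[OF w gm g0 g(2)] test_functions_mult d\<phi> \<phi>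
            smooth_fun_dir_deriv \<eta>(1) b)
      also have "(\<integral>p. g p * (\<eta> n p * dir_deriv b \<phi> p) \<partial>lborel) = (\<integral>p. \<eta> n p * (g p * dir_deriv b \<phi> p) \<partial>lborel)"
        by (simp only: mult.left_commute)
      also have "(\<integral>p. g p * (dir_deriv b (\<eta> n) p * \<phi> p) \<partial>lborel) = (\<integral>p. g p * \<phi> p * dir_deriv b (\<eta> n) p \<partial>lborel)"
        by (simp only: mult_ac)
      finally have "T (dir_deriv b (\<lambda>p. \<eta> n p * \<phi> p)) =
        (\<integral>p. \<eta> n p * (g p * dir_deriv b \<phi> p) \<partial>lborel) + (\<integral>p. g p * \<phi> p * dir_deriv b (\<eta> n) p \<partial>lborel)" .
      moreover have "- T (dir_deriv b (\<lambda>p. \<eta> n p * \<phi> p)) = (\<integral>p. h p * (\<eta> n p * \<phi> p) \<partial>lborel)"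
        using h(1) \<psi> by (simp add: represents_def dist_deriv_def)
      moreover have "(\<integral>p. h p * (\<eta> n p * \<phi> p) \<partial>lborel) = (\<integral>p. \<eta> n p * (h p * \<phi> p) \<partial>lborel)"
        by (simp only: mult.left_commute)
      ultimately show ?thesis by simp
    qed
    have "(\<lambda>n. - (\<integral>p. \<eta> n p * (g p * dir_deriv b \<phi> p) \<partial>lborel) - (\<integral>p. g p * \<phi> p * dir_deriv b (\<eta> n) p \<partial>lborel))
      \<longlonglongrightarrow> - (\<integral>p. g p * dir_deriv b \<phi> p \<partial>lborel) - 0"
      using MC L(1)
      by (intro tendsto_diff tendsto_minus cutoff_limit[OF integrable_test[OF w gm g0 g(2) d\<phi>] \<eta>(1,2,4)]
          cutoff_remainder[OF gm g(2) L(2) \<eta>(5)[OF b]]) auto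
    moreover have "(\<lambda>n. \<integral>p. \<eta> n p * (h p * \<phi> p) \<partial>lborel) \<longlonglongrightarrow> (\<integral>p. h p * \<phi> p \<partial>lborel)"
      by (intro cutoff_limit[OF integrable_test[OF w hm h0 h(2) \<phi>] \<eta>(1,2,4)])
    ultimately have "- (\<integral>p. g p * dir_deriv b \<phi> p \<partial>lborel) = (\<integral>p. h p * \<phi> p \<partial>lborel)"
      unfolding eq using LIMSEQ_unique by force
    then show "dist_deriv b T \<phi> = (\<integral>p. h p * \<phi> p \<partial>lborel)"
      using g(1) d\<phi> by (simp add: represents_def dist_deriv_def)
  qed (use hm h0 in auto)
qed

text \<open>The start of the induction: u and h have equal integrals against test functions cut off
  near the origin, and in the limit against all.\<close>

lemma represents_origin_removable:
  fixes T :: "(real \<times> real) distrib"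
  assumes D: "open D" and u: "represents D T u" "sqnorm (\<lambda>_. 1) u < \<infinity>"
    and h: "represents (D - {0}) T h" "sqnorm (\<lambda>_. 1) h < \<infinity>"
  shows "represents D T h"
proof -
  obtain \<eta> M C where MC: "0 < M" "0 < C" and \<eta>: "\<And>n. smooth_fun (\<eta> n)" "\<And>n p. cmod (\<eta> n p) \<le> M"
    "\<And>n p. norm p \<le> 1 / real (Suc n) \<Longrightarrow> \<eta> n p = (0::complex)"
    "\<And>p. p \<noteq> 0 \<Longrightarrow> eventually (\<lambda>n. \<eta> n p = 1) sequentially"
    "\<And>n p b. b \<in> Basis \<Longrightarrow> cmod (dir_deriv b (\<eta> n) p) \<le> C * (real (Suc n) * indicator (small_square n) p)"
    by (rule cutoff_exists) blast
  have um: "u \<in> borel_measurable borel" and u0: "\<And>p. p \<notin> D \<Longrightarrow> u p = 0"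
    and hm: "h \<in> borel_measurable borel" and h0: "\<And>p. p \<notin> D \<Longrightarrow> h p = 0"
    using u h by (auto simp: represents_def)
  note w = good_weight_1[OF D]
  show ?thesis
    unfolding represents_def
  proof (intro conjI ballI)
    fix \<phi> assume \<phi>: "\<phi> \<in> test_functions D"
    have eq: "(\<integral>p. \<eta> n p * (u p * \<phi> p) \<partial>lborel) = (\<integral>p. \<eta> n p * (h p * \<phi> p) \<partial>lborel)" for n
    proof -
      have e: "1 / real (Suc n) > 0" by simp
      have \<psi>: "(\<lambda>p. \<eta> n p * \<phi> p) \<in> test_functions (D - {0})"
        by (rule cutoff_test_functions[OF \<phi> \<eta>(1) \<eta>(3) e])
      then have "(\<lambda>p. \<eta> n p * \<phi> p) \<in> test_functions D" using test_functions_mono[of "D - {0}" D] by blast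
      with \<psi> u(1) h(1) have "(\<integral>p. u p * (\<eta> n p * \<phi> p) \<partial>lborel) = (\<integral>p. h p * (\<eta> n p * \<phi> p) \<partial>lborel)"
        unfolding represents_def by metis
      then show ?thesis by (simp only: mult.left_commute)
    qed
    have "(\<lambda>n. \<integral>p. \<eta> n p * (u p * \<phi> p) \<partial>lborel) \<longlonglongrightarrow> (\<integral>p. u p * \<phi> p \<partial>lborel)"
      "(\<lambda>n. \<integral>p. \<eta> n p * (h p * \<phi> p) \<partial>lborel) \<longlonglongrightarrow> (\<integral>p. h p * \<phi> p \<partial>lborel)"
      by (rule cutoff_limit[OF integrable_test[OF w um u0 u(2) \<phi>] \<eta>(1,2,4)]
          cutoff_limit[OF integrable_test[OF w hm h0 h(2) \<phi>] \<eta>(1,2,4)] | assumption)+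
    then have "(\<integral>p. u p * \<phi> p \<partial>lborel) = (\<integral>p. h p * \<phi> p \<partial>lborel)"
      unfolding eq using LIMSEQ_unique by blast
    then show "T \<phi> = (\<integral>p. h p * \<phi> p \<partial>lborel)"
      using u(1) \<phi> by (simp add: represents_def)
  qed (use hm h0 in auto)
qed

definition dist_Sobolev_sqnorm :: "nat \<Rightarrow> (real \<times> real) set \<Rightarrow> (real \<times> real) distrib \<Rightarrow> ennreal" where
  "dist_Sobolev_sqnorm m D T = (\<Sum>(a, b) \<in> {(a, b). a + b \<le> m}. dist_L2_sqnorm (\<lambda>_. 1) D (mixed a b T))"

lemma finite_order_pairs: "finite {(a, b). a + b \<le> (m::nat)}"
  by (rule finite_subset[of _ "{..m} \<times> {..m}"]) auto

text \<open>If the right side is finite, all derivatives up to order m have square integrable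
  representatives off the origin, and these are extended across it order by order.\<close>

lemma dist_Sobolev_sqnorm_remove_origin:
  assumes D: "open D" and u: "represents D T u" "sqnorm (\<lambda>_. 1) u < \<infinity>"
  shows "dist_Sobolev_sqnorm m D T \<le> dist_Sobolev_sqnorm m (D - {0}) T"
proof (cases "dist_Sobolev_sqnorm m (D - {0}) T < \<infinity>")
  case True
  let ?N = "dist_L2_sqnorm (\<lambda>_. 1)"
  have D0: "open (D - {0})" using D by (simp add: open_delete)
  note w = good_weight_1[OF D] and w0 = good_weight_1[OF D0]
  have fin: "?N (D - {0}) (mixed a b T) < \<infinity>" if "a + b \<le> m" for a b
  proof -
    have "?N (D - {0}) (mixed a b T) \<le> dist_Sobolev_sqnorm m (D - {0}) T"
      unfolding dist_Sobolev_sqnorm_def using that member_le_sum[of "(a, b)" "{(a, b). a + b \<le> m}" "\<lambda>(a, b). ?N (D - {0}) (mixed a b T)"] finite_order_pairs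
      by simp
    then show ?thesis using True by (rule le_less_trans)
  qed
  \<comment> \<open>Every representative has to extend, because the norm is an infimum over all of
    them.\<close>
  have rep: "represents D (mixed a b T) h"
    if "a + b \<le> m" "represents (D - {0}) (mixed a b T) h" "sqnorm (\<lambda>_. 1) h < \<infinity>" for a b h
    using that
  proof (induction "a + b" arbitrary: a b h)
    case 0
    then show ?case using represents_origin_removable[OF D u] by simp
  next
    case (Suc n)
    show ?case
    proof (cases a)
      case (Suc a')
      have ab: "n = a' + b" "a' + b \<le> m" using Suc.hyps(2) Suc.prems(1) \<open>a = Suc a'\<close> by auto
      obtain g where g: "represents (D - {0}) (mixed a' b T) g" "sqnorm (\<lambda>_. 1) g < \<infinity>"
        using dist_L2_sqnorm_less[OF w0 fin[OF ab(2)]] by blast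
      from represents_origin_removable_deriv[OF D Basis_real2(1) Suc.hyps(1)[OF ab g] g(2)]
      show ?thesis using Suc.prems(2,3) by (simp add: \<open>a = Suc a'\<close>)
    next
      case 0
      then obtain b' where b: "b = Suc b'" using Suc.hyps(2) by (cases b) auto
      have ab: "n = 0 + b'" "0 + b' \<le> m" using Suc.hyps(2) Suc.prems(1) 0 b by auto
      obtain g where g: "represents (D - {0}) (mixed 0 b' T) g" "sqnorm (\<lambda>_. 1) g < \<infinity>"
        using dist_L2_sqnorm_less[OF w0 fin[OF ab(2)]] by blast
      from represents_origin_removable_deriv[OF D Basis_real2(2) Suc.hyps(1)[OF ab g] g(2)]
      show ?thesis using Suc.prems(2,3) by (simp add: 0 b)
    qed
  qed
  have "?N D (mixed a b T) \<le> ?N (D - {0}) (mixed a b T)" if "a + b \<le> m" for a b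
  proof -
    have "?N D (mixed a b T) \<le> ennreal 1 * ?N (D - {0}) (mixed a b T)"
      by (rule dist_L2_sqnorm_mono[OF w0 w]) (use rep[OF that] in auto)
    then show ?thesis by simp
  qed
  then show ?thesis unfolding dist_Sobolev_sqnorm_def by (intro sum_mono) auto
next
  case False
  then show ?thesis by (simp add: less_top[symmetric])
qed

lemma dist_L2_sqnorm_restrict:
  assumes "open D" shows "dist_L2_sqnorm (\<lambda>_. 1) (D - {0 :: real \<times> real}) T \<le> dist_L2_sqnorm (\<lambda>_. 1) D T"
proof -
  have "dist_L2_sqnorm (\<lambda>_. 1) (D - {0}) T \<le> ennreal 1 * dist_L2_sqnorm (\<lambda>_. 1) D T"
  proof (rule dist_L2_sqnorm_mono)
    fix f assume f: "represents D T f"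
    \<comment> \<open>Representing functions vanish outside their domain, so the value at the origin
      is set to 0.\<close>
    let ?f = "\<lambda>x. indicator (- {0 :: real \<times> real}) x *\<^sub>R f x"
    note ae = AE_lborel_singleton[of "0 :: real \<times> real"]
    have fm: "f \<in> borel_measurable borel" using f by (simp add: represents_def)
    then have fm': "?f \<in> borel_measurable borel" by measurable
    have "represents (D - {0}) T ?f"
      unfolding represents_def
    proof (intro conjI ballI allI impI)
      fix \<phi> assume \<phi>: "\<phi> \<in> test_functions (D - {0})"
      then have "T \<phi> = (\<integral>x. f x * \<phi> x \<partial>lborel)"
        using f test_functions_mono[of "D - {0}" D] by (auto simp: represents_def)
      also have "\<dots> = (\<integral>x. ?f x * \<phi> x \<partial>lborel)"
        using fm fm' test_functions_measurable[OF \<phi>] eventually_mono[OF ae, of "\<lambda>x. f x * \<phi> x = ?f x * \<phi> x"]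
        by (intro integral_cong_AE) auto
      finally show "T \<phi> = (\<integral>x. ?f x * \<phi> x \<partial>lborel)" .
    qed (use f fm' in \<open>auto simp: represents_def\<close>)
    moreover have "sqnorm (\<lambda>_. 1) ?f = sqnorm (\<lambda>_. 1) f"
      unfolding sqnorm_def using eventually_mono[OF ae, of "\<lambda>x. ennreal (1 * (cmod (?f x))\<^sup>2) = ennreal (1 * (cmod (f x))\<^sup>2)"]
      by (intro nn_integral_cong_AE) auto
    ultimately show "\<exists>g. represents (D - {0}) T g \<and> sqnorm (\<lambda>_. 1) g \<le> ennreal 1 * sqnorm (\<lambda>_. 1) f"
      by (intro exI[of _ ?f]) simp
  qed (use assms in \<open>auto intro!: good_weight_1 simp: open_delete\<close>)
  then show ?thesis by simp
qed

lemma dist_Sobolev_sqnorm_restrict: "open D \<Longrightarrow> dist_Sobolev_sqnorm m (D - {0}) T \<le> dist_Sobolev_sqnorm m D T"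
  unfolding dist_Sobolev_sqnorm_def by (intro sum_mono) (auto intro: dist_L2_sqnorm_restrict)

section \<open>Equivalence of the norms\<close>

text \<open>An index bundles mode, domain and functions; the single constant serves the whole index
  set, which is the independence of \<open>k\<close> and of the domain.\<close>

definition dominated :: "'i set \<Rightarrow> ('i \<Rightarrow> ennreal) \<Rightarrow> ('i \<Rightarrow> ennreal) \<Rightarrow> bool" where
  "dominated I f g \<longleftrightarrow> (\<exists>C::real. C > 0 \<and> (\<forall>i\<in>I. f i \<le> ennreal C * g i))"

lemma dominatedI: "0 < C \<Longrightarrow> (\<And>i. i \<in> I \<Longrightarrow> f i \<le> ennreal C * g i) \<Longrightarrow> dominated I f g"
  by (auto simp: dominated_def)

lemma dominatedE:
  assumes "dominated I f g"
  obtains C where "0 < C" "\<And>i. i \<in> I \<Longrightarrow> f i \<le> ennreal C * g i"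
  using assms by (auto simp: dominated_def)

lemma dominated_le: "(\<And>i. i \<in> I \<Longrightarrow> f i \<le> g i) \<Longrightarrow> dominated I f g"
  by (rule dominatedI[of 1]) auto

lemma dominated_subset: "dominated I f g \<Longrightarrow> J \<subseteq> I \<Longrightarrow> dominated J f g"
  by (auto simp: dominated_def)

lemma dominated_trans:
  assumes "dominated I f g" "dominated I g h" shows "dominated I f h"
proof -
  obtain C where C: "0 < C" "\<And>i. i \<in> I \<Longrightarrow> f i \<le> ennreal C * g i" using assms(1) by (rule dominatedE) blast
  obtain D where D: "0 < D" "\<And>i. i \<in> I \<Longrightarrow> g i \<le> ennreal D * h i" using assms(2) by (rule dominatedE) blast
  show ?thesis
  proof (rule dominatedI[of "C * D"])
    fix i assume i: "i \<in> I"
    have "f i \<le> ennreal C * (ennreal D * h i)" using C(2)[OF i] D(2)[OF i] by (meson mult_left_mono order_trans zero_le)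
    then show "f i \<le> ennreal (C * D) * h i" using C(1) D(1) by (simp add: ennreal_mult mult.assoc)
  qed (use C D in simp)
qed

lemma dominated_add:
  assumes "dominated I f h" "dominated I g h" shows "dominated I (\<lambda>i. f i + g i) h"
proof -
  obtain C where C: "0 < C" "\<And>i. i \<in> I \<Longrightarrow> f i \<le> ennreal C * h i" using assms(1) by (rule dominatedE) blast
  obtain D where D: "0 < D" "\<And>i. i \<in> I \<Longrightarrow> g i \<le> ennreal D * h i" using assms(2) by (rule dominatedE) blast
  show ?thesis
  proof (rule dominatedI[of "C + D"])
    fix i assume i: "i \<in> I"
    show "f i + g i \<le> ennreal (C + D) * h i"
      using add_mono[OF C(2)[OF i] D(2)[OF i]] C(1) D(1) by (simp add: ennreal_plus distrib_right)
  qed (use C D in simp)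
qed

lemma dominated_mono:
  assumes "dominated I f g" "\<And>i. i \<in> I \<Longrightarrow> g i \<le> h i" shows "dominated I f h"
  using assms(1) dominated_le[OF assms(2)] by (rule dominated_trans)

lemma dominated_cong:
  assumes "dominated I f g" "\<And>i. i \<in> I \<Longrightarrow> f i = f' i" "\<And>i. i \<in> I \<Longrightarrow> g i = g' i" shows "dominated I f' g'"
  using assms by (auto simp: dominated_def)

lemma dominated_add_mono:
  assumes "dominated I f f'" "dominated I g g'" shows "dominated I (\<lambda>i. f i + g i) (\<lambda>i. f' i + g' i)"
  by (intro dominated_add dominated_mono[OF assms(1)] dominated_mono[OF assms(2)]) simp_all

lemma dominated_sum:
  assumes "finite A" "\<And>a. a \<in> A \<Longrightarrow> dominated I (f a) g" shows "dominated I (\<lambda>i. \<Sum>a\<in>A. f a i) g"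
  using assms by (induction A rule: finite_induct) (auto intro: dominated_add dominated_le)

lemma dominated_sum_mono:
  assumes "finite A" "\<And>a. a \<in> A \<Longrightarrow> dominated I (f a) (g a)"
  shows "dominated I (\<lambda>i. \<Sum>a\<in>A. f a i) (\<lambda>i. \<Sum>a\<in>A. g a i)"
  by (rule dominated_sum[OF assms(1)], rule dominated_mono[OF assms(2)])
    (auto intro!: member_le_sum[of _ A "\<lambda>a. g a _"] assms(1))

lemma dominated_Un:
  assumes "dominated I f g" "dominated J f g" shows "dominated (I \<union> J) f g"
proof -
  obtain C where C: "0 < C" "\<And>i. i \<in> I \<Longrightarrow> f i \<le> ennreal C * g i" using assms(1) by (rule dominatedE) blast
  obtain D where D: "0 < D" "\<And>i. i \<in> J \<Longrightarrow> f i \<le> ennreal D * g i" using assms(2) by (rule dominatedE) blast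
  show ?thesis
  proof (rule dominatedI[of "max C D"])
    fix i assume i: "i \<in> I \<union> J"
    have "ennreal C * g i \<le> ennreal (max C D) * g i" "ennreal D * g i \<le> ennreal (max C D) * g i"
      by (auto intro!: mult_right_mono ennreal_leI)
    then show "f i \<le> ennreal (max C D) * g i" using i C(2) D(2) by (meson Un_iff order_trans)
  qed (use C in simp)
qed

lemma dominated_UN:
  assumes "finite A" "\<And>a. a \<in> A \<Longrightarrow> dominated (I a) f g" shows "dominated (\<Union>a\<in>A. I a) f g"
  using assms by (induction A rule: finite_induct) (auto intro: dominated_Un dominated_le)

lemma dominated_power2: "(\<And>i. i \<in> I \<Longrightarrow> f i \<le> 2 ^ j * g i) \<Longrightarrow> dominated I f g"
  by (rule dominatedI[of "2 ^ j"]) (auto simp: ennreal_power[symmetric])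

section \<open>Equivalence for a single mode away from the origin\<close>

definition euler_dist_sqnorm :: "real set \<Rightarrow> real distrib \<Rightarrow> nat \<Rightarrow> complex poly \<Rightarrow> ennreal" where
  "euler_dist_sqnorm U S j p = dist_L2_sqnorm axi_weight U (euler_dist S j p)"

definition dist_C_sqnorm :: "nat \<Rightarrow> nat \<Rightarrow> real set \<Rightarrow> real distrib \<Rightarrow> ennreal" where
  "dist_C_sqnorm m k U S = (\<Sum>j\<le>m. Csum j k (euler_dist_sqnorm U S j))"

definition meridian_dist :: "real set \<Rightarrow> real distrib \<Rightarrow> bool" where
  "meridian_dist U S \<longleftrightarrow> open U \<and> U \<subseteq> {0<..} \<and> linear_dist U S"

lemma quasi_euler_dist_sqnorm: "meridian_dist U S \<Longrightarrow> quasi (euler_dist_sqnorm U S j)"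
  unfolding euler_dist_sqnorm_def[abs_def] meridian_dist_def by (intro quasi_euler good_weight_axi) auto

text \<open>Changing the sign of \<kappa> exchanges the two kinds of shifts, so only |\<kappa>|
  matters.\<close>

lemma Hsum_int: "(\<Sum>a\<le>j. \<nu> (hpoly (of_int \<kappa>) a (j - a))) = Hsum j (nat \<bar>\<kappa>\<bar>) \<nu>"
proof (cases "\<kappa> \<ge> 0")
  case True
  then show ?thesis by (simp add: Hsum_def)
next
  case False
  then have "of_int \<kappa> = - (of_nat (nat \<bar>\<kappa>\<bar>) :: complex)" by simp
  then have "(\<Sum>a\<le>j. \<nu> (hpoly (of_int \<kappa>) a (j - a))) = (\<Sum>a\<le>j. \<nu> (hpoly (of_nat (nat \<bar>\<kappa>\<bar>)) (j - a) a))"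
    by (simp only: hpoly_uminus)
  also have "\<dots> = Hsum j (nat \<bar>\<kappa>\<bar>) \<nu>"
    unfolding Hsum_def by (rule sum.reindex_bij_witness[where i = "\<lambda>a. j - a" and j = "\<lambda>a. j - a"]) auto
  finally show ?thesis .
qed

abbreviation "scalar_data \<equiv> {(\<kappa>, U, S). meridian_dist U S}"

text \<open>A chain at a fixed order: Cartesian words, mode shifting words, \<open>Hsum\<close>,
  \<open>Csum\<close>.\<close>

lemma xynorm_Csum:
  shows "dominated scalar_data (\<lambda>(\<kappa>, U, S). xynorm (annulus U) j (tdist \<kappa> S 0 0)) (\<lambda>(\<kappa>, U, S). Csum j (nat \<bar>\<kappa>\<bar>) (euler_dist_sqnorm U S j))"
    "dominated scalar_data (\<lambda>(\<kappa>, U, S). Csum j (nat \<bar>\<kappa>\<bar>) (euler_dist_sqnorm U S j)) (\<lambda>(\<kappa>, U, S). xynorm (annulus U) j (tdist \<kappa> S 0 0))"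
proof -
  let ?xy = "\<lambda>(\<kappa>, U, S). xynorm (annulus U) j (tdist \<kappa> S 0 0)"
  let ?pm = "\<lambda>(\<kappa>, U, S). pmnorm (annulus U) j (tdist \<kappa> S 0 0)"
  let ?H = "\<lambda>(\<kappa>, U, S). Hsum j (nat \<bar>\<kappa>\<bar>) (euler_dist_sqnorm U S j)"
  let ?C = "\<lambda>(\<kappa>, U, S). Csum j (nat \<bar>\<kappa>\<bar>) (euler_dist_sqnorm U S j)"
  have 1: "dominated scalar_data ?xy ?pm" "dominated scalar_data ?pm ?xy"
    using xynorm_pmnorm[of j] by (force simp: dominated_def meridian_dist_def open_annulus)+
  have H: "Hsum j (nat \<bar>\<kappa>\<bar>) (euler_dist_sqnorm U S j) = (\<Sum>n\<le>j. euler_dist_sqnorm U S j (hpoly (of_int \<kappa>) n (j - n)))" for \<kappa> U S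
    by (rule Hsum_int[symmetric])
  have 2: "dominated scalar_data ?pm ?H"
    by (rule dominated_power2[of _ _ j]) (use pmnorm_tdist(2)[where a = 0 and b = 0 and i = j] in \<open>auto simp: H euler_dist_sqnorm_def meridian_dist_def\<close>)
  have 3: "dominated scalar_data ?H ?pm"
  proof -
    have "dominated scalar_data (\<lambda>i. \<Sum>n\<in>{..j}. (\<lambda>(\<kappa>, U, S). euler_dist_sqnorm U S j (hpoly (of_int \<kappa>) n (j - n))) i) ?pm"
      by (intro dominated_sum dominated_le)
        (use pmnorm_tdist(1)[where a = 0 and b = 0 and i = j] in \<open>auto simp: euler_dist_sqnorm_def meridian_dist_def\<close>)
    then show ?thesis by (rule dominated_cong) (auto simp: H)
  qed
  have 4: "dominated scalar_data ?H ?C" "dominated scalar_data ?C ?H"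
    using Hsum_le_Csum[of j] Csum_le_Hsum[of j] quasi_euler_dist_sqnorm by (force simp: dominated_def)+
  show "dominated scalar_data ?xy ?C" using 1(1) 2 4(1) by (blast intro: dominated_trans)
  show "dominated scalar_data ?C ?xy" using 4(2) 3 1(2) by (blast intro: dominated_trans)
qed

lemma dist_Sobolev_C_sqnorm:
  shows "dominated scalar_data (\<lambda>(\<kappa>, U, S). dist_Sobolev_sqnorm m (annulus U) (tdist \<kappa> S 0 0)) (\<lambda>(\<kappa>, U, S). dist_C_sqnorm m (nat \<bar>\<kappa>\<bar>) U S)"
    "dominated scalar_data (\<lambda>(\<kappa>, U, S). dist_C_sqnorm m (nat \<bar>\<kappa>\<bar>) U S) (\<lambda>(\<kappa>, U, S). dist_Sobolev_sqnorm m (annulus U) (tdist \<kappa> S 0 0))"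
proof -
  let ?N = "\<lambda>a b (\<kappa>, U, S). dist_L2_sqnorm (\<lambda>_. 1) (annulus U) (mixed a b (tdist \<kappa> S 0 0))"
  let ?xy = "\<lambda>j (\<kappa>, U, S). xynorm (annulus U) j (tdist \<kappa> S 0 0)"
  let ?C = "\<lambda>j (\<kappa>, U, S). Csum j (nat \<bar>\<kappa>\<bar>) (euler_dist_sqnorm U S j)"
  let ?dist_C_sqnorm = "\<lambda>(\<kappa>, U, S). dist_C_sqnorm m (nat \<bar>\<kappa>\<bar>) U S"
  let ?dist_Sobolev_sqnorm = "\<lambda>(\<kappa>, U, S). dist_Sobolev_sqnorm m (annulus U) (tdist \<kappa> S 0 0)"
  have dist_Sobolev_sqnorm: "(\<lambda>i. \<Sum>ab\<in>{(a, b). a + b \<le> m}. ?N (fst ab) (snd ab) i) = ?dist_Sobolev_sqnorm"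
    by (auto simp: dist_Sobolev_sqnorm_def case_prod_beta' fun_eq_iff)
  have dist_C_sqnorm: "(\<lambda>i. \<Sum>j\<in>{..m}. ?C j i) = ?dist_C_sqnorm"
    by (auto simp: dist_C_sqnorm_def fun_eq_iff)
  have "dominated scalar_data (?N a b) ?dist_C_sqnorm" if "a + b \<le> m" for a b
  proof -
    have "dominated scalar_data (?N a b) (?xy (a + b))"
      by (rule dominated_le) (auto simp: sqnorm_mixed_le_xynorm)
    from dominated_trans[OF this xynorm_Csum(1)] show ?thesis
    proof (rule dominated_mono)
      fix i
      show "?C (a + b) i \<le> ?dist_C_sqnorm i" unfolding dist_C_sqnorm[symmetric] using that by (intro member_le_sum) auto
    qed
  qed
  then have "dominated scalar_data (\<lambda>i. \<Sum>ab\<in>{(a, b). a + b \<le> m}. ?N (fst ab) (snd ab) i) ?dist_C_sqnorm"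
    by (intro dominated_sum finite_order_pairs) auto
  then show "dominated scalar_data ?dist_Sobolev_sqnorm ?dist_C_sqnorm" unfolding dist_Sobolev_sqnorm .
  have "dominated scalar_data (?C j) ?dist_Sobolev_sqnorm" if "j \<le> m" for j
  proof -
    have "dominated scalar_data (?xy j) (\<lambda>i. \<Sum>a\<in>{..j}. ?N a (j - a) i)"
      by (rule dominated_power2[of _ _ j]) (auto intro: xynorm_le_sqnorm_mixed)
    from dominated_trans[OF xynorm_Csum(2) this] show ?thesis
    proof (rule dominated_mono)
      fix i
      have "(\<Sum>a\<in>{..j}. ?N a (j - a) i) = (\<Sum>ab\<in>(\<lambda>a. (a, j - a)) ` {..j}. ?N (fst ab) (snd ab) i)"
        by (subst sum.reindex) (auto simp: inj_on_def)
      also have "\<dots> \<le> ?dist_Sobolev_sqnorm i"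
        unfolding dist_Sobolev_sqnorm[symmetric] using that by (intro sum_mono2 finite_order_pairs) auto
      finally show "(\<Sum>a\<in>{..j}. ?N a (j - a) i) \<le> ?dist_Sobolev_sqnorm i" .
    qed
  qed
  then have "dominated scalar_data (\<lambda>i. \<Sum>j\<in>{..m}. ?C j i) ?dist_Sobolev_sqnorm"
    by (intro dominated_sum) auto
  then show "dominated scalar_data ?dist_C_sqnorm ?dist_Sobolev_sqnorm" unfolding dist_C_sqnorm .
qed

lemma mixed_eq: "dist_eq U T T' \<Longrightarrow> dist_eq U (mixed a b T) (mixed a b T')"
  by (intro dist_deriv_pow_eq Basis_real2)

lemma dist_Sobolev_sqnorm_cong: "dist_eq U T T' \<Longrightarrow> dist_Sobolev_sqnorm m U T = dist_Sobolev_sqnorm m U T'"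
  unfolding dist_Sobolev_sqnorm_def using dist_eq_sqnorm[OF mixed_eq] by (intro sum.cong) auto

lemma dist_deriv_pow_linear:
  "(dist_deriv v ^^ n) (\<lambda>\<phi>. x * S \<phi> + y * T \<phi>) = (\<lambda>\<phi>. x * (dist_deriv v ^^ n) S \<phi> + y * (dist_deriv v ^^ n) T \<phi>)"
  by (induction n) (auto simp: dist_deriv_def algebra_simps)

lemma dist_Sobolev_sqnorm_linear:
  assumes "open U"
  shows "dist_Sobolev_sqnorm m U (\<lambda>\<phi>. x * S \<phi> + y * T \<phi>) \<le> ennreal (2 * ((cmod x)\<^sup>2 + (cmod y)\<^sup>2)) * (dist_Sobolev_sqnorm m U S + dist_Sobolev_sqnorm m U T)"
proof -
  let ?P = "{(a, b). a + b \<le> m}" and ?N = "\<lambda>T (a, b). dist_L2_sqnorm (\<lambda>_. 1) U (mixed a b T)"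
  have "dist_Sobolev_sqnorm m U (\<lambda>\<phi>. x * S \<phi> + y * T \<phi>) \<le> (\<Sum>ab\<in>?P. ennreal (2 * ((cmod x)\<^sup>2 + (cmod y)\<^sup>2)) * (?N S ab + ?N T ab))"
    unfolding dist_Sobolev_sqnorm_def dist_deriv_pow_linear
  proof (rule sum_mono)
    fix ab
    show "(case ab of (a, b) \<Rightarrow> dist_L2_sqnorm (\<lambda>_. 1) U (\<lambda>\<phi>. x * mixed a b S \<phi> + y * mixed a b T \<phi>))
      \<le> ennreal (2 * ((cmod x)\<^sup>2 + (cmod y)\<^sup>2)) * (?N S ab + ?N T ab)"
      by (cases ab) (simp only: prod.case, rule dist_L2_sqnorm_linear[OF good_weight_1[OF assms]])
  qed
  also have "\<dots> = ennreal (2 * ((cmod x)\<^sup>2 + (cmod y)\<^sup>2)) * (dist_Sobolev_sqnorm m U S + dist_Sobolev_sqnorm m U T)"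
    by (simp only: sum_distrib_left[symmetric] sum.distrib dist_Sobolev_sqnorm_def)
  finally show ?thesis .
qed

lemma euler_dist_dist_linear:
  "euler_dist (\<lambda>\<phi>. x * S \<phi> + y * T \<phi>) j p = (\<lambda>\<phi>. x * euler_dist S j p \<phi> + y * euler_dist T j p \<phi>)"
  by (rule ext) (simp add: euler_dist_def sum_distrib_left sum.distrib[symmetric] algebra_simps)

lemma Csum_linear:
  assumes "\<And>p. \<nu> p \<le> e * (\<mu> p + \<mu>' p)"
  shows "Csum j k \<nu> \<le> e * (Csum j k \<mu> + Csum j k \<mu>')"
proof -
  have *: "sum (\<lambda>l. \<nu> (f l)) A \<le> e * (sum (\<lambda>l. \<mu> (f l)) A + sum (\<lambda>l. \<mu>' (f l)) A)" for f :: "nat \<Rightarrow> complex poly" and A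
  proof -
    have "sum (\<lambda>l. \<nu> (f l)) A \<le> sum (\<lambda>l. e * (\<mu> (f l) + \<mu>' (f l))) A" by (intro sum_mono assms)
    then show ?thesis by (simp only: sum_distrib_left[symmetric] sum.distrib)
  qed
  have "Csum j k \<nu> \<le> e * ((\<Sum>l\<in>{..min k j}. \<mu> (smult (of_nat k ^ l) (fall l j))) + (\<Sum>l\<in>{..min k j}. \<mu>' (smult (of_nat k ^ l) (fall l j))))
     + e * ((\<Sum>l\<in>{1..(j - k) div 2}. \<mu> (spoly k l j)) + (\<Sum>l\<in>{1..(j - k) div 2}. \<mu>' (spoly k l j)))"
    unfolding Csum_def by (intro add_mono *)
  also have "\<dots> = e * (Csum j k \<mu> + Csum j k \<mu>')"
    unfolding Csum_def by (simp only: distrib_left add_ac)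
  finally show ?thesis .
qed

lemma dist_C_sqnorm_linear:
  assumes "open U" "U \<subseteq> {0<..}"
  shows "dist_C_sqnorm m k U (\<lambda>\<phi>. x * S \<phi> + y * T \<phi>) \<le> ennreal (2 * ((cmod x)\<^sup>2 + (cmod y)\<^sup>2)) * (dist_C_sqnorm m k U S + dist_C_sqnorm m k U T)"
proof -
  have "dist_C_sqnorm m k U (\<lambda>\<phi>. x * S \<phi> + y * T \<phi>) \<le> (\<Sum>j\<le>m. ennreal (2 * ((cmod x)\<^sup>2 + (cmod y)\<^sup>2)) * (Csum j k (euler_dist_sqnorm U S j) + Csum j k (euler_dist_sqnorm U T j)))"
    unfolding dist_C_sqnorm_def euler_dist_sqnorm_def[abs_def] euler_dist_dist_linear
    by (intro sum_mono Csum_linear dist_L2_sqnorm_linear[OF good_weight_axi[OF assms]])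
  also have "\<dots> = ennreal (2 * ((cmod x)\<^sup>2 + (cmod y)\<^sup>2)) * (dist_C_sqnorm m k U S + dist_C_sqnorm m k U T)"
    by (simp only: sum_distrib_left[symmetric] sum.distrib dist_C_sqnorm_def)
  finally show ?thesis .
qed

lemma euler_dist_cong:
  assumes "dist_eq U S S'" "U \<subseteq> {0<..}" shows "dist_eq U (euler_dist S j p) (euler_dist S' j p)"
  using assms(1) euler_adj_pow_test[OF test_functions_inverse[OF _ assms(2)]]
  by (simp add: dist_eq_def euler_dist_def)

text \<open>For large |k| the weighted norm has the index |k|, while the modes have |k + 1| and |k -
  1|. At orders up to both indices the second sums are empty and the first ones differ by factors (k
  / k')^l with k / k' \<le> 2, whose squares are at most 4^j.\<close>

lemma Csum_change_k:
  assumes "quasi \<nu>" "j \<le> k" "j \<le> k'" "k \<le> k' + 1"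
  shows "Csum j k \<nu> \<le> ennreal (4 ^ j) * Csum j k' \<nu>"
proof -
  have "\<nu> (smult (of_nat k ^ l) (fall l j)) \<le> ennreal (4 ^ j) * \<nu> (smult (of_nat k' ^ l) (fall l j))" if l: "l \<le> j" for l
  proof (cases "l = 0")
    case True
    have "ennreal 1 * \<nu> (fall 0 j) \<le> ennreal (4 ^ j) * \<nu> (fall 0 j)"
      by (intro mult_right_mono ennreal_leI) auto
    then show ?thesis using True by simp
  next
    case False
    then have k': "k' > 0" using l assms(3) by auto
    let ?c = "(of_nat k / of_nat k') ^ l :: complex"
    have "smult (of_nat k ^ l) (fall l j) = smult ?c (smult (of_nat k' ^ l) (fall l j))"
      using k' by (simp add: power_divide)
    then have "\<nu> (smult (of_nat k ^ l) (fall l j)) \<le> ennreal ((cmod ?c)\<^sup>2) * \<nu> (smult (of_nat k' ^ l) (fall l j))"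
      using quasi_smult[OF assms(1)] by metis
    also have "\<dots> \<le> ennreal (4 ^ j) * \<nu> (smult (of_nat k' ^ l) (fall l j))"
    proof (intro mult_right_mono ennreal_leI)
      have "real k / real k' \<le> 2" using assms(4) k' by (simp add: divide_le_eq)
      then have "(real k / real k') ^ l \<le> 2 ^ l" by (intro power_mono) auto
      also have "\<dots> \<le> 2 ^ j" using l by (intro power_increasing) auto
      finally have "((real k / real k') ^ l)\<^sup>2 \<le> (2 ^ j)\<^sup>2" by (intro power_mono) auto
      also have "((2::real) ^ j)\<^sup>2 = 4 ^ j" by (simp add: power2_eq_square power_mult_distrib[symmetric])
      finally show "(cmod ?c)\<^sup>2 \<le> 4 ^ j" by (simp add: norm_power norm_divide)
    qed simp
    finally show ?thesis .
  qed
  moreover have "min k j = j" "min k' j = j" "(j - k) div 2 = 0" "(j - k') div 2 = 0" using assms by auto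
  ultimately show ?thesis
    unfolding Csum_def by (auto simp: sum_distrib_left intro!: sum_mono)
qed

section \<open>Vector fields and their two modes\<close>

lemma borel_measurable_lebesgue_AE:
  fixes f F :: "'a::euclidean_space \<Rightarrow> complex"
  assumes "F \<in> borel_measurable borel" "AE x in lborel. f x = F x"
  shows "f \<in> borel_measurable lebesgue"
proof (rule borel_measurable_AE)
  show "F \<in> borel_measurable lebesgue" using assms(1) by (intro measurable_completion) simp
  show "AE x in lebesgue. F x = f x" using AE_completion[OF assms(2)] by (auto elim: eventually_mono)
qed

lemma dist_of_AE_borel:
  fixes f F :: "'a::euclidean_space \<Rightarrow> complex"
  assumes D: "open D" and F: "F \<in> borel_measurable borel" and ae: "AE x in lborel. x \<in> D \<longrightarrow> f x = F x"
  shows "dist_eq D (dist_of D f) (dist_of D F)"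
  unfolding dist_eq_def
proof
  fix \<phi> assume \<phi>: "\<phi> \<in> test_functions D"
  \<comment> \<open>\<open>f\<close> is controlled on \<open>D\<close> only; patching it with
    \<open>F\<close> outside gives a function measurable on the whole space.\<close>
  define f' where "f' x = (if x \<in> D then f x else F x)" for x
  have "f' \<in> borel_measurable lebesgue"
    by (rule borel_measurable_lebesgue_AE[OF F]) (use ae in \<open>auto simp: f'_def elim: eventually_mono\<close>)
  then have f': "f' \<in> borel_measurable (lebesgue_on D)" by (rule measurable_restrict_space1)
  have "AE x in lebesgue. x \<in> D \<longrightarrow> f' x = F x"
    using AE_completion[OF ae] by (auto simp: f'_def elim: eventually_mono)
  then have "AE x in lebesgue_on D. f' x = F x" using D by (simp add: AE_restrict_space_iff)
  then have "dist_of D f' \<phi> = dist_of D F \<phi>"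
    by (rule dist_of_cong_AE[OF f' borel_imp_lebesgue_on[OF F] _ test_functions_measurable[OF \<phi>]])
  moreover have "dist_of D f' \<phi> = dist_of D f \<phi>"
    unfolding dist_of_def by (intro Bochner_Integration.integral_cong refl) (simp add: f'_def)
  ultimately show "dist_of D f \<phi> = dist_of D F \<phi>" by simp
qed

text \<open>By polar coordinates, the preimage of a null set under the norm is null. This carries
  changes of wr and wt on null sets over to the plane.\<close>

lemma AE_norm:
  assumes "AE r in lborel. P r"
  shows "AE p in (lborel :: (real \<times> real) measure). P (norm p)"
proof -
  obtain N where N: "{r. \<not> P r} \<subseteq> N" "N \<in> null_sets lborel"
    using assms by (auto elim!: AE_E simp: null_sets_def)
  have [measurable]: "N \<in> sets borel" using N(2) by auto
  have n: "(norm :: real \<times> real \<Rightarrow> real) \<in> borel_measurable borel"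
    by (intro borel_measurable_continuous_onI continuous_intros)
  have [measurable]: "(norm :: real \<times> real \<Rightarrow> real) -` N \<in> sets borel"
    using measurable_sets_borel[OF n, of N] by simp
  have "emeasure lborel ((norm :: real \<times> real \<Rightarrow> real) -` N) = (\<integral>\<^sup>+p. indicator ((norm :: real \<times> real \<Rightarrow> real) -` N) p \<partial>lborel)"
    by simp
  also have "\<dots> = (\<integral>\<^sup>+r. (\<integral>\<^sup>+\<theta>. indicator ((norm :: real \<times> real \<Rightarrow> real) -` N) (polar (r, \<theta>)) * indicator angles \<theta> \<partial>lborel) * ennreal r * indicator {0<..} r \<partial>lborel)"
    by (rule nn_integral_polar_iterated) measurable
  also have "\<dots> = (\<integral>\<^sup>+r. 0 \<partial>(lborel :: real measure))"
  proof (rule nn_integral_cong_AE)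
    have "AE r in lborel. r \<notin> N" using N(2) by (rule AE_not_in)
    then show "AE r in lborel. (\<integral>\<^sup>+\<theta>. indicator ((norm :: real \<times> real \<Rightarrow> real) -` N) (polar (r, \<theta>)) * indicator angles \<theta> \<partial>lborel) * ennreal r * indicator {0<..} r = 0"
    proof eventually_elim
      case (elim r)
      show ?case
      proof (cases "r > 0")
        case True
        then have "indicator ((norm :: real \<times> real \<Rightarrow> real) -` N) (polar (r, \<theta>)) = (0 :: ennreal)" for \<theta>
          using elim norm_polar[of r \<theta>] by (simp add: indicator_def)
        then show ?thesis by simp
      qed simp
    qed
  qed
  finally have "(norm :: real \<times> real \<Rightarrow> real) -` N \<in> null_sets lborel" by (simp add: null_sets_def)
  then have "AE p in lborel. p \<notin> (norm :: real \<times> real \<Rightarrow> real) -` N" by (rule AE_not_in)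
  then show ?thesis using N(1) by (auto elim: eventually_mono)
qed

lemma polar_polar_angle:
  assumes "p \<noteq> 0" shows "p = polar (norm p, polar_angle p)"
proof -
  have "Complex (fst p) (snd p) \<noteq> 0" using assms by (cases p) (simp add: complex_eq_iff zero_prod_def)
  moreover have "cmod (Complex (fst p) (snd p)) = norm p" by (cases p) (simp add: cmod_def norm_Pair)
  ultimately have "Complex (fst p) (snd p) = of_real (norm p) * cis (polar_angle p)"
    using rcis_cmod_Arg[of "Complex (fst p) (snd p)"] by (simp add: polar_angle_def rcis_def)
  then show ?thesis
    by (cases p) (simp add: polar_def complex_eq_iff)
qed

lemma field_eq:
  assumes p: "p \<noteq> 0"
  shows "field_x k f g p = (1/2) * lift (k + 1) (\<lambda>r. f r + \<i> * g r) p + (1/2) * lift (k - 1) (\<lambda>r. f r - \<i> * g r) p"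
    "field_y k f g p = (-\<i>/2) * lift (k + 1) (\<lambda>r. f r + \<i> * g r) p + (\<i>/2) * lift (k - 1) (\<lambda>r. f r - \<i> * g r) p"
proof -
  define r \<theta> where "r = norm p" and "\<theta> = polar_angle p"
  have r: "r > 0" using p by (simp add: r_def)
  have pp: "p = polar (r, \<theta>)" unfolding r_def \<theta>_def by (rule polar_polar_angle[OF p])
  have l: "lift n h p = h r * cis (of_int n * \<theta>)" for n h
    unfolding pp by (rule lift_polar[OF r])
  have c: "cis (of_int (k + 1) * \<theta>) = cis \<theta> * cis (of_int k * \<theta>)" "cis (of_int (k - 1) * \<theta>) = cis (- \<theta>) * cis (of_int k * \<theta>)"
    by (simp_all add: cis_mult algebra_simps)
  have cs: "of_real (cos \<theta>) = (1/2) * (cis \<theta> + cis (- \<theta>))" "of_real (sin \<theta>) = (1/2) * (\<i> * cis (- \<theta>) - \<i> * cis \<theta>)"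
    by (simp_all add: complex_eq_iff)
  have e: "exp (\<i> * of_int k * of_real \<theta>) = cis (of_int k * \<theta>)"
    by (simp add: cis_conv_exp mult.assoc)
  show "field_x k f g p = (1/2) * lift (k + 1) (\<lambda>r. f r + \<i> * g r) p + (1/2) * lift (k - 1) (\<lambda>r. f r - \<i> * g r) p"
    "field_y k f g p = (-\<i>/2) * lift (k + 1) (\<lambda>r. f r + \<i> * g r) p + (\<i>/2) * lift (k - 1) (\<lambda>r. f r - \<i> * g r) p"
    unfolding field_x_def field_y_def Let_def r_def[symmetric] \<theta>_def[symmetric] l c e cs
    by (simp_all add: algebra_simps)
qed

lemma open_meridian: "open D \<Longrightarrow> open (meridian D)"
proof -
  assume "open D"
  then have "open ((\<lambda>r::real. (r, 0::real)) -` D)"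
    by (intro open_vimage continuous_intros)
  moreover have "meridian D = {0<..} \<inter> (\<lambda>r::real. (r, 0::real)) -` D" by (auto simp: meridian_def)
  ultimately show ?thesis by (simp only:) (intro open_Int open_greaterThan)
qed

text \<open>A rotation takes p to (|p|, 0). The origin drops out because the meridian contains
  positive radii only.\<close>

lemma annulus_meridian:
  assumes "axisymmetric_domain D" shows "annulus (meridian D) = D - {0}"
proof -
  have rot: "rotation \<theta> q \<in> D" if "q \<in> D" for q \<theta>
    using assms that unfolding axisymmetric_domain_def by blast
  have rp: "rotation \<theta> (r, 0) = polar (r, \<theta>)" for r \<theta> by (simp add: rotation_def polar_def)
  have rn: "rotation (- \<theta>) (polar (r, \<theta>)) = (r, 0)" for r \<theta>
  proof -
    have "cos \<theta> * cos \<theta> + sin \<theta> * sin \<theta> = 1" using sin_cos_squared_add2[of \<theta>] by (simp add: power2_eq_square)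
    then have "r * (cos \<theta> * cos \<theta>) + r * (sin \<theta> * sin \<theta>) = r" by (metis distrib_left mult.right_neutral)
    then show ?thesis by (simp add: rotation_def polar_def algebra_simps)
  qed
  have "p \<in> annulus (meridian D) \<longleftrightarrow> p \<in> D - {0}" for p
  proof (cases "p = 0")
    case False
    define r \<theta> where "r = norm p" and "\<theta> = polar_angle p"
    have pp: "p = polar (r, \<theta>)" unfolding r_def \<theta>_def by (rule polar_polar_angle[OF False])
    have "p \<in> D \<longleftrightarrow> (r, 0) \<in> D"
      using rot[of "(r, 0)" \<theta>] rot[of p "- \<theta>"] rp[of \<theta> r] rn[of \<theta> r] pp by auto
    then show ?thesis using False by (simp add: annulus_def meridian_def r_def)
  qed (simp add: annulus_def meridian_def)
  then show ?thesis by blast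
qed

text \<open>For \<open>s = \<plusminus>1\<close> the radial part of \<open>u\<^sub>x + s\<i>u\<^sub>y\<close>, which has the mode \<open>k + s\<close>.\<close>

definition mode_dist :: "complex \<Rightarrow> real set \<Rightarrow> (real \<Rightarrow> complex) \<Rightarrow> (real \<Rightarrow> complex) \<Rightarrow> real distrib" where
  "mode_dist s U f g = (\<lambda>\<phi>. 1 * dist_of U f \<phi> + (s * \<i>) * dist_of U g \<phi>)"

lemma L2_borel:
  assumes "open U" "f \<in> L2_space axi_weight U"
  obtains g where "g \<in> borel_measurable borel" "\<And>x. x \<notin> U \<Longrightarrow> g x = 0" "sqnorm axi_weight g < \<infinity>"
    "AE x in lborel. x \<in> U \<longrightarrow> f x = g x"
proof -
  have f: "f \<in> borel_measurable (lebesgue_on U)" "L2_sqnorm axi_weight U f < \<infinity>"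
    using assms(2) by (auto simp: L2_space_def)
  obtain g where g: "g \<in> borel_measurable borel" "\<And>x. x \<notin> U \<Longrightarrow> g x = 0" "AE x in lebesgue_on U. f x = g x" "AE x in lborel. x \<in> U \<longrightarrow> f x = g x"
    by (rule borel_representative[OF f(1) assms(1)]) blast
  have m: "axi_weight \<in> borel_measurable borel" unfolding axi_weight_def[abs_def] by measurable
  have "sqnorm axi_weight g = L2_sqnorm axi_weight U g" using L2_sqnorm_borel[OF assms(1) g(1,2) m] by simp
  also have "\<dots> = L2_sqnorm axi_weight U f"
    unfolding L2_sqnorm_def using g(3) by (intro nn_integral_cong_AE) (auto elim!: eventually_mono)
  finally have "sqnorm axi_weight g < \<infinity>" using f(2) by simp
  with g that show ?thesis by blast
qed

text \<open>Splitting the integral of a sum requires integrability against test functions, which is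
  available for the Borel versions f' and g'.\<close>

lemma dist_of_comb_borel:
  assumes U: "open U" "U \<subseteq> {0<..}"
    and f: "f' \<in> borel_measurable borel" "\<And>x. x \<notin> U \<Longrightarrow> f' x = 0" "sqnorm axi_weight f' < \<infinity>" "AE x in lborel. x \<in> U \<longrightarrow> f x = f' x"
    and g: "g' \<in> borel_measurable borel" "\<And>x. x \<notin> U \<Longrightarrow> g' x = 0" "sqnorm axi_weight g' < \<infinity>" "AE x in lborel. x \<in> U \<longrightarrow> g x = g' x"
  shows "represents U (\<lambda>\<phi>. 1 * dist_of U f \<phi> + c * dist_of U g \<phi>) (\<lambda>x. f' x + c * g' x)"
    "sqnorm axi_weight (\<lambda>x. f' x + c * g' x) < \<infinity>"
    "dist_eq U (dist_of U (\<lambda>x. f x + c * g x)) (\<lambda>\<phi>. 1 * dist_of U f \<phi> + c * dist_of U g \<phi>)"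
    "linear_dist U (dist_of U f)"
    "linear_dist U (\<lambda>\<phi>. 1 * dist_of U f \<phi> + c * dist_of U g \<phi>)"
proof -
  note w = good_weight_axi[OF U]
  have m: "axi_weight \<in> borel_measurable borel" unfolding axi_weight_def[abs_def] by measurable
  have fd: "dist_of U f \<phi> = (\<integral>x. f' x * \<phi> x \<partial>lborel)" and gd: "dist_of U g \<phi> = (\<integral>x. g' x * \<phi> x \<partial>lborel)"
    if "\<phi> \<in> test_functions U" for \<phi>
    using dist_of_AE_borel[OF U(1) f(1,4)] dist_of_AE_borel[OF U(1) g(1,4)] that
      dist_of_borel[OF U(1) f(1,2) test_functions_measurable[OF that]] dist_of_borel[OF U(1) g(1,2) test_functions_measurable[OF that]]
    by (simp_all add: dist_eq_def)
  have eq: "1 * dist_of U f \<phi> + c * dist_of U g \<phi> = (\<integral>x. (f' x + c * g' x) * \<phi> x \<partial>lborel)" if "\<phi> \<in> test_functions U" for \<phi>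
    unfolding fd[OF that] gd[OF that] distrib_right mult.assoc
    using integrable_test[OF w f(1,2,3) that] integrable_test[OF w g(1,2,3) that] by simp
  show r: "represents U (\<lambda>\<phi>. 1 * dist_of U f \<phi> + c * dist_of U g \<phi>) (\<lambda>x. f' x + c * g' x)"
    using f g eq by (auto simp: represents_def)
  have cg: "(\<lambda>x. c * g' x) \<in> borel_measurable borel" using g(1) by measurable
  have "sqnorm axi_weight (\<lambda>x. f' x + c * g' x) \<le> 2 * (sqnorm axi_weight f' + sqnorm axi_weight (\<lambda>x. c * g' x))"
    using f g cg by (intro sqnorm_add_le[OF w]) auto
  also have "\<dots> < \<infinity>"
    using f(3) g(3) by (simp add: sqnorm_cmult[OF g(1) m] ennreal_mult_less_top)
  finally show fin: "sqnorm axi_weight (\<lambda>x. f' x + c * g' x) < \<infinity>" .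
  show "dist_eq U (dist_of U (\<lambda>x. f x + c * g x)) (\<lambda>\<phi>. 1 * dist_of U f \<phi> + c * dist_of U g \<phi>)"
  proof -
    have b: "(\<lambda>x. f' x + c * g' x) \<in> borel_measurable borel" using f(1) g(1) by measurable
    have "AE x in lborel. x \<in> U \<longrightarrow> f x + c * g x = f' x + c * g' x"
      using f(4) g(4) by eventually_elim simp
    from dist_of_AE_borel[OF U(1) b this]
    show ?thesis
      using eq dist_of_borel[OF U(1) b _ test_functions_measurable] f(2) g(2) by (simp add: dist_eq_def)
  qed
  have lin: "linear_dist U T" if "represents U T h" "sqnorm axi_weight h < \<infinity>" for T h
  proof -
    have h: "h \<in> borel_measurable borel" "\<And>x. x \<notin> U \<Longrightarrow> h x = 0" using that(1) by (auto simp: represents_def)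
    have e: "dist_of U h \<phi> = T \<phi>" if "\<phi> \<in> test_functions U" for \<phi>
      using dist_of_borel[OF U(1) h(1) h(2) test_functions_measurable[OF that]] \<open>represents U T h\<close> that by (simp add: represents_def)
    have l: "linear_dist U (dist_of U h)" by (rule linear_dist_of[OF w h(1) h(2) that(2)])
    show ?thesis
      unfolding linear_dist_def
    proof (intro conjI ballI allI)
      fix \<phi> \<psi> assume \<phi>: "\<phi> \<in> test_functions U" and \<psi>: "\<psi> \<in> test_functions U"
      show "T (\<lambda>x. \<phi> x + \<psi> x) = T \<phi> + T \<psi>"
        using linear_dist_add[OF l \<phi> \<psi>] by (simp only: e[OF \<phi>] e[OF \<psi>] e[OF test_functions_add[OF \<phi> \<psi>]])
    next
      fix \<phi> and c :: complex assume \<phi>: "\<phi> \<in> test_functions U"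
      show "T (\<lambda>x. c * \<phi> x) = c * T \<phi>"
        using linear_dist_cmult[OF l \<phi>] by (simp only: e[OF \<phi>] e[OF test_functions_cmult[OF \<phi>]])
    qed
  qed
  show "linear_dist U (\<lambda>\<phi>. 1 * dist_of U f \<phi> + c * dist_of U g \<phi>)" by (rule lin[OF r fin])
  show "linear_dist U (dist_of U f)"
    by (rule lin[OF _ f(3)]) (use f fd in \<open>auto simp: represents_def\<close>)
qed

text \<open>\<open>tdist\<close> describes the modes off the origin only. \<open>Tp\<close> and
  \<open>Tm\<close> are given by the lifted functions on all of \<open>D\<close>, so that the
  components of the field are their combinations on \<open>D\<close> itself; the removal of the
  origin is applied to them.\<close>

lemma field_distributions:
  assumes D: "axisymmetric_domain D" and wr: "wr \<in> L2_space axi_weight (meridian D)" and wt: "wt \<in> L2_space axi_weight (meridian D)"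
  defines "U \<equiv> meridian D"
  obtains Tp Tm up um where "represents D Tp up" "sqnorm (\<lambda>_. 1) up < \<infinity>" "represents D Tm um" "sqnorm (\<lambda>_. 1) um < \<infinity>"
    "dist_eq (D - {0}) Tp (tdist (k + 1) (mode_dist 1 U wr wt) 0 0)" "dist_eq (D - {0}) Tm (tdist (k - 1) (mode_dist (-1) U wr wt) 0 0)"
    "dist_eq D (dist_of D (field_x k wr wt)) (\<lambda>\<phi>. (1/2) * Tp \<phi> + (1/2) * Tm \<phi>)"
    "dist_eq D (dist_of D (field_y k wr wt)) (\<lambda>\<phi>. (-\<i>/2) * Tp \<phi> + (\<i>/2) * Tm \<phi>)"
proof -
  have oD: "open D" using D by (simp add: axisymmetric_domain_def)
  have U: "open U" "U \<subseteq> {0<..}" unfolding U_def using open_meridian[OF oD] by (auto simp: meridian_def)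
  have ann: "annulus U = D - {0}" unfolding U_def by (rule annulus_meridian[OF D])
  obtain f where f: "f \<in> borel_measurable borel" "\<And>x. x \<notin> U \<Longrightarrow> f x = 0" "sqnorm axi_weight f < \<infinity>" "AE x in lborel. x \<in> U \<longrightarrow> wr x = f x"
    using L2_borel[OF U(1) wr[folded U_def]] by blast
  obtain g where g: "g \<in> borel_measurable borel" "\<And>x. x \<notin> U \<Longrightarrow> g x = 0" "sqnorm axi_weight g < \<infinity>" "AE x in lborel. x \<in> U \<longrightarrow> wt x = g x"
    using L2_borel[OF U(1) wt[folded U_def]] by blast
  note C = dist_of_comb_borel[OF U f g]
  define h where "h s x = f x + (s * \<i>) * g x" for s x
  have hr: "represents U (mode_dist s U wr wt) (h s)" and hs: "sqnorm axi_weight (h s) < \<infinity>" for s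
    unfolding mode_dist_def h_def[abs_def] using C(1,2) by auto
  have hb: "h s \<in> borel_measurable borel" and h0: "x \<notin> U \<Longrightarrow> h s x = 0" for s x
    using hr[of s] by (auto simp: represents_def)
  define T where "T s n = dist_of D (lift n (h s))" for s n
  have l0: "lift n (h s) p = 0" if "p \<notin> D" for n s p
  proof -
    have "norm p \<notin> U" using that ann by (auto simp: annulus_def)
    then show ?thesis by (simp add: lift_def h0)
  qed
  note lb = lift_measurable[OF hb]
  have Tr: "represents D (T s n) (lift n (h s))" for s n
    unfolding represents_def T_def
    using lb l0 dist_of_borel[OF oD lb l0 test_functions_measurable] by blast
  have Ts: "sqnorm (\<lambda>_. 1) (lift n (h s)) < \<infinity>" for s n
    using sqnorm_lift[OF U(2) hb h0] hs by simp
  have Tt: "dist_eq (D - {0}) (T s n) (tdist n (mode_dist s U wr wt) 0 0)" for s n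
    unfolding dist_eq_def
  proof
    fix \<phi> assume \<phi>: "\<phi> \<in> test_functions (D - {0})"
    then have "\<phi> \<in> test_functions D" using test_functions_mono[of "D - {0}" D] by blast
    then have "T s n \<phi> = (\<integral>p. lift n (h s) p * \<phi> p \<partial>lborel)" using Tr[of s n] by (simp add: represents_def)
    also have "\<dots> = lift_dist n (mode_dist s U wr wt) \<phi>"
      using represents_lift[OF U hr hs, of n s] \<phi> unfolding ann by (simp add: represents_def)
    also have "\<dots> = tdist n (mode_dist s U wr wt) 0 0 \<phi>"
      by (simp add: tdist_def lift_dist_def hpoly_0 euler_dist_1)
    finally show "T s n \<phi> = tdist n (mode_dist s U wr wt) 0 0 \<phi>" .
  qed
  have ae: "AE p in (lborel :: (real \<times> real) measure). p \<noteq> 0 \<and> (norm p \<in> U \<longrightarrow> wr (norm p) = f (norm p) \<and> wt (norm p) = g (norm p))"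
  proof -
    have "AE p in (lborel :: (real \<times> real) measure). (norm p \<in> U \<longrightarrow> wr (norm p) = f (norm p)) \<and> (norm p \<in> U \<longrightarrow> wt (norm p) = g (norm p))"
      using AE_norm[OF f(4)] AE_norm[OF g(4)] by (rule AE_conjI)
    from AE_conjI[OF AE_lborel_singleton[of "0 :: real \<times> real"] this] show ?thesis
      by (rule eventually_mono) simp
  qed
  have F: "AE p in lborel. p \<in> D \<longrightarrow> field_x k wr wt p = (1/2) * lift (k + 1) (h 1) p + (1/2) * lift (k - 1) (h (-1)) p"
    "AE p in lborel. p \<in> D \<longrightarrow> field_y k wr wt p = (-\<i>/2) * lift (k + 1) (h 1) p + (\<i>/2) * lift (k - 1) (h (-1)) p"
  proof -
    have F0: "field_x k wr wt p = (1/2) * lift (k + 1) (h 1) p + (1/2) * lift (k - 1) (h (-1)) p \<and>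
       field_y k wr wt p = (-\<i>/2) * lift (k + 1) (h 1) p + (\<i>/2) * lift (k - 1) (h (-1)) p"
      if p: "p \<in> D" "p \<noteq> 0 \<and> (norm p \<in> U \<longrightarrow> wr (norm p) = f (norm p) \<and> wt (norm p) = g (norm p))" for p
    proof -
      have "norm p \<in> U" using p ann by (auto simp: annulus_def)
      then have "field_x k wr wt p = field_x k f g p" "field_y k wr wt p = field_y k f g p"
        using p by (auto simp: field_x_def field_y_def Let_def)
      moreover have "h 1 = (\<lambda>r. f r + \<i> * g r)" "h (-1) = (\<lambda>r. f r - \<i> * g r)" by (auto simp: h_def)
      ultimately show ?thesis using field_eq[of p k f g] p(2) by simp
    qed
    show "AE p in lborel. p \<in> D \<longrightarrow> field_x k wr wt p = (1/2) * lift (k + 1) (h 1) p + (1/2) * lift (k - 1) (h (-1)) p"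
      "AE p in lborel. p \<in> D \<longrightarrow> field_y k wr wt p = (-\<i>/2) * lift (k + 1) (h 1) p + (\<i>/2) * lift (k - 1) (h (-1)) p"
      by (rule eventually_mono[OF ae], use F0 in blast)+
  qed
  have comb: "dist_eq D (dist_of D (\<lambda>p. x * lift (k + 1) (h 1) p + y * lift (k - 1) (h (-1)) p)) (\<lambda>\<phi>. x * T 1 (k + 1) \<phi> + y * T (-1) (k - 1) \<phi>)" for x y
    unfolding dist_eq_def
  proof
    fix \<phi> assume \<phi>: "\<phi> \<in> test_functions D"
    have b: "(\<lambda>p. x * lift (k + 1) (h 1) p + y * lift (k - 1) (h (-1)) p) \<in> borel_measurable borel"
      using lb by measurable
    have "dist_of D (\<lambda>p. x * lift (k + 1) (h 1) p + y * lift (k - 1) (h (-1)) p) \<phi>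
       = (\<integral>p. x * (lift (k + 1) (h 1) p * \<phi> p) + y * (lift (k - 1) (h (-1)) p * \<phi> p) \<partial>lborel)"
      by (subst dist_of_borel[OF oD b _ test_functions_measurable[OF \<phi>]]) (auto simp: l0 distrib_right mult.assoc)
    also have "\<dots> = x * T 1 (k + 1) \<phi> + y * T (-1) (k - 1) \<phi>"
      using Tr[of 1 "k + 1"] Tr[of "-1" "k - 1"] \<phi> integrable_test[OF good_weight_1[OF oD] lb l0 Ts \<phi>]
      by (simp add: represents_def)
    finally show "dist_of D (\<lambda>p. x * lift (k + 1) (h 1) p + y * lift (k - 1) (h (-1)) p) \<phi> = x * T 1 (k + 1) \<phi> + y * T (-1) (k - 1) \<phi>" .
  qed
  have b: "(\<lambda>p. x * lift (k + 1) (h 1) p + y * lift (k - 1) (h (-1)) p) \<in> borel_measurable borel" for x y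
    using lb by measurable
  show ?thesis
    by (rule that[OF Tr Ts Tr Ts Tt Tt dist_eq_trans[OF dist_of_AE_borel[OF oD b F(1)] comb] dist_eq_trans[OF dist_of_AE_borel[OF oD b F(2)] comb]])
qed

section \<open>Squared norms of a field and of its two modes\<close>

definition field_data :: "(int \<times> (real \<times> real) set \<times> (real \<Rightarrow> complex) \<times> (real \<Rightarrow> complex)) set" where
  "field_data = {(k, D, wr, wt). axisymmetric_domain D \<and>
     wr \<in> L2_space axi_weight (meridian D) \<and> wt \<in> L2_space axi_weight (meridian D)}"

definition H_sq :: "nat \<Rightarrow> int \<times> (real \<times> real) set \<times> (real \<Rightarrow> complex) \<times> (real \<Rightarrow> complex) \<Rightarrow> ennreal" where
  "H_sq m = (\<lambda>(k, D, wr, wt). Sobolev_sqnorm m D (field_x k wr wt) + Sobolev_sqnorm m D (field_y k wr wt))"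

definition mode_C_sq :: "nat \<Rightarrow> complex \<Rightarrow> (int \<Rightarrow> nat) \<Rightarrow> int \<times> (real \<times> real) set \<times> (real \<Rightarrow> complex) \<times> (real \<Rightarrow> complex) \<Rightarrow> ennreal" where
  "mode_C_sq m s n = (\<lambda>(k, D, wr, wt). dist_C_sqnorm m (n k) (meridian D) (mode_dist s (meridian D) wr wt))"

definition components_C_sq :: "nat \<Rightarrow> (int \<Rightarrow> nat) \<Rightarrow> int \<times> (real \<times> real) set \<times> (real \<Rightarrow> complex) \<times> (real \<Rightarrow> complex) \<Rightarrow> ennreal" where
  "components_C_sq m n = (\<lambda>(k, D, wr, wt). dist_C_sqnorm m (n k) (meridian D) (dist_of (meridian D) wr) + dist_C_sqnorm m (n k) (meridian D) (dist_of (meridian D) wt))"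

text \<open>The quantity through which the two norms are compared: each of the two modes, measured
  in the weighted norm with its own index.\<close>

definition modes_sq :: "nat \<Rightarrow> int \<times> (real \<times> real) set \<times> (real \<Rightarrow> complex) \<times> (real \<Rightarrow> complex) \<Rightarrow> ennreal" where
  "modes_sq m = (\<lambda>i. mode_C_sq m 1 (\<lambda>k. nat \<bar>k + 1\<bar>) i + mode_C_sq m (-1) (\<lambda>k. nat \<bar>k - 1\<bar>) i)"

lemma meridian_subset: "meridian D \<subseteq> {0<..}"
  by (auto simp: meridian_def)

lemma field_data_meridian:
  assumes "(k, D, wr, wt) \<in> field_data"
  shows "meridian_dist (meridian D) (mode_dist s (meridian D) wr wt)"
    "linear_dist (meridian D) (dist_of (meridian D) wr)"
    "linear_dist (meridian D) (dist_of (meridian D) wt)"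
    "dist_eq (meridian D) (dist_of (meridian D) (\<lambda>x. wr x + (s * \<i>) * wt x)) (mode_dist s (meridian D) wr wt)"
    "open (meridian D)"
proof -
  have D: "axisymmetric_domain D" and wr: "wr \<in> L2_space axi_weight (meridian D)" and wt: "wt \<in> L2_space axi_weight (meridian D)"
    using assms by (auto simp: field_data_def)
  show o: "open (meridian D)" using D by (intro open_meridian) (simp add: axisymmetric_domain_def)
  obtain f where f: "f \<in> borel_measurable borel" "\<And>x. x \<notin> meridian D \<Longrightarrow> f x = 0" "sqnorm axi_weight f < \<infinity>" "AE x in lborel. x \<in> meridian D \<longrightarrow> wr x = f x"
    using L2_borel[OF o wr] by blast
  obtain g where g: "g \<in> borel_measurable borel" "\<And>x. x \<notin> meridian D \<Longrightarrow> g x = 0" "sqnorm axi_weight g < \<infinity>" "AE x in lborel. x \<in> meridian D \<longrightarrow> wt x = g x"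
    using L2_borel[OF o wt] by blast
  note 1 = dist_of_comb_borel[OF o meridian_subset f g]
  note 2 = dist_of_comb_borel[OF o meridian_subset g f]
  show "linear_dist (meridian D) (dist_of (meridian D) wr)" by (rule 1(4))
  show "linear_dist (meridian D) (dist_of (meridian D) wt)" by (rule 2(4))
  show "dist_eq (meridian D) (dist_of (meridian D) (\<lambda>x. wr x + (s * \<i>) * wt x)) (mode_dist s (meridian D) wr wt)"
    unfolding mode_dist_def by (rule 1(3))
  show "meridian_dist (meridian D) (mode_dist s (meridian D) wr wt)"
    unfolding mode_dist_def meridian_dist_def using 1(5) o meridian_subset by blast
qed

lemma Sobolev_sqnorm_eq: "Sobolev_sqnorm m D u = dist_Sobolev_sqnorm m D (dist_of D u)"
  by (simp add: Sobolev_sqnorm_def dist_Sobolev_sqnorm_def)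

text \<open>The single mode equivalence holds off the origin. The Sobolev norm on \<open>D\<close>
  is bounded from above by removing the origin, from below by restriction to the punctured
  domain.\<close>

lemma H_sq_modes_sq: "dominated field_data (H_sq m) (modes_sq m)" "dominated field_data (modes_sq m) (H_sq m)"
proof -
  obtain C where C: "0 < C" "\<And>i. i \<in> scalar_data \<Longrightarrow> (\<lambda>(\<kappa>, U, S). dist_Sobolev_sqnorm m (annulus U) (tdist \<kappa> S 0 0)) i \<le> ennreal C * (\<lambda>(\<kappa>, U, S). dist_C_sqnorm m (nat \<bar>\<kappa>\<bar>) U S) i"
    by (rule dominatedE[OF dist_Sobolev_C_sqnorm(1)[of m]]) blast
  have Cs: "dist_Sobolev_sqnorm m (annulus U) (tdist \<kappa> S 0 0) \<le> ennreal C * dist_C_sqnorm m (nat \<bar>\<kappa>\<bar>) U S" if "meridian_dist U S" for \<kappa> U S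
    using C(2)[of "(\<kappa>, U, S)"] that by simp
  obtain C' where C': "0 < C'" "\<And>i. i \<in> scalar_data \<Longrightarrow> (\<lambda>(\<kappa>, U, S). dist_C_sqnorm m (nat \<bar>\<kappa>\<bar>) U S) i \<le> ennreal C' * (\<lambda>(\<kappa>, U, S). dist_Sobolev_sqnorm m (annulus U) (tdist \<kappa> S 0 0)) i"
    by (rule dominatedE[OF dist_Sobolev_C_sqnorm(2)[of m]]) blast
  have Cs': "dist_C_sqnorm m (nat \<bar>\<kappa>\<bar>) U S \<le> ennreal C' * dist_Sobolev_sqnorm m (annulus U) (tdist \<kappa> S 0 0)" if "meridian_dist U S" for \<kappa> U S
    using C'(2)[of "(\<kappa>, U, S)"] that by simp
  have "H_sq m i \<le> ennreal (2 * C) * modes_sq m i \<and> modes_sq m i \<le> ennreal (8 * C') * H_sq m i" if "i \<in> field_data" for i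
  proof -
    obtain k D wr wt where i: "i = (k, D, wr, wt)" by (cases i)
    note fd = that[unfolded i]
    have D: "axisymmetric_domain D" "wr \<in> L2_space axi_weight (meridian D)" "wt \<in> L2_space axi_weight (meridian D)"
      using fd by (auto simp: field_data_def)
    have oD: "open D" using D(1) by (simp add: axisymmetric_domain_def)
    define U P M where "U = meridian D" and "P = mode_dist 1 U wr wt" and "M = mode_dist (-1) U wr wt"
    have g: "meridian_dist U P" "meridian_dist U M" unfolding U_def P_def M_def by (rule field_data_meridian(1)[OF fd])+
    obtain Tp Tm up um where Tp: "represents D Tp up" "sqnorm (\<lambda>_. 1) up < \<infinity>" and Tm: "represents D Tm um" "sqnorm (\<lambda>_. 1) um < \<infinity>"
      and t: "dist_eq (D - {0}) Tp (tdist (k + 1) P 0 0)" "dist_eq (D - {0}) Tm (tdist (k - 1) M 0 0)"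
      and xy: "dist_eq D (dist_of D (field_x k wr wt)) (\<lambda>\<phi>. (1/2) * Tp \<phi> + (1/2) * Tm \<phi>)"
        "dist_eq D (dist_of D (field_y k wr wt)) (\<lambda>\<phi>. (-\<i>/2) * Tp \<phi> + (\<i>/2) * Tm \<phi>)"
      unfolding U_def P_def M_def by (rule field_distributions[OF D])
    define X Y where "X = dist_Sobolev_sqnorm m D (dist_of D (field_x k wr wt))" and "Y = dist_Sobolev_sqnorm m D (dist_of D (field_y k wr wt))"
    define p q where "p = dist_C_sqnorm m (nat \<bar>k + 1\<bar>) U P" and "q = dist_C_sqnorm m (nat \<bar>k - 1\<bar>) U M"
    have H: "H_sq m i = X + Y" by (simp add: i H_sq_def Sobolev_sqnorm_eq X_def Y_def)
    have PM: "modes_sq m i = p + q" by (simp add: i modes_sq_def mode_C_sq_def p_def q_def P_def M_def U_def)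
    have ann: "annulus U = D - {0}" unfolding U_def by (rule annulus_meridian[OF D(1)])
    have s: "dist_Sobolev_sqnorm m (D - {0}) Tp = dist_Sobolev_sqnorm m (annulus U) (tdist (k + 1) P 0 0)"
      "dist_Sobolev_sqnorm m (D - {0}) Tm = dist_Sobolev_sqnorm m (annulus U) (tdist (k - 1) M 0 0)"
      unfolding ann by (rule dist_Sobolev_sqnorm_cong[OF t(1)], rule dist_Sobolev_sqnorm_cong[OF t(2)])
    have up: "dist_Sobolev_sqnorm m D Tp \<le> ennreal C * p" "dist_Sobolev_sqnorm m D Tm \<le> ennreal C * q"
      using dist_Sobolev_sqnorm_remove_origin[OF oD Tp, of m] dist_Sobolev_sqnorm_remove_origin[OF oD Tm, of m] Cs[OF g(1), of "k + 1"] Cs[OF g(2), of "k - 1"]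
      unfolding s p_def q_def by (auto intro: order_trans)
    \<comment> \<open>The constant is 2 (1/4 + 1/4) = 1.\<close>
    have "X \<le> 1 * (dist_Sobolev_sqnorm m D Tp + dist_Sobolev_sqnorm m D Tm)" "Y \<le> 1 * (dist_Sobolev_sqnorm m D Tp + dist_Sobolev_sqnorm m D Tm)"
      using dist_Sobolev_sqnorm_linear[OF oD, of m "1/2" Tp "1/2" Tm] dist_Sobolev_sqnorm_linear[OF oD, of m "-\<i>/2" Tp "\<i>/2" Tm]
      unfolding X_def Y_def dist_Sobolev_sqnorm_cong[OF xy(1)] dist_Sobolev_sqnorm_cong[OF xy(2)] by (simp_all add: norm_divide power2_eq_square)
    then have "X + Y \<le> 2 * (dist_Sobolev_sqnorm m D Tp + dist_Sobolev_sqnorm m D Tm)"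
      unfolding mult_2 mult_1 by (rule add_mono)
    also have "\<dots> \<le> 2 * (ennreal C * p + ennreal C * q)" by (intro mult_left_mono add_mono up) simp
    also have "\<dots> = ennreal (2 * C) * (p + q)" using C(1) by (simp add: ennreal_mult distrib_left mult.assoc)
    finally have 1: "H_sq m i \<le> ennreal (2 * C) * modes_sq m i" unfolding H PM .
    have Teq: "dist_eq D Tp (\<lambda>\<phi>. 1 * dist_of D (field_x k wr wt) \<phi> + \<i> * dist_of D (field_y k wr wt) \<phi>)"
      "dist_eq D Tm (\<lambda>\<phi>. 1 * dist_of D (field_x k wr wt) \<phi> + (-\<i>) * dist_of D (field_y k wr wt) \<phi>)"
    proof -
      have e: "p = 1 * ((1/2) * p + (1/2) * q) + \<i> * ((-\<i>/2) * p + (\<i>/2) * q)"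
        "q = 1 * ((1/2) * p + (1/2) * q) + (-\<i>) * ((-\<i>/2) * p + (\<i>/2) * q)" for p q
        by (simp_all add: complex_eq_iff)
      show "dist_eq D Tp (\<lambda>\<phi>. 1 * dist_of D (field_x k wr wt) \<phi> + \<i> * dist_of D (field_y k wr wt) \<phi>)"
        "dist_eq D Tm (\<lambda>\<phi>. 1 * dist_of D (field_x k wr wt) \<phi> + (-\<i>) * dist_of D (field_y k wr wt) \<phi>)"
        using xy by (auto simp only: dist_eq_def e[symmetric])
    qed
    \<comment> \<open>The constant is 2 (1 + 1) = 4 for each mode, hence 8 for their sum.\<close>
    have T4: "dist_Sobolev_sqnorm m D Tp \<le> 4 * (X + Y)" "dist_Sobolev_sqnorm m D Tm \<le> 4 * (X + Y)"
      using dist_Sobolev_sqnorm_linear[OF oD, of m 1 "dist_of D (field_x k wr wt)" \<i> "dist_of D (field_y k wr wt)"]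
        dist_Sobolev_sqnorm_linear[OF oD, of m 1 "dist_of D (field_x k wr wt)" "-\<i>" "dist_of D (field_y k wr wt)"]
      unfolding X_def Y_def dist_Sobolev_sqnorm_cong[OF Teq(1)] dist_Sobolev_sqnorm_cong[OF Teq(2)] by (simp_all add: power2_eq_square)
    have "p \<le> ennreal C' * dist_Sobolev_sqnorm m D Tp" "q \<le> ennreal C' * dist_Sobolev_sqnorm m D Tm"
      using Cs'[OF g(1), of "k + 1"] Cs'[OF g(2), of "k - 1"] dist_Sobolev_sqnorm_restrict[OF oD, of m Tp] dist_Sobolev_sqnorm_restrict[OF oD, of m Tm]
      unfolding s[symmetric] p_def q_def by (meson order_trans mult_left_mono zero_le)+
    then have "p \<le> ennreal C' * (4 * (X + Y))" "q \<le> ennreal C' * (4 * (X + Y))"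
      using T4 by (meson order_trans mult_left_mono zero_le)+
    then have "p + q \<le> ennreal C' * (4 * (X + Y)) + ennreal C' * (4 * (X + Y))" by (rule add_mono)
    also have "\<dots> = ennreal C' * (4 * (X + Y) + 4 * (X + Y))" by (rule distrib_left[symmetric])
    also have "4 * (X + Y) + 4 * (X + Y) = (4 + 4) * (X + Y)" by (rule distrib_right[symmetric])
    also have "ennreal C' * ((4 + 4) * (X + Y)) = ennreal (8 * C') * (X + Y)"
      using C'(1) by (simp add: ennreal_mult mult_ac)
    finally have "modes_sq m i \<le> ennreal (8 * C') * H_sq m i" unfolding H PM .
    with 1 show ?thesis ..
  qed
  then show "dominated field_data (H_sq m) (modes_sq m)" "dominated field_data (modes_sq m) (H_sq m)"
    using C(1) C'(1) dominatedI[of "2 * C" field_data "H_sq m" "modes_sq m"] dominatedI[of "8 * C'" field_data "modes_sq m" "H_sq m"] by auto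
qed

text \<open>An invertible linear change between wr, wt and wr + i wt, wr - i wt. It keeps the index
  \<open>n\<close>; changing the index of one combination alone is a separate matter.\<close>

lemma components_C_sq_modes:
  shows "dominated field_data (components_C_sq m n) (\<lambda>i. mode_C_sq m 1 n i + mode_C_sq m (-1) n i)"
    "dominated field_data (mode_C_sq m s n) (components_C_sq m n)"
proof -
  have *: "components_C_sq m n i \<le> ennreal 2 * (mode_C_sq m 1 n i + mode_C_sq m (-1) n i)
      \<and> mode_C_sq m s n i \<le> ennreal (2 * (1 + (cmod s)\<^sup>2)) * components_C_sq m n i"
    if i: "i \<in> field_data" for i
  proof -
    obtain k D wr wt where "i = (k, D, wr, wt)" by (cases i)
    note i = i[unfolded this] this
    let ?U = "meridian D"
    have eq: "dist_of ?U wr = (\<lambda>\<phi>. (1/2) * mode_dist 1 ?U wr wt \<phi> + (1/2) * mode_dist (-1) ?U wr wt \<phi>)"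
      "dist_of ?U wt = (\<lambda>\<phi>. (-\<i>/2) * mode_dist 1 ?U wr wt \<phi> + (\<i>/2) * mode_dist (-1) ?U wr wt \<phi>)"
      by (auto simp: mode_dist_def algebra_simps fun_eq_iff)
    note lin = dist_C_sqnorm_linear[OF field_data_meridian(5)[OF i(1)] meridian_subset, where m = m and k = "n k"]
    have "dist_C_sqnorm m (n k) ?U (dist_of ?U wr) \<le> 1 * (dist_C_sqnorm m (n k) ?U (mode_dist 1 ?U wr wt) + dist_C_sqnorm m (n k) ?U (mode_dist (-1) ?U wr wt))"
      "dist_C_sqnorm m (n k) ?U (dist_of ?U wt) \<le> 1 * (dist_C_sqnorm m (n k) ?U (mode_dist 1 ?U wr wt) + dist_C_sqnorm m (n k) ?U (mode_dist (-1) ?U wr wt))"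
      using lin[of "1/2" "mode_dist 1 ?U wr wt" "1/2" "mode_dist (-1) ?U wr wt"] lin[of "-\<i>/2" "mode_dist 1 ?U wr wt" "\<i>/2" "mode_dist (-1) ?U wr wt"]
      unfolding eq[symmetric] by (simp_all add: norm_divide power2_eq_square)
    then have "components_C_sq m n i \<le> 2 * (mode_C_sq m 1 n i + mode_C_sq m (-1) n i)"
      unfolding i(2) components_C_sq_def mode_C_sq_def prod.case mult_1 mult_2 by (rule add_mono)
    moreover have "mode_C_sq m s n i \<le> ennreal (2 * (1 + (cmod s)\<^sup>2)) * components_C_sq m n i"
      using lin[of 1 "dist_of ?U wr" "s * \<i>" "dist_of ?U wt"]
      by (simp add: i(2) components_C_sq_def mode_C_sq_def mode_dist_def norm_mult)
    ultimately show ?thesis by simp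
  qed
  show "dominated field_data (components_C_sq m n) (\<lambda>i. mode_C_sq m 1 n i + mode_C_sq m (-1) n i)"
    by (rule dominatedI[of 2]) (use * in auto)
  show "dominated field_data (mode_C_sq m s n) (components_C_sq m n)"
    by (rule dominatedI[of "2 * (1 + (cmod s)\<^sup>2)"]) (use * in \<open>auto intro: add_pos_nonneg\<close>)
qed

lemma scal_C_sqnorm_components:
  assumes "(k, D, wr, wt) \<in> field_data"
  shows "scal_C_sqnorm m (f k) (meridian D) wr + scal_C_sqnorm m (f k) (meridian D) wt = components_C_sq m (\<lambda>k. nat \<bar>f k\<bar>) (k, D, wr, wt)"
  using scal_C_sqnorm_eq[OF field_data_meridian(2)[OF assms] meridian_subset, of m "f k"]
    scal_C_sqnorm_eq[OF field_data_meridian(3)[OF assms] meridian_subset, of m "f k"]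
  by (simp add: components_C_sq_def dist_C_sqnorm_def euler_dist_sqnorm_def[abs_def])

definition C_sq :: "nat \<Rightarrow> int \<times> (real \<times> real) set \<times> (real \<Rightarrow> complex) \<times> (real \<Rightarrow> complex) \<Rightarrow> ennreal" where
  "C_sq m = (\<lambda>(k, D, wr, wt).
     if \<bar>k\<bar> \<ge> int m + 1 then scal_C_sqnorm m k (meridian D) wr + scal_C_sqnorm m k (meridian D) wt
     else if 1 \<le> \<bar>k\<bar> then
       scal_C_sqnorm m (\<bar>k\<bar> - 1) (meridian D) wr + scal_C_sqnorm m (\<bar>k\<bar> - 1) (meridian D) wt
       + H1_sqnorm (m - nat \<bar>k\<bar>) (meridian D)
           (dist_of (meridian D) (\<lambda>r. of_real ((1 / r) ^ nat \<bar>k\<bar>) * (wr r + \<i> * (of_int k / of_int \<bar>k\<bar>) * wt r)))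
     else scal_C_sqnorm m 1 (meridian D) wr + scal_C_sqnorm m 1 (meridian D) wt)"

lemma vec_norms_sq:
  "vec_H_norm m k D wr wt = ennreal_sqrt (H_sq m (k, D, wr, wt))"
  "vec_C_norm m k (meridian D) wr wt = ennreal_sqrt (C_sq m (k, D, wr, wt))"
  by (simp_all add: vec_H_norm_def vec_C_norm_def H_sq_def C_sq_def)

text \<open>For k = 0 the modes are 1 and -1; both have index 1, so the change between components
  and combinations is all that is needed.\<close>

lemma C_sq_modes_sq_zero:
  defines "I \<equiv> {(k, D, wr, wt). (k, D, wr, wt) \<in> field_data \<and> k = 0}"
  shows "dominated I (C_sq m) (modes_sq m)" "dominated I (modes_sq m) (C_sq m)"
proof -
  have sub: "I \<subseteq> field_data" by (auto simp: I_def)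
  have C: "components_C_sq m (\<lambda>_. 1) i = C_sq m i" if "i \<in> I" for i
    using that scal_C_sqnorm_components[where f = "\<lambda>_. 1" and m = m] by (auto simp: I_def C_sq_def)
  have P: "mode_C_sq m 1 (\<lambda>_. 1) i + mode_C_sq m (-1) (\<lambda>_. 1) i = modes_sq m i" if "i \<in> I" for i
    using that by (auto simp: I_def modes_sq_def mode_C_sq_def)
  show "dominated I (C_sq m) (modes_sq m)"
    by (rule dominated_cong[OF dominated_subset[OF components_C_sq_modes(1) sub] C P])
  show "dominated I (modes_sq m) (C_sq m)"
    by (rule dominated_cong[OF dominated_subset[OF dominated_add[OF components_C_sq_modes(2) components_C_sq_modes(2)] sub] P C])
qed

lemma dist_C_sqnorm_change_k:
  assumes "meridian_dist U S" "m \<le> k" "m \<le> k'" "k \<le> k' + 1"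
  shows "dist_C_sqnorm m k U S \<le> ennreal (4 ^ m) * dist_C_sqnorm m k' U S"
proof -
  have "Csum j k (euler_dist_sqnorm U S j) \<le> ennreal (4 ^ m) * Csum j k' (euler_dist_sqnorm U S j)" if "j \<le> m" for j
  proof -
    have "Csum j k (euler_dist_sqnorm U S j) \<le> ennreal (4 ^ j) * Csum j k' (euler_dist_sqnorm U S j)"
      by (rule Csum_change_k[OF quasi_euler_dist_sqnorm[OF assms(1)]]) (use assms that in auto)
    also have "\<dots> \<le> ennreal (4 ^ m) * Csum j k' (euler_dist_sqnorm U S j)"
      using that by (intro mult_right_mono ennreal_leI power_increasing) auto
    finally show ?thesis .
  qed
  then show ?thesis unfolding dist_C_sqnorm_def sum_distrib_left by (intro sum_mono) auto
qed

text \<open>Here |k|, |k + 1| and |k - 1| are all at least m and neighbours differ by one, so the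
  indices may be exchanged at the cost of 4^m.\<close>

lemma C_sq_modes_sq_large:
  fixes m :: nat
  defines "I \<equiv> {(k, D, wr, wt). (k, D, wr, wt) \<in> field_data \<and> \<bar>k\<bar> \<ge> int m + 1}"
  shows "dominated I (C_sq m) (modes_sq m)" "dominated I (modes_sq m) (C_sq m)"
proof -
  have sub: "I \<subseteq> field_data" by (auto simp: I_def)
  have change: "dominated I (mode_C_sq m s n) (mode_C_sq m s n')"
    if n: "\<And>k. \<bar>k\<bar> \<ge> int m + 1 \<Longrightarrow> m \<le> n k \<and> m \<le> n' k \<and> n k \<le> n' k + 1" for s n n'
  proof (rule dominatedI[of "4 ^ m"])
    fix i assume "i \<in> I"
    then show "mode_C_sq m s n i \<le> ennreal (4 ^ m) * mode_C_sq m s n' i"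
      using n field_data_meridian(1) by (auto simp: I_def mode_C_sq_def intro!: dist_C_sqnorm_change_k)
  qed simp
  have C: "components_C_sq m (\<lambda>k. nat \<bar>k\<bar>) i = C_sq m i" if "i \<in> I" for i
    using that scal_C_sqnorm_components[where f = "\<lambda>k. k" and m = m] by (auto simp: I_def C_sq_def)
  have c: "dominated I (\<lambda>i. mode_C_sq m 1 (\<lambda>k. nat \<bar>k\<bar>) i + mode_C_sq m (-1) (\<lambda>k. nat \<bar>k\<bar>) i) (modes_sq m)"
    unfolding modes_sq_def by (intro dominated_add_mono change) auto
  have c': "dominated I (modes_sq m) (\<lambda>i. mode_C_sq m 1 (\<lambda>k. nat \<bar>k\<bar>) i + mode_C_sq m (-1) (\<lambda>k. nat \<bar>k\<bar>) i)"
    unfolding modes_sq_def by (intro dominated_add_mono change) auto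
  show "dominated I (C_sq m) (modes_sq m)"
    by (rule dominated_cong[OF dominated_trans[OF dominated_subset[OF components_C_sq_modes(1) sub] c] C]) auto
  show "dominated I (modes_sq m) (C_sq m)"
    by (rule dominated_cong[OF dominated_trans[OF c' dominated_subset[OF dominated_add[OF components_C_sq_modes(2) components_C_sq_modes(2)] sub]] _ C]) auto
qed

text \<open>The squared norm of r^-K S in H^(m-K), grouped by total order. As in
  \<open>Vsum\<close>, the guard excludes orders at which \<open>fall K j\<close> is an empty
  product.\<close>

definition coupling_term :: "nat \<Rightarrow> nat \<Rightarrow> real set \<Rightarrow> real distrib \<Rightarrow> ennreal" where
  "coupling_term m K U S = (\<Sum>j\<le>m. if K \<le> j then euler_dist_sqnorm U S j (fall K j) else 0)"

lemma dist_C_sqnorm_coupling: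
  assumes "1 \<le> K"
  shows "\<exists>C>0. \<forall>U S. meridian_dist U S \<longrightarrow> dist_C_sqnorm m (K + 1) U S \<le> ennreal C * (dist_C_sqnorm m (K - 1) U S + coupling_term m K U S)"
    "\<exists>C>0. \<forall>U S. meridian_dist U S \<longrightarrow> dist_C_sqnorm m (K - 1) U S + coupling_term m K U S \<le> ennreal C * dist_C_sqnorm m (K + 1) U S"
proof -
  let ?G = "{(U, S). meridian_dist U S}"
  let ?V = "\<lambda>(U, S). dist_C_sqnorm m (K - 1) U S + coupling_term m K U S" and ?C = "\<lambda>(U, S). dist_C_sqnorm m (K + 1) U S"
  have V: "(\<lambda>i. \<Sum>j\<in>{..m}. (\<lambda>(U, S). Vsum j K (euler_dist_sqnorm U S j)) i) = ?V"
    by (auto simp: Vsum_def dist_C_sqnorm_def coupling_term_def sum.distrib fun_eq_iff)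
  have C: "(\<lambda>i. \<Sum>j\<in>{..m}. (\<lambda>(U, S). Csum j (K + 1) (euler_dist_sqnorm U S j)) i) = ?C"
    by (auto simp: dist_C_sqnorm_def fun_eq_iff)
  have "dominated ?G (\<lambda>(U, S). Csum j (K + 1) (euler_dist_sqnorm U S j)) (\<lambda>(U, S). Vsum j K (euler_dist_sqnorm U S j))"
    "dominated ?G (\<lambda>(U, S). Vsum j K (euler_dist_sqnorm U S j)) (\<lambda>(U, S). Csum j (K + 1) (euler_dist_sqnorm U S j))" for j
    using Csum_le_Vsum[OF assms, of j] Vsum_le_Csum[OF assms, of j] quasi_euler_dist_sqnorm by (force simp: dominated_def)+
  then have "dominated ?G ?C ?V" "dominated ?G ?V ?C"
    unfolding V[symmetric] C[symmetric] by (intro dominated_sum_mono finite_atMost; blast)+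
  then show "\<exists>C>0. \<forall>U S. meridian_dist U S \<longrightarrow> dist_C_sqnorm m (K + 1) U S \<le> ennreal C * (dist_C_sqnorm m (K - 1) U S + coupling_term m K U S)"
    "\<exists>C>0. \<forall>U S. meridian_dist U S \<longrightarrow> dist_C_sqnorm m (K - 1) U S + coupling_term m K U S \<le> ennreal C * dist_C_sqnorm m (K + 1) U S"
    by (auto simp: dominated_def)
qed

lemma H1_sqnorm_coupling_term:
  assumes "(k, D, wr, wt) \<in> field_data" "K \<le> m"
  shows "H1_sqnorm (m - K) (meridian D) (dist_of (meridian D) (\<lambda>r. of_real ((1 / r) ^ K) * (wr r + s * \<i> * wt r)))
    = coupling_term m K (meridian D) (mode_dist s (meridian D) wr wt)"
proof -
  let ?U = "meridian D" and ?S = "mode_dist s (meridian D) wr wt"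
  have lin: "linear_dist ?U ?S" using field_data_meridian(1)[OF assms(1)] by (simp add: meridian_dist_def)
  have "dist_of ?U (\<lambda>r. of_real ((1 / r) ^ K) * (wr r + s * \<i> * wt r)) = euler_dist (dist_of ?U (\<lambda>r. wr r + s * \<i> * wt r)) K 1"
    using dist_of_mult_inverse_power[of ?U 1 K "\<lambda>r. wr r + s * \<i> * wt r"] by (simp add: one_pCons)
  then have "dist_eq ?U (dist_of ?U (\<lambda>r. of_real ((1 / r) ^ K) * (wr r + s * \<i> * wt r))) (euler_dist ?S K 1)"
    using euler_dist_cong[OF field_data_meridian(4)[OF assms(1), of s] meridian_subset] by simp
  then have "H1_sqnorm (m - K) ?U (dist_of ?U (\<lambda>r. of_real ((1 / r) ^ K) * (wr r + s * \<i> * wt r)))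
      = (\<Sum>a\<le>m - K. euler_dist_sqnorm ?U ?S (K + a) (fall K (K + a)))"
    using H1_sqnorm_euler[OF lin meridian_subset] by (simp only: euler_dist_sqnorm_def mult_1_left)
  also have "\<dots> = (\<Sum>j\<in>{j. j \<le> m \<and> K \<le> j}. euler_dist_sqnorm ?U ?S j (fall K j))"
    by (rule sum.reindex_bij_witness[where i = "\<lambda>j. j - K" and j = "\<lambda>a. K + a"]) (use assms(2) in auto)
  also have "\<dots> = coupling_term m K ?U ?S"
    unfolding coupling_term_def by (intro sum.mono_neutral_cong_left) auto
  finally show ?thesis .
qed

text \<open>Write big for the combination of mode K + 1 in absolute value with its own index, mid
  for the same combination with index K - 1, small for the other one. The weighted norm is
  comparable to mid + small + E with the coupling term E, and mid + E is comparable to big. The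
  constants depend on K.\<close>

lemma C_sq_modes_sq_small:
  fixes K m :: nat and \<sigma> :: int
  assumes K: "1 \<le> K" "K \<le> m" and \<sigma>: "\<sigma> = 1 \<or> \<sigma> = -1"
  defines "I \<equiv> {(k, D, wr, wt). (k, D, wr, wt) \<in> field_data \<and> k = \<sigma> * int K}"
  shows "dominated I (C_sq m) (modes_sq m)" "dominated I (modes_sq m) (C_sq m)"
proof -
  define s where "s = (of_int \<sigma> :: complex)"
  define E where "E = (\<lambda>(k :: int, D, wr, wt). coupling_term m K (meridian D) (mode_dist s (meridian D) wr wt))"
  define big where "big = mode_C_sq m s (\<lambda>_. K + 1)"
  define mid where "mid = mode_C_sq m s (\<lambda>_. K - 1)"
  define small where "small = mode_C_sq m (-s) (\<lambda>_. K - 1)"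
  define rt where "rt = components_C_sq m (\<lambda>_. K - 1)"
  have sub: "I \<subseteq> field_data" by (auto simp: I_def)
  have P: "modes_sq m i = big i + small i" if "i \<in> I" for i
    using that \<sigma> K by (auto simp: I_def modes_sq_def big_def small_def mode_C_sq_def s_def nat_diff_distrib nat_add_distrib add.commute)
  have C: "C_sq m i = rt i + E i" if i: "i \<in> I" for i
  proof -
    obtain k D wr wt where i': "i = (k, D, wr, wt)" by (cases i)
    then have fd: "(k, D, wr, wt) \<in> field_data" and k: "k = \<sigma> * int K" using i by (auto simp: I_def)
    have ak: "\<bar>k\<bar> = int K" using \<sigma> by (auto simp: k)
    \<comment> \<open>The sign of \<open>k\<close> in the coupling term selects the combination
      whose mode is the larger one, as |k + \<sigma>| = K + 1.\<close>
    have sg: "\<i> * (of_int k / of_int \<bar>k\<bar>) = s * \<i>" using K \<sigma> by (auto simp: k s_def)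
    have "C_sq m i = scal_C_sqnorm m (\<bar>k\<bar> - 1) (meridian D) wr + scal_C_sqnorm m (\<bar>k\<bar> - 1) (meridian D) wt
       + H1_sqnorm (m - K) (meridian D) (dist_of (meridian D) (\<lambda>r. of_real ((1 / r) ^ K) * (wr r + s * \<i> * wt r)))"
      unfolding C_sq_def i' prod.case sg using K by (simp add: ak)
    also have "\<dots> = components_C_sq m (\<lambda>k. nat \<bar>\<bar>k\<bar> - 1\<bar>) i + E i"
      unfolding H1_sqnorm_coupling_term[OF fd K(2)] scal_C_sqnorm_components[OF fd, where f = "\<lambda>k. \<bar>k\<bar> - 1"] by (simp add: i' E_def)
    also have "components_C_sq m (\<lambda>k. nat \<bar>\<bar>k\<bar> - 1\<bar>) i = rt i"
      using K by (simp add: rt_def components_C_sq_def i' ak nat_diff_distrib)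
    finally show ?thesis .
  qed
  have rt: "dominated I rt (\<lambda>i. mid i + small i)"
    using dominated_subset[OF components_C_sq_modes(1) sub, of m "\<lambda>_. K - 1"] \<sigma>
    by (auto simp: rt_def mid_def small_def s_def add.commute)
  have ms: "dominated I mid rt" "dominated I small rt"
    unfolding mid_def small_def rt_def by (rule dominated_subset[OF components_C_sq_modes(2) sub])+
  have gd: "meridian_dist (meridian D) (mode_dist s (meridian D) wr wt)" if "(k, D, wr, wt) \<in> I" for k D wr wt
    using field_data_meridian(1) that sub by blast
  have b1: "dominated I big (\<lambda>i. mid i + E i)"
    using dist_C_sqnorm_coupling(1)[OF K(1), of m] gd by (force simp: dominated_def big_def mid_def E_def mode_C_sq_def)
  have b2: "dominated I (\<lambda>i. mid i + E i) big"
    using dist_C_sqnorm_coupling(2)[OF K(1), of m] gd by (force simp: dominated_def big_def mid_def E_def mode_C_sq_def)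
  have m1: "dominated I mid big" and e1: "dominated I E big"
    by (rule dominated_trans[OF _ b2], rule dominated_le, simp)+
  have "dominated I (\<lambda>i. mid i + small i) (\<lambda>i. big i + small i)"
    by (intro dominated_add_mono m1 dominated_le order_refl)
  from dominated_trans[OF rt this] have "dominated I (\<lambda>i. rt i + E i) (\<lambda>i. big i + small i)"
    by (intro dominated_add dominated_mono[OF e1]) simp_all
  then show "dominated I (C_sq m) (modes_sq m)"
    by (rule dominated_cong) (simp_all add: P C)
  have "dominated I (\<lambda>i. mid i + E i) (\<lambda>i. rt i + E i)"
    by (intro dominated_add_mono ms dominated_le order_refl)
  from dominated_trans[OF b1 this] have "dominated I (\<lambda>i. big i + small i) (\<lambda>i. rt i + E i)"
    by (intro dominated_add dominated_mono[OF ms(2)]) simp_all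
  then show "dominated I (modes_sq m) (C_sq m)"
    by (rule dominated_cong) (simp_all add: P C)
qed

text \<open>Apart from k = 0 and large |k| only finitely many pairs of |k| and sign remain, so the
  constants that depend on them combine to one that depends on m.\<close>

lemma C_sq_modes_sq: "dominated field_data (C_sq m) (modes_sq m)" "dominated field_data (modes_sq m) (C_sq m)"
proof -
  let ?Z = "{(k, D, wr, wt). (k, D, wr, wt) \<in> field_data \<and> k = 0}"
  let ?L = "{(k, D, wr, wt). (k, D, wr, wt) \<in> field_data \<and> \<bar>k\<bar> \<ge> int m + 1}"
  let ?A = "{1..m} \<times> {1, -1 :: int}"
  let ?I = "\<lambda>(K, \<sigma>). {(k, D, wr, wt). (k, D, wr, wt) \<in> field_data \<and> k = \<sigma> * int K}"
  have sub: "field_data \<subseteq> ?Z \<union> ?L \<union> (\<Union>a\<in>?A. ?I a)"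
  proof
    fix i assume i: "i \<in> field_data"
    obtain k D wr wt where i': "i = (k, D, wr, wt)" by (cases i)
    show "i \<in> ?Z \<union> ?L \<union> (\<Union>a\<in>?A. ?I a)"
    proof (cases "k = 0 \<or> \<bar>k\<bar> \<ge> int m + 1")
      case False
      then have "(nat \<bar>k\<bar>, sgn k) \<in> ?A" "k = sgn k * int (nat \<bar>k\<bar>)" by (auto simp: sgn_if)
      then have "i \<in> ?I (nat \<bar>k\<bar>, sgn k)" using i by (simp add: i')
      then show ?thesis using \<open>(nat \<bar>k\<bar>, sgn k) \<in> ?A\<close> by blast
    qed (use i in \<open>auto simp: i'\<close>)
  qed
  have 1: "dominated (?I a) (C_sq m) (modes_sq m)" and 2: "dominated (?I a) (modes_sq m) (C_sq m)" if "a \<in> ?A" for a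
    using that C_sq_modes_sq_small[of "fst a" m "snd a"] by (cases a; force)+
  show "dominated field_data (C_sq m) (modes_sq m)"
    by (rule dominated_subset[OF _ sub], intro dominated_Un C_sq_modes_sq_zero C_sq_modes_sq_large dominated_UN 1) auto
  show "dominated field_data (modes_sq m) (C_sq m)"
    by (rule dominated_subset[OF _ sub], intro dominated_Un C_sq_modes_sq_zero C_sq_modes_sq_large dominated_UN 2) auto
qed

lemma ennreal_sqrt_le:
  assumes "a \<le> ennreal C * b" "0 < C"
  shows "ennreal_sqrt a \<le> ennreal (sqrt C) * ennreal_sqrt b"
proof (cases b)
  case (real y)
  then have "a \<le> ennreal (C * y)" using assms by (simp add: ennreal_mult)
  then obtain x where "a = ennreal x" "0 \<le> x" "x \<le> C * y"
    using assms(2) real by (cases a) (auto simp: top_unique)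
  then show ?thesis
    using real assms(2) by (simp add: ennreal_sqrt_def ennreal_mult[symmetric] real_sqrt_mult[symmetric])
qed (use assms(2) in \<open>simp add: ennreal_sqrt_def ennreal_mult_top\<close>)

lemma dominated_sqrt:
  assumes "dominated I f g"
  obtains C where "0 < C" "\<And>i. i \<in> I \<Longrightarrow> ennreal_sqrt (f i) \<le> ennreal C * ennreal_sqrt (g i)"
proof -
  obtain C where C: "0 < C" "\<And>i. i \<in> I \<Longrightarrow> f i \<le> ennreal C * g i" using assms by (rule dominatedE) blast
  show ?thesis by (rule that[of "sqrt C"]) (use C ennreal_sqrt_le in auto)
qed

theorem theorem6p2:
  shows "\<forall>m :: nat. \<exists>c C :: real. 0 < c \<and> 0 < C \<and>
    (\<forall>(k :: int) (D :: (real \<times> real) set) (wr :: real \<Rightarrow> complex) (wt :: real \<Rightarrow> complex).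
       axisymmetric_domain D \<longrightarrow>
       wr \<in> L2_space axi_weight (meridian D) \<longrightarrow>
       wt \<in> L2_space axi_weight (meridian D) \<longrightarrow>
       ennreal c * vec_H_norm m k D wr wt \<le> vec_C_norm m k (meridian D) wr wt \<and>
       vec_C_norm m k (meridian D) wr wt \<le> ennreal C * vec_H_norm m k D wr wt)"
proof
  fix m :: nat
  obtain B where B: "0 < B" "\<And>i. i \<in> field_data \<Longrightarrow> ennreal_sqrt (H_sq m i) \<le> ennreal B * ennreal_sqrt (C_sq m i)"
    using dominated_sqrt[OF dominated_trans[OF H_sq_modes_sq(1) C_sq_modes_sq(2)], of m] by blast
  obtain C where C: "0 < C" "\<And>i. i \<in> field_data \<Longrightarrow> ennreal_sqrt (C_sq m i) \<le> ennreal C * ennreal_sqrt (H_sq m i)"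
    using dominated_sqrt[OF dominated_trans[OF C_sq_modes_sq(1) H_sq_modes_sq(2)], of m] by blast
  have "ennreal (1 / B) * ennreal_sqrt (H_sq m i) \<le> ennreal_sqrt (C_sq m i)" if "i \<in> field_data" for i
  proof -
    have "ennreal (1 / B) * ennreal_sqrt (H_sq m i) \<le> ennreal (1 / B) * (ennreal B * ennreal_sqrt (C_sq m i))"
      by (intro mult_left_mono B(2) that) simp
    also have "\<dots> = ennreal_sqrt (C_sq m i)"
      using B(1) by (simp add: mult.assoc[symmetric] ennreal_mult[symmetric])
    finally show ?thesis .
  qed
  with B(1) C show "\<exists>c C :: real. 0 < c \<and> 0 < C \<and>
    (\<forall>(k :: int) (D :: (real \<times> real) set) (wr :: real \<Rightarrow> complex) (wt :: real \<Rightarrow> complex).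
       axisymmetric_domain D \<longrightarrow>
       wr \<in> L2_space axi_weight (meridian D) \<longrightarrow>
       wt \<in> L2_space axi_weight (meridian D) \<longrightarrow>
       ennreal c * vec_H_norm m k D wr wt \<le> vec_C_norm m k (meridian D) wr wt \<and>
       vec_C_norm m k (meridian D) wr wt \<le> ennreal C * vec_H_norm m k D wr wt)"
    by (intro exI[of _ "1 / B"] exI[of _ C]) (simp add: vec_norms_sq field_data_def)
qed

end
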